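(* For every sufficiently small $\eta>0$ there is a sufficiently large $\mathcal{A}=\mathcal{A}(\eta)$ and a choice of the parameters $X,Y,Z$ (functions of $N$ with $XYZ=N$) such that, with $\Pi$ constructed as described below, the following hold. For every square-free $\mathfrak q\ge1$ there is a decomposition $$|\mathfrak A_{\mathfrak q}|=\beta(\mathfrak q)\,|\Pi|+r(\mathfrak q),$$ where $\beta$ is a multiplicative function satisfying, for some constant $C$ and all $2\le w<z$, $$\prod_{w\le p<z}(1-\beta(p))^{-1}\le C\Big(\frac{\log z}{\log w}\Big)^2,$$ and the remainders satisfy, for every $K<\infty$, $$\sum_{\substack{\mathfrak q<\mathcal{Q}\\ \mathfrak q\text{ square-free}}}|r(\mathfrak q)|\ll_K \frac{|\Pi|}{\log^K N},\qquad\text{with }\mathcal{Q}=T^{1/72-\eta}.$$ Finally, $|\Pi|>N^{2\delta_{\mathcal{A}}-\eta}$.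
   Context: For an integer $\mathcal{A}\ge1$, $\Gamma_{\mathcal{A}}$ is the semigroup of all products of even length of the matrices $\begin{pmatrix}a&1\\1&0\end{pmatrix}$, $1\le a\le \mathcal{A}$; $\delta_{\mathcal{A}}$ is the Hausdorff dimension of the set of real numbers $[0;a_1,a_2,\dots]$ whose continued fraction partial quotients all satisfy $a_j\le\mathcal{A}$. For $g\in\mathrm{SL}_2(\mathbb{R})$, $\|g\|=\sqrt{\mathrm{tr}(g\,{}^{t}g)}$ and $B_X=\{g:\|g\|<X\}$; ${}^t$ is transpose; $\mathfrak f(\varphi)=\mathrm{tr}(\varphi\,{}^t\varphi)=a^2+b^2+c^2+d^2$ for $\varphi=\begin{pmatrix}a&b\\c&d\end{pmatrix}$. Construction: fix absolute constants $C_0,\Theta>0$ such that for every $Y\ge1$ there is a nonempty set $\aleph\subset\{\gamma\in\Gamma_2:\|\gamma\|<Y\}$ with $\#\{\mathfrak a\in\aleph:\mathfrak a\equiv\mathfrak a_0 \bmod q\}=|\aleph|/|\mathrm{SL}_2(\mathbb{Z}/q)|+O(|\aleph|q^{C_0}Y^{-\Theta})$ for all $q\ge1$ and $\mathfrak a_0\in\mathrm{SL}_2(\mathbb{Z}/q)$ (such sets exist by known spectral gap results); take such an $\aleph$ for the parameter $Y$. Let $\Omega_X\subset\Gamma_{\mathcal{A}}\cap B_X$ be a subset all of whose elements have the same word length in the generators, with $\#\Omega_X\gg X^{2\delta_{\mathcal{A}}}/\log X$, and similarly $\Omega_Z\subset\Gamma_{\mathcal{A}}\cap B_Z$. Set $\Pi=\Omega_X\cdot\aleph\cdot\Omega_Z$.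 Define $a_N(n)=\#\{\varphi\in\Pi:\mathfrak f(\varphi)^2-4=n\}$, which is supported on $n<T$ for some $T\asymp N^4$, and for square-free $\mathfrak q$, $|\mathfrak A_{\mathfrak q}|=\sum_{n\equiv 0\bmod \mathfrak q}a_N(n)$. *)

theory Defs
  imports "HOL-Analysis.Analysis" "HOL-Library.Landau_Symbols"
    "HOL-Number_Theory.Cong" "HOL-Computational_Algebra.Squarefree"
begin

section \<open>Hausdorff dimension\<close>

text \<open>Covers are required to be bounded because \<^const>\<open>diameter\<close> is unspecified on unbounded
  sets, and the exponent in the dimension ranges over positive reals because
  \<open>0 powr 0 = 0\<close>; neither restriction changes the dimension.\<close>

definition hausdorff_premeasure :: "real \<Rightarrow> real \<Rightarrow> 'a::metric_space set \<Rightarrow> ennreal" where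
  "hausdorff_premeasure s d E =
     (INF U \<in> {U :: nat \<Rightarrow> 'a set. E \<subseteq> (\<Union>i. U i) \<and> (\<forall>i. bounded (U i) \<and> diameter (U i) \<le> d)}.
        \<Sum>i. ennreal (diameter (U i) powr s))"

definition hausdorff_measure :: "real \<Rightarrow> 'a::metric_space set \<Rightarrow> ennreal" where
  "hausdorff_measure s E = (SUP d \<in> {0<..}. hausdorff_premeasure s d E)"

definition hausdorff_dim :: "'a::metric_space set \<Rightarrow> real" where
  "hausdorff_dim E = Inf {s. 0 < s \<and> hausdorff_measure s E = 0}"

section \<open>Continued fractions with bounded partial quotients\<close>

text \<open>Sequences are indexed from 0, so \<open>cf_convergent a n\<close> is \<open>[0; a 0, \<dots>, a (n - 1)]\<close>.\<close>

primrec cf_convergent :: "(nat \<Rightarrow> nat) \<Rightarrow> nat \<Rightarrow> real" where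
  "cf_convergent a 0 = 0"
| "cf_convergent a (Suc n) = 1 / (real (a 0) + cf_convergent (\<lambda>k. a (Suc k)) n)"

definition bounded_cf_set :: "nat \<Rightarrow> real set" where
  "bounded_cf_set A =
     {x. \<exists>a :: nat \<Rightarrow> nat. (\<forall>j. 1 \<le> a j \<and> a j \<le> A) \<and> cf_convergent a \<longlonglongrightarrow> x}"

definition cf_dim :: "nat \<Rightarrow> real" where
  "cf_dim A = hausdorff_dim (bounded_cf_set A)"

section \<open>The semigroup\<close>

definition cf_gen :: "nat \<Rightarrow> int^2^2" where
  "cf_gen a = vector [vector [int a, 1], vector [1, 0]]"

definition word_matrix :: "nat list \<Rightarrow> int^2^2" where
  "word_matrix w = foldr (\<lambda>a M. cf_gen a ** M) w (mat 1)"

text \<open>The empty product is excluded: a semigroup, not a monoid.\<close>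

definition Gamma :: "nat \<Rightarrow> (int^2^2) set" where
  "Gamma A = word_matrix ` {w. set w \<subseteq> {1..A} \<and> even (length w) \<and> w \<noteq> []}"

definition quad_form :: "int^2^2 \<Rightarrow> int" where
  "quad_form g = trace (g ** transpose g)"

definition mat_norm :: "int^2^2 \<Rightarrow> real" where
  "mat_norm g = sqrt (of_int (quad_form g))"

section \<open>The sets entering the construction\<close>

text \<open>The residue classes modulo \<open>q\<close> are represented by entries in \<open>{0..<q}\<close>.\<close>

definition SL2_mod :: "nat \<Rightarrow> (int^2^2) set" where
  "SL2_mod q = {m. (\<forall>i j. m $ i $ j \<in> {0..<int q}) \<and> [det m = 1] (mod int q)}"

definition mat_cong :: "nat \<Rightarrow> int^2^2 \<Rightarrow> int^2^2 \<Rightarrow> bool" where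
  "mat_cong q g h \<longleftrightarrow> (\<forall>i j. [g $ i $ j = h $ i $ j] (mod int q))"

definition is_aleph :: "real \<Rightarrow> real \<Rightarrow> real \<Rightarrow> real \<Rightarrow> (int^2^2) set \<Rightarrow> bool" where
  "is_aleph C\<^sub>0 \<theta> c Y S \<longleftrightarrow>
     S \<noteq> {} \<and> S \<subseteq> {g \<in> Gamma 2. mat_norm g < Y} \<and>
     (\<forall>q\<ge>1. \<forall>m \<in> SL2_mod q.
        \<bar>real (card {g \<in> S. mat_cong q g m}) - real (card S) / real (card (SL2_mod q))\<bar>
          \<le> c * (real (card S) * real q powr C\<^sub>0 * Y powr (- \<theta>)))"

definition is_Omega :: "nat \<Rightarrow> real \<Rightarrow> real \<Rightarrow> (int^2^2) set \<Rightarrow> bool" where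
  "is_Omega A c X S \<longleftrightarrow>
     S \<subseteq> {g \<in> Gamma A. mat_norm g < X} \<and>
     (\<exists>l. S \<subseteq> word_matrix ` {w. set w \<subseteq> {1..A} \<and> length w = l}) \<and>
     real (card S) \<ge> c * (X powr (2 * cf_dim A) / ln X)"

definition triple_product ::
  "(int^2^2) set \<Rightarrow> (int^2^2) set \<Rightarrow> (int^2^2) set \<Rightarrow> (int^2^2) set" where
  "triple_product S\<^sub>1 S\<^sub>2 S\<^sub>3 = {x ** a ** z | x a z. x \<in> S\<^sub>1 \<and> a \<in> S\<^sub>2 \<and> z \<in> S\<^sub>3}"

text \<open>Natural indices suffice: \<open>quad_form g \<ge> 2\<close> whenever \<open>det g = 1\<close>.\<close>

definition sieve_seq :: "(int^2^2) set \<Rightarrow> nat \<Rightarrow> nat" where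
  "sieve_seq P n = card {g \<in> P. (quad_form g)\<^sup>2 - 4 = int n}"

text \<open>The sum over all multiples of \<open>q\<close>, restricted to the (finite) support so that \<^const>\<open>sum\<close>
  applies.\<close>

definition sieve_mass :: "(int^2^2) set \<Rightarrow> nat \<Rightarrow> nat" where
  "sieve_mass P q = (\<Sum>n | sieve_seq P n \<noteq> 0 \<and> q dvd n. sieve_seq P n)"

definition multiplicative :: "(nat \<Rightarrow> real) \<Rightarrow> bool" where
  "multiplicative b \<longleftrightarrow> b 1 = 1 \<and>
     (\<forall>m n. 0 < m \<and> 0 < n \<and> coprime m n \<longrightarrow> b (m * n) = b m * b n)"

end

theory Submission
  imports Defs "HOL-Number_Theory.Number_Theory" "HOL-Library.Sublist" "HOL-Real_Asymp.Real_Asymp"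
begin

text \<open>For a prime \<open>p \<equiv> 1\<close> modulo 4 the form \<open>x\<^sup>2 + y\<^sup>2\<close> has two isotropic lines, and
  \<open>\<ff>(\<phi>) \<equiv> \<plusminus>2\<close> modulo \<open>p\<close> exactly when \<open>\<phi>\<close> maps one of them to one of them; the other odd primes
  contribute only \<open>O(1/p\<^sup>2)\<close>. Hence the indicator of \<open>p | \<ff>\<^sup>2 - 4\<close> is a constant \<open>4/(p+1)\<close>, plus
  mean-zero incidences on the projective line, plus an error of density \<open>O(1/p\<^sup>2)\<close>. Multiplying out
  over the primes dividing \<open>\<qq>\<close>, the terms of small modulus are handled by the equidistribution of
  the middle factor \<open>\<aleph>\<close>. Those with a large error modulus are bounded trivially, by counting
  congruent pairs in a norm ball (which is sharp up to \<open>X\<^sup>\<epsilon>\<close>, by the divisor bound). The remaining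
  ones are oscillating of large modulus \<open>d\<close>: after Cauchy--Schwarz over \<open>x\<close>, the elements \<open>x\<close> are
  completed to all products \<open>x\<^sub>1 x\<^sub>2 x\<^sub>3\<close> of three matrices of size \<open>X\<^sup>1\<^sup>/\<^sup>3\<close>, and the sum over the middle
  factor of a product of two incidences for \<open>d \<noteq> d'\<close> is computed by orthogonality on
  \<open>SL\<^sub>2\<close> modulo \<open>d d'\<close>. Completion loses only \<open>X\<^sup>2\<^sup>(\<^sup>1\<^sup>-\<^sup>\<delta>\<^sup>)\<close>, which is negligible since
  \<open>\<delta>\<close> tends to 1 as the digit bound grows.\<close>

section \<open>Schur test and divisor bounds\<close>

text \<open>The exponents come from the collision counts. In a box of size M the expected number
  M^4/r^3 of pairs congruent modulo r exceeds the diagonal M^2 only while r^3 \<le> M^2. In the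
  large sieve r runs up to d d' \<le> Q^2 and M is about X^(1/3), so the method reaches Q = X^(1/9).
  With X = N^(3/4 - \<alpha>) this covers Q = N^(1/18), and since T is of order N^4, the level
  T^(1/72 - \<eta>) stays below N^(1/18). No equidistribution is available for the two outer sets,
  so they enter through their sizes and collision counts; the equidistributed middle factor has size
  N^\<alpha> and controls only moduli up to a tiny power of N. At primes dividing both d and d' the
  two incidences are correlated, so cancellation comes only from the primes dividing exactly one of
  them. With D = gcd(d, d'), d = D t and d' = D t', the resulting weight D^(-2) (t t')^(-3/2) is
  still summable over pairs with a saving in the smallest modulus. The sieve dimension is two
  because a density of about 4/p sits on the half of the primes that are 1 modulo 4.\<close>

lemma schur_test:
  fixes a b :: "'a \<Rightarrow> real" and K :: "'a \<Rightarrow> 'a \<Rightarrow> real"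
  assumes fin: "finite G" and K: "\<And>g h. g \<in> G \<Longrightarrow> h \<in> G \<Longrightarrow> 0 \<le> K g h"
    and row: "\<And>g. g \<in> G \<Longrightarrow> (\<Sum>h\<in>G. K g h) \<le> L"
    and col: "\<And>h. h \<in> G \<Longrightarrow> (\<Sum>g\<in>G. K g h) \<le> L"
  shows "(\<Sum>g\<in>G. \<Sum>h\<in>G. a g * b h * K g h)
          \<le> L * sqrt (\<Sum>g\<in>G. (a g)\<^sup>2) * sqrt (\<Sum>h\<in>G. (b h)\<^sup>2)"
proof (cases "G = {}")
  case False
  then obtain g where "g \<in> G" by blast
  then have L: "0 \<le> L" using row[of g] sum_nonneg[of G "K g"] K by (meson order_trans)
  let ?P = "G \<times> G"
  \<comment> \<open>Splitting K as sqrt K * sqrt K, one root for each sequence, makes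
    Cauchy--Schwarz over pairs produce exactly the row and column sums.\<close>
  have "(\<Sum>g\<in>G. \<Sum>h\<in>G. a g * b h * K g h)
      = (\<Sum>(g,h)\<in>?P. (a g * sqrt (K g h)) * (b h * sqrt (K g h)))"
    using K by (auto simp: sum.cartesian_product algebra_simps intro!: sum.cong)
  also have "\<dots> \<le> \<bar>\<Sum>x\<in>?P. (a (fst x) * sqrt (K (fst x) (snd x))) * (b (snd x) * sqrt (K (fst x) (snd x)))\<bar>"
    by (simp add: case_prod_unfold)
  also have "\<dots> \<le> sqrt (\<Sum>x\<in>?P. (a (fst x) * sqrt (K (fst x) (snd x)))\<^sup>2)
      * sqrt (\<Sum>x\<in>?P. (b (snd x) * sqrt (K (fst x) (snd x)))\<^sup>2)"
    using L2_set_mult_ineq[of "\<lambda>x. a (fst x) * sqrt (K (fst x) (snd x))" "\<lambda>x. b (snd x) * sqrt (K (fst x) (snd x))" ?P]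
    by (intro order_trans[OF sum_abs]) (simp add: abs_mult L2_set_def)
  also have "(\<Sum>x\<in>?P. (a (fst x) * sqrt (K (fst x) (snd x)))\<^sup>2) = (\<Sum>g\<in>G. (a g)\<^sup>2 * (\<Sum>h\<in>G. K g h))"
    using K by (simp add: sum.cartesian_product' sum_distrib_left power_mult_distrib)
  also have "(\<Sum>x\<in>?P. (b (snd x) * sqrt (K (fst x) (snd x)))\<^sup>2) = (\<Sum>h\<in>G. (b h)\<^sup>2 * (\<Sum>g\<in>G. K g h))"
  proof -
    have "(\<Sum>x\<in>?P. (b (snd x) * sqrt (K (fst x) (snd x)))\<^sup>2) = (\<Sum>g\<in>G. \<Sum>h\<in>G. (b h)\<^sup>2 * K g h)"
      unfolding sum.cartesian_product' by (intro sum.cong refl) (use K in \<open>simp add: power_mult_distrib\<close>)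
    also have "\<dots> = (\<Sum>h\<in>G. \<Sum>g\<in>G. (b h)\<^sup>2 * K g h)" by (rule sum.swap)
    finally show ?thesis by (simp only: sum_distrib_left)
  qed
  also have "sqrt (\<Sum>g\<in>G. (a g)\<^sup>2 * (\<Sum>h\<in>G. K g h)) * sqrt (\<Sum>h\<in>G. (b h)\<^sup>2 * (\<Sum>g\<in>G. K g h))
     \<le> sqrt (\<Sum>g\<in>G. (a g)\<^sup>2 * L) * sqrt (\<Sum>h\<in>G. (b h)\<^sup>2 * L)"
    by (intro mult_mono real_sqrt_le_mono sum_mono mult_left_mono row col)
       (auto intro!: sum_nonneg mult_nonneg_nonneg K L)
  also have "\<dots> = (sqrt L * sqrt L) * sqrt (\<Sum>g\<in>G. (a g)\<^sup>2) * sqrt (\<Sum>h\<in>G. (b h)\<^sup>2)"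
    by (subst (1 2) sum_distrib_right[symmetric]) (simp only: real_sqrt_mult mult_ac)
  also have "sqrt L * sqrt L = L" using L by simp
  finally show ?thesis .
qed simp

section \<open>Functions of the prime factorization bounded by n^e\<close>

abbreviation \<omega> :: "nat \<Rightarrow> nat" where
  "\<omega> n \<equiv> card (prime_factors n)"

text \<open>Primes above \<open>B\<close> satisfy C \<le> p^e and are charged to n itself, as the
  product of distinct primes dividing n is at most n. At most \<open>B\<close> small primes remain,
  and they cost the constant \<open>C ^ B\<close>.\<close>

lemma pow_omega_le:
  fixes C e :: real
  assumes "e > 0" "C \<ge> 1"
  shows "\<exists>K\<ge>1. \<forall>n\<ge>1::nat. C ^ \<omega> n \<le> K * real n powr e"
proof -
  define B where "B = nat \<lceil>C powr (1/e)\<rceil>"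
  have B: "C \<le> real p powr e" if "p > B" for p
  proof -
    have "C powr (1/e) \<le> real p" using that unfolding B_def by linarith
    then have "(C powr (1/e)) powr e \<le> real p powr e"
      using assms by (intro powr_mono2) auto
    then show ?thesis using assms by (simp add: powr_powr)
  qed
  show ?thesis
  proof (intro exI[of _ "C ^ B"] conjI allI impI)
    show "1 \<le> C ^ B" using assms by simp
    fix n :: nat assume n: "1 \<le> n"
    let ?P = "prime_factors n"
    let ?S = "{p\<in>?P. p \<le> B}" and ?L = "{p\<in>?P. p > B}"
    have "?P = ?S \<union> ?L" by auto
    then have "card ?P = card ?S + card ?L" by (metis (no_types, lifting) card_Un_disjoint disjoint_iff finite_Un finite_set_mset mem_Collect_eq not_less)
    then have "C ^ card ?P = C ^ card ?S * C ^ card ?L" by (simp add: power_add)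
    also have "\<dots> \<le> C ^ B * real n powr e"
    proof (intro mult_mono)
      have "?S \<subseteq> {1..B}" by (auto simp: Suc_le_eq dest!: in_prime_factors_imp_prime intro: prime_gt_0_nat)
      then have "card ?S \<le> B" using card_mono[of "{1..B}" ?S] by simp
      then show "C ^ card ?S \<le> C ^ B" using assms by (intro power_increasing) auto
      have "C ^ card ?L = (\<Prod>p\<in>?L. C)" by simp
      also have "\<dots> \<le> (\<Prod>p\<in>?L. real p powr e)" using assms B by (intro prod_mono) auto
      also have "\<dots> = (\<Prod>p\<in>?L. real p) powr e" by (simp add: prod_powr_distrib)
      also have "\<dots> \<le> real n powr e"
      proof (intro powr_mono2)
        have "(\<Prod>p\<in>?L. p) dvd (\<Prod>p\<in>?P. p)" by (rule prod_dvd_prod_subset) auto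
        also have "(\<Prod>p\<in>?P. p) dvd (\<Prod>p\<in>?P. p ^ multiplicity p n)"
          by (intro prod_dvd_prod) (auto simp: prime_factors_multiplicity intro!: dvd_power)
        also have "\<dots> = n" using n by (intro prime_factorization_nat[symmetric]) simp
        finally have "(\<Prod>p\<in>?L. p) \<le> n" using n by (auto dest: dvd_imp_le)
        then show "(\<Prod>p\<in>?L. real p) \<le> real n" unfolding of_nat_prod[symmetric] of_nat_le_iff .
      qed (use assms in \<open>auto intro!: prod_nonneg\<close>)
      finally show "C ^ card ?L \<le> real n powr e" .
    qed (use assms in auto)
    finally show "C ^ card ?P \<le> C ^ B * real n powr e" .
  qed
qed

lemma card_divisors_mult_le:
  fixes m n :: nat
  assumes "m > 0" "n > 0"
  shows "card {d. d dvd m * n} \<le> card {d. d dvd m} * card {d. d dvd n}"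
proof -
  have "{d. d dvd m * n} \<subseteq> (\<lambda>(a,b). a * b) ` ({d. d dvd m} \<times> {d. d dvd n})"
    by (auto elim!: dvd_productE simp: image_iff)
  then have "card {d. d dvd m * n} \<le> card ({d. d dvd m} \<times> {d. d dvd n})"
    using assms by (intro surj_card_le) auto
  then show ?thesis by (simp add: card_cartesian_product)
qed

text \<open>Since k + 1 is O(2^(k f)), a prime power P contributes at most C P^f with C independent
  of the prime. Multiplying over the primes leaves \<open>C ^ \<omega> n\<close>, which costs a
  second factor n^f; hence f = e/2.\<close>

lemma divisor_bound:
  fixes e :: real
  assumes "e > 0"
  shows "\<exists>K\<ge>1. \<forall>n\<ge>1::nat. real (card {d. d dvd n}) \<le> K * real n powr e"
proof -
  define f where "f = e / 2"
  have f: "f > 0" using assms by (simp add: f_def)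
  obtain C :: real where C: "C \<ge> 1" "\<And>k. real k + 1 \<le> C * 2 powr (real k * f)"
  proof -
    have "((\<lambda>k. (real k + 1) / 2 powr (real k * f)) \<longlongrightarrow> 0) sequentially"
      using f by real_asymp
    then have "Bseq (\<lambda>k. (real k + 1) / 2 powr (real k * f))"
      by (intro convergent_imp_Bseq convergentI)
    then obtain C0 where C0: "C0 > 0" "\<And>k. \<bar>(real k + 1) / 2 powr (real k * f)\<bar> \<le> C0"
      by (auto simp: Bseq_def)
    then have "real k + 1 \<le> max C0 1 * 2 powr (real k * f)" for k
      using C0(2)[of k] by (simp add: field_simps) (smt (verit) mult_right_mono powr_ge_zero)
    then show ?thesis using that[of "max C0 1"] by simp
  qed
  obtain K where K: "K \<ge> 1" "\<And>n. n \<ge> 1 \<Longrightarrow> C ^ \<omega> n \<le> K * real n powr f"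
    using pow_omega_le[OF f C(1)] by blast
  have pk: "real (card {d. d dvd p ^ k}) \<le> C * real (p ^ k) powr f" if "prime p" for p k :: nat
  proof -
    have "{d. d dvd p ^ k} = (\<lambda>i. p ^ i) ` {0..k}"
      using that by (auto simp: divides_primepow_nat)
    then have "card {d. d dvd p ^ k} \<le> k + 1" using card_image_le[of "{0..k}" "\<lambda>i. p ^ i"] by simp
    then have "real (card {d. d dvd p ^ k}) \<le> real k + 1" by linarith
    also have "\<dots> \<le> C * 2 powr (real k * f)" by (rule C)
    also have "2 powr (real k * f) = (2 ^ k) powr f" by (simp add: powr_powr powr_realpow[symmetric])
    also have "\<dots> \<le> real (p ^ k) powr f"
      using that f by (auto intro!: powr_mono2 power_mono dest: prime_ge_2_nat)
    finally show ?thesis using C(1) by simp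
  qed
  have main: "real (card {d. d dvd n}) \<le> C ^ \<omega> n * real n powr f" if "n \<ge> 1" for n :: nat
    using that
  proof (induction n rule: nat_less_induct)
    case (1 n)
    show ?case
    proof (cases "n = 1")
      case False
      then obtain p where p: "prime p" "p dvd n" using prime_factor_nat by blast
      define k where "k = multiplicity p n"
      have np: "\<not> is_unit p" "n \<noteq> 0" using p "1.prems" by auto
      obtain m where m: "n = p ^ k * m" "\<not> p dvd m"
        unfolding k_def using multiplicity_decompose'[OF np(2,1)] by metis
      have k: "k > 0" using p np unfolding k_def by (simp add: prime_multiplicity_gt_zero_iff)
      have m1: "m \<ge> 1" "m < n"
        using m "1.prems" k one_less_power[OF prime_gt_1_nat[OF p(1)] k] by (auto simp: Suc_le_eq intro!: Nat.gr0I)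
      have pf: "prime_factors n = insert p (prime_factors m)"
        using m p(1) m1 k by (simp add: prime_factors_product prime_factorization_prime_power)
      have "p \<notin> prime_factors m" using m(2) by auto
      then have cd: "\<omega> n = Suc (\<omega> m)" unfolding pf by simp
      have "real (card {d. d dvd n}) \<le> real (card {d. d dvd p ^ k}) * real (card {d. d dvd m})"
        unfolding m(1) of_nat_mult[symmetric] of_nat_le_iff
        using p(1) m1 by (intro card_divisors_mult_le) (auto simp: prime_gt_0_nat)
      also have "\<dots> \<le> (C * real (p ^ k) powr f) * (C ^ \<omega> m * real m powr f)"
        using 1 m1 pk[OF p(1)] C(1) by (intro mult_mono) auto
      also have "\<dots> = C ^ \<omega> n * real n powr f"
        by (subst m(1), subst cd) (simp add: powr_mult)
      finally show ?thesis .
    qed auto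
  qed
  show ?thesis
  proof (intro exI[of _ K] conjI allI impI)
    fix n :: nat assume n: "1 \<le> n"
    have "real (card {d. d dvd n}) \<le> (K * real n powr f) * real n powr f"
      by (rule order_trans[OF main[OF n] mult_right_mono[OF K(2)[OF n]]]) simp
    also have "\<dots> = K * real n powr e" by (simp add: f_def powr_add[symmetric])
    finally show "real (card {d. d dvd n}) \<le> K * real n powr e" .
  qed (use K in auto)
qed

section \<open>Periodic functions on integer matrices\<close>

abbreviation m2 :: "int \<Rightarrow> int \<Rightarrow> int \<Rightarrow> int \<Rightarrow> int^2^2" where
  "m2 a b c d \<equiv> vector [vector [a, b], vector [c, d]]"

lemma m2_nth [simp]:
  "(m2 a b c d) $ 1 $ 1 = a" "(m2 a b c d) $ 1 $ 2 = b" "(m2 a b c d) $ 2 $ 1 = c" "(m2 a b c d) $ 2 $ 2 = d"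
  by (simp_all add: vector_2)

lemma mat2_eq_iff:
  "(g :: int^2^2) = h \<longleftrightarrow> g$1$1 = h$1$1 \<and> g$1$2 = h$1$2 \<and> g$2$1 = h$2$1 \<and> g$2$2 = h$2$2"
  by (auto simp: vec_eq_iff forall_2)

lemma mat2_mult_nth: "((g :: int^2^2) ** h) $ i $ j = g$i$1 * h$1$j + g$i$2 * h$2$j"
  by (simp add: matrix_matrix_mult_def sum_2)

lemma mat2_vmult_nth: "((g :: int^2^2) *v u) $ i = g$i$1 * u$1 + g$i$2 * u$2"
  by (simp add: matrix_vector_mult_def sum_2)

lemma mat2_one_nth [simp]:
  "(mat 1 :: int^2^2)$1$1 = 1" "(mat 1 :: int^2^2)$1$2 = 0" "(mat 1 :: int^2^2)$2$1 = 0" "(mat 1 :: int^2^2)$2$2 = 1"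
  by (simp_all add: mat_def)

text \<open>The adjugate. It is the inverse on determinant 1, and being polynomial in the entries it
  also inverts modulo r whenever the determinant is only congruent to 1.\<close>

definition adj2 :: "int^2^2 \<Rightarrow> int^2^2" where
  "adj2 g = m2 (g$2$2) (- g$1$2) (- g$2$1) (g$1$1)"

lemma adj2_nth [simp]:
  "adj2 g $ 1 $ 1 = g$2$2" "adj2 g $ 1 $ 2 = - g$1$2" "adj2 g $ 2 $ 1 = - g$2$1" "adj2 g $ 2 $ 2 = g$1$1"
  by (simp_all add: adj2_def)

lemma det_adj2 [simp]: "det (adj2 g) = det g"
  by (simp add: det_2)

lemma adj2_mult: "adj2 (g ** h) = adj2 h ** adj2 g"
  by (simp add: mat2_eq_iff mat2_mult_nth)

lemma adj2_left: "det g = 1 \<Longrightarrow> adj2 g ** g = mat 1"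
  by (simp add: mat2_eq_iff mat2_mult_nth det_2 algebra_simps)

lemma adj2_right: "det g = 1 \<Longrightarrow> g ** adj2 g = mat 1"
  by (simp add: mat2_eq_iff mat2_mult_nth det_2 algebra_simps)

lemma adj2_cancel:
  assumes "det g = 1"
  shows "adj2 g ** (g ** h) = h" "g ** (adj2 g ** h) = h" "h ** g ** adj2 g = h" "h ** adj2 g ** g = h"
  using adj2_left[OF assms] adj2_right[OF assms]
  by (simp_all add: matrix_mul_assoc matrix_mul_assoc[of h, symmetric])

text \<open>Points of the projective line modulo p are represented by integer vectors; two of them
  agree exactly when p divides \<open>cross\<close>. The form is invariant under determinant
  1.\<close>

definition cross :: "int^2 \<Rightarrow> int^2 \<Rightarrow> int" where
  "cross u v = u$1 * v$2 - u$2 * v$1"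

lemma cross_mult: "cross (g *v u) (g *v v) = det g * cross u v"
  by (simp add: cross_def mat2_vmult_nth det_2 algebra_simps)

lemma cross_adj2: "cross (g *v u) v = cross u (adj2 g *v v)"
  by (simp add: cross_def mat2_vmult_nth algebra_simps)

lemma mat_cong_iff: "mat_cong r g h \<longleftrightarrow>
    [g$1$1 = h$1$1] (mod int r) \<and> [g$1$2 = h$1$2] (mod int r) \<and>
    [g$2$1 = h$2$1] (mod int r) \<and> [g$2$2 = h$2$2] (mod int r)"
  unfolding mat_cong_def forall_2 by blast

lemma mat_cong_refl [simp]: "mat_cong r g g"
  by (simp add: mat_cong_def)

lemma mat_cong_sym: "mat_cong r g h \<Longrightarrow> mat_cong r h g"
  by (simp add: mat_cong_def cong_sym)

lemma mat_cong_trans: "mat_cong r g h \<Longrightarrow> mat_cong r h k \<Longrightarrow> mat_cong r g k"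
  unfolding mat_cong_def by (blast intro: cong_trans)

lemma mat_cong_mult: "mat_cong r g g' \<Longrightarrow> mat_cong r h h' \<Longrightarrow> mat_cong r (g ** h) (g' ** h')"
  by (simp add: mat_cong_iff mat2_mult_nth cong_add cong_mult)

lemma mat_cong_adj2: "mat_cong r g h \<Longrightarrow> mat_cong r (adj2 g) (adj2 h)"
  by (simp add: mat_cong_iff cong_minus_minus_iff)

lemma mat_cong_det: "mat_cong r g h \<Longrightarrow> [det g = det h] (mod int r)"
  by (simp add: mat_cong_iff det_2 cong_diff cong_mult)

lemma mat_cong_dvd: "mat_cong r g h \<Longrightarrow> s dvd r \<Longrightarrow> mat_cong s g h"
  unfolding mat_cong_def by (metis cong_dvd_modulus int_dvd_int_iff)

lemma mat_cong_mult_coprime: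
  "coprime r s \<Longrightarrow> mat_cong (r * s) g h \<longleftrightarrow> mat_cong r g h \<and> mat_cong s g h"
  unfolding mat_cong_def of_nat_mult
  by (metis cong_modulus_mult mult.commute coprime_cong_mult coprime_int_iff)

lemma mat_cong_adj2_left: "[det g = 1] (mod int r) \<Longrightarrow> mat_cong r (adj2 g ** (g ** h)) h"
proof -
  assume d: "[det g = 1] (mod int r)"
  have "adj2 g ** (g ** h) = (\<chi> i j. det g * h$i$j)"
    by (simp add: mat2_eq_iff mat2_mult_nth det_2 algebra_simps)
  then show ?thesis using cong_mult[OF d cong_refl] by (simp add: mat_cong_def)
qed

lemma mat_cong_adj2_right: "[det g = 1] (mod int r) \<Longrightarrow> mat_cong r (h ** g ** adj2 g) h"
proof -
  assume d: "[det g = 1] (mod int r)"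
  have "h ** g ** adj2 g = (\<chi> i j. det g * h$i$j)"
    by (simp add: mat2_eq_iff mat2_mult_nth det_2 algebra_simps)
  then show ?thesis using cong_mult[OF d cong_refl] by (simp add: mat_cong_def)
qed

lemma adj2_adj2 [simp]: "adj2 (adj2 g) = g"
  by (simp add: mat2_eq_iff)

section \<open>Representatives of SL2 modulo r and sums over them\<close>

definition red :: "nat \<Rightarrow> int^2^2 \<Rightarrow> int^2^2" where
  "red r g = (\<chi> i j. g$i$j mod int r)"

lemma red_cong [simp]: "mat_cong r (red r g) g"
  by (simp add: mat_cong_def red_def)

lemma red_eq_iff: "red r g = red r h \<longleftrightarrow> mat_cong r g h"
  by (auto simp: red_def mat_cong_def cong_def vec_eq_iff)

lemma red_in_SL2: "r > 0 \<Longrightarrow> [det g = 1] (mod int r) \<Longrightarrow> red r g \<in> SL2_mod r"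
  using mat_cong_det[OF red_cong[of r g]] cong_trans by (auto simp: SL2_mod_def red_def)

lemma SL2_mod_det: "g \<in> SL2_mod r \<Longrightarrow> [det g = 1] (mod int r)"
  by (simp add: SL2_mod_def)

lemma red_id: "g \<in> SL2_mod r \<Longrightarrow> red r g = g"
  by (auto simp: SL2_mod_def red_def vec_eq_iff)

lemma SL2_mod_eqI: "g \<in> SL2_mod r \<Longrightarrow> h \<in> SL2_mod r \<Longrightarrow> mat_cong r g h \<Longrightarrow> g = h"
  by (metis red_id red_eq_iff)

lemma finite_bounded_mats: "finite {g :: int^2^2. \<forall>i j. g$i$j \<in> {a..b}}"
proof (rule finite_subset)
  show "{g :: int^2^2. \<forall>i j. g$i$j \<in> {a..b}}
     \<subseteq> (\<lambda>(p,q,r,s). m2 p q r s) ` ({a..b} \<times> {a..b} \<times> {a..b} \<times> {a..b})"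
  proof
    fix g :: "int^2^2" assume "g \<in> {g. \<forall>i j. g$i$j \<in> {a..b}}"
    then have "g = (\<lambda>(p,q,r,s). m2 p q r s) (g$1$1, g$1$2, g$2$1, g$2$2)"
      "(g$1$1, g$1$2, g$2$1, g$2$2) \<in> {a..b} \<times> {a..b} \<times> {a..b} \<times> {a..b}"
      by (auto simp: mat2_eq_iff)
    then show "g \<in> (\<lambda>(p,q,r,s). m2 p q r s) ` ({a..b} \<times> {a..b} \<times> {a..b} \<times> {a..b})" by (rule image_eqI)
  qed
qed simp

lemma finite_SL2_mod [simp]: "finite (SL2_mod r)"
  by (rule finite_subset[OF _ finite_bounded_mats[of 0 "int r"]]) (auto simp: SL2_mod_def less_imp_le)

lemma card_SL2_mod_le: "card (SL2_mod r) \<le> r ^ 4"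
proof -
  let ?I = "{0..<int r}"
  have "SL2_mod r \<subseteq> (\<lambda>(p,q,r,s). m2 p q r s) ` (?I \<times> ?I \<times> ?I \<times> ?I)"
  proof
    fix g :: "int^2^2" assume "g \<in> SL2_mod r"
    then have "g = (\<lambda>(p,q,r,s). m2 p q r s) (g$1$1, g$1$2, g$2$1, g$2$2)"
      "(g$1$1, g$1$2, g$2$1, g$2$2) \<in> ?I \<times> ?I \<times> ?I \<times> ?I"
      by (auto simp: mat2_eq_iff SL2_mod_def)
    then show "g \<in> (\<lambda>(p,q,r,s). m2 p q r s) ` (?I \<times> ?I \<times> ?I \<times> ?I)" by (rule image_eqI)
  qed
  then have "card (SL2_mod r) \<le> card (?I \<times> ?I \<times> ?I \<times> ?I)" by (intro surj_card_le) auto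
  also have "\<dots> = r ^ 4" by (simp add: card_cartesian_product eval_nat_numeral)
  finally show ?thesis .
qed

lemma SL2_mod_1: "SL2_mod 1 = {0}"
proof (intro equalityI subsetI)
  fix x assume "x \<in> SL2_mod 1"
  then have "0 \<le> x$i$j \<and> x$i$j < 1" for i j by (auto simp: SL2_mod_def)
  note * = this
  have "x$i$j = 0" for i j using *[of i j] by linarith
  then show "x \<in> {0}" by (simp add: vec_eq_iff)
qed (simp add: SL2_mod_def)

lemma SL2_mod_nonempty: "r > 0 \<Longrightarrow> SL2_mod r \<noteq> {}"
  using red_in_SL2[of r "mat 1"] by (auto simp: det_I)

text \<open>Functions on the residue ring matrices are kept as functions of integer matrices that
  respect congruence. They can then be evaluated at unreduced products, and moduli can be changed
  without coercions.\<close>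

definition periodic :: "nat \<Rightarrow> (int^2^2 \<Rightarrow> 'a) \<Rightarrow> bool" where
  "periodic r F \<longleftrightarrow> (\<forall>g h. mat_cong r g h \<longrightarrow> F g = F h)"

lemma periodicD: "periodic r F \<Longrightarrow> mat_cong r g h \<Longrightarrow> F g = F h"
  by (simp add: periodic_def)

lemma periodic_dvd: "periodic s F \<Longrightarrow> s dvd r \<Longrightarrow> periodic r F"
  by (meson periodic_def mat_cong_dvd)

lemma periodic_shift: "periodic r F \<Longrightarrow> periodic r (\<lambda>g. F (x ** g ** y))"
  by (simp add: periodic_def mat_cong_mult)

lemma periodic_red: "periodic r F \<Longrightarrow> F (red r g) = F g"
  by (rule periodicD[OF _ red_cong])

lemma sum_SL2_left:
  fixes F :: "int^2^2 \<Rightarrow> real"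
  assumes r: "r > 0" and F: "periodic r F" and x: "[det x = 1] (mod int r)"
  shows "(\<Sum>g\<in>SL2_mod r. F (x ** g)) = (\<Sum>g\<in>SL2_mod r. F g)"
proof (rule sum.reindex_bij_witness[where i = "\<lambda>g. red r (adj2 x ** g)" and j = "\<lambda>g. red r (x ** g)"])
  have *: "red r (x ** g) \<in> SL2_mod r" "red r (adj2 x ** (red r (x ** g))) = g"
    if "g \<in> SL2_mod r" "[det x = 1] (mod int r)" for g x
  proof -
    show "red r (x ** g) \<in> SL2_mod r"
      using cong_mult[OF that(2) SL2_mod_det[OF that(1)]] r by (intro red_in_SL2) (simp_all add: det_mul)
    have "mat_cong r (adj2 x ** (red r (x ** g))) (adj2 x ** (x ** g))"
      by (intro mat_cong_mult) auto
    then have "mat_cong r (adj2 x ** (red r (x ** g))) g"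
      using mat_cong_adj2_left[OF that(2)] mat_cong_trans by blast
    then show "red r (adj2 x ** (red r (x ** g))) = g"
      using red_eq_iff red_id[OF that(1)] by metis
  qed
  show "red r (x ** g) \<in> SL2_mod r" if "g \<in> SL2_mod r" for g using *(1)[OF that x] .
  show "red r (adj2 x ** (red r (x ** g))) = g" if "g \<in> SL2_mod r" for g using *(2)[OF that x] .
  show "red r (adj2 x ** g) \<in> SL2_mod r" if "g \<in> SL2_mod r" for g using *(1)[OF that] x by simp
  show "red r (x ** red r (adj2 x ** g)) = g" if "g \<in> SL2_mod r" for g
    using *(2)[OF that, of "adj2 x"] x by simp
  show "F (red r (x ** g)) = F (x ** g)" for g by (rule periodic_red[OF F])
qed

lemma sum_SL2_right:
  fixes F :: "int^2^2 \<Rightarrow> real"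
  assumes r: "r > 0" and F: "periodic r F" and x: "[det x = 1] (mod int r)"
  shows "(\<Sum>g\<in>SL2_mod r. F (g ** x)) = (\<Sum>g\<in>SL2_mod r. F g)"
proof (rule sum.reindex_bij_witness[where i = "\<lambda>g. red r (g ** adj2 x)" and j = "\<lambda>g. red r (g ** x)"])
  have *: "red r (g ** x) \<in> SL2_mod r" "red r ((red r (g ** x)) ** adj2 x) = g"
    if "g \<in> SL2_mod r" "[det x = 1] (mod int r)" for g x
  proof -
    show "red r (g ** x) \<in> SL2_mod r"
      using cong_mult[OF SL2_mod_det[OF that(1)] that(2)] r by (intro red_in_SL2) (simp_all add: det_mul)
    have "mat_cong r ((red r (g ** x)) ** adj2 x) ((g ** x) ** adj2 x)"
      by (intro mat_cong_mult) auto
    then have "mat_cong r ((red r (g ** x)) ** adj2 x) g"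
      using mat_cong_adj2_right[OF that(2)] mat_cong_trans by blast
    then show "red r ((red r (g ** x)) ** adj2 x) = g"
      using red_eq_iff red_id[OF that(1)] by metis
  qed
  show "red r (g ** x) \<in> SL2_mod r" if "g \<in> SL2_mod r" for g using *(1)[OF that x] .
  show "red r ((red r (g ** x)) ** adj2 x) = g" if "g \<in> SL2_mod r" for g using *(2)[OF that x] .
  show "red r (g ** adj2 x) \<in> SL2_mod r" if "g \<in> SL2_mod r" for g using *(1)[OF that] x by simp
  show "red r (red r (g ** adj2 x) ** x) = g" if "g \<in> SL2_mod r" for g
    using *(2)[OF that, of "adj2 x"] x by simp
  show "F (red r (g ** x)) = F (g ** x)" for g by (rule periodic_red[OF F])
qed

lemma sum_SL2_shift:
  fixes F :: "int^2^2 \<Rightarrow> real"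
  assumes "r > 0" and F: "periodic r F" and "[det x = 1] (mod int r)" "[det y = 1] (mod int r)"
  shows "(\<Sum>g\<in>SL2_mod r. F (x ** g ** y)) = (\<Sum>g\<in>SL2_mod r. F g)"
proof -
  have "periodic r (\<lambda>g. F (g ** y))" using periodic_shift[OF F, of "mat 1" y] by simp
  from sum_SL2_left[OF assms(1) this assms(3)] sum_SL2_right[OF assms(1) F assms(4)]
  show ?thesis by simp
qed

text \<open>The Chinese remainder theorem applied entry by entry; the determinant condition modulo r
  s splits into the conditions modulo r and modulo s, so the pair of reductions is a
  bijection.\<close>

lemma sum_SL2_mult:
  fixes F G :: "int^2^2 \<Rightarrow> real"
  assumes cop: "coprime r s" and pos: "r > 0" "s > 0" and F: "periodic r F" and G: "periodic s G"
  shows "(\<Sum>g\<in>SL2_mod (r * s). F g * G g) = (\<Sum>g\<in>SL2_mod r. F g) * (\<Sum>g\<in>SL2_mod s. G g)"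
proof -
  have bij: "bij_betw (\<lambda>g. (red r g, red s g)) (SL2_mod (r * s)) (SL2_mod r \<times> SL2_mod s)"
  proof (rule bij_betw_imageI)
    show "inj_on (\<lambda>g. (red r g, red s g)) (SL2_mod (r * s))"
      by (rule inj_onI) (auto simp: red_eq_iff mat_cong_mult_coprime[OF cop] intro: SL2_mod_eqI)
    show "(\<lambda>g. (red r g, red s g)) ` SL2_mod (r * s) = SL2_mod r \<times> SL2_mod s"
    proof (intro equalityI subsetI)
      fix y assume "y \<in> (\<lambda>g. (red r g, red s g)) ` SL2_mod (r * s)"
      then obtain g where "g \<in> SL2_mod (r * s)" "y = (red r g, red s g)" by auto
      moreover from this have "[det g = 1] (mod int r)" "[det g = 1] (mod int s)"
        by (auto dest!: SL2_mod_det intro: cong_dvd_modulus)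
      ultimately show "y \<in> SL2_mod r \<times> SL2_mod s" using pos by (auto intro: red_in_SL2)
    next
      fix y assume "y \<in> SL2_mod r \<times> SL2_mod s"
      then obtain g h where y: "y = (g, h)" "g \<in> SL2_mod r" "h \<in> SL2_mod s" by auto
      have "\<exists>x. [x = g$i$j] (mod int r) \<and> [x = h$i$j] (mod int s)" for i j
        using binary_chinese_remainder_int[of "int r" "int s"] cop by simp
      then obtain x where x: "\<And>i j. [x i j = g$i$j] (mod int r)" "\<And>i j. [x i j = h$i$j] (mod int s)"
        by metis
      define k where "k = (\<chi> i j. x i j)"
      have k: "mat_cong r k g" "mat_cong s k h" using x by (auto simp: k_def mat_cong_def)
      have "[det k = 1] (mod int r)" "[det k = 1] (mod int s)"
        using mat_cong_det[OF k(1)] mat_cong_det[OF k(2)] SL2_mod_det y cong_trans by blast+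
      then have "[det k = 1] (mod int (r * s))" using cop by (simp add: coprime_cong_mult)
      then have "red (r * s) k \<in> SL2_mod (r * s)" using pos by (intro red_in_SL2) auto
      moreover have "red r (red (r * s) k) = g" "red s (red (r * s) k) = h"
        using k y by (metis red_eq_iff red_id red_cong mat_cong_mult_coprime[OF cop] mat_cong_trans)+
      ultimately show "y \<in> (\<lambda>g. (red r g, red s g)) ` SL2_mod (r * s)"
        unfolding y by (intro image_eqI[where x = "red (r * s) k"]) auto
    qed
  qed
  have "(\<Sum>g\<in>SL2_mod r. F g) * (\<Sum>g\<in>SL2_mod s. G g) = (\<Sum>y\<in>SL2_mod r \<times> SL2_mod s. F (fst y) * G (snd y))"
    by (simp add: sum_product sum.cartesian_product')
  also have "\<dots> = (\<Sum>g\<in>SL2_mod (r * s). F g * G g)"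
    by (subst sum.reindex_bij_betw[OF bij, symmetric]) (simp add: periodic_red[OF F] periodic_red[OF G])
  finally show ?thesis by simp
qed

lemma squarefree_eq_prod_prime_factors:
  fixes n :: nat assumes "squarefree n" shows "\<Prod>(prime_factors n) = n"
proof -
  have n: "n > 0" using assms by (metis not_squarefree_0 neq0_conv)
  have "(\<Prod>p\<in>prime_factors n. p ^ multiplicity p n) = \<Prod>(prime_factors n)"
    using assms n by (intro prod.cong refl) (simp add: squarefree_factorial_semiring')
  then show ?thesis using prime_factorization_nat[OF n] by simp
qed

lemma coprime_prod_primes:
  fixes p :: nat assumes "finite P" "\<And>q. q \<in> insert p P \<Longrightarrow> prime q" "p \<notin> P"
  shows "coprime p (\<Prod>P)"
  using assms by (intro prod_coprime_right) (metis primes_coprime insertCI)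

lemma periodic_prod:
  assumes "\<And>p. p \<in> P \<Longrightarrow> periodic r (F p)"
  shows "periodic r (\<lambda>g. \<Prod>p\<in>P. F p g)"
  using assms unfolding periodic_def by (auto intro!: prod.cong)

lemma sum_SL2_prod:
  fixes F :: "nat \<Rightarrow> int^2^2 \<Rightarrow> real"
  assumes "finite P" "\<And>p. p \<in> P \<Longrightarrow> prime p" "\<And>p. p \<in> P \<Longrightarrow> periodic p (F p)"
  shows "(\<Sum>g\<in>SL2_mod (\<Prod>P). \<Prod>p\<in>P. F p g) = (\<Prod>p\<in>P. \<Sum>g\<in>SL2_mod p. F p g)"
  using assms
proof (induction P rule: finite_induct)
  case empty
  then show ?case using SL2_mod_1 by simp
next
  case (insert p P)
  have "(\<Sum>g\<in>SL2_mod (p * \<Prod>P). F p g * (\<Prod>q\<in>P. F q g))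
      = (\<Sum>g\<in>SL2_mod p. F p g) * (\<Sum>g\<in>SL2_mod (\<Prod>P). \<Prod>q\<in>P. F q g)"
  proof (rule sum_SL2_mult)
    show "coprime p (\<Prod>P)" using insert by (intro coprime_prod_primes) auto
    show "0 < p" "0 < \<Prod>P" using insert by (auto intro!: prod_pos prime_gt_0_nat)
    show "periodic (\<Prod>P) (\<lambda>g. \<Prod>q\<in>P. F q g)"
    proof (rule periodic_prod)
      fix q assume q: "q \<in> P"
      then have "periodic q (F q)" using insert.prems by simp
      moreover have "q dvd \<Prod>P" using insert.hyps(1) q by (rule dvd_prodI)
      ultimately show "periodic (\<Prod>P) (F q)" by (rule periodic_dvd)
    qed
  qed (use insert in auto)
  then show ?case using insert by simp
qed

lemma sum_SL2_squarefree:
  fixes F :: "nat \<Rightarrow> int^2^2 \<Rightarrow> real"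
  assumes "squarefree n" "\<And>p. prime p \<Longrightarrow> p dvd n \<Longrightarrow> periodic p (F p)"
  shows "(\<Sum>g\<in>SL2_mod n. \<Prod>p\<in>prime_factors n. F p g) = (\<Prod>p\<in>prime_factors n. \<Sum>g\<in>SL2_mod p. F p g)"
  using sum_SL2_prod[of "prime_factors n" F] squarefree_eq_prod_prime_factors[OF assms(1)] assms(2)
  by auto

section \<open>Congruent pairs as a second moment\<close>

text \<open>The second moment of the distribution of \<open>A\<close> over residue classes, see
  \<open>coll_eq_sum\<close>. The large sieve sees its boxes of matrices only through these
  numbers.\<close>

definition coll :: "nat \<Rightarrow> (int^2^2) set \<Rightarrow> nat" where
  "coll r A = card {(x, y). x \<in> A \<and> y \<in> A \<and> mat_cong r x y}"

lemma sum_by_residue: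
  fixes F :: "int^2^2 \<Rightarrow> real"
  assumes r: "r > 0" and A: "finite A" "\<And>x. x \<in> A \<Longrightarrow> det x = 1" and F: "periodic r F"
  shows "(\<Sum>x\<in>A. F x) = (\<Sum>g\<in>SL2_mod r. real (card {x\<in>A. red r x = g}) * F g)"
proof -
  have "red r ` A \<subseteq> SL2_mod r" using r A(2) by (auto intro!: red_in_SL2)
  then have "(\<Sum>x\<in>A. F x) = (\<Sum>g\<in>SL2_mod r. \<Sum>x\<in>{x\<in>A. red r x = g}. F x)"
    using A by (intro sum.group[symmetric]) auto
  also have "\<dots> = (\<Sum>g\<in>SL2_mod r. real (card {x\<in>A. red r x = g}) * F g)"
  proof (rule sum.cong[OF refl])
    fix g
    have "(\<Sum>x\<in>{x\<in>A. red r x = g}. F x) = (\<Sum>x\<in>{x\<in>A. red r x = g}. F g)"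
    proof (rule sum.cong[OF refl])
      fix x assume "x \<in> {x\<in>A. red r x = g}"
      then have "g = red r x" by simp
      then show "F x = F g" by (simp add: periodic_red[OF F])
    qed
    then show "(\<Sum>x\<in>{x\<in>A. red r x = g}. F x) = real (card {x\<in>A. red r x = g}) * F g" by simp
  qed
  finally show ?thesis .
qed

lemma coll_eq_sum:
  assumes r: "r > 0" and A: "finite A" "\<And>x. x \<in> A \<Longrightarrow> det x = 1"
  shows "real (coll r A) = (\<Sum>g\<in>SL2_mod r. (real (card {x\<in>A. red r x = g}))\<^sup>2)"
proof -
  have "{(x, y). x \<in> A \<and> y \<in> A \<and> mat_cong r x y} = (SIGMA x:A. {y\<in>A. mat_cong r x y})" by auto
  then have "real (coll r A) = (\<Sum>x\<in>A. real (card {y\<in>A. mat_cong r x y}))"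
    using A by (simp add: coll_def)
  also have "\<dots> = (\<Sum>g\<in>SL2_mod r. real (card {x\<in>A. red r x = g}) * real (card {y\<in>A. mat_cong r g y}))"
  proof (rule sum_by_residue[OF r A])
    have "{y\<in>A. mat_cong r g y} = {y\<in>A. mat_cong r h y}" if "mat_cong r g h" for g h
      using that by (blast intro: mat_cong_trans mat_cong_sym)
    then show "periodic r (\<lambda>x. real (card {y\<in>A. mat_cong r x y}))" by (simp add: periodic_def)
  qed
  also have "\<dots> = (\<Sum>g\<in>SL2_mod r. (real (card {x\<in>A. red r x = g}))\<^sup>2)"
  proof (rule sum.cong[OF refl])
    fix g assume g: "g \<in> SL2_mod r"
    have "{y\<in>A. mat_cong r g y} = {x\<in>A. red r x = g}"
      using red_id[OF g] red_eq_iff by metis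
    then show "real (card {x\<in>A. red r x = g}) * real (card {y\<in>A. mat_cong r g y}) = (real (card {x\<in>A. red r x = g}))\<^sup>2"
      by (simp add: power2_eq_square)
  qed
  finally show ?thesis .
qed

text \<open>Grouping both sums by residue class turns them into a bilinear form in the class
  multiplicities, whose squared l2 norms are the collision counts; the Schur test then
  applies.\<close>

lemma bilinear_coll_bound:
  fixes K :: "int^2^2 \<Rightarrow> int^2^2 \<Rightarrow> real"
  assumes r: "r > 0" and A: "finite A" "\<And>x. x \<in> A \<Longrightarrow> det x = 1"
    and B: "finite B" "\<And>x. x \<in> B \<Longrightarrow> det x = 1"
    and K: "\<And>g h. 0 \<le> K g h"
    and per: "\<And>h. periodic r (\<lambda>g. K g h)" "\<And>g. periodic r (K g)"
    and row: "\<And>g. g \<in> SL2_mod r \<Longrightarrow> (\<Sum>h\<in>SL2_mod r. K g h) \<le> L"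
    and col: "\<And>h. h \<in> SL2_mod r \<Longrightarrow> (\<Sum>g\<in>SL2_mod r. K g h) \<le> L"
  shows "(\<Sum>x\<in>A. \<Sum>y\<in>B. K x y) \<le> L * sqrt (real (coll r A)) * sqrt (real (coll r B))"
proof -
  let ?a = "\<lambda>g. real (card {x\<in>A. red r x = g})" and ?b = "\<lambda>g. real (card {x\<in>B. red r x = g})"
  have "(\<Sum>x\<in>A. \<Sum>y\<in>B. K x y) = (\<Sum>x\<in>A. \<Sum>h\<in>SL2_mod r. ?b h * K x h)"
    by (intro sum.cong refl sum_by_residue r B per)
  also have "\<dots> = (\<Sum>g\<in>SL2_mod r. ?a g * (\<Sum>h\<in>SL2_mod r. ?b h * K g h))"
    using per(1) by (intro sum_by_residue r A) (auto simp: periodic_def intro!: sum.cong)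
  also have "\<dots> = (\<Sum>g\<in>SL2_mod r. \<Sum>h\<in>SL2_mod r. ?a g * ?b h * K g h)"
    by (simp add: sum_distrib_left mult.assoc)
  also have "\<dots> \<le> L * sqrt (\<Sum>g\<in>SL2_mod r. (?a g)\<^sup>2) * sqrt (\<Sum>g\<in>SL2_mod r. (?b g)\<^sup>2)"
    by (rule schur_test) (use K row col in auto)
  finally show ?thesis by (simp add: coll_eq_sum[OF r A] coll_eq_sum[OF r B])
qed

section \<open>Incidences on the projective line modulo a prime\<close>

lemma prime_dvd_cong_mult_iff:
  fixes a x y :: int
  assumes "[a = 1] (mod p)" shows "p dvd a * x \<longleftrightarrow> p dvd x"
  using cong_dvd_iff[OF cong_mult[OF assms cong_refl[of x p]]] by simp

lemma inverse_mod_prime: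
  assumes "prime p" "\<not> int p dvd a" shows "\<exists>x. [a * x = 1] (mod int p)"
proof (rule cong_solve_coprime_int)
  show "coprime a (int p)" using assms by (metis coprime_commute prime_imp_coprime prime_nat_int_transfer)
qed

text \<open>Once the top-left entry a is a unit, the equation a d - b c = 1 determines d, so a (p -
  1 choices) and the off-diagonal pair are free.\<close>

lemma card_SL2_unit_corner:
  assumes p: "prime p" and S: "S \<subseteq> {0..<int p} \<times> {0..<int p}"
  shows "card {g \<in> SL2_mod p. \<not> int p dvd g$1$1 \<and> (g$1$2, g$2$1) \<in> S} = (p - 1) * card S"
proof -
  let ?G = "{g \<in> SL2_mod p. \<not> int p dvd g$1$1 \<and> (g$1$2, g$2$1) \<in> S}"
  have p1: "int p > 1" using prime_gt_1_nat[OF p] by simp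
  obtain i where i: "\<And>a. \<not> int p dvd a \<Longrightarrow> [a * i a = 1] (mod int p)"
    using inverse_mod_prime[OF p] by metis
  have "bij_betw (\<lambda>g. (g$1$1, g$1$2, g$2$1)) ?G ({1..<int p} \<times> S)"
  proof (rule bij_betw_imageI)
    show "inj_on (\<lambda>g. (g$1$1, g$1$2, g$2$1)) ?G"
    proof (rule inj_onI)
      fix g h assume g: "g \<in> ?G" and h: "h \<in> ?G"
        and eq: "(g$1$1, g$1$2, g$2$1) = (h$1$1, h$1$2, h$2$1)"
      have "[det g = det h] (mod int p)"
        using g h by (metis (lifting) SL2_mod_det cong_sym cong_trans mem_Collect_eq)
      then have "[g$1$1 * g$2$2 = g$1$1 * h$2$2] (mod int p)"
        using eq by (simp add: det_2 cong_iff_dvd_diff)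
      moreover have "coprime (g$1$1) (int p)"
        using g p by (metis (lifting) coprime_commute mem_Collect_eq prime_imp_coprime prime_nat_int_transfer)
      ultimately have "[g$2$2 = h$2$2] (mod int p)" by (simp add: cong_mult_lcancel)
      then have "mat_cong p g h" using eq by (simp add: mat_cong_iff)
      then show "g = h" using g h by (auto intro: SL2_mod_eqI)
    qed
    show "(\<lambda>g. (g$1$1, g$1$2, g$2$1)) ` ?G = {1..<int p} \<times> S"
    proof (intro equalityI subsetI)
      fix y assume "y \<in> (\<lambda>g. (g$1$1, g$1$2, g$2$1)) ` ?G"
      then obtain g where g: "g \<in> ?G" "y = (g$1$1, g$1$2, g$2$1)" by auto
      then have "g$1$1 \<noteq> 0" "0 \<le> g$1$1" "g$1$1 < int p" by (auto simp: SL2_mod_def)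
      then show "y \<in> {1..<int p} \<times> S" using g by auto
    next
      fix y assume "y \<in> {1..<int p} \<times> S"
      then obtain a b c where y: "y = (a, b, c)" "a \<in> {1..<int p}" "(b, c) \<in> S" by auto
      have a: "\<not> int p dvd a" using y zdvd_not_zless by auto
      define d where "d = (i a * (1 + b * c)) mod int p"
      have "[a * d = a * (i a * (1 + b * c))] (mod int p)"
        unfolding d_def by (intro cong_mult cong_refl) (simp add: cong_def)
      also have "[a * (i a * (1 + b * c)) = 1 + b * c] (mod int p)"
        using cong_mult[OF i[OF a] cong_refl[of "1 + b * c"]] by (simp add: mult.assoc)
      finally have "[a * d - b * c = 1] (mod int p)" by (simp add: cong_iff_dvd_diff algebra_simps)
      then have "m2 a b c d \<in> ?G"
        using y a S p1 by (auto simp: SL2_mod_def forall_2 det_2 d_def)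
      then show "y \<in> (\<lambda>g. (g$1$1, g$1$2, g$2$1)) ` ?G"
        unfolding y by (intro image_eqI[where x = "m2 a b c d"]) auto
    qed
  qed
  then have "card ?G = card ({1..<int p} \<times> S)" by (rule bij_betw_same_card)
  also have "\<dots> = (p - 1) * card S" using p1 by (simp add: card_cartesian_product nat_diff_distrib)
  finally show ?thesis .
qed

lemma sum_of_bool_card:
  "finite A \<Longrightarrow> (\<Sum>x\<in>A. of_bool (P x)) = (of_nat (card {x\<in>A. P x}) :: real)"
  by (simp add: sum.If_cases of_bool_def Int_def)

lemma SL2_prime_entry: "prime p \<Longrightarrow> g \<in> SL2_mod p \<Longrightarrow> int p dvd g$i$j \<longleftrightarrow> g$i$j = 0"
  by (auto simp: SL2_mod_def dest: zdvd_imp_le) (metis dvd_imp_mod_0 mod_pos_pos_trivial)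

lemma card_SL2_lower_zero:
  assumes p: "prime p"
  shows "card {g \<in> SL2_mod p. int p dvd g$2$1} = p * (p - 1)"
proof -
  have "{g \<in> SL2_mod p. int p dvd g$2$1}
      = {g \<in> SL2_mod p. \<not> int p dvd g$1$1 \<and> (g$1$2, g$2$1) \<in> {0..<int p} \<times> {0}}" (is "_ = ?R")
  proof (intro equalityI subsetI)
    fix g assume "g \<in> {g \<in> SL2_mod p. int p dvd g$2$1}"
    then have g: "g \<in> SL2_mod p" "int p dvd g$2$1" by auto
    have "\<not> int p dvd g$1$1"
    proof
      assume "int p dvd g$1$1"
      then have "int p dvd det g" using g(2) by (simp add: det_2)
      then have "int p dvd 1" using SL2_mod_det[OF g(1)] cong_dvd_iff by blast
      then show False using prime_gt_1_nat[OF p] by simp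
    qed
    then show "g \<in> ?R" using g SL2_prime_entry[OF p g(1)] by (auto simp: SL2_mod_def)
  qed auto
  also have "card \<dots> = (p - 1) * card ({0..<int p} \<times> {0::int})"
    using prime_gt_0_nat[OF p] by (intro card_SL2_unit_corner p) auto
  finally show ?thesis by (simp add: card_cartesian_product)
qed

lemma card_SL2_diagonal:
  assumes p: "prime p"
  shows "card {g \<in> SL2_mod p. int p dvd g$2$1 \<and> int p dvd g$1$2} = p - 1"
proof -
  have "{g \<in> SL2_mod p. int p dvd g$2$1 \<and> int p dvd g$1$2}
      = {g \<in> SL2_mod p. \<not> int p dvd g$1$1 \<and> (g$1$2, g$2$1) \<in> {(0,0)}}" (is "_ = ?R")
  proof (intro equalityI subsetI)
    fix g assume "g \<in> {g \<in> SL2_mod p. int p dvd g$2$1 \<and> int p dvd g$1$2}"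
    then have g: "g \<in> SL2_mod p" "int p dvd g$2$1" "int p dvd g$1$2" by auto
    have "\<not> int p dvd g$1$1"
    proof
      assume "int p dvd g$1$1"
      then have "int p dvd det g" using g(2) by (simp add: det_2)
      then have "int p dvd 1" using SL2_mod_det[OF g(1)] cong_dvd_iff by blast
      then show False using prime_gt_1_nat[OF p] by simp
    qed
    then show "g \<in> ?R" using g SL2_prime_entry[OF p g(1)] by auto
  qed auto
  also have "card \<dots> = (p - 1) * card {(0::int,0::int)}"
    using prime_gt_0_nat[OF p] by (intro card_SL2_unit_corner p) auto
  finally show ?thesis by simp
qed

lemma periodic_of_bool:
  assumes "\<And>g h. mat_cong r g h \<Longrightarrow> P g \<longleftrightarrow> P h"
  shows "periodic r (\<lambda>g. of_bool (P g))"
  using assms by (auto simp: periodic_def)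

lemma card_SL2_prime:
  assumes p: "prime p"
  shows "real (card (SL2_mod p)) = real p * (real p ^ 2 - 1)"
proof -
  let ?A = "{g \<in> SL2_mod p. int p dvd g$1$1}" and ?B = "{g \<in> SL2_mod p. \<not> int p dvd g$1$1}"
  have "?B = {g \<in> SL2_mod p. \<not> int p dvd g$1$1 \<and> (g$1$2, g$2$1) \<in> {0..<int p} \<times> {0..<int p}}"
    by (auto simp: SL2_mod_def)
  then have B: "card ?B = (p - 1) * (p * p)"
    using card_SL2_unit_corner[OF p, of "{0..<int p} \<times> {0..<int p}"] by (simp add: card_cartesian_product)
  \<comment> \<open>The Weyl element moves the top-left entry, up to sign, to the lower-left place,
    so the matrices with non-unit top-left entry are as many as the upper triangular ones.\<close>
  have "(\<Sum>g\<in>SL2_mod p. of_bool (int p dvd (m2 0 1 (-1) 0 ** g)$2$1) :: real)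
      = (\<Sum>g\<in>SL2_mod p. of_bool (int p dvd g$2$1))"
    using prime_gt_0_nat[OF p]
    by (intro sum_SL2_left periodic_of_bool) (auto simp: mat_cong_iff cong_dvd_iff det_2)
  then have "real (card ?A) = real (card {g \<in> SL2_mod p. int p dvd g$2$1})"
    by (simp only: sum_of_bool_card[OF finite_SL2_mod] mat2_mult_nth m2_nth mult_minus1 mult_zero_left
        add_0_right dvd_minus_iff)
  then have A: "card ?A = p * (p - 1)" unfolding of_nat_eq_iff card_SL2_lower_zero[OF p] .
  have "SL2_mod p = ?A \<union> ?B" by auto
  then have "card (SL2_mod p) = card (?A \<union> ?B)" by simp
  also have "\<dots> = card ?A + card ?B" by (intro card_Un_disjoint) auto
  finally have "real (card (SL2_mod p)) = real (p * (p - 1) + (p - 1) * (p * p))" using A B by simp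
  then show ?thesis using prime_gt_0_nat[OF p] by (simp add: of_nat_diff algebra_simps power2_eq_square)
qed

section \<open>The action of SL2 on lines modulo p\<close>

definition nz :: "nat \<Rightarrow> int^2 \<Rightarrow> bool" where
  "nz p u \<longleftrightarrow> \<not> (int p dvd u$1 \<and> int p dvd u$2)"

text \<open>Each coordinate of b times \<open>cross a c\<close> is a combination of
  \<open>cross a b\<close> and \<open>cross b c\<close>, and one coordinate of b is a unit modulo p.
  Being parallel is transitive only through a vector that is nonzero modulo p.\<close>

lemma cross_parallel_trans:
  assumes p: "prime p" and b: "nz p b" and ab: "int p dvd cross a b" and bc: "int p dvd cross b c"
  shows "int p dvd cross a c"
proof -
  have "b$1 * cross a c = a$1 * cross b c + c$1 * cross a b"
    "b$2 * cross a c = a$2 * cross b c + c$2 * cross a b"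
    by (simp_all add: cross_def algebra_simps)
  then have "int p dvd b$1 * cross a c" "int p dvd b$2 * cross a c" using ab bc by auto
  then show ?thesis using b p by (metis nz_def prime_dvd_mult_iff prime_nat_int_transfer)
qed

lemma cross_commute_dvd: "int p dvd cross a b \<longleftrightarrow> int p dvd cross b a"
proof -
  have "cross a b = - cross b a" by (simp add: cross_def)
  then show ?thesis by simp
qed

lemma exists_nonparallel:
  assumes "nz p u" shows "\<exists>w. nz p w \<and> \<not> int p dvd cross u w"
proof -
  have "nz p (vector [1, 0] :: int^2) \<or> p = 1" "nz p (vector [0, 1] :: int^2) \<or> p = 1"
    by (auto simp: nz_def)
  moreover have "p \<noteq> 1" using assms by (auto simp: nz_def)
  ultimately show ?thesis using assms
    by (cases "int p dvd u$2") (auto simp: nz_def cross_def intro: exI[of _ "vector [1, 0]"] exI[of _ "vector [0, 1]"])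
qed

lemma nz_mult:
  assumes "[det g = 1] (mod int p)" "nz p u" shows "nz p (g *v u)"
proof -
  have "det g * u$1 = g$2$2 * (g *v u)$1 - g$1$2 * (g *v u)$2"
    "det g * u$2 = g$1$1 * (g *v u)$2 - g$2$1 * (g *v u)$1"
    by (simp_all add: mat2_vmult_nth det_2 algebra_simps)
  then show ?thesis using assms prime_dvd_cong_mult_iff[OF assms(1)] unfolding nz_def
    by (metis dvd_diff dvd_mult)
qed

text \<open>Rescaling w by the inverse of \<open>cross u w\<close> gives the matrix with columns u
  and w determinant 1. Such frames move two distinct lines to the coordinate axes, which is double
  transitivity on lines.\<close>

lemma unimodular_frame:
  assumes p: "prime p" and uw: "\<not> int p dvd cross u w"
  obtains U l where "[det U = 1] (mod int p)" "U *v vector [1, 0] = u"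
    "\<not> int p dvd l" "\<And>i. (U *v vector [0, 1])$i = l * w$i"
proof -
  obtain l where l: "[cross u w * l = 1] (mod int p)" using inverse_mod_prime[OF p uw] by blast
  let ?U = "m2 (u$1) (l * w$1) (u$2) (l * w$2)"
  show thesis
  proof
    have "det ?U = cross u w * l" by (simp add: det_2 cross_def algebra_simps)
    then show "[det ?U = 1] (mod int p)" using l by simp
    show "?U *v vector [1, 0] = u" by (simp add: vec_eq_iff forall_2 mat2_vmult_nth)
    show "\<not> int p dvd l"
    proof
      assume "int p dvd l"
      then have "int p dvd cross u w * l" by simp
      then have "int p dvd 1" using cong_dvd_iff[OF l] by blast
      then show False using prime_gt_1_nat[OF p] by simp
    qed
    show "(?U *v vector [0, 1])$i = l * w$i" for i
      using exhaust_2[of i] by (auto simp: mat2_vmult_nth)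
  qed
qed

lemma frame_change:
  assumes p: "prime p" and U: "[det U = 1] (mod int p)" and V: "[det V = 1] (mod int p)"
  shows "int p dvd cross (V ** g ** adj2 U *v (U *v e)) (V *v f) \<longleftrightarrow> int p dvd cross (g *v e) f"
proof -
  have "cross (V ** g ** adj2 U *v (U *v e)) (V *v f) = det V * (det U * cross (g *v e) f)"
    by (simp add: cross_def mat2_vmult_nth mat2_mult_nth det_2 algebra_simps)
  then show ?thesis using prime_dvd_cong_mult_iff[OF U] prime_dvd_cong_mult_iff[OF V] by simp
qed

lemma periodic_parallel: "periodic p (\<lambda>g. of_bool (int p dvd cross (g *v u) v) :: real)"
proof (rule periodic_of_bool)
  fix g h assume "mat_cong p g h"
  then have "[cross (g *v u) v = cross (h *v u) v] (mod int p)"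
    by (simp add: mat_cong_iff cross_def mat2_vmult_nth cong_add cong_diff cong_mult)
  then show "int p dvd cross (g *v u) v \<longleftrightarrow> int p dvd cross (h *v u) v" by (rule cong_dvd_iff)
qed

text \<open>Frames at u and v move both lines to the first axis, where the incidence says that the
  lower-left entry vanishes: the set is a translate of a Borel subgroup.\<close>

lemma card_parallel:
  assumes p: "prime p" and u: "nz p u" and v: "nz p v"
  shows "(\<Sum>g\<in>SL2_mod p. of_bool (int p dvd cross (g *v u) v) :: real) = real p * (real p - 1)"
proof -
  obtain w where w: "\<not> int p dvd cross u w" using exists_nonparallel[OF u] by blast
  obtain w' where w': "\<not> int p dvd cross v w'" using exists_nonparallel[OF v] by blast
  obtain U where U: "[det U = 1] (mod int p)" "U *v vector [1, 0] = u" using unimodular_frame[OF p w] by metis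
  obtain V where V: "[det V = 1] (mod int p)" "V *v vector [1, 0] = v" using unimodular_frame[OF p w'] by metis
  have "(\<Sum>g\<in>SL2_mod p. of_bool (int p dvd cross (g *v u) v) :: real)
      = (\<Sum>g\<in>SL2_mod p. of_bool (int p dvd cross ((V ** g ** adj2 U) *v u) v))"
    using U V prime_gt_0_nat[OF p] by (intro sum_SL2_shift[symmetric] periodic_parallel) auto
  also have "\<dots> = (\<Sum>g\<in>SL2_mod p. of_bool (int p dvd g$2$1))"
    using frame_change[OF p U(1) V(1), of _ "vector [1,0]" "vector [1,0]"] unfolding U(2) V(2)
    by (simp add: cross_def mat2_vmult_nth)
  also have "\<dots> = real p * (real p - 1)"
    unfolding sum_of_bool_card[OF finite_SL2_mod] card_SL2_lower_zero[OF p]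
    using prime_gt_0_nat[OF p] by (simp add: of_nat_diff Suc_le_eq)
  finally show ?thesis .
qed

text \<open>Here the frames send u, u' and v, v' to the two axes, so both incidences together say
  that the matrix is diagonal: a torus with p - 1 elements.\<close>

lemma card_parallel2:
  assumes p: "prime p" and u: "\<not> int p dvd cross u u'" and v: "\<not> int p dvd cross v v'"
  shows "(\<Sum>g\<in>SL2_mod p. of_bool (int p dvd cross (g *v u) v) * of_bool (int p dvd cross (g *v u') v') :: real)
    = real p - 1"
proof -
  let ?e = "vector [1, 0] :: int^2" and ?f = "vector [0, 1] :: int^2"
  obtain U l where U: "[det U = 1] (mod int p)" "U *v ?e = u" "\<not> int p dvd l" "\<And>i. (U *v ?f)$i = l * u'$i"
    using unimodular_frame[OF p u] by metis
  obtain V l' where V: "[det V = 1] (mod int p)" "V *v ?e = v" "\<not> int p dvd l'" "\<And>i. (V *v ?f)$i = l' * v'$i"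
    using unimodular_frame[OF p v] by metis
  have "(\<Sum>g\<in>SL2_mod p. of_bool (int p dvd cross (g *v u) v) * of_bool (int p dvd cross (g *v u') v') :: real)
      = (\<Sum>g\<in>SL2_mod p. of_bool (int p dvd cross ((V ** g ** adj2 U) *v u) v)
           * of_bool (int p dvd cross ((V ** g ** adj2 U) *v u') v'))"
  proof (rule sum_SL2_shift[symmetric])
    show "periodic p (\<lambda>g. of_bool (int p dvd cross (g *v u) v) * of_bool (int p dvd cross (g *v u') v') :: real)"
      using periodic_parallel[of p u v] periodic_parallel[of p u' v'] by (simp add: periodic_def)
  qed (use U V prime_gt_0_nat[OF p] in auto)
  also have "\<dots> = (\<Sum>g\<in>SL2_mod p. of_bool (int p dvd g$2$1 \<and> int p dvd g$1$2))"
  proof (rule sum.cong[OF refl])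
    fix g
    have 1: "int p dvd cross ((V ** g ** adj2 U) *v u) v \<longleftrightarrow> int p dvd g$2$1"
      using frame_change[OF p U(1) V(1), of g ?e ?e] unfolding U(2) V(2)
      by (simp add: cross_def mat2_vmult_nth)
    have "cross ((V ** g ** adj2 U) *v (U *v ?f)) (V *v ?f) = l * (l' * cross ((V ** g ** adj2 U) *v u') v')"
      by (simp add: cross_def mat2_vmult_nth[of _ "U *v ?f"] mat2_vmult_nth[of _ u'] U(4) V(4) algebra_simps)
    moreover have "int p dvd l * (l' * x) \<longleftrightarrow> int p dvd x" for x
      using U(3) V(3) p by (simp add: prime_dvd_mult_iff)
    moreover have "int p dvd cross ((V ** g ** adj2 U) *v (U *v ?f)) (V *v ?f) \<longleftrightarrow> int p dvd g$1$2"
      unfolding frame_change[OF p U(1) V(1)] by (simp add: cross_def mat2_vmult_nth)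
    ultimately have 2: "int p dvd cross ((V ** g ** adj2 U) *v u') v' \<longleftrightarrow> int p dvd g$1$2" by simp
    show "of_bool (int p dvd cross ((V ** g ** adj2 U) *v u) v) * of_bool (int p dvd cross ((V ** g ** adj2 U) *v u') v')
        = (of_bool (int p dvd g$2$1 \<and> int p dvd g$1$2) :: real)" by (simp only: 1 2 of_bool_conj)
  qed
  also have "\<dots> = real p - 1"
    unfolding sum_of_bool_card[OF finite_SL2_mod] card_SL2_diagonal[OF p]
    using prime_gt_0_nat[OF p] by (simp add: of_nat_diff Suc_le_eq)
  finally show ?thesis .
qed

definition par :: "nat \<Rightarrow> int^2 \<Rightarrow> int^2 \<Rightarrow> real" where
  "par p u v = of_bool (int p dvd cross u v)"

text \<open>There are p + 1 lines modulo p and the action is transitive, so 1/(p + 1) is the mean of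
  the incidence and \<open>par0\<close> averages to zero.\<close>

definition par0 :: "nat \<Rightarrow> int^2 \<Rightarrow> int^2 \<Rightarrow> real" where
  "par0 p u v = par p u v - 1 / (real p + 1)"

lemma par0_abs_le: "\<bar>par0 p u v\<bar> \<le> par p u v + 1 / (real p + 1)"
  unfolding par0_def par_def by (intro abs_leI) (auto simp: of_bool_def)

lemma periodic_par: "periodic p (\<lambda>g. par p (g *v u) v)"
  unfolding par_def by (rule periodic_parallel)

lemma periodic_par0: "periodic p (\<lambda>g. par0 p (g *v u) v)"
  using periodic_par[of p u v] by (simp add: par0_def periodic_def)

lemma sum_par:
  assumes "prime p" "nz p u" "nz p v"
  shows "(\<Sum>g\<in>SL2_mod p. par p (g *v u) v) = real (card (SL2_mod p)) / (real p + 1)"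
proof -
  have "real p * (real p ^ 2 - 1) / (real p + 1) = real p * (real p - 1)"
    by (simp add: field_simps power2_eq_square)
  then show ?thesis using card_parallel[OF assms] unfolding par_def card_SL2_prime[OF assms(1)] by simp
qed

lemma sum_par0:
  assumes "prime p" "nz p u" "nz p v"
  shows "(\<Sum>g\<in>SL2_mod p. par0 p (g *v u) v) = 0"
  using sum_par[OF assms] by (simp add: par0_def sum_subtractf)

text \<open>Double transitivity of the action on the projective line.\<close>

lemma sum_par0_par0:
  assumes p: "prime p" and nz: "nz p u" "nz p v" "nz p u'" "nz p v'"
  shows "(\<Sum>g\<in>SL2_mod p. par0 p (g *v u) v * par0 p (g *v u') v')
    = (real p ^ 2 - 1) * (par0 p u u' * par0 p v v')"
proof -
  let ?G = "SL2_mod p" and ?q = "1 / (real p + 1)"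
  let ?A = "\<lambda>g. int p dvd cross (g *v u) v" and ?B = "\<lambda>g. int p dvd cross (g *v u') v'"
  define AB where "AB = (\<Sum>g\<in>?G. par p (g *v u) v * par p (g *v u') v')"
  obtain Q where Q: "real p = Q - 1" "Q \<noteq> 0" by (rule that[of "real p + 1"]) auto
  have "(\<Sum>g\<in>?G. par0 p (g *v u) v * par0 p (g *v u') v')
      = (\<Sum>g\<in>?G. par p (g *v u) v * par p (g *v u') v' - ?q * par p (g *v u) v - ?q * par p (g *v u') v' + ?q * ?q)"
    by (intro sum.cong refl) (simp add: par0_def algebra_simps)
  also have "\<dots> = AB - ?q * (\<Sum>g\<in>?G. par p (g *v u) v) - ?q * (\<Sum>g\<in>?G. par p (g *v u') v') + real (card ?G) * (?q * ?q)"
    by (simp only: sum.distrib sum_subtractf sum_distrib_left[symmetric] AB_def sum_constant mult_ac)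
  also have "\<dots> = AB - ?q * ?q * real (card ?G)"
    unfolding sum_par[OF p nz(1,2)] sum_par[OF p nz(3,4)] by simp
  also have "\<dots> = AB - real p * (real p - 1) / (real p + 1)"
    unfolding card_SL2_prime[OF p] Q(1) using Q(2) by (simp add: field_simps power2_eq_square)
  finally have main: "(\<Sum>g\<in>?G. par0 p (g *v u) v * par0 p (g *v u') v')
      = AB - real p * (real p - 1) / (real p + 1)" .
  have nzg: "nz p (g *v u)" "nz p (g *v u')" if "g \<in> ?G" for g
    using nz_mult[OF SL2_mod_det[OF that]] nz by auto
  have cg: "int p dvd cross (g *v u) (g *v u') \<longleftrightarrow> int p dvd cross u u'" if "g \<in> ?G" for g
    unfolding cross_mult by (rule prime_dvd_cong_mult_iff[OF SL2_mod_det[OF that]])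
  have tr: "int p dvd cross a b \<Longrightarrow> int p dvd cross b c \<Longrightarrow> nz p b \<Longrightarrow> int p dvd cross a c" for a b c
    using cross_parallel_trans[OF p] by blast
  note sy = cross_commute_dvd
  \<comment> \<open>\<open>AB\<close> depends only on which of the lines coincide: the two
    incidences are equivalent if both pairs agree, contradictory if exactly one pair agrees, and
    counted by a torus if neither does.\<close>
  consider "int p dvd cross u u'" "int p dvd cross v v'" | "int p dvd cross u u'" "\<not> int p dvd cross v v'"
    | "\<not> int p dvd cross u u'" "int p dvd cross v v'" | "\<not> int p dvd cross u u'" "\<not> int p dvd cross v v'" by blast
  then show ?thesis
  proof cases
    case 1
    have "?A g \<longleftrightarrow> ?B g" if g: "g \<in> ?G" for g
      using 1 nz nzg[OF g] cg[OF g] tr sy by meson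
    then have "AB = (\<Sum>g\<in>?G. par p (g *v u) v)"
      unfolding AB_def by (intro sum.cong) (auto simp: par_def)
    then have AB: "AB = real p * (real p - 1)" using card_parallel[OF p nz(1,2)] by (simp add: par_def)
    show ?thesis unfolding main AB using 1 Q(2) by (simp add: par0_def par_def Q(1) field_simps power2_eq_square)
  next
    case 2
    have "\<not> (?A g \<and> ?B g)" if g: "g \<in> ?G" for g
      using 2 nz nzg[OF g] cg[OF g] tr sy by meson
    then have "AB = 0" unfolding AB_def by (intro sum.neutral) (auto simp: par_def)
    then show ?thesis unfolding main using 2 Q(2) by (simp add: par0_def par_def Q(1) field_simps power2_eq_square)
  next
    case 3
    have "\<not> (?A g \<and> ?B g)" if g: "g \<in> ?G" for g
      using 3 nz nzg[OF g] cg[OF g] tr sy by meson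
    then have "AB = 0" unfolding AB_def by (intro sum.neutral) (auto simp: par_def)
    then show ?thesis unfolding main using 3 Q(2) by (simp add: par0_def par_def Q(1) field_simps power2_eq_square)
  next
    case 4
    have AB: "AB = real p - 1" unfolding AB_def par_def by (rule card_parallel2[OF p 4])
    show ?thesis unfolding main AB using 4 Q(2) by (simp add: par0_def par_def Q(1) field_simps power2_eq_square)
  qed
qed

section \<open>Local densities\<close>

lemma quad_form_eq: "quad_form g = (g$1$1)\<^sup>2 + (g$1$2)\<^sup>2 + (g$2$1)\<^sup>2 + (g$2$2)\<^sup>2"
  by (simp add: quad_form_def trace_def sum_2 mat2_mult_nth transpose_def power2_eq_square)

text \<open>With \<open>quad_form_sum\<close> this factors f^2 - 4 det^2 into two sums of two
  squares; hence the behaviour of p in the Gaussian integers decides when p divides f^2 - 4.\<close>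

lemma quad_form_diff: "quad_form g - 2 * det g = (g$1$1 - g$2$2)\<^sup>2 + (g$1$2 + g$2$1)\<^sup>2"
  by (simp add: quad_form_eq det_2 power2_eq_square algebra_simps)

lemma quad_form_sum: "quad_form g + 2 * det g = (g$1$1 + g$2$2)\<^sup>2 + (g$1$2 - g$2$1)\<^sup>2"
  by (simp add: quad_form_eq det_2 power2_eq_square algebra_simps)

lemma quad_form_square_ge:
  assumes "det g = 1" shows "0 \<le> (quad_form g)\<^sup>2 - 4"
proof -
  have "0 \<le> (g$1$1 - g$2$2)\<^sup>2 + (g$1$2 + g$2$1)\<^sup>2" by simp
  then have "2 \<le> quad_form g" unfolding quad_form_diff[symmetric] using assms by simp
  then have "2\<^sup>2 \<le> (quad_form g)\<^sup>2" by (intro power_mono) auto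
  then show ?thesis by simp
qed

lemma minus_one_square_mod_iff:
  assumes p: "prime p" "p \<noteq> 2"
  shows "(\<exists>i. [i\<^sup>2 = -1] (mod int p)) \<longleftrightarrow> p mod 4 = 1"
proof -
  have p2: "2 < p" using p prime_ge_2_nat[of p] by linarith
  have n1: "\<not> [-1 = 0] (mod int p)" using p2 by (simp add: cong_0_iff)
  have n2: "\<not> [1 = -1] (mod int p)" using p2 zdvd_imp_le[of "int p" 2] by (auto simp: cong_iff_dvd_diff)
  have ec: "[Legendre (-1) (int p) = (-1) ^ ((p - 1) div 2)] (mod int p)"
    by (rule euler_criterion[OF p(1) p2])
  have odd: "odd p" using p by (simp add: prime_odd_nat p2)
  have ev: "even ((p - 1) div 2) \<longleftrightarrow> p mod 4 = 1" using odd by presburger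
  show ?thesis
  proof (cases "p mod 4 = 1")
    case True
    then have "[Legendre (-1) (int p) = 1] (mod int p)" using ec ev by simp
    then have "QuadRes (int p) (-1)"
      using n2 n1 by (auto simp: Legendre_def cong_sym_eq split: if_splits)
    then show ?thesis using True by (simp add: QuadRes_def)
  next
    case False
    then have "[Legendre (-1) (int p) = -1] (mod int p)" using ec ev by simp
    then have "\<not> QuadRes (int p) (-1)"
      using n2 n1 by (auto simp: Legendre_def split: if_splits)
    then show ?thesis using False by (simp add: QuadRes_def)
  qed
qed

text \<open>If y were a unit modulo p, then x/y would be a square root of -1, which does not exist
  for odd p not congruent to 1 modulo 4.\<close>

lemma dvd_sum_squares:
  assumes p: "prime p" "p \<noteq> 2" "p mod 4 \<noteq> 1" and d: "int p dvd x\<^sup>2 + y\<^sup>2"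
  shows "int p dvd x \<and> int p dvd y"
proof -
  have ip: "prime (int p)" using p(1) by simp
  have y: "int p dvd y"
  proof (rule ccontr)
    assume "\<not> int p dvd y"
    then obtain j where j: "[y * j = 1] (mod int p)" using inverse_mod_prime[OF p(1)] by blast
    have "[x\<^sup>2 + y\<^sup>2 = 0] (mod int p)" using d by (simp add: cong_0_iff)
    then have "[(x\<^sup>2 + y\<^sup>2) * j\<^sup>2 = 0 * j\<^sup>2] (mod int p)" by (intro cong_mult cong_refl)
    then have "[(x * j)\<^sup>2 + (y * j)\<^sup>2 = 0] (mod int p)" by (simp add: power_mult_distrib algebra_simps)
    moreover have "[(x * j)\<^sup>2 + (y * j)\<^sup>2 = (x * j)\<^sup>2 + 1] (mod int p)"
      using cong_pow[OF j, of 2] by (intro cong_add cong_refl) simp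
    ultimately have "[(x * j)\<^sup>2 + 1 = 0] (mod int p)" using cong_sym cong_trans by blast
    then have "[(x * j)\<^sup>2 = -1] (mod int p)" by (simp add: cong_iff_dvd_diff)
    then show False using minus_one_square_mod_iff[OF p(1,2)] p(3) by blast
  qed
  then have "int p dvd y\<^sup>2" by (simp add: power2_eq_square)
  then have "int p dvd x\<^sup>2" using d by (simp add: dvd_add_left_iff)
  then show ?thesis using y ip by (simp add: prime_dvd_power_iff)
qed

text \<open>The square root \<open>rt p\<close> of \<open>-1\<close> is junk unless \<open>p \<equiv> 1\<close> modulo 4 (or \<open>p = 2\<close>); then \<open>line p s\<close>
  for \<open>s = \<plusminus>1\<close> spans an isotropic line of \<open>x\<^sup>2 + y\<^sup>2\<close>.\<close>

definition rt :: "nat \<Rightarrow> int" where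
  "rt p = (SOME i. [i\<^sup>2 = -1] (mod int p))"

definition line :: "nat \<Rightarrow> int \<Rightarrow> int^2" where
  "line p s = vector [1, s * rt p]"

lemma nz_line: "prime p \<Longrightarrow> nz p (line p s)"
  by (auto simp: nz_def line_def)

definition hit :: "nat \<Rightarrow> int^2^2 \<Rightarrow> real" where
  "hit p g = of_bool (int p dvd (quad_form g)\<^sup>2 - 4)"

text \<open>There are four ordered pairs of isotropic lines, and each incidence has probability 1/(p
  + 1).\<close>

definition rho :: "nat \<Rightarrow> real" where
  "rho p = (if p mod 4 = 1 then 4 / (real p + 1) else 0)"

definition osc :: "nat \<Rightarrow> int^2^2 \<Rightarrow> real" where
  "osc p g = (if p mod 4 = 1 then \<Sum>s\<in>{1,-1}. \<Sum>t\<in>{1,-1}. par0 p (g *v line p s) (line p t) else 0)"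

definition kap :: "nat \<Rightarrow> int^2^2 \<Rightarrow> real" where
  "kap p g = hit p g - rho p - osc p g"

text \<open>Both squares of one of the two sums in \<open>quad_form_diff\<close> and
  \<open>quad_form_sum\<close> vanish modulo p. At a split prime this means two simultaneous
  incidences; at an odd inert prime it is the only way for p to divide f^2 - 4.\<close>

definition isotropic :: "nat \<Rightarrow> int^2^2 \<Rightarrow> bool" where
  "isotropic p g \<longleftrightarrow> int p dvd g$1$1 - g$2$2 \<and> int p dvd g$1$2 + g$2$1
     \<or> int p dvd g$1$1 + g$2$2 \<and> int p dvd g$1$2 - g$2$1"

text \<open>Representatives have determinant 1 only modulo p, so the factorization is used in its
  homogeneous form f^2 - 4 det^2.\<close>

lemma hit_iff_det:
  assumes "[det g = 1] (mod int p)"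
  shows "int p dvd (quad_form g)\<^sup>2 - 4 \<longleftrightarrow> int p dvd (quad_form g - 2 * det g) * (quad_form g + 2 * det g)"
proof -
  have "[(det g)\<^sup>2 = 1\<^sup>2] (mod int p)" by (rule cong_pow[OF assms])
  then have "[(quad_form g)\<^sup>2 - 4 * (det g)\<^sup>2 = (quad_form g)\<^sup>2 - 4 * 1] (mod int p)"
    by (intro cong_diff cong_mult cong_refl) simp
  moreover have "(quad_form g - 2 * det g) * (quad_form g + 2 * det g) = (quad_form g)\<^sup>2 - 4 * (det g)\<^sup>2"
    by (simp add: power2_eq_square algebra_simps)
  ultimately show ?thesis using cong_dvd_iff by fastforce
qed

lemma not_dvd_det_multiples:
  assumes p: "prime p" "p \<noteq> 2" and d: "[det g = 1] (mod int p)"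
  shows "\<not> (int p dvd quad_form g - 2 * det g \<and> int p dvd quad_form g + 2 * det g)"
proof
  assume "int p dvd quad_form g - 2 * det g \<and> int p dvd quad_form g + 2 * det g"
  then have "int p dvd (quad_form g + 2 * det g) - (quad_form g - 2 * det g)" by (elim conjE) (rule dvd_diff)
  then have "int p dvd det g * 4" by (simp add: algebra_simps)
  then have "int p dvd 2 ^ 2" using prime_dvd_cong_mult_iff[OF d] by simp
  then have "p dvd 2 ^ 2" by (metis int_dvd_int_iff of_nat_numeral of_nat_power)
  then show False using p by (metis prime_dvd_power primes_dvd_imp_eq two_is_prime_nat)
qed

text \<open>Each of the two sums of squares splits into two linear forms, and the four forms are the
  four incidences of isotropic lines. So \<open>kap\<close> is the indicator of a union minus the
  sum of the indicators. The two sums cannot both vanish modulo p, hence at most two events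
  coincide, and these make the matrix \<open>isotropic\<close>.\<close>

lemma kap_split:
  assumes p: "prime p" "p mod 4 = 1" and d: "[det g = 1] (mod int p)"
  shows "kap p g \<le> 0" "\<bar>kap p g\<bar> \<le> of_bool (isotropic p g)"
proof -
  have p2: "p \<noteq> 2" using p(2) by auto
  have ip: "prime (int p)" using p(1) by simp
  define i where "i = rt p"
  have i: "[i\<^sup>2 = -1] (mod int p)"
    unfolding i_def rt_def using minus_one_square_mod_iff[OF p(1) p2] p(2) by (metis someI_ex)
  have ni: "\<not> int p dvd i"
  proof
    assume "int p dvd i"
    then have "int p dvd i\<^sup>2" by (simp add: power2_eq_square)
    then have "int p dvd -1" using cong_dvd_iff[OF i] by blast
    then show False using prime_gt_1_nat[OF p(1)] by simp
  qed
  have n2: "\<not> int p dvd 2"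
  proof
    assume "int p dvd 2"
    then have "p dvd 2" by (metis int_dvd_int_iff of_nat_numeral)
    then show False using p(1) p2 by (simp add: primes_dvd_imp_eq)
  qed
  define al be ga de where "al = g$1$1 - g$2$2" and "be = g$1$2 + g$2$1"
    and "ga = g$1$1 + g$2$2" and "de = g$1$2 - g$2$1"
  have cr: "[cross (g *v line p s) (line p t) = i * (t * g$1$1 - s * g$2$2) - g$2$1 - s * t * g$1$2] (mod int p)" for s t
  proof -
    have "cross (g *v line p s) (line p t) = i * (t * g$1$1 - s * g$2$2) - g$2$1 + s * t * g$1$2 * i\<^sup>2"
      by (simp add: cross_def mat2_vmult_nth line_def i_def[symmetric] power2_eq_square algebra_simps)
    also have "[\<dots> = i * (t * g$1$1 - s * g$2$2) - g$2$1 + s * t * g$1$2 * (-1)] (mod int p)"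
      by (intro cong_add cong_mult cong_refl i)
    finally show ?thesis by simp
  qed
  let ?e = "\<lambda>s t. int p dvd cross (g *v line p s) (line p t)"
  have e: "?e 1 1 \<longleftrightarrow> int p dvd i * al - be" "?e (-1) (-1) \<longleftrightarrow> int p dvd i * al + be"
    "?e 1 (-1) \<longleftrightarrow> int p dvd i * ga - de" "?e (-1) 1 \<longleftrightarrow> int p dvd i * ga + de"
    subgoal using cong_dvd_iff[OF cr[of 1 1]] by (simp add: al_def be_def algebra_simps)
    subgoal
    proof -
      have "i * (- 1 * g$1$1 - - 1 * g$2$2) - g$2$1 - - 1 * - 1 * g$1$2 = - (i * al + be)"
        by (simp add: al_def be_def algebra_simps)
      then show ?thesis using cong_dvd_iff[OF cr[of "-1" "-1"]] by (metis dvd_minus_iff)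
    qed
    subgoal
    proof -
      have "i * (- 1 * g$1$1 - 1 * g$2$2) - g$2$1 - 1 * - 1 * g$1$2 = - (i * ga - de)"
        by (simp add: ga_def de_def algebra_simps)
      then show ?thesis using cong_dvd_iff[OF cr[of 1 "-1"]] by (metis dvd_minus_iff)
    qed
    subgoal using cong_dvd_iff[OF cr[of "-1" 1]] by (simp add: ga_def de_def algebra_simps)
    done
  \<comment> \<open>Since i^2 = -1 modulo p, the product (i x - y)(i x + y) is congruent to -(x^2 +
    y^2).\<close>
  have fac: "int p dvd x\<^sup>2 + y\<^sup>2 \<longleftrightarrow> int p dvd i * x - y \<or> int p dvd i * x + y" for x y
  proof -
    have "(i * x - y) * (i * x + y) = i\<^sup>2 * x\<^sup>2 - y\<^sup>2" by (simp add: power2_eq_square algebra_simps)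
    also have "[\<dots> = (-1) * x\<^sup>2 - y\<^sup>2] (mod int p)" by (intro cong_diff cong_mult cong_refl i)
    also have "(-1) * x\<^sup>2 - y\<^sup>2 = - (x\<^sup>2 + y\<^sup>2)" by simp
    finally have "int p dvd (i * x - y) * (i * x + y) \<longleftrightarrow> int p dvd - (x\<^sup>2 + y\<^sup>2)"
      by (rule cong_dvd_iff)
    then show ?thesis unfolding dvd_minus_iff prime_dvd_mult_iff[OF ip] by blast
  qed
  have both: "int p dvd x \<and> int p dvd y" if "int p dvd i * x - y" "int p dvd i * x + y" for x y
  proof -
    note dvd_add[OF that] dvd_diff[OF that(2) that(1)]
    then have "int p dvd 2 * (i * x)" "int p dvd 2 * y" by (simp_all add: algebra_simps)
    then show ?thesis using ip n2 ni by (simp add: prime_dvd_mult_iff)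
  qed
  have hitp: "int p dvd (quad_form g)\<^sup>2 - 4 \<longleftrightarrow> ?e 1 1 \<or> ?e (-1) (-1) \<or> ?e 1 (-1) \<or> ?e (-1) 1"
    unfolding hit_iff_det[OF d] prime_dvd_mult_iff[OF ip] quad_form_diff quad_form_sum
      al_def[symmetric] be_def[symmetric] ga_def[symmetric] de_def[symmetric] fac e by blast
  have excl: "\<not> ((?e 1 1 \<or> ?e (-1) (-1)) \<and> (?e 1 (-1) \<or> ?e (-1) 1))"
    using not_dvd_det_multiples[OF p(1) p2 d] unfolding quad_form_diff quad_form_sum
      al_def[symmetric] be_def[symmetric] ga_def[symmetric] de_def[symmetric] fac e .
  have iso: "?e 1 1 \<and> ?e (-1) (-1) \<or> ?e 1 (-1) \<and> ?e (-1) 1 \<Longrightarrow> isotropic p g"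
    unfolding isotropic_def al_def[symmetric] be_def[symmetric] ga_def[symmetric] de_def[symmetric] e
    using both by blast
  \<comment> \<open>The four subtracted means 1/(p + 1) inside \<open>osc\<close> cancel
    \<open>rho p\<close> exactly.\<close>
  have k: "kap p g = of_bool (?e 1 1 \<or> ?e (-1) (-1) \<or> ?e 1 (-1) \<or> ?e (-1) 1)
      - (of_bool (?e 1 1) + of_bool (?e (-1) (-1)) + of_bool (?e 1 (-1)) + of_bool (?e (-1) 1))"
    unfolding kap_def hit_def hitp osc_def rho_def par0_def par_def using p(2) by simp
  show "kap p g \<le> 0" unfolding k by (auto simp: of_bool_def)
  show "\<bar>kap p g\<bar> \<le> of_bool (isotropic p g)"
    unfolding k using excl iso by (auto simp: of_bool_def)
qed

lemma kap_inert:
  assumes p: "prime p" "p \<noteq> 2" "p mod 4 \<noteq> 1" and d: "[det g = 1] (mod int p)"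
  shows "\<bar>kap p g\<bar> \<le> of_bool (isotropic p g)"
proof -
  have ip: "prime (int p)" using p(1) by simp
  have iso: "isotropic p g" if "int p dvd (quad_form g)\<^sup>2 - 4"
    using that dvd_sum_squares[OF p]
    unfolding hit_iff_det[OF d] prime_dvd_mult_iff[OF ip] quad_form_diff quad_form_sum isotropic_def by blast
  have k: "kap p g = hit p g" using p(3) by (simp add: kap_def rho_def osc_def)
  show ?thesis unfolding k hit_def
    by (cases "int p dvd (quad_form g)\<^sup>2 - 4") (simp_all add: iso)
qed

lemma kap_abs_le_isotropic:
  assumes "prime p" "p \<noteq> 2" "[det g = 1] (mod int p)"
  shows "\<bar>kap p g\<bar> \<le> of_bool (isotropic p g)"
  using kap_split(2)[OF assms(1) _ assms(3)] kap_inert[OF assms(1,2) _ assms(3)] by blast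

lemma kap_abs_le_1:
  assumes "prime p" "[det g = 1] (mod int p)" shows "\<bar>kap p g\<bar> \<le> 1"
proof (cases "p = 2")
  case True
  then have "rho p = 0" "osc p g = 0" by (simp_all add: rho_def osc_def)
  then show ?thesis by (simp add: kap_def hit_def)
next
  case False
  show ?thesis by (rule order_trans[OF kap_abs_le_isotropic[OF assms(1) False assms(2)]]) simp
qed

section \<open>Counting the exceptional matrices and bounding the local terms\<close>

lemma card_square_roots_le:
  assumes p: "prime p"
  shows "card {b \<in> {0..<int p}. int p dvd b\<^sup>2 - k} \<le> 2"
proof (cases "{b \<in> {0..<int p}. int p dvd b\<^sup>2 - k} = {}")
  case True
  show ?thesis unfolding True by simp
next
  case False
  have ip: "prime (int p)" using p by simp
  from False obtain b where b: "0 \<le> b" "b < int p" "int p dvd b\<^sup>2 - k" by auto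
  have "{b \<in> {0..<int p}. int p dvd b\<^sup>2 - k} \<subseteq> {b, (- b) mod int p}"
  proof
    fix c assume "c \<in> {b \<in> {0..<int p}. int p dvd b\<^sup>2 - k}"
    then have c: "0 \<le> c" "c < int p" "int p dvd c\<^sup>2 - k" by auto
    have "int p dvd (c\<^sup>2 - k) - (b\<^sup>2 - k)" using b(3) c(3) by (rule dvd_diff[rotated])
    then have "int p dvd (c - b) * (c + b)" by (simp add: power2_eq_square algebra_simps)
    then have "[c = b] (mod int p) \<or> [c = - b] (mod int p)"
      using ip by (simp add: prime_dvd_mult_iff cong_iff_dvd_diff)
    then show "c \<in> {b, (- b) mod int p}" using b c by (auto simp: cong_def)
  qed
  then have "card {b \<in> {0..<int p}. int p dvd b\<^sup>2 - k} \<le> card {b, (- b) mod int p}" by (intro card_mono) auto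
  also have "\<dots> \<le> 2" by (simp add: card_insert_if)
  finally show ?thesis .
qed

text \<open>With sign e, the second row is determined by the first row (a, b), and the determinant
  condition becomes a^2 + b^2 = e. For each of the p values of a at most two b remain, and there are
  two signs.\<close>

lemma card_isotropic:
  assumes p: "prime p"
  shows "card {g \<in> SL2_mod p. isotropic p g} \<le> 4 * p"
proof -
  let ?I = "{0..<int p}"
  let ?S = "\<lambda>k e. SIGMA a:?I. {b \<in> ?I. int p dvd b\<^sup>2 - (k - e * a\<^sup>2)}"
  have fin: "finite {b \<in> ?I. P b}" for P by (rule finite_subset[of _ ?I]) auto
  have finS: "finite (?S k e)" for k e by (intro finite_SigmaI fin finite_atLeastLessThan_int)
  have S: "card (?S k e) \<le> 2 * p" for k e
  proof -
    have "card (?S k e) = (\<Sum>a\<in>?I. card {b \<in> ?I. int p dvd b\<^sup>2 - (k - e * a\<^sup>2)})"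
      by (intro card_SigmaI ballI fin finite_atLeastLessThan_int)
    also have "\<dots> \<le> (\<Sum>a\<in>?I. 2)" by (intro sum_mono card_square_roots_le p)
    finally show ?thesis by simp
  qed
  have *: "card {g \<in> SL2_mod p. int p dvd g$1$1 - e * g$2$2 \<and> int p dvd g$1$2 + e * g$2$1} \<le> 2 * p"
    (is "card ?G \<le> _") if e: "e = 1 \<or> e = -1" for e
  proof -
    have ee: "e * e = 1" using e by auto
    have "(\<lambda>g. (g$1$1, g$1$2)) ` ?G \<subseteq> ?S e 1"
    proof
      fix y assume "y \<in> (\<lambda>g. (g$1$1, g$1$2)) ` ?G"
      then obtain g where g: "g \<in> SL2_mod p" "int p dvd g$1$1 - e * g$2$2" "int p dvd g$1$2 + e * g$2$1"
        "y = (g$1$1, g$1$2)" by auto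
      have "int p dvd det g - 1" using SL2_mod_det[OF g(1)] by (simp add: cong_iff_dvd_diff)
      moreover have "(g$1$2)\<^sup>2 - (e - 1 * (g$1$1)\<^sup>2)
         = e * (det g - 1) + g$1$1 * (g$1$1 - e * g$2$2) + g$1$2 * (g$1$2 + e * g$2$1)"
        by (simp add: det_2 power2_eq_square algebra_simps)
      ultimately have "int p dvd (g$1$2)\<^sup>2 - (e - 1 * (g$1$1)\<^sup>2)" using g(2,3) by simp
      then show "y \<in> ?S e 1" using g by (auto simp: SL2_mod_def)
    qed
    moreover have "inj_on (\<lambda>g. (g$1$1, g$1$2)) ?G"
    proof (rule inj_onI)
      fix g h assume g: "g \<in> ?G" and h: "h \<in> ?G" and eq: "(g$1$1, g$1$2) = (h$1$1, h$1$2)"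
      have "int p dvd (h$1$1 - e * h$2$2) - (g$1$1 - e * g$2$2)" "int p dvd (g$1$2 + e * g$2$1) - (h$1$2 + e * h$2$1)"
        using g h by (auto intro: dvd_diff)
      then have "int p dvd e * (g$2$2 - h$2$2)" "int p dvd e * (g$2$1 - h$2$1)"
        using eq by (simp_all add: algebra_simps)
      then have "int p dvd g$2$2 - h$2$2" "int p dvd g$2$1 - h$2$1" using e by (auto simp: dvd_diff_commute)
      then have "mat_cong p g h" using eq by (simp add: mat_cong_iff cong_iff_dvd_diff)
      then show "g = h" using g h by (auto intro: SL2_mod_eqI)
    qed
    ultimately have "card ?G \<le> card (?S e 1)" using finS by (intro card_inj_on_le)
    then show ?thesis using S[of e 1] by linarith
  qed
  have "{g \<in> SL2_mod p. isotropic p g} \<subseteq>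
      {g \<in> SL2_mod p. int p dvd g$1$1 - 1 * g$2$2 \<and> int p dvd g$1$2 + 1 * g$2$1} \<union>
      {g \<in> SL2_mod p. int p dvd g$1$1 - (-1) * g$2$2 \<and> int p dvd g$1$2 + (-1) * g$2$1}"
    by (auto simp: isotropic_def)
  then have "card {g \<in> SL2_mod p. isotropic p g} \<le> card (
      {g \<in> SL2_mod p. int p dvd g$1$1 - 1 * g$2$2 \<and> int p dvd g$1$2 + 1 * g$2$1} \<union>
      {g \<in> SL2_mod p. int p dvd g$1$1 - (-1) * g$2$2 \<and> int p dvd g$1$2 + (-1) * g$2$1})"
    by (intro card_mono) auto
  also have "\<dots> \<le> 2 * p + 2 * p"
    by (intro order_trans[OF card_Un_le] add_mono *) auto
  finally show ?thesis by simp
qed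

lemma sum_abs_kap_odd:
  assumes p: "prime p" "p \<noteq> 2"
  shows "(\<Sum>g\<in>SL2_mod p. \<bar>kap p g\<bar>) \<le> 4 / (real p ^ 2 - 1) * real (card (SL2_mod p))"
proof -
  have "(\<Sum>g\<in>SL2_mod p. \<bar>kap p g\<bar>) \<le> (\<Sum>g\<in>SL2_mod p. of_bool (isotropic p g))"
    using p by (intro sum_mono kap_abs_le_isotropic) (auto dest: SL2_mod_det)
  also have "\<dots> \<le> 4 * real p"
    unfolding sum_of_bool_card[OF finite_SL2_mod] using of_nat_mono[OF card_isotropic[OF p(1)], where ?'a = real] by simp
  also have "\<dots> = 4 / (real p ^ 2 - 1) * real (card (SL2_mod p))"
  proof -
    have "real p ^ 2 > 1" using prime_gt_1_nat[OF p(1)] by simp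
    then show ?thesis by (simp add: card_SL2_prime[OF p(1)])
  qed
  finally show ?thesis .
qed

lemma sum_abs_kap:
  assumes p: "prime p"
  shows "(\<Sum>g\<in>SL2_mod p. \<bar>kap p g\<bar>) \<le> 8 / real p ^ 2 * real (card (SL2_mod p))"
proof (cases "p = 2")
  \<comment> \<open>At p = 2 the trivial bound 1 for \<open>kap\<close> is enough, because 8/4
    exceeds 1; this keeps the constant 8 uniform in p.\<close>
  case True
  have "(\<Sum>g\<in>SL2_mod p. \<bar>kap p g\<bar>) \<le> (\<Sum>g\<in>SL2_mod p. 1)"
    using p by (intro sum_mono kap_abs_le_1) (auto dest: SL2_mod_det)
  then show ?thesis using True by simp
next
  case False
  have "real p \<ge> 2" using prime_ge_2_nat[OF p] by simp
  then have "real p ^ 2 \<ge> 2 ^ 2" by (intro power_mono) auto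
  moreover have "4 / (x - 1) \<le> 8 / x" if "x \<ge> 2 ^ 2" for x :: real
  proof -
    have "4 / (x - 1) = (2 * 4) / (2 * (x - 1))" by (rule mult_divide_mult_cancel_left[symmetric]) simp
    also have "\<dots> \<le> 8 / x" by (rule frac_le) (use that in auto)
    finally show ?thesis .
  qed
  ultimately have "4 / (real p ^ 2 - 1) \<le> 8 / real p ^ 2" by blast
  then show ?thesis
    by (rule order_trans[OF sum_abs_kap_odd[OF p False] mult_right_mono]) simp
qed

lemma sum_osc:
  assumes p: "prime p" shows "(\<Sum>g\<in>SL2_mod p. osc p g) = 0"
proof (cases "p mod 4 = 1")
  case True
  have "(\<Sum>g\<in>SL2_mod p. osc p g)
      = (\<Sum>g\<in>SL2_mod p. \<Sum>s\<in>{1,-1}. \<Sum>t\<in>{1,-1}. par0 p (g *v line p s) (line p t))"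
    unfolding osc_def by (simp only: True simp_thms if_True)
  also have "\<dots> = (\<Sum>s\<in>{1,-1}. \<Sum>g\<in>SL2_mod p. \<Sum>t\<in>{1,-1}. par0 p (g *v line p s) (line p t))"
    by (rule sum.swap)
  also have "\<dots> = (\<Sum>s\<in>{1,-1}. \<Sum>t\<in>{1,-1}. \<Sum>g\<in>SL2_mod p. par0 p (g *v line p s) (line p t))"
    by (intro sum.cong refl sum.swap)
  also have "\<dots> = 0" by (intro sum.neutral ballI sum_par0 p nz_line)
  finally show ?thesis .
next
  case False
  then show ?thesis unfolding osc_def by (simp only: simp_thms if_False sum.neutral_const)
qed

lemma sum_abs_par0:
  assumes "prime p" "nz p u" "nz p v"
  shows "(\<Sum>g\<in>SL2_mod p. \<bar>par0 p (g *v u) v\<bar>) \<le> 2 / (real p + 1) * real (card (SL2_mod p))"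
proof -
  have "(\<Sum>g\<in>SL2_mod p. \<bar>par0 p (g *v u) v\<bar>) \<le> (\<Sum>g\<in>SL2_mod p. par p (g *v u) v + 1 / (real p + 1))"
    by (intro sum_mono par0_abs_le)
  also have "\<dots> = 2 / (real p + 1) * real (card (SL2_mod p))"
    using sum_par[OF assms] by (simp add: sum.distrib)
  finally show ?thesis .
qed

lemma sum_abs_osc:
  assumes p: "prime p"
  shows "(\<Sum>g\<in>SL2_mod p. \<bar>osc p g\<bar>) \<le> 8 / real p * real (card (SL2_mod p))"
proof (cases "p mod 4 = 1")
  case True
  let ?c = "2 / (real p + 1) * real (card (SL2_mod p))"
  let ?f = "\<lambda>s t g. \<bar>par0 p (g *v line p s) (line p t)\<bar>"
  have "(\<Sum>g\<in>SL2_mod p. \<bar>osc p g\<bar>) \<le> (\<Sum>g\<in>SL2_mod p. ?f 1 1 g + ?f 1 (-1) g + ?f (-1) 1 g + ?f (-1) (-1) g)"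
    using True by (intro sum_mono) (auto simp: osc_def)
  also have "\<dots> \<le> ?c + ?c + ?c + ?c"
    unfolding sum.distrib by (intro add_mono sum_abs_par0 p nz_line)
  also have "\<dots> = 8 / (real p + 1) * real (card (SL2_mod p))" by simp
  also have "\<dots> \<le> 8 / real p * real (card (SL2_mod p))"
    using prime_gt_0_nat[OF p] by (intro mult_right_mono divide_left_mono) auto
  finally show ?thesis .
qed (simp add: osc_def)

lemma hit_minus_rho_abs_le_1:
  assumes "prime p" shows "\<bar>hit p g - rho p\<bar> \<le> 1"
proof -
  have "0 \<le> rho p" "rho p \<le> 1"
  proof -
    have "real p + 1 \<ge> 4" if "p mod 4 = 1"
    proof -
      have "p \<noteq> 1" using assms by auto
      then have "p \<ge> 3" using that by presburger
      then show ?thesis by linarith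
    qed
    then show "0 \<le> rho p" "rho p \<le> 1" by (auto simp: rho_def divide_simps)
  qed
  then show ?thesis by (auto simp: hit_def of_bool_def)
qed

lemma periodic_hit: "periodic p (hit p)"
  unfolding hit_def
proof (rule periodic_of_bool)
  fix g h assume "mat_cong p g h"
  then have "[(quad_form g)\<^sup>2 - 4 = (quad_form h)\<^sup>2 - 4] (mod int p)"
    unfolding quad_form_eq mat_cong_iff by (intro cong_diff cong_pow cong_add cong_refl) auto
  then show "int p dvd (quad_form g)\<^sup>2 - 4 \<longleftrightarrow> int p dvd (quad_form h)\<^sup>2 - 4" by (rule cong_dvd_iff)
qed

lemma periodic_osc: "periodic p (osc p)"
  using periodic_par0 by (simp add: periodic_def osc_def)

lemma periodic_kap: "periodic p (kap p)"
  using periodic_hit[of p] periodic_osc[of p] by (simp add: periodic_def kap_def)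

section \<open>The local density of p dividing f^2 - 4\<close>

definition dens :: "nat \<Rightarrow> real" where
  "dens p = (\<Sum>g\<in>SL2_mod p. hit p g) / real (card (SL2_mod p))"

lemma card_SL2_pos: "r > 0 \<Longrightarrow> 0 < card (SL2_mod r)"
  using SL2_mod_nonempty by (simp add: card_gt_0_iff)

lemma dens_eq:
  assumes "prime p"
  shows "dens p = rho p + (\<Sum>g\<in>SL2_mod p. kap p g) / real (card (SL2_mod p))"
proof -
  have c: "real (card (SL2_mod p)) > 0" using card_SL2_pos prime_gt_0_nat[OF assms] by simp
  have "(\<Sum>g\<in>SL2_mod p. hit p g) = (\<Sum>g\<in>SL2_mod p. rho p + kap p g + osc p g)"
    by (simp add: kap_def)
  also have "\<dots> = rho p * real (card (SL2_mod p)) + (\<Sum>g\<in>SL2_mod p. kap p g)"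
    by (simp add: sum.distrib sum_osc[OF assms])
  finally have *: "(\<Sum>g\<in>SL2_mod p. hit p g) = rho p * real (card (SL2_mod p)) + (\<Sum>g\<in>SL2_mod p. kap p g)" .
  have "real (card (SL2_mod p)) \<noteq> 0" using c by linarith
  from nonzero_mult_div_cancel_right[OF this] show ?thesis unfolding dens_def * add_divide_distrib by simp
qed

lemma dens_nonneg: "0 \<le> dens p"
  by (auto simp: dens_def hit_def intro!: divide_nonneg_nonneg sum_nonneg)

text \<open>The union bound: \<open>kap\<close> is nonpositive and \<open>osc\<close> has mean zero,
  so the density cannot exceed \<open>rho p\<close>.\<close>

lemma dens_split_le:
  assumes p: "prime p" "p mod 4 = 1" shows "dens p \<le> 4 / (real p + 1)"
proof -
  have "(\<Sum>g\<in>SL2_mod p. kap p g) \<le> 0"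
    using kap_split(1)[OF p] by (intro sum_nonpos) (auto dest: SL2_mod_det)
  then have "(\<Sum>g\<in>SL2_mod p. kap p g) / real (card (SL2_mod p)) \<le> 0" by (simp add: divide_nonpos_nonneg)
  then show ?thesis using dens_eq[OF p(1)] p(2) by (simp add: rho_def)
qed

lemma dens_inert_le:
  assumes p: "prime p" "p \<noteq> 2" "p mod 4 \<noteq> 1" shows "dens p \<le> 4 / (real p ^ 2 - 1)"
proof -
  have c: "real (card (SL2_mod p)) > 0" using card_SL2_pos prime_gt_0_nat[OF p(1)] by simp
  have "(\<Sum>g\<in>SL2_mod p. kap p g) \<le> (\<Sum>g\<in>SL2_mod p. \<bar>kap p g\<bar>)" by (intro sum_mono) auto
  also note sum_abs_kap_odd[OF p(1,2)]
  finally have "(\<Sum>g\<in>SL2_mod p. kap p g) / real (card (SL2_mod p)) \<le> 4 / (real p ^ 2 - 1)"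
    unfolding pos_divide_le_eq[OF c] .
  moreover have "rho p = 0" using p(3) by (simp add: rho_def)
  ultimately show ?thesis unfolding dens_eq[OF p(1)] by simp
qed

lemma dens_2_less: "dens 2 < 1"
proof -
  \<comment> \<open>A unipotent witness with f = 3, for which f^2 - 4 = 5 is odd; so not every class
    modulo 2 is hit.\<close>
  let ?g = "m2 1 1 0 1"
  have g: "?g \<in> SL2_mod 2" by (auto simp: SL2_mod_def forall_2 det_2)
  have "hit 2 ?g = 0" by (simp add: hit_def quad_form_eq)
  then have "(\<Sum>g\<in>SL2_mod 2. hit 2 g) < (\<Sum>g\<in>SL2_mod 2. 1)"
    using g by (intro sum_strict_mono_ex1) (auto simp: hit_def intro!: bexI[of _ ?g])
  then show ?thesis using card_SL2_pos[of 2] by (simp add: dens_def)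
qed

text \<open>The bound 4/(p + 1) is largest at p = 5, where it equals 2/3; the inert prime 3 gives
  1/2. The value 2/3 is the end of the range of \<open>inverse_one_minus_le_exp\<close>.\<close>

lemma dens_odd_le:
  assumes p: "prime p" "p \<noteq> 2" shows "dens p \<le> 2 / 3"
proof (cases "p mod 4 = 1")
  case True
  have "p \<noteq> 1" using p by auto
  then have "p \<ge> 5" using True by presburger
  then have "4 / (real p + 1) \<le> 2 / 3" by (simp add: field_simps)
  then show ?thesis using dens_split_le[OF p(1) True] by linarith
next
  case False
  have "p \<ge> 3" using p prime_ge_2_nat[OF p(1)] by linarith
  then have "real p ^ 2 \<ge> 3 ^ 2" by (intro power_mono) auto
  then have "4 / (real p ^ 2 - 1) \<le> 2 / 3" by (simp add: field_simps)
  then show ?thesis using dens_inert_le[OF p False] by linarith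
qed

lemma dens_less_1:
  assumes "prime p" shows "dens p < 1"
proof (cases "p = 2")
  case False
  show ?thesis using dens_odd_le[OF assms False] by linarith
qed (use dens_2_less in simp)

section \<open>Congruent pairs of bounded matrices\<close>

text \<open>The slopes b/a lie in [0, 1], and two of them differ by the determinant divided by a
  product of size at most M^2, hence by at least K/M^2. After scaling they have distinct integer
  parts.\<close>

lemma card_separated_slopes:
  fixes a b :: "'v \<Rightarrow> real"
  assumes fin: "finite V" and K: "K > 0" and M: "M \<ge> 0"
    and ab: "\<And>v. v \<in> V \<Longrightarrow> 0 < a v \<and> a v \<le> M \<and> 0 \<le> b v \<and> b v \<le> a v"
    and sep: "\<And>v w. v \<in> V \<Longrightarrow> w \<in> V \<Longrightarrow> v \<noteq> w \<Longrightarrow> K \<le> \<bar>a v * b w - a w * b v\<bar>"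
  shows "real (card V) \<le> M\<^sup>2 / K + 1"
proof -
  let ?s = "\<lambda>v. b v / a v * (M\<^sup>2 / K)"
  have far: "1 \<le> \<bar>?s v - ?s w\<bar>" if "v \<in> V" "w \<in> V" "v \<noteq> w" for v w
  proof -
    have pos: "0 < a v" "0 < a w" "a v * a w \<le> M * M" "0 < a v * a w"
      using ab[OF that(1)] ab[OF that(2)] by (auto intro: mult_mono)
    have "b v / a v - b w / a w = (a w * b v - a v * b w) / (a v * a w)"
      using pos by (simp add: diff_frac_eq mult.commute)
    then have "?s v - ?s w = (a w * b v - a v * b w) / (a v * a w) * (M\<^sup>2 / K)"
      by (simp only: left_diff_distrib[symmetric])
    then have "\<bar>?s v - ?s w\<bar> = \<bar>a v * b w - a w * b v\<bar> / (a v * a w) * (M\<^sup>2 / K)"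
      using pos K by (simp add: abs_mult abs_divide abs_minus_commute)
    moreover have "K / M\<^sup>2 * (M\<^sup>2 / K) \<le> \<bar>a v * b w - a w * b v\<bar> / (a v * a w) * (M\<^sup>2 / K)"
      using sep[OF that] pos K by (intro mult_right_mono frac_le) (auto simp: power2_eq_square)
    moreover have "M \<noteq> 0" using pos ab[OF that(1)] by auto
    ultimately show ?thesis using K by simp
  qed
  have "inj_on (\<lambda>v. \<lfloor>?s v\<rfloor>) V"
  proof (rule inj_onI, rule ccontr)
    fix v w assume vw: "v \<in> V" "w \<in> V" "\<lfloor>?s v\<rfloor> = \<lfloor>?s w\<rfloor>" "v \<noteq> w"
    show False using far[OF vw(1,2,4)] vw(3) by linarith
  qed
  moreover have "(\<lambda>v. \<lfloor>?s v\<rfloor>) ` V \<subseteq> {0..\<lfloor>M\<^sup>2 / K\<rfloor>}"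
  proof
    fix y assume "y \<in> (\<lambda>v. \<lfloor>?s v\<rfloor>) ` V"
    then obtain v where v: "v \<in> V" "y = \<lfloor>?s v\<rfloor>" by auto
    have "0 \<le> b v / a v" "b v / a v \<le> 1" using ab[OF v(1)] by auto
    moreover have "0 \<le> M\<^sup>2 / K" using K by simp
    ultimately have "0 \<le> ?s v \<and> ?s v \<le> M\<^sup>2 / K" by (intro conjI mult_nonneg_nonneg mult_left_le_one_le)
    then show "y \<in> {0..\<lfloor>M\<^sup>2 / K\<rfloor>}" using v by (auto intro: floor_mono)
  qed
  ultimately have "card V \<le> card {0..\<lfloor>M\<^sup>2 / K\<rfloor>}" by (intro card_inj_on_le) auto
  moreover have "0 \<le> M\<^sup>2 / K" using K by simp
  ultimately show ?thesis by simp linarith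
qed

text \<open>The quadrant is cut along its diagonal, with the coordinates exchanged in the upper
  half, so that slopes stay in [0, 1] in either part.\<close>

lemma card_separated:
  fixes a b :: "'v \<Rightarrow> real"
  assumes fin: "finite V" and K: "K > 0" and M: "M \<ge> 0"
    and ab: "\<And>v. v \<in> V \<Longrightarrow> 0 \<le> a v \<and> a v \<le> M \<and> 0 \<le> b v \<and> b v \<le> M \<and> (0 < a v \<or> 0 < b v)"
    and sep: "\<And>v w. v \<in> V \<Longrightarrow> w \<in> V \<Longrightarrow> v \<noteq> w \<Longrightarrow> K \<le> \<bar>a v * b w - a w * b v\<bar>"
  shows "real (card V) \<le> 2 * (M\<^sup>2 / K + 1)"
proof -
  let ?V1 = "{v\<in>V. b v \<le> a v}" and ?V2 = "{v\<in>V. a v < b v}"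
  have "real (card ?V1) \<le> M\<^sup>2 / K + 1"
    by (rule card_separated_slopes[where a = a and b = b]) (use fin K M ab sep in fastforce)+
  moreover have "real (card ?V2) \<le> M\<^sup>2 / K + 1"
  proof (rule card_separated_slopes[where a = b and b = a])
    fix v w assume "v \<in> ?V2" "w \<in> ?V2" "v \<noteq> w"
    then have "K \<le> \<bar>a v * b w - a w * b v\<bar>" using sep by auto
    also have "\<dots> = \<bar>b v * a w - b w * a v\<bar>" by (simp add: abs_minus_commute mult.commute)
    finally show "K \<le> \<bar>b v * a w - b w * a v\<bar>" .
  qed (use fin K M ab in fastforce)+
  moreover have "card V = card ?V1 + card ?V2"
    by (subst card_Un_disjoint[symmetric]) (use fin in \<open>auto intro!: arg_cong[where f = card]\<close>)
  ultimately show ?thesis by simp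
qed

section \<open>The box of word-like matrices and its translates\<close>

text \<open>A box containing the matrices of all even words of positive digits with top-left entry
  at most M. The strict inequality in the first row makes the first column determine the
  matrix.\<close>

definition semibox :: "real \<Rightarrow> (int^2^2) set" where
  "semibox M = {x. det x = 1 \<and> 0 \<le> x$1$2 \<and> x$1$2 < x$1$1 \<and> 0 \<le> x$2$1 \<and> x$2$1 \<le> x$1$1
     \<and> 0 \<le> x$2$2 \<and> x$2$2 \<le> x$1$1 \<and> real_of_int (x$1$1) \<le> M}"

lemma semibox_det: "x \<in> semibox M \<Longrightarrow> det x = 1"
  by (simp add: semibox_def)

lemma finite_semibox [simp]: "finite (semibox M)"
  by (rule finite_subset[OF _ finite_bounded_mats[of 0 "\<lfloor>M\<rfloor>"]]) (auto simp: semibox_def forall_2 le_floor_iff)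

lemma int_fractions_eq:
  fixes a c a' c' :: int
  assumes "coprime a c" "coprime a' c'" "a > 0" "a' > 0" "a * c' = a' * c"
  shows "a = a' \<and> c = c'"
proof -
  have "a dvd a'" "a' dvd a"
    using assms by (metis coprime_dvd_mult_left_iff dvd_triv_left)+
  then have "a = a'" using assms by (simp add: zdvd_antisym_nonneg)
  then show ?thesis using assms by simp
qed

lemma det_1_coprime:
  assumes "det (g :: int^2^2) = 1" shows "coprime (g$1$1) (g$2$1)"
proof (rule coprimeI)
  fix d assume "d dvd g$1$1" "d dvd g$2$1"
  then have "d dvd det g" unfolding det_2 by simp
  then show "is_unit d" using assms by simp
qed

text \<open>The determinant condition fixes the entry (1,2) modulo the entry (1,1), because the
  first column is primitive; the range of the entry (1,2) then leaves a single value.\<close>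

lemma semibox_first_column_inj: "inj_on (\<lambda>x. (x$1$1, x$2$1)) (semibox M)"
proof (rule inj_onI)
  fix x y assume x: "x \<in> semibox M" and y: "y \<in> semibox M" and "(x$1$1, x$2$1) = (y$1$1, y$2$1)"
  then have eq: "y$1$1 = x$1$1" "y$2$1 = x$2$1" by auto
  have det: "x$1$1 * x$2$2 - x$1$2 * x$2$1 = 1" "x$1$1 * y$2$2 - y$1$2 * x$2$1 = 1"
    using semibox_det[OF x] semibox_det[OF y] by (simp_all add: det_2 eq)
  then have "x$1$1 * (x$2$2 - y$2$2) = (x$1$2 - y$1$2) * x$2$1" by (simp add: algebra_simps)
  then have "x$1$1 dvd (x$1$2 - y$1$2) * x$2$1" by (metis dvd_triv_left)
  then have "x$1$1 dvd x$1$2 - y$1$2"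
    using det_1_coprime[OF semibox_det[OF x]] by (simp add: coprime_dvd_mult_left_iff)
  moreover have "\<bar>x$1$2 - y$1$2\<bar> < x$1$1" using x y eq by (auto simp: semibox_def)
  ultimately have b: "x$1$2 = y$1$2" using zdvd_not_zless[of "\<bar>x$1$2 - y$1$2\<bar>" "x$1$1"] by force
  moreover have "x$1$1 > 0" using x by (auto simp: semibox_def)
  moreover have "x$1$1 * x$2$2 = x$1$1 * y$2$2" using det unfolding b by linarith
  ultimately have "x$2$2 = y$2$2" by simp
  then show "x = y" using b eq by (simp add: mat2_eq_iff)
qed

lemma card_semibox_le:
  assumes "M \<ge> 1" shows "real (card (semibox M)) \<le> 2 * M\<^sup>2"
proof -
  have "card (semibox M) \<le> card ({1..\<lfloor>M\<rfloor>} \<times> {0..\<lfloor>M\<rfloor>})"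
    by (rule card_inj_on_le[OF semibox_first_column_inj]) (auto simp: semibox_def le_floor_iff)
  then have "real (card (semibox M)) \<le> real (nat \<lfloor>M\<rfloor>) * real (nat (\<lfloor>M\<rfloor> + 1))"
    by (simp add: card_cartesian_product flip: of_nat_mult)
  also have "\<dots> \<le> M * (M + 1)" using assms by (intro mult_mono) linarith+
  also have "\<dots> \<le> 2 * M\<^sup>2" using assms by (simp add: power2_eq_square algebra_simps)
  finally show ?thesis .
qed

text \<open>The first columns of the elements counted here are primitive vectors lying, together
  with their images under \<open>g\<close>, in a fixed semibox; they are separated in slope by the size of \<open>g\<close>.\<close>

lemma card_semibox_translate:
  assumes M: "M \<ge> 1" and e: "e \<in> {g$1$1, g$1$2, g$2$1, g$2$2}" "e \<noteq> 0" "real_of_int \<bar>e\<bar> \<le> M\<^sup>2"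
  shows "real (card {y \<in> semibox M. g ** y \<in> semibox M}) \<le> 4 * M\<^sup>2 / real_of_int \<bar>e\<bar>"
proof -
  let ?Y = "{y \<in> semibox M. g ** y \<in> semibox M}"
  let ?s = "\<lambda>y. g$1$1 * y$1$1 + g$1$2 * y$2$1" and ?t = "\<lambda>y. g$2$1 * y$1$1 + g$2$2 * y$2$1"
  have fin: "finite ?Y" by simp
  have bds: "0 < y$1$1" "0 \<le> y$2$1" "y$2$1 \<le> y$1$1" "real_of_int (y$1$1) \<le> M"
    "0 < ?s y" "0 \<le> ?t y" "?t y \<le> ?s y" "real_of_int (?s y) \<le> M" if "y \<in> ?Y" for y
    using that by (auto simp: semibox_def mat2_mult_nth)
  have bds': "real_of_int (y$2$1) \<le> M" "real_of_int (?t y) \<le> M" if "y \<in> ?Y" for y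
    using bds(3,4,7,8)[OF that] by linarith+
  have sep: "1 \<le> \<bar>x$1$1 * y$2$1 - y$1$1 * x$2$1\<bar>" if "x \<in> ?Y" "y \<in> ?Y" "x \<noteq> y" for x y
  proof -
    have "x$1$1 * y$2$1 \<noteq> y$1$1 * x$2$1"
    proof
      assume "x$1$1 * y$2$1 = y$1$1 * x$2$1"
      then have "x$1$1 = y$1$1 \<and> x$2$1 = y$2$1"
        using that bds(1) by (intro int_fractions_eq det_1_coprime semibox_det) auto
      then show False using that inj_onD[OF semibox_first_column_inj[of M], of x y] by auto
    qed
    then show ?thesis by linarith
  qed
  \<comment> \<open>Pairing one coordinate of the image column with one of the original column
    multiplies the determinant of two columns by the entry \<open>e\<close>, up to sign. Distinct
    primitive columns have nonzero determinant, so the pairs are separated by |e|.\<close>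
  have main: "real (card ?Y) \<le> 2 * (M\<^sup>2 / real_of_int \<bar>e\<bar> + 1)"
    if ab: "\<And>y. y \<in> ?Y \<Longrightarrow> 0 \<le> a y \<and> real_of_int (a y) \<le> M \<and> 0 \<le> b y \<and> real_of_int (b y) \<le> M \<and> (0 < a y \<or> 0 < b y)"
      and det: "\<And>x y. \<bar>a x * b y - a y * b x\<bar> = \<bar>e\<bar> * \<bar>x$1$1 * y$2$1 - y$1$1 * x$2$1\<bar>"
    for a b :: "int^2^2 \<Rightarrow> int"
  proof (rule card_separated[where a = "\<lambda>y. real_of_int (a y)" and b = "\<lambda>y. real_of_int (b y)"])
    fix x y assume xy: "x \<in> ?Y" "y \<in> ?Y" "x \<noteq> y"
    have "\<bar>e\<bar> * 1 \<le> \<bar>a x * b y - a y * b x\<bar>"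
      unfolding det using sep[OF xy] by (intro mult_left_mono) auto
    then show "real_of_int \<bar>e\<bar> \<le> \<bar>real_of_int (a x) * real_of_int (b y) - real_of_int (a y) * real_of_int (b x)\<bar>"
      by (simp flip: of_int_mult of_int_diff of_int_abs)
  qed (use M e fin ab in auto)
  have "real (card ?Y) \<le> 2 * (M\<^sup>2 / real_of_int \<bar>e\<bar> + 1)"
  proof -
    from e(1) consider "e = g$1$1" | "e = g$1$2" | "e = g$2$1" | "e = g$2$2" by auto
    then show ?thesis
    proof cases
      case 1
      have "?s x * y$2$1 - ?s y * x$2$1 = e * (x$1$1 * y$2$1 - y$1$1 * x$2$1)" for x y
        unfolding 1 by (simp add: algebra_simps)
      note d = this
      show ?thesis by (rule main[of ?s "\<lambda>y. y$2$1"]; (simp only: d abs_mult abs_minus_cancel)?) (use bds bds' in \<open>auto simp: less_imp_le\<close>)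
    next
      case 2
      have "?s x * y$1$1 - ?s y * x$1$1 = - (e * (x$1$1 * y$2$1 - y$1$1 * x$2$1))" for x y
        unfolding 2 by (simp add: algebra_simps)
      note d = this
      show ?thesis by (rule main[of ?s "\<lambda>y. y$1$1"]; (simp only: d abs_mult abs_minus_cancel)?) (use bds bds' in \<open>auto simp: less_imp_le\<close>)
    next
      case 3
      have "?t x * y$2$1 - ?t y * x$2$1 = e * (x$1$1 * y$2$1 - y$1$1 * x$2$1)" for x y
        unfolding 3 by (simp add: algebra_simps)
      note d = this
      \<comment> \<open>Neither coordinate of this pair is automatically positive; if the lower
        entry of the column vanishes, its image is e times a positive number and hence
        nonzero.\<close>
      have "0 < ?t y \<or> 0 < y$2$1" if "y \<in> ?Y" for y
      proof (cases "y$2$1 = 0")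
        case True
        then have "?t y \<noteq> 0" using e(2) 3 bds(1)[OF that] by simp
        then show ?thesis using bds(6)[OF that] by linarith
      qed (use bds(2)[OF that] in linarith)
      then show ?thesis by (intro main[of ?t "\<lambda>y. y$2$1"]; (simp only: d abs_mult abs_minus_cancel)?) (use bds bds' in \<open>auto simp: less_imp_le\<close>)
    next
      case 4
      have "?t x * y$1$1 - ?t y * x$1$1 = - (e * (x$1$1 * y$2$1 - y$1$1 * x$2$1))" for x y
        unfolding 4 by (simp add: algebra_simps)
      note d = this
      show ?thesis by (rule main[of ?t "\<lambda>y. y$1$1"]; (simp only: d abs_mult abs_minus_cancel)?) (use bds bds' in \<open>auto simp: less_imp_le\<close>)
    qed
  qed
  moreover have "1 \<le> M\<^sup>2 / real_of_int \<bar>e\<bar>" using e by (simp add: le_divide_eq)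
  moreover have "x \<le> 4 * q" if "x \<le> 2 * (q + 1)" "1 \<le> q" for x q :: real using that by (simp add: algebra_simps)
  ultimately have "real (card ?Y) \<le> 4 * (M\<^sup>2 / real_of_int \<bar>e\<bar>)" by blast
  then show ?thesis by simp
qed

section \<open>Elementary sums and the collision bound in the box\<close>

lemma sum_fibers_le:
  fixes f :: "'b \<Rightarrow> real"
  assumes "finite S" "finite T" "k ` S \<subseteq> T" "\<And>y. y \<in> T \<Longrightarrow> 0 \<le> f y"
    "\<And>y. y \<in> T \<Longrightarrow> real (card {x\<in>S. k x = y}) \<le> m"
  shows "(\<Sum>x\<in>S. f (k x)) \<le> m * (\<Sum>y\<in>T. f y)"
proof -
  have "(\<Sum>x\<in>S. f (k x)) = (\<Sum>y\<in>T. \<Sum>x\<in>{x\<in>S. k x = y}. f (k x))"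
    using assms by (intro sum.group[symmetric]) auto
  also have "\<dots> = (\<Sum>y\<in>T. real (card {x\<in>S. k x = y}) * f y)"
    by (intro sum.cong refl) simp
  also have "\<dots> \<le> (\<Sum>y\<in>T. m * f y)" using assms by (intro sum_mono mult_right_mono) auto
  finally show ?thesis by (simp add: sum_distrib_left)
qed

lemma sum_inverse_abs_int:
  "(\<Sum>j | j \<noteq> 0 \<and> \<bar>j\<bar> \<le> int n. 1 / real_of_int \<bar>j\<bar>) = 2 * (\<Sum>j=1..n. 1 / real j)"
proof -
  let ?P = "int ` {1..n}" and ?N = "(\<lambda>j. - int j) ` {1..n}"
  have "{j. j \<noteq> 0 \<and> \<bar>j\<bar> \<le> int n} = ?P \<union> ?N"
  proof (intro equalityI subsetI)
    fix j assume j: "j \<in> {j. j \<noteq> 0 \<and> \<bar>j\<bar> \<le> int n}"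
    show "j \<in> ?P \<union> ?N"
    proof (cases "j > 0")
      case True
      then have "j = int (nat j)" "nat j \<in> {1..n}" using j by auto
      then show ?thesis by blast
    next
      case False
      then have "j = - int (nat (- j))" "nat (- j) \<in> {1..n}" using j by auto
      then show ?thesis by blast
    qed
  qed auto
  moreover have "?P \<inter> ?N = {}" by auto
  ultimately have "(\<Sum>j | j \<noteq> 0 \<and> \<bar>j\<bar> \<le> int n. 1 / real_of_int \<bar>j\<bar>)
      = (\<Sum>j\<in>?P. 1 / real_of_int \<bar>j\<bar>) + (\<Sum>j\<in>?N. 1 / real_of_int \<bar>j\<bar>)"
    by (simp only:) (rule sum.union_disjoint, auto)
  also have "\<dots> = (\<Sum>j=1..n. 1 / real j) + (\<Sum>j=1..n. 1 / real j)"
    by (subst (1 2) sum.reindex) (auto simp: inj_on_def)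
  finally show ?thesis by simp
qed

lemma card_congruent_interval:
  fixes k n :: int
  assumes r: "r > 0" and n: "n \<ge> 0"
  shows "real (card {l. \<bar>l\<bar> \<le> n \<and> int r dvd k + l}) \<le> 2 * real_of_int n / real r + 1"
proof -
  let ?S = "{l. \<bar>l\<bar> \<le> n \<and> int r dvd k + l}"
  have "inj_on (\<lambda>l. (k + l) div int r) ?S"
    by (rule inj_onI) (use r in \<open>auto elim!: dvdE\<close>)
  moreover have "(\<lambda>l. (k + l) div int r) ` ?S \<subseteq> {\<lceil>real_of_int (k - n) / real r\<rceil>..\<lfloor>real_of_int (k + n) / real r\<rfloor>}"
  proof
    fix y assume "y \<in> (\<lambda>l. (k + l) div int r) ` ?S"
    then obtain l where l: "\<bar>l\<bar> \<le> n" "int r dvd k + l" "y = (k + l) div int r" by auto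
    then have "y * int r = k + l" by simp
    then have "real_of_int y * real r = real_of_int (k + l)" by (metis of_int_mult of_int_of_nat_eq)
    then show "y \<in> {\<lceil>real_of_int (k - n) / real r\<rceil>..\<lfloor>real_of_int (k + n) / real r\<rfloor>}"
      using l(1) r by (auto simp: ceiling_le_iff le_floor_iff divide_le_eq le_divide_eq)
  qed
  ultimately have "card ?S \<le> card {\<lceil>real_of_int (k - n) / real r\<rceil>..\<lfloor>real_of_int (k + n) / real r\<rfloor>}"
    by (intro card_inj_on_le) auto
  also have "\<dots> = nat (\<lfloor>real_of_int (k + n) / real r\<rfloor> + 1 - \<lceil>real_of_int (k - n) / real r\<rceil>)" by simp
  finally have "real (card ?S) \<le> max 0 (real_of_int (k + n) / real r + 1 - real_of_int (k - n) / real r)"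
    by linarith
  also have "real_of_int (k + n) / real r + 1 - real_of_int (k - n) / real r = 2 * real_of_int n / real r + 1"
    by (simp add: diff_divide_distrib add_divide_distrib)
  finally show ?thesis using r n by (simp add: max_def split: if_splits)
qed

lemma card_int_divisors_le:
  fixes n :: int assumes "n \<noteq> 0"
  shows "card {d. d dvd n} \<le> 2 * card {d. d dvd nat \<bar>n\<bar>}" "finite {d. d dvd n}"
proof -
  let ?D = "{d. d dvd nat \<bar>n\<bar>}"
  have fin: "finite ?D" using assms by (intro finite_divisors_nat) simp
  have sub: "{d. d dvd n} \<subseteq> int ` ?D \<union> (\<lambda>d. - int d) ` ?D"
  proof
    fix d assume "d \<in> {d. d dvd n}"
    then have "nat \<bar>d\<bar> \<in> ?D" by (simp add: nat_dvd_iff)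
    moreover have "d = int (nat \<bar>d\<bar>) \<or> d = - int (nat \<bar>d\<bar>)" by linarith
    ultimately show "d \<in> int ` ?D \<union> (\<lambda>d. - int d) ` ?D" by blast
  qed
  then show "finite {d. d dvd n}" using fin by (meson finite_Un finite_imageI finite_subset)
  have "card {d. d dvd n} \<le> card (int ` ?D \<union> (\<lambda>d. - int d) ` ?D)"
    using fin sub by (intro card_mono) auto
  also have "\<dots> \<le> card ?D + card ?D"
    by (intro order_trans[OF card_Un_le] add_mono card_image_le fin)
  finally show "card {d. d dvd n} \<le> 2 * card ?D" by simp
qed

lemma sum_Un_le:
  fixes f :: "'a \<Rightarrow> real"
  assumes "finite A" "finite B" "\<And>x. 0 \<le> f x"
  shows "sum f (A \<union> B) \<le> sum f A + sum f B"
  using sum.union_inter[OF assms(1,2), of f] sum_nonneg[of "A \<inter> B" f] assms(3) by simp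

text \<open>An element \<open>g \<equiv> 1\<close> modulo \<open>r\<close> of determinant 1 has trace \<open>\<equiv> 2\<close> modulo \<open>r\<^sup>2\<close>; given its
  diagonal, the divisor bound controls the remaining entries. This saves the full factor \<open>r\<^sup>3\<close>.\<close>

lemma coll_semibox_aux:
  fixes M h :: real
  assumes M: "M \<ge> 1" and r3: "r \<ge> 3" and rM: "real r ^ 3 \<le> M\<^sup>2" and h: "h \<ge> 1"
    and H: "\<And>n::nat. real n \<le> 2 * M\<^sup>2 \<Longrightarrow> (\<Sum>j=1..n. 1 / real j) \<le> h"
    and D: "\<And>n::nat. 1 \<le> n \<Longrightarrow> real n \<le> 2 * M ^ 4 \<Longrightarrow> real (card {d. d dvd n}) \<le> h"
  shows "real (coll r (semibox M)) \<le> 400 * h\<^sup>2 * M ^ 4 / real r ^ 3"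
proof -
  define L where "L = \<lfloor>M\<^sup>2\<rfloor>"
  define G where "G = {g :: int^2^2. det g = 1 \<and> mat_cong r g (mat 1) \<and> (\<forall>i j. \<bar>g$i$j\<bar> \<le> L)}"
  define Y where "Y g = {y \<in> semibox M. g ** y \<in> semibox M}" for g
  have M2: "M\<^sup>2 \<ge> 1" using M by simp
  have rpos: "real r > 0" using r3 by simp
  have L: "L \<ge> 1" "real_of_int L \<le> M\<^sup>2" using M2 by (auto simp: L_def le_floor_iff)
  have finG: "finite G"
    by (rule finite_subset[OF _ finite_bounded_mats[of "-L" L]]) (auto simp: G_def abs_le_iff minus_le_iff)
  have finY: "finite (Y g)" for g by (simp add: Y_def)
  have Yb: "real (card (Y g)) \<le> 4 * M\<^sup>2 / real_of_int \<bar>e\<bar>"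
    if "g \<in> G" "e \<in> {g$1$1, g$1$2, g$2$1, g$2$2}" "e \<noteq> 0" for g e
  proof -
    have "\<bar>e\<bar> \<le> L" using that by (auto simp: G_def)
    then have "real_of_int \<bar>e\<bar> \<le> M\<^sup>2" using L(2) by linarith
    then show ?thesis unfolding Y_def using that by (intro card_semibox_translate M) auto
  qed
  \<comment> \<open>A congruent pair (x, y) is recorded as (g, y) with g = x y^(-1), an element
    congruent to 1 modulo r. Its entries are differences of products of entries in [0, M], hence at
    most M^2.\<close>
  have "coll r (semibox M) \<le> card (Sigma G Y)"
    unfolding coll_def
  proof (rule card_inj_on_le[where f = "\<lambda>(x,y). (x ** adj2 y, y)"])
    show "inj_on (\<lambda>(x,y). (x ** adj2 y, y)) {(x, y). x \<in> semibox M \<and> y \<in> semibox M \<and> mat_cong r x y}"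
    proof (rule inj_onI, clarsimp)
      fix x x' y :: "int^2^2" assume "y \<in> semibox M" and "x ** adj2 y = x' ** adj2 y"
      then show "x = x'" using adj2_cancel(4)[OF semibox_det[OF \<open>y \<in> semibox M\<close>]] by metis
    qed
    show "finite (Sigma G Y)" using finG finY by auto
    show "(\<lambda>(x,y). (x ** adj2 y, y)) ` {(x, y). x \<in> semibox M \<and> y \<in> semibox M \<and> mat_cong r x y} \<subseteq> Sigma G Y"
    proof clarify
      fix x y assume x: "x \<in> semibox M" and y: "y \<in> semibox M" and c: "mat_cong r x y"
      have bx: "0 \<le> x$i$j \<and> real_of_int (x$i$j) \<le> M" if "x \<in> semibox M" for x i j
        using that exhaust_2[of i] exhaust_2[of j] by (auto simp: semibox_def)
      have diff: "\<bar>x$i$j * y$k$l - x$i'$j' * y$k'$l'\<bar> \<le> L" for i j k l i' j' k' l'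
      proof -
        have pr: "0 \<le> x$i$j * y$k$l \<and> x$i$j * y$k$l \<le> L" for i j k l
        proof -
          have "real_of_int (x$i$j) * real_of_int (y$k$l) \<le> M * M"
            using bx[OF x, of i j] bx[OF y, of k l] by (intro mult_mono) auto
          then have "x$i$j * y$k$l \<le> L" by (simp add: L_def le_floor_iff power2_eq_square)
          then show ?thesis using bx[OF x, of i j] bx[OF y, of k l] by simp
        qed
        show ?thesis using pr[of i j k l] pr[of i' j' k' l'] by linarith
      qed
      have "mat_cong r (x ** adj2 y) (y ** adj2 y)" by (intro mat_cong_mult c mat_cong_refl)
      then have "mat_cong r (x ** adj2 y) (mat 1)" using adj2_right[OF semibox_det[OF y]] by simp
      moreover have "\<forall>i j. \<bar>(x ** adj2 y)$i$j\<bar> \<le> L"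
        unfolding forall_2 mat2_mult_nth adj2_nth mult_minus_right
        using diff by (simp add: abs_minus_commute)
      moreover have "det (x ** adj2 y) = 1" using semibox_det[OF x] semibox_det[OF y] by (simp add: det_mul)
      ultimately have "x ** adj2 y \<in> G" by (simp add: G_def)
      moreover have "y \<in> Y (x ** adj2 y)"
        using x y adj2_cancel(4)[OF semibox_det[OF y], of x] by (simp add: Y_def)
      ultimately show "x ** adj2 y \<in> G \<and> y \<in> Y (x ** adj2 y)" by blast
    qed
  qed
  also have "card (Sigma G Y) = (\<Sum>g\<in>G. card (Y g))" using finG finY by simp
  finally have collG: "real (coll r (semibox M)) \<le> (\<Sum>g\<in>G. real (card (Y g)))"
    unfolding of_nat_sum[symmetric] of_nat_le_iff .
  \<comment> \<open>Diagonal product 1 means that the off-diagonal product vanishes. These unipotent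
    elements are listed directly; on \<open>G2\<close> the off-diagonal product is nonzero and the
    divisor bound applies.\<close>
  define G2 where "G2 = {g \<in> G. g$1$1 * g$2$2 \<noteq> 1}"
  define n where "n = nat (L div int r)"
  have Ld: "0 \<le> L div int r" using L(1) r3 by (simp add: pos_imp_zdiv_nonneg_iff)
  then have n: "int n = L div int r" by (simp add: n_def)
  have rL: "int r * (L div int r) \<le> L" using r3 by (simp add: minus_mod_eq_mult_div[symmetric])
  define J where "J = {j. j \<noteq> 0 \<and> \<bar>j\<bar> \<le> int n}"
  have finJ: "finite J" by (rule finite_subset[of _ "{- int n..int n}"]) (auto simp: J_def)
  let ?u = "\<lambda>j. m2 1 (int r * j) 0 1" and ?l = "\<lambda>j. m2 1 0 (int r * j) 1"
  have diag: "int r dvd g$1$1 - 1" "int r dvd g$2$2 - 1" "int r dvd g$1$2" "int r dvd g$2$1" if "g \<in> G" for g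
    using that by (auto simp: G_def mat_cong_iff cong_iff_dvd_diff)
  have nrange: "j \<in> J" if "\<bar>int r * j\<bar> \<le> L" "j \<noteq> 0" for j
  proof -
    have "int r * \<bar>j\<bar> \<le> L" using that by (simp add: abs_mult)
    then have "int r * \<bar>j\<bar> div int r \<le> L div int r" using r3 by (intro zdiv_mono1) auto
    then show ?thesis using that(2) r3 by (simp add: J_def n)
  qed
  have G1: "G - G2 \<subseteq> {mat 1} \<union> (?u ` J \<union> ?l ` J)"
  proof
    fix g assume "g \<in> G - G2"
    then have g: "g \<in> G" "g$1$1 * g$2$2 = 1" by (auto simp: G2_def)
    then have "g$1$1 = 1 \<and> g$2$2 = 1 \<or> g$1$1 = -1 \<and> g$2$2 = -1" by (simp add: zmult_eq_1_iff)
    \<comment> \<open>Here r \<ge> 3 matters: -1 is congruent to 1 modulo r only for r \<le>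
      2.\<close>
    moreover have "g$1$1 \<noteq> -1" using diag(1)[OF g(1)] r3 zdvd_imp_le[of "int r" 2] by auto
    ultimately have one: "g$1$1 = 1" "g$2$2 = 1" by auto
    have "det g = 1" using g(1) by (simp add: G_def)
    then have z: "g$1$2 = 0 \<or> g$2$1 = 0" using one by (simp add: det_2)
    obtain b c where bc: "g$1$2 = int r * b" "g$2$1 = int r * c" using diag(3,4)[OF g(1)] by (auto elim!: dvdE)
    have "\<bar>int r * b\<bar> \<le> L" "\<bar>int r * c\<bar> \<le> L" using g(1) bc unfolding G_def by (metis (lifting) mem_Collect_eq)+
    then have "b \<in> J \<or> b = 0" "c \<in> J \<or> c = 0" using nrange by auto
    moreover have "c = 0 \<Longrightarrow> g = ?u b" "b = 0 \<Longrightarrow> g = ?l c" "b = 0 \<Longrightarrow> c = 0 \<Longrightarrow> g = mat 1"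
      using one bc by (auto simp: mat2_eq_iff)
    moreover have "b = 0 \<or> c = 0" using z bc r3 by auto
    ultimately show "g \<in> {mat 1} \<union> (?u ` J \<union> ?l ` J)" by blast
  qed
  have uG: "?u j \<in> G \<and> ?l j \<in> G" if "j \<in> J" for j
  proof -
    have "\<bar>j\<bar> \<le> L div int r" using that by (simp add: J_def n)
    then have "int r * \<bar>j\<bar> \<le> int r * (L div int r)" by (intro mult_left_mono) auto
    also note rL
    finally have "\<bar>int r * j\<bar> \<le> L" by (simp add: abs_mult)
    then show ?thesis using L(1) by (auto simp: G_def det_2 mat_cong_iff cong_0_iff forall_2)
  qed
  have harmJ: "(\<Sum>j\<in>J. 4 * M\<^sup>2 / real_of_int \<bar>int r * j\<bar>) \<le> 8 * h * M\<^sup>2 / real r"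
  proof -
    have "(\<Sum>j\<in>J. 4 * M\<^sup>2 / real_of_int \<bar>int r * j\<bar>) = 4 * M\<^sup>2 / real r * (\<Sum>j\<in>J. 1 / real_of_int \<bar>j\<bar>)"
      by (simp add: sum_distrib_left abs_mult)
    also have "\<dots> = 4 * M\<^sup>2 / real r * (2 * (\<Sum>j=1..n. 1 / real j))"
      unfolding J_def sum_inverse_abs_int ..
    also have "\<dots> \<le> 4 * M\<^sup>2 / real r * (2 * h)"
    proof (intro mult_left_mono H)
      have "1 * (L div int r) \<le> int r * (L div int r)" using r3 Ld by (intro mult_right_mono) auto
      then have "int n \<le> L" using rL n by linarith
      then show "real n \<le> 2 * M\<^sup>2" using L M2 by linarith
    qed auto
    finally show ?thesis by (simp add: mult_ac)
  qed
  have Y1: "(\<Sum>g\<in>G - G2. real (card (Y g))) \<le> 2 * M\<^sup>2 + 16 * h * M\<^sup>2 / real r"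
  proof -
    have "(\<Sum>g\<in>G - G2. real (card (Y g))) \<le> (\<Sum>g\<in>{mat 1} \<union> (?u ` J \<union> ?l ` J). real (card (Y g)))"
      using G1 finJ by (intro sum_mono2) auto
    also have "\<dots> \<le> real (card (Y (mat 1))) + ((\<Sum>g\<in>?u ` J. real (card (Y g))) + (\<Sum>g\<in>?l ` J. real (card (Y g))))"
      using finJ by (intro order_trans[OF sum_Un_le] add_mono sum_Un_le) auto
    also have "real (card (Y (mat 1))) \<le> 2 * M\<^sup>2"
      using card_semibox_le[OF M] by (simp add: Y_def)
    also have "(\<Sum>g\<in>?u ` J. real (card (Y g))) \<le> (\<Sum>j\<in>J. real (card (Y (?u j))))"
      using sum_image_le[OF finJ, of "\<lambda>g. real (card (Y g))" ?u] by (simp add: o_def)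
    also have "\<dots> \<le> (\<Sum>j\<in>J. 4 * M\<^sup>2 / real_of_int \<bar>int r * j\<bar>)"
      using uG r3 by (intro sum_mono Yb) (auto simp: J_def)
    also note harmJ
    also have "(\<Sum>g\<in>?l ` J. real (card (Y g))) \<le> (\<Sum>j\<in>J. real (card (Y (?l j))))"
      using sum_image_le[OF finJ, of "\<lambda>g. real (card (Y g))" ?l] by (simp add: o_def)
    also have "\<dots> \<le> (\<Sum>j\<in>J. 4 * M\<^sup>2 / real_of_int \<bar>int r * j\<bar>)"
      using uG r3 by (intro sum_mono Yb) (auto simp: J_def)
    also note harmJ
    finally show ?thesis by simp
  qed
  define R where "R = (L + 1) div int r"
  define T where "T = {(k, l). (k, l) \<noteq> (0, 0) \<and> \<bar>k\<bar> \<le> R \<and> \<bar>l\<bar> \<le> R \<and> int r dvd k + l}"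
  \<comment> \<open>The translate bound for the larger diagonal entry: with diagonal 1 + r k, 1 + r
    l and m the larger of k, l in absolute value, |1 + r m| is at least r |m|/2.\<close>
  define f where "f = (\<lambda>(k, l). 8 * M\<^sup>2 / (real r * real_of_int (max \<bar>k\<bar> \<bar>l\<bar>)))"
  define kk where "kk g = ((g$1$1 - 1) div int r, (g$2$2 - 1) div int r)" for g :: "int^2^2"
  have finT: "finite T"
    by (rule finite_subset[of _ "{-R..R} \<times> {-R..R}"]) (auto simp: T_def abs_le_iff minus_le_iff)
  have kk: "g$1$1 = 1 + int r * fst (kk g)" "g$2$2 = 1 + int r * snd (kk g)" if "g \<in> G" for g
    using diag(1,2)[OF that] by (simp_all add: kk_def)
  have R: "real_of_int R \<le> 2 * M\<^sup>2 / real r" "R \<ge> 0"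
  proof -
    have "real_of_int R \<le> real_of_int (L + 1) / real_of_int (int r)" unfolding R_def by (rule real_of_int_div4)
    also have "\<dots> \<le> 2 * M\<^sup>2 / real r" using L(2) M2 rpos by (intro divide_right_mono frac_le) auto
    finally show "real_of_int R \<le> 2 * M\<^sup>2 / real r" .
    show "R \<ge> 0" using L(1) r3 by (simp add: R_def pos_imp_zdiv_nonneg_iff)
  qed
  have Rrange: "\<bar>k\<bar> \<le> R" if "\<bar>1 + int r * k\<bar> \<le> L" for k
  proof -
    have "int r * \<bar>k\<bar> \<le> L + 1" using that by (simp flip: abs_mult[of "int r", simplified])
    then have "int r * \<bar>k\<bar> div int r \<le> (L + 1) div int r" using r3 by (intro zdiv_mono1) auto
    then show ?thesis using r3 by (simp add: R_def)
  qed
  have kT: "kk g \<in> T" if "g \<in> G2" for g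
  proof -
    have g: "g \<in> G" "g$1$1 * g$2$2 \<noteq> 1" using that by (auto simp: G2_def)
    obtain k l where kl: "kk g = (k, l)" by fastforce
    have e: "g$1$1 = 1 + int r * k" "g$2$2 = 1 + int r * l" using kk[OF g(1)] kl by simp_all
    have "\<bar>k\<bar> \<le> R" "\<bar>l\<bar> \<le> R" using g(1) e by (auto simp: G_def intro!: Rrange) (metis)+
    moreover have "(k, l) \<noteq> (0, 0)" using g(2) e by auto
    moreover have "int r dvd k + l"
    proof -
      obtain b c where bc: "g$1$2 = int r * b" "g$2$1 = int r * c" using diag(3,4)[OF g(1)] by (auto elim!: dvdE)
      have "det g = 1" using g(1) by (simp add: G_def)
      then have "int r * (k + l) = int r * (int r * (b * c - k * l))"
        unfolding det_2 e bc by (simp add: algebra_simps)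
      then have "k + l = int r * (b * c - k * l)" using r3 by simp
      then show ?thesis by simp
    qed
    ultimately show ?thesis by (simp add: T_def kl)
  qed
  have Yf: "real (card (Y g)) \<le> f (kk g)" if "g \<in> G2" for g
  proof -
    have g: "g \<in> G" using that by (auto simp: G2_def)
    obtain k l where kl: "kk g = (k, l)" by fastforce
    have e: "g$1$1 = 1 + int r * k" "g$2$2 = 1 + int r * l" using kk[OF g] kl by simp_all
    have nz: "(k, l) \<noteq> (0, 0)" using kT[OF that] kl by (auto simp: T_def)
    have *: "4 * M\<^sup>2 / real_of_int \<bar>1 + int r * m\<bar> \<le> 8 * M\<^sup>2 / (real r * real_of_int \<bar>m\<bar>) \<and> 1 + int r * m \<noteq> 0"
      if "m \<noteq> 0" for m
    proof -
      have "int r * \<bar>m\<bar> \<ge> 3 * 1" using r3 that by (intro mult_mono) auto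
      moreover have "\<bar>1 + int r * m\<bar> \<ge> \<bar>int r * m\<bar> - 1" by linarith
      ultimately have b: "2 * \<bar>1 + int r * m\<bar> \<ge> int r * \<bar>m\<bar>" "int r * \<bar>m\<bar> > 0" by (auto simp: abs_mult)
      then have b': "real r * real_of_int \<bar>m\<bar> \<le> 2 * real_of_int \<bar>1 + int r * m\<bar>" "real r * real_of_int \<bar>m\<bar> > 0"
        using of_int_le_iff[where ?'a = real, THEN iffD2, OF b(1)] rpos that by simp_all
      have "4 * M\<^sup>2 / real_of_int \<bar>1 + int r * m\<bar> = 8 * M\<^sup>2 / (2 * real_of_int \<bar>1 + int r * m\<bar>)" by simp
      also have "\<dots> \<le> 8 * M\<^sup>2 / (real r * real_of_int \<bar>m\<bar>)" using b' by (intro frac_le) simp_all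
      finally show ?thesis using b by auto
    qed
    show ?thesis
    proof (cases "\<bar>l\<bar> \<le> \<bar>k\<bar>")
      case True
      then have "k \<noteq> 0" using nz by auto
      then show ?thesis using Yb[OF g, of "g$1$1"] *[of k] True unfolding e f_def kl by (auto simp: max_def)
    next
      case False
      then have "l \<noteq> 0" by auto
      then show ?thesis using Yb[OF g, of "g$2$2"] *[of l] False unfolding e f_def kl by (auto simp: max_def)
    qed
  qed
  have "(\<Sum>g\<in>G2. real (card (Y g))) \<le> (\<Sum>g\<in>G2. f (kk g))" by (intro sum_mono Yf)
  also have "\<dots> \<le> (2 * h) * (\<Sum>y\<in>T. f y)"
  proof (rule sum_fibers_le)
    show "finite G2" using finG by (simp add: G2_def)
    show "kk ` G2 \<subseteq> T" using kT by blast
    show "0 \<le> f y" for y by (auto simp: f_def split: prod.split)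
    fix y assume "y \<in> T"
    show "real (card {x \<in> G2. kk x = y}) \<le> 2 * h"
    proof (cases "{x \<in> G2. kk x = y} = {}")
      case True
      show ?thesis unfolding True using h by simp
    next
      case False
      then obtain g where g: "g \<in> G2" "kk g = y" by auto
      let ?n = "g$1$1 * g$2$2 - 1"
      have n0: "?n \<noteq> 0" using g by (auto simp: G2_def)
      have same: "x$1$1 = g$1$1 \<and> x$2$2 = g$2$2 \<and> x$1$2 * x$2$1 = ?n" if "x \<in> {x \<in> G2. kk x = y}" for x
      proof -
        have x: "x \<in> G" "kk x = kk g" "g \<in> G" using that g by (auto simp: G2_def)
        then have "x$1$1 = g$1$1" "x$2$2 = g$2$2" using kk[OF x(1)] kk[OF x(3)] by simp_all
        moreover have "det x = 1" using x(1) by (simp add: G_def)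
        ultimately show ?thesis by (simp add: det_2)
      qed
      have "card {x \<in> G2. kk x = y} \<le> card {d. d dvd ?n}"
      proof (rule card_inj_on_le[where f = "\<lambda>x. x$1$2"])
        show "inj_on (\<lambda>x. x$1$2) {x \<in> G2. kk x = y}"
        proof (rule inj_onI)
          fix x x' assume x: "x \<in> {x \<in> G2. kk x = y}" "x' \<in> {x \<in> G2. kk x = y}" "x$1$2 = x'$1$2"
          have "x$1$2 * x$2$1 = x$1$2 * x'$2$1" "x$1$2 \<noteq> 0" using same[OF x(1)] same[OF x(2)] x(3) n0 by auto
          then have "x$2$1 = x'$2$1" by simp
          then show "x = x'" using same[OF x(1)] same[OF x(2)] x(3) by (simp add: mat2_eq_iff)
        qed
        show "(\<lambda>x. x$1$2) ` {x \<in> G2. kk x = y} \<subseteq> {d. d dvd ?n}" using same by (auto intro: dvdI dest!: sym[of _ ?n])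
        show "finite {d. d dvd ?n}" by (rule card_int_divisors_le(2)[OF n0])
      qed
      also have "\<dots> \<le> 2 * card {d. d dvd nat \<bar>?n\<bar>}" by (rule card_int_divisors_le(1)[OF n0])
      finally have "real (card {x \<in> G2. kk x = y}) \<le> 2 * real (card {d. d dvd nat \<bar>?n\<bar>})" by linarith
      also have "real (card {d. d dvd nat \<bar>?n\<bar>}) \<le> h"
      proof (rule D)
        show "1 \<le> nat \<bar>?n\<bar>" using n0 by linarith
        have "\<bar>g$1$1\<bar> \<le> L" "\<bar>g$2$2\<bar> \<le> L" using g by (auto simp: G2_def G_def)
        then have "\<bar>g$1$1\<bar> * \<bar>g$2$2\<bar> \<le> L * L" using L(1) by (intro mult_mono) auto
        then have "\<bar>?n\<bar> \<le> L * L + 1" by (simp add: abs_mult[symmetric])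
        then have "real_of_int \<bar>?n\<bar> \<le> real_of_int L * real_of_int L + 1"
          by (metis of_int_le_iff of_int_mult of_int_add of_int_1)
        also have "\<dots> \<le> M\<^sup>2 * M\<^sup>2 + M\<^sup>2 * M\<^sup>2"
          using L M2 by (intro add_mono mult_mono) (auto intro: order_trans[OF _ mult_mono[of 1 "M\<^sup>2" 1 "M\<^sup>2", simplified]])
        also have "\<dots> = 2 * M ^ 4" by (simp add: power4_eq_xxxx power2_eq_square)
        finally show "real (nat \<bar>?n\<bar>) \<le> 2 * M ^ 4" by simp
      qed
      finally show ?thesis by simp
    qed
  qed (rule finT)
  finally have Y2T: "(\<Sum>g\<in>G2. real (card (Y g))) \<le> (2 * h) * (\<Sum>y\<in>T. f y)" .
  have fT: "(\<Sum>y\<in>T. f y) \<le> 8 * M\<^sup>2 / real r * (16 * M\<^sup>2 / (real r)\<^sup>2 + 4 * h)"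
  proof -
    define J' where "J' = {k. k \<noteq> 0 \<and> \<bar>k\<bar> \<le> int (nat R)}"
    \<comment> \<open>By symmetry one may let |k| be the larger; for each such k the congruence
      leaves at most 2|k|/r + 1 values of l, so weighting by 1/|k| gives a main term and a harmonic
      sum.\<close>
    define S where "S = (SIGMA k:J'. {l. \<bar>l\<bar> \<le> \<bar>k\<bar> \<and> int r dvd k + l})"
    let ?w = "\<lambda>(k::int, l::int). 1 / real_of_int (max \<bar>k\<bar> \<bar>l\<bar>)"
    have finJ': "finite J'" by (rule finite_subset[of _ "{- int (nat R)..int (nat R)}"]) (auto simp: J'_def)
    have finl: "finite {l. \<bar>l\<bar> \<le> \<bar>k\<bar> \<and> int r dvd k + l}" for k
      by (rule finite_subset[of _ "{-\<bar>k\<bar>..\<bar>k\<bar>}"]) auto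
    have finS: "finite S" unfolding S_def by (rule finite_SigmaI[OF finJ' finl])
    have sumS: "(\<Sum>y\<in>S. ?w y) \<le> 8 * M\<^sup>2 / (real r)\<^sup>2 + 2 * h"
    proof -
      have "(\<Sum>y\<in>S. ?w y) = (\<Sum>k\<in>J'. \<Sum>l\<in>{l. \<bar>l\<bar> \<le> \<bar>k\<bar> \<and> int r dvd k + l}. 1 / real_of_int (max \<bar>k\<bar> \<bar>l\<bar>))"
        unfolding S_def
        by (rule sum.Sigma[symmetric, OF finJ']) (simp add: finl)
      also have "\<dots> = (\<Sum>k\<in>J'. real (card {l. \<bar>l\<bar> \<le> \<bar>k\<bar> \<and> int r dvd k + l}) * (1 / real_of_int \<bar>k\<bar>))"
      proof (rule sum.cong[OF refl])
        fix k
        have "(\<Sum>l | \<bar>l\<bar> \<le> \<bar>k\<bar> \<and> int r dvd k + l. 1 / real_of_int (max \<bar>k\<bar> \<bar>l\<bar>))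
            = (\<Sum>l | \<bar>l\<bar> \<le> \<bar>k\<bar> \<and> int r dvd k + l. 1 / real_of_int \<bar>k\<bar>)"
          by (intro sum.cong refl) (auto simp: max_def)
        then show "(\<Sum>l | \<bar>l\<bar> \<le> \<bar>k\<bar> \<and> int r dvd k + l. 1 / real_of_int (max \<bar>k\<bar> \<bar>l\<bar>))
            = real (card {l. \<bar>l\<bar> \<le> \<bar>k\<bar> \<and> int r dvd k + l}) * (1 / real_of_int \<bar>k\<bar>)"
          by (simp only: sum_constant)
      qed
      also have "\<dots> \<le> (\<Sum>k\<in>J'. (2 * real_of_int \<bar>k\<bar> / real r + 1) * (1 / real_of_int \<bar>k\<bar>))"
        using r3 by (intro sum_mono mult_right_mono card_congruent_interval) auto
      also have "\<dots> = (\<Sum>k\<in>J'. 2 / real r + 1 / real_of_int \<bar>k\<bar>)"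
        by (intro sum.cong refl) (auto simp: J'_def field_simps)
      also have "\<dots> = real (card J') * (2 / real r) + 2 * (\<Sum>j=1..nat R. 1 / real j)"
        unfolding sum.distrib sum_constant J'_def sum_inverse_abs_int ..
      also have "\<dots> \<le> (2 * real_of_int R) * (2 / real r) + 2 * h"
      proof (intro add_mono mult_right_mono mult_left_mono H)
        have J': "J' = {- int (nat R)..-1} \<union> {1..int (nat R)}" by (auto simp: J'_def)
        have "card J' \<le> card {- int (nat R)..-1} + card {1..int (nat R)}" unfolding J' by (rule card_Un_le)
        then show "real (card J') \<le> 2 * real_of_int R" using R(2) by simp
        have "2 * M\<^sup>2 / real r \<le> 2 * M\<^sup>2 / 1" using r3 by (intro divide_left_mono) auto
        then show "real (nat R) \<le> 2 * M\<^sup>2" using R by simp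
      qed auto
      also have "\<dots> \<le> (2 * (2 * M\<^sup>2 / real r)) * (2 / real r) + 2 * h"
        using R(1) by (intro add_mono mult_right_mono mult_left_mono) auto
      also have "\<dots> = 8 * M\<^sup>2 / (real r)\<^sup>2 + 2 * h" by (simp add: power2_eq_square)
      finally show ?thesis .
    qed
    have "T \<subseteq> S \<union> prod.swap ` S"
    proof clarify
      fix k l assume kl: "(k, l) \<in> T" "(k, l) \<notin> prod.swap ` S"
      have "(l, k) \<notin> S" using kl(2) by (metis image_eqI swap_simp)
      then show "(k, l) \<in> S" using kl(1) by (auto simp: T_def S_def J'_def add.commute)
    qed
    then have "(\<Sum>y\<in>T. ?w y) \<le> (\<Sum>y\<in>S \<union> prod.swap ` S. ?w y)"
      using finS by (intro sum_mono2) auto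
    also have "\<dots> \<le> (\<Sum>y\<in>S. ?w y) + (\<Sum>y\<in>prod.swap ` S. ?w y)"
      using finS by (intro sum_Un_le) (auto split: prod.split)
    also have "(\<Sum>y\<in>prod.swap ` S. ?w y) = (\<Sum>y\<in>S. ?w y)"
      by (subst sum.reindex) (auto simp: case_prod_unfold max.commute intro!: sum.cong)
    finally have *: "(\<Sum>y\<in>T. ?w y) \<le> 16 * M\<^sup>2 / (real r)\<^sup>2 + 4 * h" using sumS by simp
    have "(\<Sum>y\<in>T. f y) = 8 * M\<^sup>2 / real r * (\<Sum>y\<in>T. ?w y)"
      by (simp add: sum_distrib_left f_def case_prod_unfold)
    also have "\<dots> \<le> 8 * M\<^sup>2 / real r * (16 * M\<^sup>2 / (real r)\<^sup>2 + 4 * h)"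
      using rpos * by (intro mult_left_mono) auto
    finally show ?thesis .
  qed
  have Y2: "(\<Sum>g\<in>G2. real (card (Y g))) \<le> (2 * h) * (8 * M\<^sup>2 / real r * (16 * M\<^sup>2 / (real r)\<^sup>2 + 4 * h))"
    by (rule order_trans[OF Y2T mult_left_mono[OF fT]]) (use h in simp)
  have "G2 \<subseteq> G" by (auto simp: G2_def)
  then have "(\<Sum>g\<in>G. real (card (Y g))) = (\<Sum>g\<in>G2. real (card (Y g))) + (\<Sum>g\<in>G - G2. real (card (Y g)))"
    using sum.subset_diff[OF _ finG] by (metis add.commute)
  also have "\<dots> \<le> (2 * h) * (8 * M\<^sup>2 / real r * (16 * M\<^sup>2 / (real r)\<^sup>2 + 4 * h)) + (2 * M\<^sup>2 + 16 * h * M\<^sup>2 / real r)"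
    by (intro add_mono Y1 Y2)
  also have "\<dots> \<le> 400 * h\<^sup>2 * M ^ 4 / real r ^ 3"
  proof -
    \<comment> \<open>The hypothesis r^3 \<le> M^2 reads r \<le> q, and the target M^4/r^3 is q^2 r;
      every contribution is dominated by h^2 q^2 r.\<close>
    define q where "q = M\<^sup>2 / (real r)\<^sup>2"
    have q: "q \<ge> real r"
      using rM rpos by (simp add: q_def le_divide_eq power3_eq_cube power2_eq_square)
    then have q1: "q \<ge> 1" using r3 by linarith
    have hh: "h \<le> h\<^sup>2" "1 \<le> h\<^sup>2"
      using mult_left_mono[of 1 h h] h one_le_power[of h 2] by (simp_all add: power2_eq_square)
    have M2q: "M\<^sup>2 = q * (real r)\<^sup>2" using rpos by (simp add: q_def)
    have "M ^ 4 = (M\<^sup>2)\<^sup>2" by simp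
    then have M4: "M ^ 4 / real r ^ 3 = q\<^sup>2 * real r"
      unfolding M2q using rpos by (simp add: power2_eq_square power3_eq_cube)
    have 1: "(2 * h) * (8 * M\<^sup>2 / real r * (16 * M\<^sup>2 / (real r)\<^sup>2 + 4 * h)) \<le> 320 * h\<^sup>2 * (q\<^sup>2 * real r)"
    proof -
      have "q \<le> h * q" "h \<le> h * q" using mult_right_mono[of 1 h q] mult_left_mono[of 1 q h] q1 h by simp_all
      then have "16 * q + 4 * h \<le> 20 * (h * q)" by linarith
      then have "16 * M\<^sup>2 / (real r)\<^sup>2 + 4 * h \<le> 20 * h * q" by (simp add: q_def)
      then have "(2 * h) * (8 * M\<^sup>2 / real r * (16 * M\<^sup>2 / (real r)\<^sup>2 + 4 * h)) \<le> (2 * h) * (8 * M\<^sup>2 / real r * (20 * h * q))"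
        using h rpos by (intro mult_left_mono) auto
      also have "\<dots> = 320 * h\<^sup>2 * (q\<^sup>2 * real r)" unfolding M2q using rpos by (simp add: power2_eq_square)
      finally show ?thesis .
    qed
    have 2: "2 * M\<^sup>2 \<le> 2 * (h\<^sup>2 * (q\<^sup>2 * real r))"
    proof -
      have "q * (real r)\<^sup>2 \<le> q\<^sup>2 * real r"
        using q q1 rpos mult_left_mono[of "real r" q "q * real r"] by (simp add: power2_eq_square mult_ac)
      also have "\<dots> \<le> h\<^sup>2 * (q\<^sup>2 * real r)" using hh rpos mult_right_mono[of 1 "h\<^sup>2" "q\<^sup>2 * real r"] by simp
      finally show ?thesis unfolding M2q by simp
    qed
    have 3: "16 * h * M\<^sup>2 / real r \<le> 16 * (h\<^sup>2 * (q\<^sup>2 * real r))"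
    proof -
      have "h * (q * real r) \<le> h\<^sup>2 * (q\<^sup>2 * real r)"
        using hh h q1 rpos by (intro mult_mono mult_right_mono) (auto simp: power2_eq_square)
      then show ?thesis unfolding M2q using rpos by (simp add: power2_eq_square)
    qed
    have "320 * h\<^sup>2 * (q\<^sup>2 * real r) + (2 * (h\<^sup>2 * (q\<^sup>2 * real r)) + 16 * (h\<^sup>2 * (q\<^sup>2 * real r)))
       \<le> 400 * (h\<^sup>2 * (q\<^sup>2 * real r))" using rpos by simp
    then have "(2 * h) * (8 * M\<^sup>2 / real r * (16 * M\<^sup>2 / (real r)\<^sup>2 + 4 * h)) + (2 * M\<^sup>2 + 16 * h * M\<^sup>2 / real r)
       \<le> 400 * (h\<^sup>2 * (q\<^sup>2 * real r))" using 1 2 3 by linarith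
    then show ?thesis unfolding M4[symmetric] by simp
  qed
  finally show ?thesis using collG by linarith
qed

lemma coll_le_card_square:
  assumes "finite A" shows "real (coll r A) \<le> (real (card A))\<^sup>2"
proof -
  have "coll r A \<le> card (A \<times> A)" unfolding coll_def using assms by (intro card_mono) auto
  then show ?thesis by (simp add: card_cartesian_product power2_eq_square flip: of_nat_mult)
qed

lemma harmonic_sum_le_ln: "n \<ge> 1 \<Longrightarrow> (\<Sum>j=1..n. 1 / real j) \<le> 1 + ln (real n)"
proof (induction n rule: nat_induct_at_least)
  case base
  then show ?case by simp
next
  case (Suc n)
  have "ln (real n / real (Suc n)) \<le> real n / real (Suc n) - 1"
    using Suc.hyps by (intro ln_le_minus_one) simp
  moreover have "real n / real (Suc n) - 1 = - (1 / real (Suc n))" by (simp add: field_simps)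
  moreover have "ln (real n / real (Suc n)) = ln (real n) - ln (real (Suc n))"
    using Suc.hyps by (simp add: ln_div)
  ultimately show ?case using Suc.IH by simp
qed

text \<open>The condition r^3 \<le> M^2 is the range where M^4/r^3 dominates M^2, the order of the
  diagonal x = y. For r \<ge> 3 the auxiliary bound applies with h absorbing divisors and harmonic
  sums; for r \<le> 2 counting all pairs is enough.\<close>

lemma coll_semibox:
  fixes e :: real assumes e: "e > 0"
  shows "\<exists>C\<ge>1. \<forall>M r. M \<ge> 1 \<longrightarrow> r \<ge> 1 \<longrightarrow> real r ^ 3 \<le> M\<^sup>2 \<longrightarrow>
    real (coll r (semibox M)) \<le> C * M powr (4 + e) / real r ^ 3"
proof -
  \<comment> \<open>Divisors are counted for numbers of size M^4 and the bound h enters squared, so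
    8 f = e.\<close>
  define f where "f = e / 8"
  have f: "f > 0" using e by (simp add: f_def)
  obtain K where K: "K \<ge> 1" "\<And>n. n \<ge> 1 \<Longrightarrow> real (card {d. d dvd n}) \<le> K * real n powr f"
    using divisor_bound[OF f] by blast
  define K0 where "K0 = max K (1 + 1 / f)"
  have K0: "K0 \<ge> 1" "K \<le> K0" "1 + 1 / f \<le> K0" using K(1) by (auto simp: K0_def)
  define C where "C = 400 * K0\<^sup>2 * 2 powr (2 * f)"
  have C400: "C \<ge> 400"
  proof -
    have "1 * 1 \<le> K0\<^sup>2 * 2 powr (2 * f)" using K0(1) f by (intro mult_mono one_le_power ge_one_powr_ge_zero) auto
    then show ?thesis by (simp add: C_def)
  qed
  show ?thesis
  proof (intro exI[of _ C] conjI allI impI)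
    show "1 \<le> C" using C400 by simp
    fix M :: real and r :: nat
    assume M: "M \<ge> 1" and r: "r \<ge> 1" and rM: "real r ^ 3 \<le> M\<^sup>2"
    have M4e: "M ^ 4 * M powr e = M powr (4 + e)" using M by (simp add: powr_add powr_realpow)
    show "real (coll r (semibox M)) \<le> C * M powr (4 + e) / real r ^ 3"
    proof (cases "r \<ge> 3")
      case True
      define h where "h = K0 * 2 powr f * M powr (e / 2)"
      have M4: "M\<^sup>2 \<le> M ^ 4" using M by (intro power_increasing) auto
      have nf: "real n powr f \<le> 2 powr f * M powr (e / 2)" if "real n \<le> 2 * M ^ 4" for n
      proof -
        have "real n powr f \<le> (2 * M ^ 4) powr f" using that f by (intro powr_mono2) auto
        also have "\<dots> = 2 powr f * (M ^ 4) powr f" by (rule powr_mult)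
        also have "M ^ 4 = M powr 4" using M by simp
        also have "(M powr 4) powr f = M powr (e / 2)" by (simp add: powr_powr f_def)
        finally show ?thesis .
      qed
      have h1: "1 \<le> h"
      proof -
        have "1 * 1 * 1 \<le> K0 * 2 powr f * M powr (e / 2)"
          using K0(1) f e M by (intro mult_mono ge_one_powr_ge_zero) auto
        then show ?thesis by (simp add: h_def)
      qed
      have "real (coll r (semibox M)) \<le> 400 * h\<^sup>2 * M ^ 4 / real r ^ 3"
      proof (rule coll_semibox_aux[OF M True rM h1])
        fix n :: nat assume n: "real n \<le> 2 * M\<^sup>2"
        show "(\<Sum>j=1..n. 1 / real j) \<le> h"
        proof (cases "n = 0")
          case True
          then show ?thesis using h1 by simp
        next
          case False
          then have n1: "n \<ge> 1" by simp
          have "(\<Sum>j=1..n. 1 / real j) \<le> 1 + ln (real n)" by (rule harmonic_sum_le_ln[OF n1])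
          also have "ln (real n) \<le> real n powr f / f" using n1 f by (intro ln_powr_bound) auto
          also have "1 + real n powr f / f \<le> real n powr f + real n powr f / f"
            using n1 f by (intro add_right_mono ge_one_powr_ge_zero) auto
          also have "\<dots> = (1 + 1 / f) * real n powr f" by (simp add: algebra_simps)
          also have "\<dots> \<le> K0 * (2 powr f * M powr (e / 2))"
            using K0 n M4 by (intro mult_mono nf) auto
          finally show ?thesis by (simp add: h_def mult.assoc)
        qed
      next
        fix n :: nat assume n: "1 \<le> n" "real n \<le> 2 * M ^ 4"
        have "real (card {d. d dvd n}) \<le> K * real n powr f" by (rule K(2)[OF n(1)])
        also have "\<dots> \<le> K0 * (2 powr f * M powr (e / 2))"
          using K0 n by (intro mult_mono nf) auto
        finally show "real (card {d. d dvd n}) \<le> h" by (simp add: h_def mult.assoc)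
      qed
      also have "h\<^sup>2 = K0\<^sup>2 * 2 powr (2 * f) * M powr e"
      proof -
        have "(x powr a)\<^sup>2 = x powr (2 * a)" for x a :: real
          by (simp add: power2_eq_square powr_add[symmetric])
        then show ?thesis unfolding h_def power_mult_distrib by simp
      qed
      also have "400 * (K0\<^sup>2 * 2 powr (2 * f) * M powr e) * M ^ 4 = C * (M ^ 4 * M powr e)"
        by (simp add: C_def)
      finally show ?thesis unfolding M4e .
    next
      case False
      then have r8: "real r ^ 3 \<le> 2 ^ 3" by (intro power_mono) auto
      have "real (coll r (semibox M)) \<le> (real (card (semibox M)))\<^sup>2" by (intro coll_le_card_square finite_semibox)
      also have "\<dots> \<le> (2 * M\<^sup>2)\<^sup>2" by (intro power_mono card_semibox_le M) auto
      also have "\<dots> = 4 * M ^ 4" by (simp add: power_mult_distrib)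
      also have "\<dots> \<le> 400 * M ^ 4 / real r ^ 3"
      proof -
        have "4 * M ^ 4 * real r ^ 3 \<le> 4 * M ^ 4 * 8" using r8 M by (intro mult_left_mono) auto
        also have "\<dots> \<le> 400 * M ^ 4" using M by simp
        finally show ?thesis using r by (simp add: le_divide_eq)
      qed
      also have "\<dots> \<le> C * M powr (4 + e) / real r ^ 3"
      proof (intro divide_right_mono mult_mono C400)
        have "M ^ 4 * 1 \<le> M ^ 4 * M powr e" using M e by (intro mult_left_mono ge_one_powr_ge_zero) auto
        then show "M ^ 4 \<le> M powr (4 + e)" unfolding M4e by simp
      qed (use C400 M in auto)
      finally show ?thesis .
    qed
  qed
qed

section \<open>The large sieve inequality\<close>

lemma par_commute: "par p u v = par p v u"
  unfolding par_def using cross_commute_dvd by simp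

lemma par_mult_left: "par p (x ** g *v u) v = par p (g *v u) (adj2 x *v v)"
  unfolding par_def matrix_vector_mul_assoc[symmetric] cross_adj2 ..

lemma par0_mult_left: "par0 p (x ** g *v u) v = par0 p (g *v u) (adj2 x *v v)"
  unfolding par0_def par_mult_left ..

lemma par0_mult_both: "par0 p (x ** g ** y *v u) v = par0 p (g *v (y *v u)) (adj2 x *v v)"
  using par0_mult_left[of p x "g ** y" u v]
  by (simp only: matrix_mul_assoc matrix_vector_mul_assoc)

lemma mat_cong_adj2_iff: "mat_cong r (adj2 g) (adj2 h) \<longleftrightarrow> mat_cong r g h"
  using mat_cong_adj2[of r g h] mat_cong_adj2[of r "adj2 g" "adj2 h"] by auto

text \<open>The lines are arbitrary rather than isotropic: freezing the outer factors of a product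
  moves them, and this family is closed under that.\<close>

definition oscp :: "nat \<Rightarrow> (nat \<Rightarrow> int^2) \<Rightarrow> (nat \<Rightarrow> int^2) \<Rightarrow> int^2^2 \<Rightarrow> real" where
  "oscp d u v g = (\<Prod>p\<in>prime_factors d. par0 p (g *v u p) (v p))"

definition nzs :: "nat \<Rightarrow> (nat \<Rightarrow> int^2) \<Rightarrow> bool" where
  "nzs d u \<longleftrightarrow> (\<forall>p\<in>prime_factors d. nz p (u p))"

lemma nzs_mult: "nzs d u \<Longrightarrow> det g = 1 \<Longrightarrow> nzs d (\<lambda>p. g *v u p)"
  by (auto simp: nzs_def intro: nz_mult)

lemma periodic_prime_factors:
  assumes "squarefree d" "\<And>p. p \<in> prime_factors d \<Longrightarrow> periodic p (F p)"
  shows "periodic d (\<lambda>g. \<Prod>p\<in>prime_factors d. F p g)"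
proof (rule periodic_prod)
  fix p assume p: "p \<in> prime_factors d"
  show "periodic d (F p)"
    by (rule periodic_dvd[OF assms(2)[OF p]]) (use p in auto)
qed

lemma periodic_oscp: "squarefree d \<Longrightarrow> periodic d (oscp d u v)"
  unfolding oscp_def by (rule periodic_prime_factors) (auto intro: periodic_par0)

lemma periodic_mat_cong: "periodic r (\<lambda>g. of_bool (mat_cong r (x ** g ** y) h) :: real)"
proof (rule periodic_of_bool)
  fix g k assume "mat_cong r g k"
  then have "mat_cong r (x ** g ** y) (x ** k ** y)" by (intro mat_cong_mult) auto
  then show "mat_cong r (x ** g ** y) h \<longleftrightarrow> mat_cong r (x ** k ** y) h"
    using mat_cong_trans mat_cong_sym by blast
qed

lemma sum_mat_cong_le_1:
  "(\<Sum>g\<in>SL2_mod r. of_bool (mat_cong r g h) :: real) \<le> 1"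
proof -
  have "card {g \<in> SL2_mod r. mat_cong r g h} \<le> card {red r h}"
  proof (rule card_mono)
    show "{g \<in> SL2_mod r. mat_cong r g h} \<subseteq> {red r h}"
    proof
      fix g assume "g \<in> {g \<in> SL2_mod r. mat_cong r g h}"
      then have "g \<in> SL2_mod r" "red r g = red r h" by (simp_all add: red_eq_iff)
      then show "g \<in> {red r h}" using red_id[of g r] by simp
    qed
  qed simp
  then show ?thesis unfolding sum_of_bool_card[OF finite_SL2_mod] by simp
qed

lemma squarefree_pos: "squarefree (d::nat) \<Longrightarrow> d > 0"
  by (cases "d = 0") auto

lemma coprime_prime_factors_disjoint:
  fixes s t :: nat
  assumes "coprime s t" shows "prime_factors s \<inter> prime_factors t = {}"
proof (rule ccontr)
  assume "prime_factors s \<inter> prime_factors t \<noteq> {}"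
  then obtain p where "prime p" "p dvd s" "p dvd t" by auto
  then show False using assms by (metis coprime_common_divisor not_prime_unit)
qed

lemma prod_prime_factors_le:
  assumes "squarefree d" "\<And>p. prime p \<Longrightarrow> p dvd d \<Longrightarrow> 0 \<le> f p \<and> f p \<le> real p ^ k"
  shows "(\<Prod>p\<in>prime_factors d. f p) \<le> real d ^ k"
proof -
  have "(\<Prod>p\<in>prime_factors d. f p) \<le> (\<Prod>p\<in>prime_factors d. real p ^ k)"
    using assms(2) by (intro prod_mono) auto
  also have "\<dots> = real (\<Prod>(prime_factors d)) ^ k" by (simp add: prod_power_distrib)
  finally show ?thesis using squarefree_eq_prod_prime_factors[OF assms(1)] by simp
qed

section \<open>Weighted collision counts and the average over the middle factor\<close>

lemma sum_par_weight:
  assumes "prime p" "nz p u" "nz p v"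
  shows "(\<Sum>g\<in>SL2_mod p. par p (g *v u) v + 1 / (real p + 1)) = 2 * (real p * (real p - 1))"
proof -
  have "real (card (SL2_mod p)) / (real p + 1) = real p * (real p - 1)"
    unfolding card_SL2_prime[OF assms(1)] by (simp add: field_simps power2_eq_square)
  then show ?thesis using sum_par[OF assms] by (simp add: sum.distrib)
qed

text \<open>Weighted collision counts: the vectors \<open>x u\<close> and \<open>y u\<close> agree on the projective line modulo
  \<open>m\<close> (up to the weight of the mean), and \<open>x\<close>, \<open>y\<close> are congruent, up to a twist, modulo \<open>D\<close>.\<close>

definition wt :: "nat \<Rightarrow> (nat \<Rightarrow> int^2) \<Rightarrow> int^2^2 \<Rightarrow> int^2^2 \<Rightarrow> real" where
  "wt m u x y = (\<Prod>p\<in>prime_factors m. par p (x *v u p) (y *v u p) + 1 / (real p + 1))"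

lemma wt_nonneg: "0 \<le> wt m u x y"
  unfolding wt_def by (intro prod_nonneg) (auto simp: par_def)

lemma wt_commute: "wt m u x y = wt m u y x"
  unfolding wt_def using par_commute by (intro prod.cong) auto

lemma periodic_wt:
  assumes "squarefree m" shows "periodic m (wt m u x)"
  unfolding wt_def
proof (rule periodic_prime_factors[OF assms])
  fix p
  show "periodic p (\<lambda>y. par p (x *v u p) (y *v u p) + 1 / (real p + 1))"
    using periodic_par[of p "u p" "x *v u p"] unfolding par_commute[of p "x *v u p"] by (simp add: periodic_def)
qed

lemma sum_wt_le:
  assumes m: "squarefree m" and u: "nzs m u" and x: "\<And>p. p dvd m \<Longrightarrow> [det x = 1] (mod int p)"
  shows "(\<Sum>y\<in>SL2_mod m. wt m u x y) \<le> 2 ^ \<omega> m * real m ^ 2"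
proof -
  have "(\<Sum>y\<in>SL2_mod m. wt m u x y)
      = (\<Prod>p\<in>prime_factors m. \<Sum>y\<in>SL2_mod p. par p (y *v u p) (x *v u p) + 1 / (real p + 1))"
    unfolding wt_def par_commute[of _ "x *v _"]
  proof (rule sum_SL2_squarefree[OF m])
    fix p
    show "periodic p (\<lambda>y. par p (y *v u p) (x *v u p) + 1 / (real p + 1))"
      using periodic_par[of p "u p" "x *v u p"] by (simp add: periodic_def)
  qed
  also have "\<dots> = (\<Prod>p\<in>prime_factors m. 2 * (real p * (real p - 1)))"
  proof (rule prod.cong[OF refl])
    fix p assume p: "p \<in> prime_factors m"
    then have "nz p (u p)" "nz p (x *v u p)" using u x by (auto simp: nzs_def intro: nz_mult)
    then show "(\<Sum>y\<in>SL2_mod p. par p (y *v u p) (x *v u p) + 1 / (real p + 1)) = 2 * (real p * (real p - 1))"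
      using p by (intro sum_par_weight) auto
  qed
  also have "\<dots> = 2 ^ \<omega> m * (\<Prod>p\<in>prime_factors m. real p * (real p - 1))"
    by (simp add: prod.distrib)
  also have "\<dots> \<le> 2 ^ \<omega> m * real m ^ 2"
  proof (rule mult_left_mono[OF prod_prime_factors_le[OF m]])
    fix p :: nat assume "prime p"
    then show "0 \<le> real p * (real p - 1) \<and> real p * (real p - 1) \<le> real p ^ 2"
      using prime_ge_1_nat[of p] by (auto simp: power2_eq_square algebra_simps)
  qed simp
  finally show ?thesis .
qed

text \<open>The congruence modulo D selects at most one class, and the weight modulo m has row sums
  at most \<open>?L\<close>; by coprimality the row sums of the product kernel multiply. Moving the
  twist k across the congruence by its adjugate exchanges x and y, so columns behave like
  rows.\<close>

lemma twisted_collisions_le: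
  assumes sf: "squarefree D" "squarefree m" "coprime D m" and u: "nzs m u"
    and W: "finite W" "\<And>x. x \<in> W \<Longrightarrow> det x = 1" and k: "[det k = 1] (mod int D)"
  shows "(\<Sum>x\<in>W. \<Sum>y\<in>W. of_bool (mat_cong D y (x ** k)) * wt m u x y)
    \<le> 2 ^ \<omega> m * real m ^ 2 * real (coll (D * m) W)"
proof -
  let ?K = "\<lambda>x y. of_bool (mat_cong D y (x ** k)) * wt m u x y"
  let ?L = "2 ^ \<omega> m * real m ^ 2"
  have pos: "D > 0" "m > 0" using sf squarefree_pos by auto
  have L: "0 \<le> ?L" by simp
  have shift: "mat_cong D x (y ** adj2 k)" if "mat_cong D y (x ** k)" "[det k = 1] (mod int D)" for x y k
  proof -
    have "mat_cong D (y ** adj2 k) (x ** k ** adj2 k)" using that(1) by (intro mat_cong_mult) auto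
    then show ?thesis using mat_cong_adj2_right[OF that(2), of x] mat_cong_trans mat_cong_sym by blast
  qed
  have swap: "mat_cong D y (x ** k) \<longleftrightarrow> mat_cong D x (y ** adj2 k)" for x y
    using shift[of y x k] shift[of x y "adj2 k"] k by auto
  have per1: "periodic D (\<lambda>y. of_bool (mat_cong D y h) :: real)" for h
    using periodic_mat_cong[of D "mat 1" "mat 1" h] by simp
  have row: "(\<Sum>y\<in>SL2_mod (D * m). of_bool (mat_cong D y h) * wt m u x y) \<le> ?L"
    if "x \<in> SL2_mod (D * m)" for x h
  proof -
    have "(\<Sum>y\<in>SL2_mod (D * m). of_bool (mat_cong D y h) * wt m u x y)
        = (\<Sum>y\<in>SL2_mod D. of_bool (mat_cong D y h)) * (\<Sum>y\<in>SL2_mod m. wt m u x y)"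
      by (rule sum_SL2_mult[OF sf(3) pos per1 periodic_wt[OF sf(2)]])
    also have "\<dots> \<le> 1 * ?L"
    proof (intro mult_mono sum_mat_cong_le_1 sum_wt_le sf u)
      fix p assume "p dvd m"
      then have "int p dvd int (D * m)" by simp
      then show "[det x = 1] (mod int p)" using SL2_mod_det[OF that] cong_dvd_modulus by blast
    qed (auto intro!: sum_nonneg wt_nonneg)
    finally show ?thesis by simp
  qed
  have "(\<Sum>x\<in>W. \<Sum>y\<in>W. ?K x y) \<le> ?L * sqrt (real (coll (D * m) W)) * sqrt (real (coll (D * m) W))"
  proof (rule bilinear_coll_bound)
    show "0 < D * m" using pos by simp
    show "0 \<le> ?K x y" for x y using wt_nonneg by simp
    have per: "periodic (D * m) (\<lambda>y. of_bool (mat_cong D y h) * wt m u x y)" for h x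
      using periodic_dvd[OF per1, of "D * m" h] periodic_dvd[OF periodic_wt[OF sf(2)], of "D * m" u x]
      by (simp add: periodic_def)
    show "periodic (D * m) (?K x)" for x by (rule per)
    show "periodic (D * m) (\<lambda>x. ?K x y)" for y
      unfolding swap wt_commute[of m u _ y] by (rule per)
    show "(\<Sum>y\<in>SL2_mod (D * m). ?K x y) \<le> ?L" if "x \<in> SL2_mod (D * m)" for x by (rule row[OF that])
    show "(\<Sum>x\<in>SL2_mod (D * m). ?K x y) \<le> ?L" if "y \<in> SL2_mod (D * m)" for y
      unfolding swap wt_commute[of m u _ y] by (rule row[OF that])
  qed (use W in auto)
  then show ?thesis by (simp add: mult.assoc)
qed

lemma plain_collisions_le:
  assumes sf: "squarefree m" and u: "nzs m u" and W: "finite W" "\<And>x. x \<in> W \<Longrightarrow> det x = 1"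
  shows "(\<Sum>x\<in>W. \<Sum>y\<in>W. wt m u x y) \<le> 2 ^ \<omega> m * real m ^ 2 * real (coll m W)"
  using twisted_collisions_le[of 1 m u W "mat 1"] assms by (simp add: mat_cong_def)

text \<open>Exact orthogonality over a middle factor \<open>g\<close> running through the group modulo \<open>D m\<close>.\<close>

lemma middle_sum_le:
  assumes sf: "squarefree D" "squarefree m" "coprime D m" and uv: "nzs m u" "nzs m v"
    and x: "det x1 = 1" "det x3 = 1" and y: "det y1 = 1" "det y3 = 1" and h: "[det h = 1] (mod int D)"
  shows "\<bar>\<Sum>g\<in>SL2_mod (D * m).
      (of_bool (mat_cong D (x1 ** g ** x3) h) * oscp m u v (x1 ** g ** x3)) *
      (of_bool (mat_cong D (y1 ** g ** y3) h) * oscp m u v (y1 ** g ** y3))\<bar>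
    \<le> real m ^ 2 * (wt m u x3 y3 *
        (of_bool (mat_cong D (adj2 y1) (adj2 x1 ** adj2 (h ** adj2 y3 ** x3 ** adj2 h))) * wt m v (adj2 x1) (adj2 y1)))"
    (is "\<bar>?S\<bar> \<le> _")
proof -
  let ?k = "h ** adj2 y3 ** x3 ** adj2 h"
  let ?c = "\<lambda>g. of_bool (mat_cong D (x1 ** g ** x3) h) * of_bool (mat_cong D (y1 ** g ** y3) h) :: real"
  let ?e = "\<lambda>p g. par0 p (x1 ** g ** x3 *v u p) (v p) * par0 p (y1 ** g ** y3 *v u p) (v p)"
  have pos: "D > 0" "m > 0" using sf squarefree_pos by auto
  have "?S = (\<Sum>g\<in>SL2_mod (D * m). ?c g * (\<Prod>p\<in>prime_factors m. ?e p g))"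
    by (intro sum.cong refl) (simp add: oscp_def prod.distrib mult_ac)
  also have "\<dots> = (\<Sum>g\<in>SL2_mod D. ?c g) * (\<Sum>g\<in>SL2_mod m. \<Prod>p\<in>prime_factors m. ?e p g)"
  proof (rule sum_SL2_mult[OF sf(3) pos])
    show "periodic D ?c" using periodic_mat_cong[of D x1 x3 h] periodic_mat_cong[of D y1 y3 h] by (simp add: periodic_def)
    have per: "periodic p (?e p)" for p
      using periodic_shift[OF periodic_par0[of p "u p" "v p"], of x1 x3] periodic_shift[OF periodic_par0[of p "u p" "v p"], of y1 y3]
      by (simp add: periodic_def)
    show "periodic m (\<lambda>g. \<Prod>p\<in>prime_factors m. ?e p g)" by (rule periodic_prime_factors[OF sf(2) per])
  qed
  also have "(\<Sum>g\<in>SL2_mod m. \<Prod>p\<in>prime_factors m. ?e p g) = (\<Prod>p\<in>prime_factors m. \<Sum>g\<in>SL2_mod p. ?e p g)"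
  proof (rule sum_SL2_squarefree[OF sf(2)])
    fix p
    show "periodic p (?e p)"
      using periodic_shift[OF periodic_par0[of p "u p" "v p"], of x1 x3] periodic_shift[OF periodic_par0[of p "u p" "v p"], of y1 y3]
      by (simp add: periodic_def)
  qed
  also have "\<dots> = (\<Prod>p\<in>prime_factors m. (real p ^ 2 - 1) *
      (par0 p (x3 *v u p) (y3 *v u p) * par0 p (adj2 x1 *v v p) (adj2 y1 *v v p)))"
  proof (rule prod.cong[OF refl])
    fix p assume p: "p \<in> prime_factors m"
    have nz: "nz p (x3 *v u p)" "nz p (y3 *v u p)" "nz p (adj2 x1 *v v p)" "nz p (adj2 y1 *v v p)"
      using uv p x y by (auto simp: nzs_def intro!: nz_mult)
    have e: "?e p g = par0 p (g *v (x3 *v u p)) (adj2 x1 *v v p) * par0 p (g *v (y3 *v u p)) (adj2 y1 *v v p)" for g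
      by (simp only: par0_mult_both)
    show "(\<Sum>g\<in>SL2_mod p. ?e p g) = (real p ^ 2 - 1) *
      (par0 p (x3 *v u p) (y3 *v u p) * par0 p (adj2 x1 *v v p) (adj2 y1 *v v p))"
      unfolding e using p nz by (intro sum_par0_par0) auto
  qed
  finally have S: "\<bar>?S\<bar> = (\<Sum>g\<in>SL2_mod D. ?c g) * (\<Prod>p\<in>prime_factors m. \<bar>(real p ^ 2 - 1) *
      (par0 p (x3 *v u p) (y3 *v u p) * par0 p (adj2 x1 *v v p) (adj2 y1 *v v p))\<bar>)"
    by (simp add: abs_mult abs_prod sum_nonneg)
  \<comment> \<open>The first congruence determines g modulo D; substituted into the second, it
    forces y1 to be h y3^(-1) x3 h^(-1) x1.\<close>
  have c: "(\<Sum>g\<in>SL2_mod D. ?c g) \<le> of_bool (mat_cong D y1 (?k ** x1))"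
  proof (cases "mat_cong D y1 (?k ** x1)")
    case True
    have "(\<Sum>g\<in>SL2_mod D. ?c g) \<le> (\<Sum>g\<in>SL2_mod D. of_bool (mat_cong D g (adj2 x1 ** h ** adj2 x3)))"
    proof (rule sum_mono)
      fix g
      have "mat_cong D g (adj2 x1 ** h ** adj2 x3)" if "mat_cong D (x1 ** g ** x3) h"
      proof -
        have "mat_cong D (adj2 x1 ** (x1 ** g ** x3) ** adj2 x3) (adj2 x1 ** h ** adj2 x3)"
          using that by (intro mat_cong_mult) auto
        moreover have "adj2 x1 ** (x1 ** g ** x3) ** adj2 x3 = g"
          using adj2_left[OF x(1)] adj2_right[OF x(2)] by (metis matrix_mul_assoc matrix_mul_lid matrix_mul_rid)
        ultimately show ?thesis by simp
      qed
      then show "?c g \<le> of_bool (mat_cong D g (adj2 x1 ** h ** adj2 x3))" by (auto simp: of_bool_def)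
    qed
    also have "\<dots> \<le> 1" by (rule sum_mat_cong_le_1)
    finally show ?thesis using True by simp
  next
    case False
    have "?c g = 0" if "g \<in> SL2_mod D" for g
    proof (rule ccontr)
      assume "?c g \<noteq> 0"
      then have 1: "mat_cong D (x1 ** g ** x3) h" and 2: "mat_cong D (y1 ** g ** y3) h" by (auto simp: of_bool_def split: if_splits)
      have "mat_cong D (adj2 (x1 ** g ** x3)) (adj2 h)" by (rule mat_cong_adj2[OF 1])
      then have "mat_cong D (y1 ** g ** y3 ** adj2 y3 ** x3 ** adj2 (x1 ** g ** x3) ** x1) (h ** adj2 y3 ** x3 ** adj2 h ** x1)"
        using 2 by (intro mat_cong_mult mat_cong_refl)
      moreover have "y1 ** g ** y3 ** adj2 y3 ** x3 ** adj2 (x1 ** g ** x3) ** x1 = y1 ** g ** adj2 g"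
      proof -
        have "y1 ** g ** y3 ** adj2 y3 ** x3 ** adj2 (x1 ** g ** x3) ** x1
            = y1 ** g ** (y3 ** adj2 y3) ** (x3 ** adj2 x3) ** adj2 g ** (adj2 x1 ** x1)"
          unfolding adj2_mult by (simp only: matrix_mul_assoc)
        then show ?thesis using adj2_right[OF x(2)] adj2_left[OF x(1)] adj2_right[OF y(2)] by simp
      qed
      moreover have "mat_cong D (y1 ** g ** adj2 g) y1" by (rule mat_cong_adj2_right[OF SL2_mod_det[OF that]])
      ultimately have "mat_cong D y1 (?k ** x1)" using mat_cong_trans mat_cong_sym by metis
      then show False using False by simp
    qed
    then show ?thesis by simp
  qed
  have "(\<Prod>p\<in>prime_factors m. \<bar>(real p ^ 2 - 1) *
      (par0 p (x3 *v u p) (y3 *v u p) * par0 p (adj2 x1 *v v p) (adj2 y1 *v v p))\<bar>)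
    = (\<Prod>p\<in>prime_factors m. \<bar>real p ^ 2 - 1\<bar>) *
      ((\<Prod>p\<in>prime_factors m. \<bar>par0 p (x3 *v u p) (y3 *v u p)\<bar>) *
       (\<Prod>p\<in>prime_factors m. \<bar>par0 p (adj2 x1 *v v p) (adj2 y1 *v v p)\<bar>))"
    by (simp only: abs_mult prod.distrib)
  also have "\<dots> \<le> real m ^ 2 * (wt m u x3 y3 * wt m v (adj2 x1) (adj2 y1))"
  proof (intro mult_mono)
    show "(\<Prod>p\<in>prime_factors m. \<bar>real p ^ 2 - 1\<bar>) \<le> real m ^ 2"
    proof (rule prod_prime_factors_le[OF sf(2)])
      fix p :: nat assume "prime p"
      then have "real p ^ 2 \<ge> 1" using prime_ge_1_nat[of p] by simp
      then show "0 \<le> \<bar>real p ^ 2 - 1\<bar> \<and> \<bar>real p ^ 2 - 1\<bar> \<le> real p ^ 2" by simp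
    qed
    show "(\<Prod>p\<in>prime_factors m. \<bar>par0 p (x3 *v u p) (y3 *v u p)\<bar>) \<le> wt m u x3 y3"
      "(\<Prod>p\<in>prime_factors m. \<bar>par0 p (adj2 x1 *v v p) (adj2 y1 *v v p)\<bar>) \<le> wt m v (adj2 x1) (adj2 y1)"
      unfolding wt_def by (intro prod_mono conjI par0_abs_le abs_ge_zero)+
  qed (auto intro!: prod_nonneg mult_nonneg_nonneg wt_nonneg)
  finally have *: "(\<Prod>p\<in>prime_factors m. \<bar>(real p ^ 2 - 1) *
      (par0 p (x3 *v u p) (y3 *v u p) * par0 p (adj2 x1 *v v p) (adj2 y1 *v v p))\<bar>)
    \<le> real m ^ 2 * (wt m u x3 y3 * wt m v (adj2 x1) (adj2 y1))" .
  have "\<bar>?S\<bar> \<le> of_bool (mat_cong D y1 (?k ** x1)) * (real m ^ 2 * (wt m u x3 y3 * wt m v (adj2 x1) (adj2 y1)))"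
    unfolding S by (intro mult_mono c *) (auto intro!: prod_nonneg)
  \<comment> \<open>Taking adjugates puts the twist on the right, the shape of
    \<open>twisted_collisions_le\<close>, and matches the weight in \<open>adj2 x1\<close> and
    \<open>adj2 y1\<close>.\<close>
  moreover have "mat_cong D y1 (?k ** x1) \<longleftrightarrow> mat_cong D (adj2 y1) (adj2 x1 ** adj2 ?k)"
    by (simp only: adj2_mult[of ?k x1, symmetric] mat_cong_adj2_iff)
  ultimately show ?thesis by (simp add: mult_ac)
qed

section \<open>Sums over triple products\<close>

lemma inj_adj2: "inj_on adj2 A"
  by (rule inj_on_inverseI[where g = adj2]) simp

lemma coll_adj2: "coll r (adj2 ` A) = coll r A"
proof -
  have "{(x, y). x \<in> adj2 ` A \<and> y \<in> adj2 ` A \<and> mat_cong r x y}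
      = (\<lambda>(x, y). (adj2 x, adj2 y)) ` {(x, y). x \<in> A \<and> y \<in> A \<and> mat_cong r x y}"
    by (auto simp: image_iff mat_cong_adj2_iff)
  moreover have "inj_on (\<lambda>(x, y). (adj2 x, adj2 y)) X" for X
    by (rule inj_on_inverseI[where g = "\<lambda>(x, y). (adj2 x, adj2 y)"]) auto
  ultimately show ?thesis by (simp add: coll_def card_image)
qed

text \<open>Cauchy--Schwarz over the residue class of the middle factor replaces it by a full group
  average at the price of one collision count. Opening the square, \<open>middle_sum_le\<close>
  decouples the outer factors: the pair (x1, y1) gives a twisted collision sum modulo D m, the pair
  (x3, y3) a plain one modulo m.\<close>

lemma triple_sum_le:
  assumes sf: "squarefree D" "squarefree m" "coprime D m" and uv: "nzs m u" "nzs m v"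
    and h: "[det h = 1] (mod int D)" and W: "finite W" "\<And>x. x \<in> W \<Longrightarrow> det x = 1"
  shows "(\<Sum>x1\<in>W. \<Sum>x2\<in>W. \<Sum>x3\<in>W. of_bool (mat_cong D (x1 ** x2 ** x3) h) * oscp m u v (x1 ** x2 ** x3))\<^sup>2
    \<le> real (coll (D * m) W) * (real m ^ 2 * ((2 ^ \<omega> m * real m ^ 2 * real (coll (D * m) W))
        * (2 ^ \<omega> m * real m ^ 2 * real (coll m W))))"
proof -
  let ?N = "D * m" and ?L = "2 ^ \<omega> m * real m ^ 2"
  let ?f = "\<lambda>x1 x3 g. of_bool (mat_cong D (x1 ** g ** x3) h) * oscp m u v (x1 ** g ** x3)"
  define F where "F g = (\<Sum>x\<in>W \<times> W. ?f (fst x) (snd x) g)" for g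
  have pos: "D > 0" "m > 0" using sf squarefree_pos by auto
  have perf: "periodic ?N (?f x1 x3)" for x1 x3
    using periodic_dvd[OF periodic_mat_cong[of D x1 x3 h], of ?N]
      periodic_dvd[OF periodic_shift[OF periodic_oscp[OF sf(2), of u v], of x1 x3], of ?N]
    by (simp add: periodic_def)
  then have perF: "periodic ?N F" unfolding F_def periodic_def by (auto intro!: sum.cong)
  have "(\<Sum>x1\<in>W. \<Sum>x2\<in>W. \<Sum>x3\<in>W. ?f x1 x3 x2) = (\<Sum>x2\<in>W. \<Sum>x1\<in>W. \<Sum>x3\<in>W. ?f x1 x3 x2)"
    by (rule sum.swap)
  also have "\<dots> = (\<Sum>x2\<in>W. F x2)" unfolding F_def by (simp add: sum.cartesian_product')
  also have "\<dots> = (\<Sum>g\<in>SL2_mod ?N. real (card {x\<in>W. red ?N x = g}) * F g)"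
    using pos by (intro sum_by_residue W perF) auto
  finally have "(\<Sum>x1\<in>W. \<Sum>x2\<in>W. \<Sum>x3\<in>W. ?f x1 x3 x2)\<^sup>2
      \<le> (\<Sum>g\<in>SL2_mod ?N. (real (card {x\<in>W. red ?N x = g}))\<^sup>2) * (\<Sum>g\<in>SL2_mod ?N. (F g)\<^sup>2)"
    by (simp only: Cauchy_Schwarz_ineq_sum)
  also have "(\<Sum>g\<in>SL2_mod ?N. (real (card {x\<in>W. red ?N x = g}))\<^sup>2) = real (coll ?N W)"
    using pos by (intro coll_eq_sum[symmetric] W) auto
  also have "(\<Sum>g\<in>SL2_mod ?N. (F g)\<^sup>2) \<le> real m ^ 2 * ((?L * real (coll ?N W)) * (?L * real (coll m W)))"
  proof -
    let ?k = "\<lambda>x3 y3. adj2 (h ** adj2 y3 ** x3 ** adj2 h)"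
    let ?w = "\<lambda>x1 x3 y1 y3. wt m u x3 y3 * (of_bool (mat_cong D (adj2 y1) (adj2 x1 ** ?k x3 y3)) * wt m v (adj2 x1) (adj2 y1))"
    have "(\<Sum>g\<in>SL2_mod ?N. (F g)\<^sup>2)
        = (\<Sum>g\<in>SL2_mod ?N. \<Sum>x\<in>W \<times> W. \<Sum>y\<in>W \<times> W. ?f (fst x) (snd x) g * ?f (fst y) (snd y) g)"
      unfolding F_def power2_eq_square sum_product ..
    also have "\<dots> = (\<Sum>x\<in>W \<times> W. \<Sum>g\<in>SL2_mod ?N. \<Sum>y\<in>W \<times> W. ?f (fst x) (snd x) g * ?f (fst y) (snd y) g)"
      by (rule sum.swap)
    also have "\<dots> = (\<Sum>x\<in>W \<times> W. \<Sum>y\<in>W \<times> W. \<Sum>g\<in>SL2_mod ?N. ?f (fst x) (snd x) g * ?f (fst y) (snd y) g)"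
      by (intro sum.cong refl sum.swap)
    also have "\<dots> \<le> (\<Sum>x\<in>W \<times> W. \<Sum>y\<in>W \<times> W. real m ^ 2 * ?w (fst x) (snd x) (fst y) (snd y))"
    proof (intro sum_mono)
      fix x y assume "x \<in> W \<times> W" "y \<in> W \<times> W"
      then have "det (fst x) = 1" "det (snd x) = 1" "det (fst y) = 1" "det (snd y) = 1" using W(2) by auto
      from middle_sum_le[OF sf uv this h]
      show "(\<Sum>g\<in>SL2_mod ?N. ?f (fst x) (snd x) g * ?f (fst y) (snd y) g) \<le> real m ^ 2 * ?w (fst x) (snd x) (fst y) (snd y)"
        by (rule order_trans[OF abs_ge_self])
    qed
    also have "\<dots> = real m ^ 2 * (\<Sum>x\<in>W \<times> W. \<Sum>y\<in>W \<times> W. ?w (fst x) (snd x) (fst y) (snd y))"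
      by (simp only: sum_distrib_left)
    also have "(\<Sum>x\<in>W \<times> W. \<Sum>y\<in>W \<times> W. ?w (fst x) (snd x) (fst y) (snd y))
        = (\<Sum>x1\<in>W. \<Sum>x3\<in>W. \<Sum>y1\<in>W. \<Sum>y3\<in>W. ?w x1 x3 y1 y3)"
      by (simp only: sum.cartesian_product' fst_conv snd_conv)
    also have "\<dots> = (\<Sum>x3\<in>W. \<Sum>x1\<in>W. \<Sum>y1\<in>W. \<Sum>y3\<in>W. ?w x1 x3 y1 y3)" by (rule sum.swap)
    also have "\<dots> = (\<Sum>x3\<in>W. \<Sum>x1\<in>W. \<Sum>y3\<in>W. \<Sum>y1\<in>W. ?w x1 x3 y1 y3)"
      by (intro sum.cong refl sum.swap)
    also have "\<dots> = (\<Sum>x3\<in>W. \<Sum>y3\<in>W. \<Sum>x1\<in>W. \<Sum>y1\<in>W. ?w x1 x3 y1 y3)"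
      by (intro sum.cong refl sum.swap)
    also have "\<dots> = (\<Sum>x3\<in>W. \<Sum>y3\<in>W. wt m u x3 y3 *
        (\<Sum>x1\<in>W. \<Sum>y1\<in>W. of_bool (mat_cong D (adj2 y1) (adj2 x1 ** ?k x3 y3)) * wt m v (adj2 x1) (adj2 y1)))"
      by (simp only: sum_distrib_left)
    also have "\<dots> \<le> (\<Sum>x3\<in>W. \<Sum>y3\<in>W. wt m u x3 y3 * (?L * real (coll ?N W)))"
    proof (intro sum_mono mult_left_mono wt_nonneg)
      fix x3 y3 assume "x3 \<in> W" "y3 \<in> W"
      then have "det x3 = 1" "det y3 = 1" using W(2) by auto
      then have k: "[det (?k x3 y3) = 1] (mod int D)" using cong_mult[OF h h] by (simp add: det_mul)
      have "(\<Sum>x1\<in>W. \<Sum>y1\<in>W. of_bool (mat_cong D (adj2 y1) (adj2 x1 ** ?k x3 y3)) * wt m v (adj2 x1) (adj2 y1))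
          = (\<Sum>x\<in>adj2 ` W. \<Sum>y\<in>adj2 ` W. of_bool (mat_cong D y (x ** ?k x3 y3)) * wt m v x y)"
        by (simp add: sum.reindex[OF inj_adj2] o_def)
      also have "\<dots> \<le> ?L * real (coll ?N (adj2 ` W))"
        by (rule twisted_collisions_le[OF sf uv(2) _ _ k]) (use W in auto)
      finally show "(\<Sum>x1\<in>W. \<Sum>y1\<in>W. of_bool (mat_cong D (adj2 y1) (adj2 x1 ** ?k x3 y3)) * wt m v (adj2 x1) (adj2 y1))
          \<le> ?L * real (coll ?N W)" unfolding coll_adj2 .
    qed
    also have "\<dots> = (?L * real (coll ?N W)) * (\<Sum>x3\<in>W. \<Sum>y3\<in>W. wt m u x3 y3)"
      by (simp only: sum_distrib_right[symmetric] mult.commute)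
    also have "\<dots> \<le> (?L * real (coll ?N W)) * (?L * real (coll m W))"
      by (intro mult_left_mono plain_collisions_le sf uv W) auto
    finally show ?thesis by (simp add: mult_left_mono)
  qed
  finally show ?thesis by (simp add: mult_left_mono)
qed

section \<open>Correlation of two moduli\<close>

lemma residue_expand:
  fixes e :: "int^2^2 \<Rightarrow> real"
  assumes D: "D > 0" and x: "[det x = 1] (mod int D)" and e: "periodic D e"
  shows "e x = (\<Sum>h\<in>SL2_mod D. of_bool (mat_cong D x h) * e h)"
proof -
  have r: "red D x \<in> SL2_mod D" by (rule red_in_SL2[OF D x])
  have "(\<Sum>h\<in>SL2_mod D. of_bool (mat_cong D x h) * e h) = (\<Sum>h\<in>SL2_mod D. if h = red D x then e h else 0)"
  proof (rule sum.cong[OF refl])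
    fix h assume h: "h \<in> SL2_mod D"
    have "mat_cong D x h \<longleftrightarrow> h = red D x" using red_id[OF h] red_eq_iff[of D x h] by auto
    then show "of_bool (mat_cong D x h) * e h = (if h = red D x then e h else 0)" by simp
  qed
  also have "\<dots> = e (red D x)" using r by simp
  finally show ?thesis using periodic_red[OF e] by simp
qed

lemma oscp_abs_sum_le:
  assumes sf: "squarefree D" and uv: "nzs D u" "nzs D v"
  shows "(\<Sum>g\<in>SL2_mod D. \<bar>oscp D u v g\<bar>) \<le> 2 ^ \<omega> D * real D ^ 2"
proof -
  have "(\<Sum>g\<in>SL2_mod D. \<bar>oscp D u v g\<bar>) \<le> (\<Sum>g\<in>SL2_mod D. \<Prod>p\<in>prime_factors D. par p (g *v u p) (v p) + 1 / (real p + 1))"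
    unfolding oscp_def abs_prod by (intro sum_mono prod_mono conjI par0_abs_le abs_ge_zero)
  also have "\<dots> = (\<Prod>p\<in>prime_factors D. \<Sum>g\<in>SL2_mod p. par p (g *v u p) (v p) + 1 / (real p + 1))"
  proof (rule sum_SL2_squarefree[OF sf])
    fix p
    show "periodic p (\<lambda>g. par p (g *v u p) (v p) + 1 / (real p + 1))"
      using periodic_par[of p "u p" "v p"] by (simp add: periodic_def)
  qed
  also have "\<dots> = (\<Prod>p\<in>prime_factors D. 2 * (real p * (real p - 1)))"
    using uv by (intro prod.cong refl sum_par_weight) (auto simp: nzs_def)
  also have "\<dots> = 2 ^ \<omega> D * (\<Prod>p\<in>prime_factors D. real p * (real p - 1))"
    by (simp add: prod.distrib)
  also have "\<dots> \<le> 2 ^ \<omega> D * real D ^ 2"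
  proof (rule mult_left_mono[OF prod_prime_factors_le[OF sf]])
    fix p :: nat assume "prime p"
    then show "0 \<le> real p * (real p - 1) \<and> real p * (real p - 1) \<le> real p ^ 2"
      using prime_ge_1_nat[of p] by (auto simp: power2_eq_square algebra_simps)
  qed simp
  finally show ?thesis .
qed

text \<open>Opening the square gives a kernel in (z, z') whose row sums factor, by translation
  invariance, into two L1 norms of \<open>oscp\<close>. This treats the common modulus D, where only
  absolute values are used.\<close>

lemma sum_square_oscp_le:
  assumes sf: "squarefree D" and uv: "nzs D u" "nzs D v" and a: "det a = 1"
    and B: "finite B" "\<And>z. z \<in> B \<Longrightarrow> det z = 1"
  shows "(\<Sum>h\<in>SL2_mod D. (\<Sum>z\<in>B. \<bar>oscp D u v (h ** a ** z)\<bar>)\<^sup>2)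
    \<le> (2 ^ \<omega> D * real D ^ 2)\<^sup>2 * real (coll D B)"
proof -
  let ?L = "2 ^ \<omega> D * real D ^ 2"
  let ?e = "\<lambda>g. \<bar>oscp D u v g\<bar>"
  have pos: "D > 0" using sf squarefree_pos by auto
  have per: "periodic D ?e" using periodic_oscp[OF sf, of u v] by (simp add: periodic_def)
  define K where "K z z' = (\<Sum>h\<in>SL2_mod D. ?e (h ** a ** z) * ?e (h ** a ** z'))" for z z'
  have Kc: "K z z' = K z' z" for z z' unfolding K_def by (simp only: mult.commute)
  have perK: "periodic D (K z)" for z
    unfolding K_def periodic_def
  proof (intro allI impI sum.cong refl)
    fix g h k assume "mat_cong D g h"
    then have "mat_cong D (k ** a ** g) (k ** a ** h)" by (intro mat_cong_mult) auto
    then show "?e (k ** a ** z) * ?e (k ** a ** g) = ?e (k ** a ** z) * ?e (k ** a ** h)"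
      using periodicD[OF per] by simp
  qed
  have row: "(\<Sum>z'\<in>SL2_mod D. K z z') \<le> ?L\<^sup>2" if z: "z \<in> SL2_mod D" for z
  proof -
    have "(\<Sum>z'\<in>SL2_mod D. K z z') = (\<Sum>h\<in>SL2_mod D. \<Sum>z'\<in>SL2_mod D. ?e (h ** a ** z) * ?e (h ** a ** z'))"
      unfolding K_def by (rule sum.swap)
    also have "\<dots> = (\<Sum>h\<in>SL2_mod D. ?e (h ** a ** z) * (\<Sum>g\<in>SL2_mod D. ?e g))"
    proof (rule sum.cong[OF refl])
      fix h assume h: "h \<in> SL2_mod D"
      have "(\<Sum>z'\<in>SL2_mod D. ?e (h ** a ** z')) = (\<Sum>g\<in>SL2_mod D. ?e g)"
        using SL2_mod_det[OF h] a by (intro sum_SL2_left pos per) (simp add: det_mul)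
      then show "(\<Sum>z'\<in>SL2_mod D. ?e (h ** a ** z) * ?e (h ** a ** z')) = ?e (h ** a ** z) * (\<Sum>g\<in>SL2_mod D. ?e g)"
        by (simp only: sum_distrib_left[symmetric])
    qed
    also have "\<dots> = (\<Sum>h\<in>SL2_mod D. ?e (h ** (a ** z))) * (\<Sum>g\<in>SL2_mod D. ?e g)"
      by (simp only: sum_distrib_right[symmetric] matrix_mul_assoc)
    also have "(\<Sum>h\<in>SL2_mod D. ?e (h ** (a ** z))) = (\<Sum>g\<in>SL2_mod D. ?e g)"
      using SL2_mod_det[OF z] a by (intro sum_SL2_right pos per) (simp add: det_mul)
    also have "(\<Sum>g\<in>SL2_mod D. ?e g) * (\<Sum>g\<in>SL2_mod D. ?e g) \<le> ?L * ?L"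
      by (intro mult_mono oscp_abs_sum_le sf uv) (auto intro: sum_nonneg)
    finally show ?thesis by (simp add: power2_eq_square)
  qed
  have "(\<Sum>h\<in>SL2_mod D. (\<Sum>z\<in>B. ?e (h ** a ** z))\<^sup>2)
      = (\<Sum>h\<in>SL2_mod D. \<Sum>z\<in>B. \<Sum>z'\<in>B. ?e (h ** a ** z) * ?e (h ** a ** z'))"
    unfolding power2_eq_square sum_product ..
  also have "\<dots> = (\<Sum>z\<in>B. \<Sum>h\<in>SL2_mod D. \<Sum>z'\<in>B. ?e (h ** a ** z) * ?e (h ** a ** z'))" by (rule sum.swap)
  also have "\<dots> = (\<Sum>z\<in>B. \<Sum>z'\<in>B. K z z')" unfolding K_def by (intro sum.cong refl sum.swap)
  also have "\<dots> \<le> ?L\<^sup>2 * sqrt (real (coll D B)) * sqrt (real (coll D B))"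
  proof (rule bilinear_coll_bound[OF pos B B])
    show "0 \<le> K g h" for g h unfolding K_def by (intro sum_nonneg) auto
    show "periodic D (\<lambda>g. K g h)" for h unfolding Kc[of _ h] by (rule perK)
    show "(\<Sum>g\<in>SL2_mod D. K g h) \<le> ?L\<^sup>2" if "h \<in> SL2_mod D" for h unfolding Kc[of _ h] by (rule row[OF that])
  qed (use perK row in auto)
  finally show ?thesis by (simp add: mult.assoc)
qed

lemma oscp_coprime_mult:
  assumes "coprime s t" "s > 0" "t > 0"
  shows "oscp (s * t) u v g = oscp s u v g * oscp t u v g"
proof -
  have "prime_factors (s * t) = prime_factors s \<union> prime_factors t"
    using assms by (simp add: prime_factors_product)
  then show ?thesis unfolding oscp_def
    using coprime_prime_factors_disjoint[OF assms(1)] by (simp add: prod.union_disjoint)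
qed

lemma nzs_dvd: "nzs d u \<Longrightarrow> s dvd d \<Longrightarrow> d > 0 \<Longrightarrow> nzs s u"
  using dvd_prime_factors[of d s] unfolding nzs_def by auto

text \<open>At the common part D the two oscillations are correlated; x is frozen in a class h
  modulo D and absolute values are taken there. At a prime of t t' only one of the two incidences
  occurs, so these primes combine into a single oscillation in x, to which \<open>J\<close>
  applies.\<close>

lemma pair_sum_le:
  assumes sf: "squarefree D" "squarefree t" "squarefree t'"
    and cop: "coprime D t" "coprime D t'" "coprime t t'"
    and uv: "nzs (D * t) u" "nzs (D * t) v" "nzs (D * t') u'" "nzs (D * t') v'"
    and a: "det a = 1" and B: "finite B" "\<And>z. z \<in> B \<Longrightarrow> det z = 1" and W: "finite W" "\<And>x. x \<in> W \<Longrightarrow> det x = 1"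
    and J0: "0 \<le> J" and J: "\<And>u v h. nzs (t * t') u \<Longrightarrow> nzs (t * t') v \<Longrightarrow> [det h = 1] (mod int D) \<Longrightarrow>
      \<bar>\<Sum>x1\<in>W. \<Sum>x2\<in>W. \<Sum>x3\<in>W. of_bool (mat_cong D (x1 ** x2 ** x3) h) * oscp (t * t') u v (x1 ** x2 ** x3)\<bar> \<le> J"
  shows "\<bar>\<Sum>x1\<in>W. \<Sum>x2\<in>W. \<Sum>x3\<in>W. \<Sum>z\<in>B. \<Sum>z'\<in>B.
      oscp (D * t) u v (x1 ** x2 ** x3 ** a ** z) * oscp (D * t') u' v' (x1 ** x2 ** x3 ** a ** z')\<bar>
    \<le> J * ((2 ^ \<omega> D * real D ^ 2)\<^sup>2 * real (coll D B))"
proof -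
  have pos: "D > 0" "t > 0" "t' > 0" using sf squarefree_pos by auto
  define e where "e z z' h = oscp D u v (h ** a ** z) * oscp D u' v' (h ** a ** z')" for z z' h
  \<comment> \<open>The combined oscillation modulo t t' uses the lines of the first modulus at
    primes of t and those of the second at primes of t'; the factors a z and a z' are absorbed into
    the lines.\<close>
  define U where "U z z' p = (if p dvd t then (a ** z) *v u p else (a ** z') *v u' p)" for z z' p
  define V where "V p = (if p dvd t then v p else v' p)" for p
  define P where "P = W \<times> W \<times> W"
  define xx :: "(int^2^2) \<times> (int^2^2) \<times> (int^2^2) \<Rightarrow> int^2^2"
    where "xx = (\<lambda>(x1, x2, x3). x1 ** x2 ** x3)"
  have finP: "finite P" using W by (simp add: P_def)
  have triple: "(\<Sum>x1\<in>W. \<Sum>x2\<in>W. \<Sum>x3\<in>W. f (x1 ** x2 ** x3)) = (\<Sum>x\<in>P. f (xx x))" for f :: "int^2^2 \<Rightarrow> real"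
    by (simp add: P_def xx_def sum.cartesian_product' case_prod_unfold)
  have detx: "det (xx x) = 1" if "x \<in> P" for x
    using that W(2) by (auto simp: P_def xx_def det_mul)
  have notboth: "\<not> p dvd t" if "p \<in> prime_factors t'" for p
    using that cop(3) by (metis coprime_common_divisor in_prime_factors_iff not_prime_unit)
  have split: "oscp (D * t) u v (x ** a ** z) * oscp (D * t') u' v' (x ** a ** z') = e z z' x * oscp (t * t') (U z z') V x" for x z z'
  proof -
    have 1: "oscp t u v (x ** a ** z) = oscp t (U z z') V x"
      unfolding oscp_def by (rule prod.cong[OF refl])
        (simp add: U_def V_def matrix_vector_mul_assoc matrix_mul_assoc in_prime_factors_iff)
    have 2: "oscp t' u' v' (x ** a ** z') = oscp t' (U z z') V x"
      unfolding oscp_def by (rule prod.cong[OF refl])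
        (simp add: U_def V_def matrix_vector_mul_assoc matrix_mul_assoc notboth)
    show ?thesis unfolding e_def oscp_coprime_mult[OF cop(1) pos(1,2)] oscp_coprime_mult[OF cop(2) pos(1,3)]
      oscp_coprime_mult[OF cop(3) pos(2,3)] 1 2 by (simp only: mult_ac)
  qed
  have nzU: "nzs (t * t') (U z z')" "nzs (t * t') V" if "z \<in> B" "z' \<in> B" for z z'
  proof -
    have n: "nzs t u" "nzs t v" "nzs t' u'" "nzs t' v'"
      using uv pos by (auto elim!: nzs_dvd)
    have pf: "prime_factors (t * t') = prime_factors t \<union> prime_factors t'"
      using pos by (simp add: prime_factors_product)
    have "det (a ** z) = 1" "det (a ** z') = 1" using a B(2) that by (simp_all add: det_mul)
    then have n': "nzs t (\<lambda>p. (a ** z) *v u p)" "nzs t' (\<lambda>p. (a ** z') *v u' p)"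
      using n nzs_mult by blast+
    show "nzs (t * t') (U z z')" "nzs (t * t') V"
      using n n' notboth unfolding nzs_def pf U_def V_def by (auto simp: in_prime_factors_iff)
  qed
  have pere: "periodic D (e z z')" for z z'
    unfolding e_def using periodic_shift[OF periodic_oscp[OF sf(1), of u v], of "mat 1" "a ** z"]
      periodic_shift[OF periodic_oscp[OF sf(1), of u' v'], of "mat 1" "a ** z'"]
    by (simp add: periodic_def matrix_mul_assoc)
  have "(\<Sum>x1\<in>W. \<Sum>x2\<in>W. \<Sum>x3\<in>W. \<Sum>z\<in>B. \<Sum>z'\<in>B.
      oscp (D * t) u v (x1 ** x2 ** x3 ** a ** z) * oscp (D * t') u' v' (x1 ** x2 ** x3 ** a ** z'))
    = (\<Sum>x\<in>P. \<Sum>z\<in>B. \<Sum>z'\<in>B. e z z' (xx x) * oscp (t * t') (U z z') V (xx x))"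
    unfolding split by (rule triple)
  also have "\<dots> = (\<Sum>z\<in>B. \<Sum>x\<in>P. \<Sum>z'\<in>B. e z z' (xx x) * oscp (t * t') (U z z') V (xx x))"
    by (rule sum.swap)
  also have "\<dots> = (\<Sum>z\<in>B. \<Sum>z'\<in>B. \<Sum>x\<in>P. e z z' (xx x) * oscp (t * t') (U z z') V (xx x))"
    by (intro sum.cong refl sum.swap)
  also have "\<bar>\<dots>\<bar> \<le> (\<Sum>z\<in>B. \<Sum>z'\<in>B. \<Sum>h\<in>SL2_mod D. \<bar>e z z' h\<bar> * J)"
  proof (rule order_trans[OF sum_abs], rule sum_mono, rule order_trans[OF sum_abs], rule sum_mono)
    fix z z' assume z: "z \<in> B" "z' \<in> B"
    have "(\<Sum>x\<in>P. e z z' (xx x) * oscp (t * t') (U z z') V (xx x))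
        = (\<Sum>x\<in>P. (\<Sum>h\<in>SL2_mod D. of_bool (mat_cong D (xx x) h) * e z z' h) * oscp (t * t') (U z z') V (xx x))"
    proof (rule sum.cong[OF refl])
      fix x assume "x \<in> P"
      then have "e z z' (xx x) = (\<Sum>h\<in>SL2_mod D. of_bool (mat_cong D (xx x) h) * e z z' h)"
        using pos pere detx by (intro residue_expand) auto
      then show "e z z' (xx x) * oscp (t * t') (U z z') V (xx x)
        = (\<Sum>h\<in>SL2_mod D. of_bool (mat_cong D (xx x) h) * e z z' h) * oscp (t * t') (U z z') V (xx x)" by simp
    qed
    also have "\<dots> = (\<Sum>x\<in>P. \<Sum>h\<in>SL2_mod D. e z z' h * (of_bool (mat_cong D (xx x) h) * oscp (t * t') (U z z') V (xx x)))"
      unfolding sum_distrib_right by (intro sum.cong refl) (simp only: mult_ac)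
    also have "\<dots> = (\<Sum>h\<in>SL2_mod D. \<Sum>x\<in>P. e z z' h * (of_bool (mat_cong D (xx x) h) * oscp (t * t') (U z z') V (xx x)))"
      by (rule sum.swap)
    also have "\<dots> = (\<Sum>h\<in>SL2_mod D. e z z' h * (\<Sum>x\<in>P. of_bool (mat_cong D (xx x) h) * oscp (t * t') (U z z') V (xx x)))"
      by (simp only: sum_distrib_left)
    also have "\<bar>\<dots>\<bar> \<le> (\<Sum>h\<in>SL2_mod D. \<bar>e z z' h\<bar> * J)"
    proof (rule order_trans[OF sum_abs], rule sum_mono)
      fix h assume h: "h \<in> SL2_mod D"
      show "\<bar>e z z' h * (\<Sum>x\<in>P. of_bool (mat_cong D (xx x) h) * oscp (t * t') (U z z') V (xx x))\<bar> \<le> \<bar>e z z' h\<bar> * J"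
        unfolding abs_mult using J[OF nzU[OF z] SL2_mod_det[OF h]]
        unfolding triple[of "\<lambda>x. of_bool (mat_cong D x h) * oscp (t * t') (U z z') V x"]
        by (intro mult_left_mono) auto
    qed
    finally show "\<bar>\<Sum>x\<in>P. e z z' (xx x) * oscp (t * t') (U z z') V (xx x)\<bar> \<le> (\<Sum>h\<in>SL2_mod D. \<bar>e z z' h\<bar> * J)" .
  qed
  also have "\<dots> = (\<Sum>z\<in>B. \<Sum>z'\<in>B. \<Sum>h\<in>SL2_mod D. \<bar>e z z' h\<bar>) * J"
    by (simp only: sum_distrib_right)
  finally have main: "\<bar>\<Sum>x1\<in>W. \<Sum>x2\<in>W. \<Sum>x3\<in>W. \<Sum>z\<in>B. \<Sum>z'\<in>B.
      oscp (D * t) u v (x1 ** x2 ** x3 ** a ** z) * oscp (D * t') u' v' (x1 ** x2 ** x3 ** a ** z')\<bar>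
    \<le> (\<Sum>z\<in>B. \<Sum>z'\<in>B. \<Sum>h\<in>SL2_mod D. \<bar>e z z' h\<bar>) * J" .
  have "(\<Sum>z\<in>B. \<Sum>z'\<in>B. \<Sum>h\<in>SL2_mod D. \<bar>e z z' h\<bar>) = (\<Sum>z\<in>B. \<Sum>h\<in>SL2_mod D. \<Sum>z'\<in>B. \<bar>e z z' h\<bar>)"
    by (intro sum.cong refl sum.swap)
  also have "\<dots> = (\<Sum>h\<in>SL2_mod D. \<Sum>z\<in>B. \<Sum>z'\<in>B. \<bar>e z z' h\<bar>)" by (rule sum.swap)
  also have "\<dots> = (\<Sum>h\<in>SL2_mod D. (\<Sum>z\<in>B. \<bar>oscp D u v (h ** a ** z)\<bar>) * (\<Sum>z'\<in>B. \<bar>oscp D u' v' (h ** a ** z')\<bar>))"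
    by (simp only: e_def abs_mult sum_product)
  also have "\<dots> \<le> (2 ^ \<omega> D * real D ^ 2)\<^sup>2 * real (coll D B)"
  proof -
    let ?X = "(2 ^ \<omega> D * real D ^ 2)\<^sup>2 * real (coll D B)"
    let ?p = "\<lambda>h. \<Sum>z\<in>B. \<bar>oscp D u v (h ** a ** z)\<bar>" and ?q = "\<lambda>h. \<Sum>z\<in>B. \<bar>oscp D u' v' (h ** a ** z)\<bar>"
    have nD: "nzs D u" "nzs D v" "nzs D u'" "nzs D v'" using uv pos by (auto elim!: nzs_dvd)
    have "(\<Sum>h\<in>SL2_mod D. ?p h * ?q h)\<^sup>2 \<le> (\<Sum>h\<in>SL2_mod D. (?p h)\<^sup>2) * (\<Sum>h\<in>SL2_mod D. (?q h)\<^sup>2)"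
      by (rule Cauchy_Schwarz_ineq_sum)
    also have "\<dots> \<le> ?X * ?X"
      by (intro mult_mono sum_square_oscp_le sf nD a B) (auto intro: sum_nonneg)
    finally have "(\<Sum>h\<in>SL2_mod D. ?p h * ?q h)\<^sup>2 \<le> ?X\<^sup>2" by (simp add: power2_eq_square)
    then show ?thesis by (rule power2_le_imp_le) simp
  qed
  finally have "(\<Sum>z\<in>B. \<Sum>z'\<in>B. \<Sum>h\<in>SL2_mod D. \<bar>e z z' h\<bar>)
      \<le> (2 ^ \<omega> D * real D ^ 2)\<^sup>2 * real (coll D B)" .
  from order_trans[OF main mult_right_mono[OF this J0]] show ?thesis by (simp only: mult.commute)
qed

section \<open>Summation over pairs of moduli\<close>

abbreviation gcd_kernel :: "nat \<Rightarrow> nat \<Rightarrow> real" where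
  "gcd_kernel d d' \<equiv> 1 / (real (gcd d d') ^ 2 * sqrt (real ((d div gcd d d') * (d' div gcd d d'))) ^ 3)"

text \<open>A power 1/4 of d = D t, which is at least \<open>M0\<close>, is taken out. The exponents
  left, -7/4, -5/4 and -3/2, are all at most -5/4, hence summable over D, t and t'.\<close>

lemma gcd_sum_term:
  fixes D t t' M0 :: real
  assumes "M0 \<ge> 1" "D \<ge> 1" "t \<ge> 1" "t' \<ge> 1" "M0 \<le> D * t"
  shows "1 / (D ^ 2 * sqrt (t * t') ^ 3)
    \<le> M0 powr (- 1 / 4) * (D powr (- 5 / 4) * (t powr (- 5 / 4) * t' powr (- 5 / 4)))"
proof -
  have s: "sqrt x ^ 3 = x powr (3 / 2)" if "x > 0" for x :: real
  proof -
    have "sqrt x ^ 3 = (x powr (1 / 2)) powr 3" using that by (simp add: powr_half_sqrt)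
    then show ?thesis by (simp add: powr_powr)
  qed
  have 1: "1 / x powr a = x powr (- a)" for x a :: real by (simp add: powr_minus_divide)
  have "D ^ 2 * sqrt (t * t') ^ 3 = D powr 2 * (t powr (3 / 2) * t' powr (3 / 2))"
    using assms by (simp add: s powr_mult)
  then have "1 / (D ^ 2 * sqrt (t * t') ^ 3) = 1 / D powr 2 * (1 / t powr (3 / 2) * (1 / t' powr (3 / 2)))" by simp
  also have "\<dots> = D powr (- 2) * (t powr (- (3 / 2)) * t' powr (- (3 / 2)))" unfolding 1 ..
  also have "D powr (- 2) = D powr (- 1 / 4) * D powr (- 7 / 4)" by (simp flip: powr_add)
  also have "t powr (- (3 / 2)) = t powr (- 1 / 4) * t powr (- 5 / 4)" by (simp flip: powr_add)
  also have "D powr (- 1 / 4) * D powr (- 7 / 4) * (t powr (- 1 / 4) * t powr (- 5 / 4) * t' powr (- (3 / 2)))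
      = (D * t) powr (- 1 / 4) * (D powr (- 7 / 4) * (t powr (- 5 / 4) * t' powr (- (3 / 2))))"
    by (simp only: powr_mult mult_ac)
  also have "\<dots> \<le> M0 powr (- 1 / 4) * (D powr (- 5 / 4) * (t powr (- 5 / 4) * t' powr (- 5 / 4)))"
    using assms by (intro mult_mono powr_mono2' powr_mono) auto
  finally show ?thesis .
qed

lemma sum_triple_product:
  fixes f :: "nat \<Rightarrow> real"
  shows "(\<Sum>(a, b, c)\<in>A \<times> B \<times> C. f a * (f b * f c)) = sum f A * (sum f B * sum f C)"
proof -
  have "(\<Sum>(a, b, c)\<in>A \<times> B \<times> C. f a * (f b * f c)) = (\<Sum>a\<in>A. \<Sum>b\<in>B. \<Sum>c\<in>C. f a * (f b * f c))"
    by (simp add: sum.cartesian_product' case_prod_unfold)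
  also have "\<dots> = (\<Sum>a\<in>A. f a * (\<Sum>b\<in>B. f b * (\<Sum>c\<in>C. f c)))"
    by (simp only: sum_distrib_left)
  also have "\<dots> = sum f A * (sum f B * sum f C)"
    by (simp only: sum_distrib_right)
  finally show ?thesis .
qed

text \<open>A pair of moduli is recovered from its gcd and the two cofactors, so the double sum is
  dominated by a product of three convergent series.\<close>

lemma gcd_sum_le:
  obtains C :: real where "C \<ge> 1" and "\<And>M0 S. M0 \<ge> 1 \<Longrightarrow> finite S \<Longrightarrow> (\<And>d. d \<in> S \<Longrightarrow> d > 0 \<and> M0 \<le> real d) \<Longrightarrow>
    (\<Sum>d\<in>S. \<Sum>d'\<in>S. gcd_kernel d d')
      \<le> C * M0 powr (- 1 / 4)"
proof -
  let ?f = "\<lambda>n::nat. real n powr (- 5 / 4)"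
  have sm: "summable ?f" by (subst summable_real_powr_iff) simp
  define K where "K = max 1 (suminf ?f)"
  have K: "K \<ge> 1" "\<And>S. finite S \<Longrightarrow> sum ?f S \<le> K"
    using sum_le_suminf[OF sm] by (auto simp: K_def intro: order_trans[OF _ max.cobounded2])
  show thesis
  proof (rule that[of "K * (K * K)"])
    show "1 \<le> K * (K * K)" using K(1) mult_mono[of 1 K 1 "K * K"] mult_mono[of 1 K 1 K] by simp
    fix M0 :: real and S :: "nat set"
    assume M0: "M0 \<ge> 1" and S: "finite S" "\<And>d. d \<in> S \<Longrightarrow> d > 0 \<and> M0 \<le> real d"
    let ?k = "\<lambda>(d, d'). (gcd d d', d div gcd d d', d' div gcd d d')"
    let ?g = "\<lambda>(D, t, t'). ?f D * (?f t * ?f t')"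
    let ?I = "fst ` ?k ` (S \<times> S)" and ?I1 = "(fst \<circ> snd) ` ?k ` (S \<times> S)" and ?I2 = "(snd \<circ> snd) ` ?k ` (S \<times> S)"
    have "(\<Sum>d\<in>S. \<Sum>d'\<in>S. gcd_kernel d d')
      \<le> (\<Sum>d\<in>S. \<Sum>d'\<in>S. M0 powr (- 1 / 4) * ?g (?k (d, d')))"
    proof (intro sum_mono)
      fix d d' assume d: "d \<in> S" "d' \<in> S"
      define D t t' where "D = gcd d d'" and "t = d div D" and "t' = d' div D"
      have dt: "d = D * t" "d' = D * t'" by (simp_all add: D_def t_def t'_def)
      then have pos: "D > 0" "t > 0" "t' > 0" using S(2)[OF d(1)] S(2)[OF d(2)] by (metis mult_is_0 neq0_conv)+
      have M0t: "M0 \<le> real D * real t" using S(2)[OF d(1)] dt(1) by (metis of_nat_mult)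
      have "1 / (real D ^ 2 * sqrt (real (t * t')) ^ 3) \<le> M0 powr (- 1 / 4) * (?f D * (?f t * ?f t'))"
        using gcd_sum_term[OF M0 _ _ _ M0t, of "real t'"] pos by simp
      then show "gcd_kernel d d'
          \<le> M0 powr (- 1 / 4) * ?g (?k (d, d'))"
        by (simp add: D_def t_def t'_def)
    qed
    also have "\<dots> = M0 powr (- 1 / 4) * (\<Sum>x\<in>S \<times> S. ?g (?k x))"
      by (simp only: sum_distrib_left sum.cartesian_product' prod.collapse)
    also have "(\<Sum>x\<in>S \<times> S. ?g (?k x)) = (\<Sum>y\<in>?k ` (S \<times> S). ?g y)"
    proof (rule sum.reindex[symmetric, unfolded o_def])
      show "inj_on ?k (S \<times> S)"
      proof (rule inj_onI, clarify)
        fix a b c d :: nat assume h: "gcd a b = gcd c d" "a div gcd a b = c div gcd c d" "b div gcd a b = d div gcd c d"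
        show "a = c \<and> b = d"
          using h dvd_div_mult_self[OF gcd_dvd1[of a b]] dvd_div_mult_self[OF gcd_dvd1[of c d]]
            dvd_div_mult_self[OF gcd_dvd2[of a b]] dvd_div_mult_self[OF gcd_dvd2[of c d]] by simp
      qed
    qed
    also have "\<dots> \<le> (\<Sum>y\<in>?I \<times> ?I1 \<times> ?I2. ?g y)"
      using S(1) by (intro sum_mono2) (force simp: image_iff case_prod_unfold)+
    also have "\<dots> = sum ?f ?I * (sum ?f ?I1 * sum ?f ?I2)"
      by (rule sum_triple_product)
    finally show "(\<Sum>d\<in>S. \<Sum>d'\<in>S. gcd_kernel d d')
      \<le> K * (K * K) * M0 powr (- 1 / 4)"
    proof (rule order_trans)
      show "M0 powr (- 1 / 4) * (sum ?f ?I * (sum ?f ?I1 * sum ?f ?I2)) \<le> K * (K * K) * M0 powr (- 1 / 4)"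
        unfolding mult.commute[of "M0 powr _"]
        using S(1) K(1) by (intro mult_right_mono mult_mono K(2) mult_nonneg_nonneg sum_nonneg) auto
    qed (auto intro: mult_left_mono)
  qed
qed

lemma coll_mono:
  assumes "A \<subseteq> B" "finite B" shows "coll r A \<le> coll r B"
  unfolding coll_def
proof (rule card_mono)
  show "finite {(x, y). x \<in> B \<and> y \<in> B \<and> mat_cong r x y}"
    by (rule finite_subset[of _ "B \<times> B"]) (use assms in auto)
  show "{(x, y). x \<in> A \<and> y \<in> A \<and> mat_cong r x y} \<subseteq> {(x, y). x \<in> B \<and> y \<in> B \<and> mat_cong r x y}"
    using assms(1) by blast
qed

lemma squarefree_cofactor:
  assumes "squarefree (d::nat)" "g dvd d"
  shows "squarefree g" "squarefree (d div g)" "coprime g (d div g)"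
proof -
  have d: "d = g * (d div g)" using assms(2) by simp
  show "squarefree g" by (rule squarefree_mono[OF assms(2,1)])
  have "d div g dvd d" by (rule dvdI[of _ _ g]) (use assms(2) in simp)
  then show "squarefree (d div g)" using assms(1) by (rule squarefree_mono)
  show "coprime g (d div g)"
  proof (rule coprimeI)
    fix c assume "c dvd g" "c dvd d div g"
    then have "c * c dvd g * (d div g)" by (rule mult_dvd_mono)
    then have "c\<^sup>2 dvd d" using d by (simp add: power2_eq_square)
    then show "is_unit c" using assms(1) by (simp add: squarefree_def)
  qed
qed

lemma pair_identity1:
  fixes D m w b :: real
  assumes "D \<noteq> 0" "m \<noteq> 0"
  shows "(b / (D * m) ^ 3) * (m ^ 2 * ((w * m ^ 2 * (b / (D * m) ^ 3)) * (w * m ^ 2 * (b / m ^ 3))))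
    = (w * w) * b ^ 3 / (D ^ 6 * m ^ 3)"
proof -
  have "(D * m) ^ 3 * ((D * m) ^ 3 * m ^ 3) = (m ^ 2 * (m ^ 2 * m ^ 2)) * (D ^ 6 * m ^ 3)"
    by (simp add: power_mult_distrib mult_ac flip: power_add)
  moreover have "(b / (D * m) ^ 3) * (m ^ 2 * ((w * m ^ 2 * (b / (D * m) ^ 3)) * (w * m ^ 2 * (b / m ^ 3))))
     = ((m ^ 2 * (m ^ 2 * m ^ 2)) * ((w * w) * b ^ 3)) / ((D * m) ^ 3 * ((D * m) ^ 3 * m ^ 3))"
    by (simp add: power3_eq_cube)
  ultimately show ?thesis using assms by simp
qed

lemma pair_identity2:
  fixes D m s o' b :: real
  assumes "D \<noteq> 0"
  shows "s / (D ^ 3 * m) * ((o' * D ^ 4) * (b / D ^ 3)) = (s * o' * b) * (1 / (D ^ 2 * m))"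
proof -
  have e: "D ^ 3 * D ^ 3 = D ^ 4 * D ^ 2" by (simp flip: power_add)
  have D4: "D ^ 4 \<noteq> 0" using assms by simp
  have "s / (D ^ 3 * m) * ((o' * D ^ 4) * (b / D ^ 3)) = (D ^ 4 * (s * o' * b)) / ((D ^ 3 * D ^ 3) * m)"
    by (simp only: times_divide_eq_left times_divide_eq_right divide_divide_eq_left mult_ac)
  also have "\<dots> = (D ^ 4 * (s * o' * b)) / (D ^ 4 * (D ^ 2 * m))" unfolding e by (simp only: mult.assoc)
  also have "\<dots> = (s * o' * b) / (D ^ 2 * m)" by (rule nonzero_mult_divide_mult_cancel_left[OF D4])
  finally show ?thesis by simp
qed

text \<open>In the weight \<open>gcd_kernel\<close>, the cofactor modulus m = t t' has exponent -3/2
  from the oscillation in x. At the gcd, the congruence in \<open>J\<close> gives D^(-3), the L1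
  norms of \<open>oscp\<close> give D^4 and the collisions in \<open>B\<close> another D^(-3),
  together D^(-2).\<close>

lemma sieve_pair_le:
  fixes BM BZ Om :: real
  assumes d: "squarefree d" "squarefree d'" and uv: "nzs d u" "nzs d v" "nzs d' u'" "nzs d' v'"
    and a: "det a = 1" and B: "finite B" "\<And>z. z \<in> B \<Longrightarrow> det z = 1" and W: "finite W" "\<And>x. x \<in> W \<Longrightarrow> det x = 1"
    and pos: "BM \<ge> 0" "BZ \<ge> 0" "Om \<ge> 0"
    and BM: "\<And>r. r \<ge> 1 \<Longrightarrow> r \<le> d * d' \<Longrightarrow> real (coll r W) \<le> BM / real r ^ 3"
    and BZ: "\<And>r. r \<ge> 1 \<Longrightarrow> r \<le> d \<Longrightarrow> real (coll r B) \<le> BZ / real r ^ 3"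
    and Om: "\<And>n. n \<ge> 1 \<Longrightarrow> n \<le> d * d' \<Longrightarrow> 4 ^ \<omega> n \<le> Om"
  shows "\<bar>\<Sum>x1\<in>W. \<Sum>x2\<in>W. \<Sum>x3\<in>W. \<Sum>z\<in>B. \<Sum>z'\<in>B.
      oscp d u v (x1 ** x2 ** x3 ** a ** z) * oscp d' u' v' (x1 ** x2 ** x3 ** a ** z')\<bar>
    \<le> (sqrt (Om * BM ^ 3) * Om * BZ) *
      gcd_kernel d d'"
proof -
  define D t t' where "D = gcd d d'" and "t = d div D" and "t' = d' div D"
  define m where "m = t * t'"
  have dpos: "d > 0" "d' > 0" using d squarefree_pos by auto
  have dt: "d = D * t" "d' = D * t'" by (simp_all add: D_def t_def t'_def)
  have sf: "squarefree D" "squarefree t" "coprime D t"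
    using squarefree_cofactor[OF d(1), of D] by (auto simp: D_def t_def)
  have sf': "squarefree t'" "coprime D t'"
    using squarefree_cofactor[OF d(2), of D] by (auto simp: D_def t'_def)
  have tt: "coprime t t'" unfolding t_def t'_def D_def using dpos by (intro div_gcd_coprime) auto
  have sfm: "squarefree m" "coprime D m"
    unfolding m_def using sf sf' tt by (auto intro: squarefree_mult_coprime)
  have p: "D > 0" "t > 0" "t' > 0" "m > 0" using sf sf' sfm squarefree_pos by auto
  have le: "D * m \<le> d * d'" "m \<le> d * d'" "D \<le> d * d'" "D \<le> d"
  proof -
    have dd: "d * d' = D * D * m" by (simp add: dt m_def)
    show "D * m \<le> d * d'" "m \<le> d * d'" "D \<le> d * d'" unfolding dd using p by simp_all
    show "D \<le> d" using dt p by simp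
  qed
  \<comment> \<open>The square root of the bound of \<open>triple_sum_le\<close> after each
    collision count is replaced by BM over the cube of its modulus: D^6 and m^3 remain in the
    denominator.\<close>
  define J where "J = sqrt (Om * BM ^ 3) / (real D ^ 3 * sqrt (real m) ^ 3)"
  have J0: "0 \<le> J" using pos by (simp add: J_def)
  have J: "\<bar>\<Sum>x1\<in>W. \<Sum>x2\<in>W. \<Sum>x3\<in>W. of_bool (mat_cong D (x1 ** x2 ** x3) h) * oscp (t * t') u v (x1 ** x2 ** x3)\<bar> \<le> J"
    if "nzs (t * t') u" "nzs (t * t') v" "[det h = 1] (mod int D)" for u v h
  proof -
    let ?S = "\<Sum>x1\<in>W. \<Sum>x2\<in>W. \<Sum>x3\<in>W. of_bool (mat_cong D (x1 ** x2 ** x3) h) * oscp m u v (x1 ** x2 ** x3)"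
    let ?w = "2 ^ \<omega> m :: real"
    have c1: "real (coll (D * m) W) \<le> BM / real (D * m) ^ 3" using p le by (intro BM) auto
    have c2: "real (coll m W) \<le> BM / real m ^ 3" using p le by (intro BM) auto
    have "?S\<^sup>2 \<le> real (coll (D * m) W) * (real m ^ 2 * ((?w * real m ^ 2 * real (coll (D * m) W)) * (?w * real m ^ 2 * real (coll m W))))"
      using that by (intro triple_sum_le sf sfm W) (auto simp: m_def)
    also have "\<dots> \<le> (BM / real (D * m) ^ 3) * (real m ^ 2 * ((?w * real m ^ 2 * (BM / real (D * m) ^ 3)) * (?w * real m ^ 2 * (BM / real m ^ 3))))"
      using pos by (intro mult_mono c1 c2 order_refl mult_nonneg_nonneg) auto
    also have "\<dots> = (?w * ?w) * BM ^ 3 / (real D ^ 6 * real m ^ 3)"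
      unfolding of_nat_mult by (rule pair_identity1) (use p in auto)
    also have "?w * ?w = 4 ^ \<omega> m" by (simp flip: power_mult_distrib)
    also have "4 ^ \<omega> m * BM ^ 3 / (real D ^ 6 * real m ^ 3) \<le> Om * BM ^ 3 / (real D ^ 6 * real m ^ 3)"
      using Om[of m] p le pos by (intro divide_right_mono mult_right_mono) auto
    also have "\<dots> = J\<^sup>2"
    proof -
      have "(sqrt (real m) ^ 3)\<^sup>2 = (sqrt (real m) ^ 2) ^ 3" by (simp only: power_mult[symmetric] mult.commute)
      then have "(sqrt (real m) ^ 3)\<^sup>2 = real m ^ 3" by simp
      moreover have "(real D ^ 3)\<^sup>2 = real D ^ 6" by (simp flip: power_mult)
      ultimately show ?thesis unfolding J_def using pos by (simp add: power_divide power_mult_distrib)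
    qed
    finally have "\<bar>?S\<bar> \<le> \<bar>J\<bar>" by (rule abs_le_square_iff[THEN iffD2])
    then show ?thesis using J0 by (simp add: m_def)
  qed
  have "\<bar>\<Sum>x1\<in>W. \<Sum>x2\<in>W. \<Sum>x3\<in>W. \<Sum>z\<in>B. \<Sum>z'\<in>B.
      oscp (D * t) u v (x1 ** x2 ** x3 ** a ** z) * oscp (D * t') u' v' (x1 ** x2 ** x3 ** a ** z')\<bar>
    \<le> J * ((2 ^ \<omega> D * real D ^ 2)\<^sup>2 * real (coll D B))"
    by (rule pair_sum_le[OF sf(1,2) sf'(1) sf(3) sf'(2) tt _ _ _ _ a B W J0 J]) (use uv dt in auto)
  also have "\<dots> \<le> J * ((Om * real D ^ 4) * (BZ / real D ^ 3))"
  proof (intro mult_left_mono mult_mono J0)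
    have "(2 ^ \<omega> D * real D ^ 2)\<^sup>2 = (2 ^ \<omega> D * 2 ^ \<omega> D) * (real D ^ 2 * real D ^ 2)"
      by (simp only: power2_eq_square mult_ac)
    also have "\<dots> = (2 * 2) ^ \<omega> D * real D ^ 4"
      unfolding power_mult_distrib power_add[symmetric] by simp
    also have "\<dots> \<le> Om * real D ^ 4" using Om[of D] p le by (intro mult_right_mono) auto
    finally show "(2 ^ \<omega> D * real D ^ 2)\<^sup>2 \<le> Om * real D ^ 4" .
    show "real (coll D B) \<le> BZ / real D ^ 3" using p le by (intro BZ) auto
  qed (use pos in auto)
  also have "\<dots> = (sqrt (Om * BM ^ 3) * Om * BZ) * (1 / (real D ^ 2 * sqrt (real m) ^ 3))"
    unfolding J_def by (rule pair_identity2) (use p in simp)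
  finally show ?thesis unfolding dt[symmetric] unfolding m_def t_def t'_def D_def .
qed

text \<open>Signs turn the absolute values into one linear form, and Cauchy--Schwarz over
  \<open>A\<close> leaves a sum of squares, which by positivity may be extended to all triple
  products. The opened square involves moduli up to d d' \<le> Q^2 in the box of size M, hence the
  condition on Q^6, and moduli up to Q in the box of size Z, hence the one on Q^3.\<close>

lemma large_sieve:
  fixes e :: real assumes e: "e > 0"
  obtains C :: real where "C \<ge> 1" and "\<And>M Z Q M0 A B a DD u v.
    M \<ge> 1 \<Longrightarrow> Z \<ge> 1 \<Longrightarrow> Q \<ge> 1 \<Longrightarrow> M0 \<ge> 1 \<Longrightarrow> Q ^ 6 \<le> M\<^sup>2 \<Longrightarrow> Q ^ 3 \<le> Z\<^sup>2 \<Longrightarrow>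
    A \<subseteq> (\<lambda>(x1, x2, x3). x1 ** x2 ** x3) ` (semibox M \<times> semibox M \<times> semibox M) \<Longrightarrow>
    B \<subseteq> semibox Z \<Longrightarrow> det a = 1 \<Longrightarrow>
    (\<And>d. d \<in> DD \<Longrightarrow> squarefree d \<and> M0 \<le> real d \<and> real d \<le> Q \<and> nzs d (u d) \<and> nzs d (v d)) \<Longrightarrow>
    (\<Sum>d\<in>DD. \<bar>\<Sum>x\<in>A. \<Sum>z\<in>B. oscp d (u d) (v d) (x ** a ** z)\<bar>)\<^sup>2
      \<le> C * real (card A) * (M powr (6 + e) * Z powr (4 + e) * Q powr e * M0 powr (- 1 / 4))"
proof -
  \<comment> \<open>\<open>Om\<close> carries Q^(2 f) and enters squared, which gives Q^e; the box
    contributes M^(3 (4 + f)/2), which is at most M^(6 + e).\<close>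
  define f where "f = e / 4"
  have f: "f > 0" using e by (simp add: f_def)
  obtain C1 where C1: "C1 \<ge> 1" "\<And>M r. M \<ge> 1 \<Longrightarrow> r \<ge> 1 \<Longrightarrow> real r ^ 3 \<le> M\<^sup>2 \<Longrightarrow>
      real (coll r (semibox M)) \<le> C1 * M powr (4 + f) / real r ^ 3"
    using coll_semibox[OF f] by metis
  obtain K :: real where K: "K \<ge> 1" "\<And>n. n \<ge> 1 \<Longrightarrow> 4 ^ \<omega> n \<le> K * real n powr f"
    using pow_omega_le[OF f, of 4] by (metis one_le_numeral)
  obtain C2 :: real where C2: "C2 \<ge> 1" "\<And>M0 S. M0 \<ge> 1 \<Longrightarrow> finite S \<Longrightarrow> (\<And>d. d \<in> S \<Longrightarrow> d > 0 \<and> M0 \<le> real d) \<Longrightarrow>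
    (\<Sum>d\<in>S. \<Sum>d'\<in>S. gcd_kernel d d')
      \<le> C2 * M0 powr (- 1 / 4)"
  proof (rule gcd_sum_le, goal_cases)
    case (1 C)
    show ?case by (rule 1(1)[OF 1(2,3)])
  qed
  define C where "C = C1\<^sup>2 * K\<^sup>2 * C1 * C2"
  show thesis
  proof (rule that[of C])
    have "1 * 1 * 1 * 1 \<le> C1\<^sup>2 * K\<^sup>2 * C1 * C2" using C1(1) K(1) C2(1) by (intro mult_mono one_le_power) auto
    then show "1 \<le> C" by (simp add: C_def)
    fix M Z Q M0 :: real and A B :: "(int^2^2) set" and a :: "int^2^2" and DD :: "nat set" and u v :: "nat \<Rightarrow> nat \<Rightarrow> int^2"
    assume M: "M \<ge> 1" and Z: "Z \<ge> 1" and Q: "Q \<ge> 1" and M0: "M0 \<ge> 1" and QM: "Q ^ 6 \<le> M\<^sup>2" and QZ: "Q ^ 3 \<le> Z\<^sup>2"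
      and A: "A \<subseteq> (\<lambda>(x1, x2, x3). x1 ** x2 ** x3) ` (semibox M \<times> semibox M \<times> semibox M)"
      and B: "B \<subseteq> semibox Z" and a: "det a = 1"
      and DD: "\<And>d. d \<in> DD \<Longrightarrow> squarefree d \<and> M0 \<le> real d \<and> real d \<le> Q \<and> nzs d (u d) \<and> nzs d (v d)"
    let ?W = "semibox M"
    define P where "P = ?W \<times> ?W \<times> ?W"
    define xx :: "(int^2^2) \<times> (int^2^2) \<times> (int^2^2) \<Rightarrow> int^2^2"
      where "xx = (\<lambda>(x1, x2, x3). x1 ** x2 ** x3)"
    have finDD: "finite DD"
    proof (rule finite_subset)
      show "DD \<subseteq> {..nat \<lfloor>Q\<rfloor>}" using DD by (force simp: le_nat_floor)
    qed simp
    have finP: "finite P" by (simp add: P_def)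
    have AP: "A \<subseteq> xx ` P" using A by (simp add: P_def xx_def)
    have finA: "finite A" using AP finP finite_subset by blast
    have finB: "finite B" by (rule finite_subset[OF B]) simp
    have detB: "det z = 1" if "z \<in> B" for z using that B semibox_det by blast
    define T where "T d x = (\<Sum>z\<in>B. oscp d (u d) (v d) (x ** a ** z))" for d x
    define s where "s d = sgn (\<Sum>x\<in>A. T d x)" for d
    define H where "H x = (\<Sum>d\<in>DD. s d * T d x)" for x
    define BM where "BM = C1 * M powr (4 + f)"
    define BZ where "BZ = C1 * Z powr (4 + f)"
    define Om where "Om = K * Q powr (2 * f)"
    define X where "X = sqrt (Om * BM ^ 3) * Om * BZ"
    have nn: "BM \<ge> 0" "BZ \<ge> 0" "Om \<ge> 0" using C1(1) K(1) by (auto simp: BM_def BZ_def Om_def)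
    then have X0: "X \<ge> 0" by (simp add: X_def)
    have pair: "\<bar>\<Sum>x\<in>P. T d (xx x) * T d' (xx x)\<bar>
      \<le> X * gcd_kernel d d'"
      if d: "d \<in> DD" "d' \<in> DD" for d d'
    proof -
      have dd: "real (d * d') \<le> Q\<^sup>2"
        using DD[OF d(1)] DD[OF d(2)] Q by (simp add: power2_eq_square mult_mono)
      have "(\<Sum>x\<in>P. T d (xx x) * T d' (xx x))
        = (\<Sum>x1\<in>?W. \<Sum>x2\<in>?W. \<Sum>x3\<in>?W. \<Sum>z\<in>B. \<Sum>z'\<in>B.
            oscp d (u d) (v d) (x1 ** x2 ** x3 ** a ** z) * oscp d' (u d') (v d') (x1 ** x2 ** x3 ** a ** z'))"
        by (simp add: P_def xx_def T_def sum.cartesian_product' sum_product)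
      also have "\<bar>\<dots>\<bar> \<le> (sqrt (Om * BM ^ 3) * Om * BZ) *
          gcd_kernel d d'"
      proof (rule sieve_pair_le[OF _ _ _ _ _ _ a finB detB finite_semibox semibox_det nn])
        fix r :: nat assume r: "1 \<le> r" "r \<le> d * d'"
        have "real r \<le> Q\<^sup>2" using r(2) dd by (meson of_nat_mono order_trans)
        then have "real r ^ 3 \<le> (Q\<^sup>2) ^ 3" by (intro power_mono) auto
        also have "(Q\<^sup>2) ^ 3 = Q ^ 6" by (simp flip: power_mult)
        finally have "real r ^ 3 \<le> M\<^sup>2" using QM by linarith
        then show "real (coll r ?W) \<le> BM / real r ^ 3" unfolding BM_def using M r by (intro C1) auto
      next
        fix r :: nat assume r: "1 \<le> r" "r \<le> d"
        have "real r \<le> Q" using r(2) DD[OF d(1)] by linarith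
        then have "real r ^ 3 \<le> Q ^ 3" by (intro power_mono) auto
        then have "real r ^ 3 \<le> Z\<^sup>2" using QZ by linarith
        then have "real (coll r (semibox Z)) \<le> BZ / real r ^ 3" unfolding BZ_def using Z r by (intro C1) auto
        moreover have "coll r B \<le> coll r (semibox Z)" by (rule coll_mono[OF B]) simp
        ultimately show "real (coll r B) \<le> BZ / real r ^ 3" by linarith
      next
        fix n :: nat assume n: "1 \<le> n" "n \<le> d * d'"
        have "real n \<le> Q\<^sup>2" using n(2) dd by (meson of_nat_mono order_trans)
        then have "real n powr f \<le> (Q\<^sup>2) powr f" using f by (intro powr_mono2) auto
        also have "Q\<^sup>2 = Q powr 2" using Q by simp
        also have "(Q powr 2) powr f = Q powr (2 * f)" by (simp add: powr_powr)
        finally have "K * real n powr f \<le> Om" unfolding Om_def using K(1) by (intro mult_left_mono) auto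
        then show "4 ^ \<omega> n \<le> Om" using K(2)[OF n(1)] by linarith
      qed (use DD[OF d(1)] DD[OF d(2)] in auto)
      finally show ?thesis by (simp only: X_def)
    qed
    have "(\<Sum>d\<in>DD. \<bar>\<Sum>x\<in>A. T d x\<bar>) = (\<Sum>d\<in>DD. \<Sum>x\<in>A. s d * T d x)"
      unfolding s_def sum_distrib_left[symmetric] abs_sgn by (intro sum.cong refl mult.commute)
    also have "\<dots> = (\<Sum>x\<in>A. 1 * H x)" unfolding H_def mult_1 by (rule sum.swap)
    finally have "(\<Sum>d\<in>DD. \<bar>\<Sum>x\<in>A. T d x\<bar>)\<^sup>2 \<le> (\<Sum>x\<in>A. 1\<^sup>2) * (\<Sum>x\<in>A. (H x)\<^sup>2)"
      by (simp only: Cauchy_Schwarz_ineq_sum)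
    then have cs: "(\<Sum>d\<in>DD. \<bar>\<Sum>x\<in>A. T d x\<bar>)\<^sup>2 \<le> real (card A) * (\<Sum>x\<in>A. (H x)\<^sup>2)" by simp
    \<comment> \<open>The completion step: the sparse set is enlarged to all products of three box
      elements, each even counted once per factorization. Only nonnegativity of the square is
      used.\<close>
    have "(\<Sum>x\<in>A. (H x)\<^sup>2) \<le> (\<Sum>x\<in>xx ` P. (H x)\<^sup>2)" using AP finP by (intro sum_mono2) auto
    also have "\<dots> \<le> (\<Sum>x\<in>P. (H (xx x))\<^sup>2)"
      using sum_image_le[OF finP, of "\<lambda>x. (H x)\<^sup>2" xx] by (simp add: o_def)
    also have "\<dots> = (\<Sum>x\<in>P. \<Sum>d\<in>DD. \<Sum>d'\<in>DD. (s d * s d') * (T d (xx x) * T d' (xx x)))"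
      unfolding H_def power2_eq_square sum_product by (intro sum.cong refl) (simp only: mult_ac)
    also have "\<dots> = (\<Sum>d\<in>DD. \<Sum>x\<in>P. \<Sum>d'\<in>DD. (s d * s d') * (T d (xx x) * T d' (xx x)))" by (rule sum.swap)
    also have "\<dots> = (\<Sum>d\<in>DD. \<Sum>d'\<in>DD. \<Sum>x\<in>P. (s d * s d') * (T d (xx x) * T d' (xx x)))"
      by (intro sum.cong refl sum.swap)
    also have "\<dots> = (\<Sum>d\<in>DD. \<Sum>d'\<in>DD. (s d * s d') * (\<Sum>x\<in>P. T d (xx x) * T d' (xx x)))"
      by (simp only: sum_distrib_left)
    also have "\<dots> \<le> (\<Sum>d\<in>DD. \<Sum>d'\<in>DD. X * gcd_kernel d d')"
    proof (intro sum_mono)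
      fix d d' assume d: "d \<in> DD" "d' \<in> DD"
      have "\<bar>s d * s d'\<bar> \<le> 1" by (simp add: s_def abs_mult sgn_real_def)
      have "(s d * s d') * (\<Sum>x\<in>P. T d (xx x) * T d' (xx x)) \<le> \<bar>s d * s d'\<bar> * \<bar>\<Sum>x\<in>P. T d (xx x) * T d' (xx x)\<bar>"
        unfolding abs_mult[symmetric] by (rule abs_ge_self)
      also have "\<dots> \<le> 1 * \<bar>\<Sum>x\<in>P. T d (xx x) * T d' (xx x)\<bar>"
        using \<open>\<bar>s d * s d'\<bar> \<le> 1\<close> by (intro mult_right_mono) auto
      also note mult_1
      also note pair[OF d]
      finally show "(s d * s d') * (\<Sum>x\<in>P. T d (xx x) * T d' (xx x))
          \<le> X * gcd_kernel d d'" .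
    qed
    also have "\<dots> = X * (\<Sum>d\<in>DD. \<Sum>d'\<in>DD. gcd_kernel d d')"
      by (simp only: sum_distrib_left)
    also have "\<dots> \<le> X * (C2 * M0 powr (- 1 / 4))"
      using DD squarefree_pos by (intro mult_left_mono X0 C2 M0 finDD) blast
    also have "\<dots> \<le> (C1\<^sup>2 * M powr (6 + e) * (K\<^sup>2 * Q powr e) * (C1 * Z powr (4 + e))) * (C2 * M0 powr (- 1 / 4))"
    proof (rule mult_right_mono)
      have Om1: "1 \<le> Om"
      proof -
        have "1 * 1 \<le> K * Q powr (2 * f)" using K(1) Q f by (intro mult_mono ge_one_powr_ge_zero) auto
        then show ?thesis by (simp add: Om_def)
      qed
      have sq: "(x powr y)\<^sup>2 = x powr (2 * y)" for x y :: real by (simp add: power2_eq_square flip: powr_add)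
      have "Om * BM ^ 3 \<le> Om\<^sup>2 * (C1\<^sup>2 * M powr (6 + e))\<^sup>2"
      proof (intro mult_mono)
        show "Om \<le> Om\<^sup>2" using mult_left_mono[of 1 Om Om] Om1 by (simp add: power2_eq_square)
        have "(M powr (4 + f)) ^ 3 = M powr (3 * (4 + f))" using M by (simp add: powr_power mult.commute)
        also have "\<dots> \<le> M powr (2 * (6 + e))" using M e by (intro powr_mono) (auto simp: f_def)
        finally have "C1 ^ 3 * (M powr (4 + f)) ^ 3 \<le> C1 ^ 4 * M powr (2 * (6 + e))"
          using C1(1) by (intro mult_mono power_increasing) auto
        then show "BM ^ 3 \<le> (C1\<^sup>2 * M powr (6 + e))\<^sup>2"
          unfolding BM_def power_mult_distrib sq by simp
      qed (use nn in auto)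
      also have "\<dots> = (Om * (C1\<^sup>2 * M powr (6 + e)))\<^sup>2" by (simp only: power_mult_distrib)
      finally have "sqrt (Om * BM ^ 3) \<le> Om * (C1\<^sup>2 * M powr (6 + e))"
        by (rule real_le_lsqrt[rotated 1]) (use nn in auto)
      then have "X \<le> Om * (C1\<^sup>2 * M powr (6 + e)) * Om * BZ"
        unfolding X_def using nn by (intro mult_right_mono) auto
      also have "\<dots> = C1\<^sup>2 * M powr (6 + e) * Om\<^sup>2 * BZ" by (simp only: power2_eq_square mult_ac)
      also have "\<dots> \<le> C1\<^sup>2 * M powr (6 + e) * (K\<^sup>2 * Q powr e) * (C1 * Z powr (4 + e))"
      proof (intro mult_mono)
        show "Om\<^sup>2 \<le> K\<^sup>2 * Q powr e" unfolding Om_def power_mult_distrib sq by (simp add: f_def)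
        have "Z powr (4 + f) \<le> Z powr (4 + e)" using Z e by (intro powr_mono) (auto simp: f_def)
        then show "BZ \<le> C1 * Z powr (4 + e)" unfolding BZ_def using C1(1) by (intro mult_left_mono) auto
      qed (use nn C1(1) in auto)
      finally show "X \<le> C1\<^sup>2 * M powr (6 + e) * (K\<^sup>2 * Q powr e) * (C1 * Z powr (4 + e))" .
    qed (use C2(1) in auto)
    also have "\<dots> = C * (M powr (6 + e) * Z powr (4 + e) * Q powr e * M0 powr (- 1 / 4))"
      by (simp only: C_def mult_ac)
    finally have "real (card A) * (\<Sum>x\<in>A. (H x)\<^sup>2)
        \<le> real (card A) * (C * (M powr (6 + e) * Z powr (4 + e) * Q powr e * M0 powr (- 1 / 4)))"
      by (intro mult_left_mono) auto
    from order_trans[OF cs this]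
    show "(\<Sum>d\<in>DD. \<bar>\<Sum>x\<in>A. \<Sum>z\<in>B. oscp d (u d) (v d) (x ** a ** z)\<bar>)\<^sup>2
      \<le> C * real (card A) * (M powr (6 + e) * Z powr (4 + e) * Q powr e * M0 powr (- 1 / 4))"
      unfolding T_def by (simp only: mult_ac)
  qed
qed

section \<open>Words\<close>

lemma cf_gen_nth [simp]: "cf_gen a $ 1 $ 1 = int a" "cf_gen a $ 1 $ 2 = 1" "cf_gen a $ 2 $ 1 = 1" "cf_gen a $ 2 $ 2 = 0"
  by (simp_all add: cf_gen_def)

lemma word_matrix_Nil [simp]: "word_matrix [] = mat 1"
  by (simp add: word_matrix_def)

lemma word_matrix_Cons: "word_matrix (a # w) = cf_gen a ** word_matrix w"
  by (simp add: word_matrix_def)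

lemma word_matrix_append: "word_matrix (u @ v) = word_matrix u ** word_matrix v"
  by (induction u) (simp_all add: word_matrix_Cons matrix_mul_assoc)

lemma word_matrix_Cons_nth:
  "word_matrix (a # w) $ 1 $ j = int a * word_matrix w $ 1 $ j + word_matrix w $ 2 $ j"
  "word_matrix (a # w) $ 2 $ j = word_matrix w $ 1 $ j"
  by (simp_all add: word_matrix_Cons mat2_mult_nth)

lemma det_word_matrix: "det (word_matrix w) = (- 1) ^ length w"
proof (induction w)
  case (Cons a w)
  have "det (cf_gen a) = - 1" by (simp add: det_2)
  then show ?case using Cons by (simp add: word_matrix_Cons det_mul)
qed simp

definition pos_word :: "nat list \<Rightarrow> bool" where
  "pos_word w \<longleftrightarrow> (\<forall>a\<in>set w. 1 \<le> a)"

lemma pos_word_simps [simp]: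
  "pos_word []" "pos_word (a # w) \<longleftrightarrow> 1 \<le> a \<and> pos_word w" "pos_word (u @ v) \<longleftrightarrow> pos_word u \<and> pos_word v"
  by (auto simp: pos_word_def)

lemma word_matrix_bounds:
  assumes "pos_word w" "w \<noteq> []"
  shows "1 \<le> word_matrix w $ 1 $ 2 \<and> word_matrix w $ 1 $ 2 \<le> word_matrix w $ 1 $ 1 \<and>
    0 \<le> word_matrix w $ 2 $ 1 \<and> word_matrix w $ 2 $ 1 \<le> word_matrix w $ 1 $ 1 \<and>
    0 \<le> word_matrix w $ 2 $ 2 \<and> word_matrix w $ 2 $ 2 \<le> word_matrix w $ 1 $ 2 \<and>
    word_matrix w $ 2 $ 2 \<le> word_matrix w $ 2 $ 1"
  using assms
proof (induction w)
  case (Cons a w)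
  show ?case
  proof (cases "w = []")
    case True
    then show ?thesis using Cons.prems by (simp add: word_matrix_Cons_nth)
  next
    case False
    let ?m = "word_matrix w"
    have IH: "1 \<le> ?m$1$2" "?m$1$2 \<le> ?m$1$1" "0 \<le> ?m$2$1" "?m$2$1 \<le> ?m$1$1" "0 \<le> ?m$2$2" "?m$2$2 \<le> ?m$1$2" "?m$2$2 \<le> ?m$2$1"
      using Cons.IH Cons.prems False by auto
    have a: "1 \<le> int a" using Cons.prems by simp
    have "1 * ?m$1$2 \<le> int a * ?m$1$2" "1 * ?m$1$1 \<le> int a * ?m$1$1" "int a * ?m$1$2 \<le> int a * ?m$1$1"
      using a IH by (auto intro: mult_right_mono mult_left_mono)
    then show ?thesis unfolding word_matrix_Cons_nth using IH by linarith
  qed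
qed simp

lemma word_matrix_11_ge_1: "pos_word w \<Longrightarrow> 1 \<le> word_matrix w $ 1 $ 1"
  using word_matrix_bounds[of w] by (cases "w = []") auto

lemma word_matrix_nonneg: "pos_word w \<Longrightarrow> 0 \<le> word_matrix w $ i $ j"
  using word_matrix_bounds[of w] exhaust_2[of i] exhaust_2[of j] by (cases "w = []") (auto simp: mat_def)

text \<open>A nonempty even word is a digit followed by a nonempty word, whose first row is at least
  its second column-wise decreasing. Equality of both entries in each of its two rows would make the
  determinant 0, so after prepending a digit the first row decreases strictly.\<close>

lemma even_word_in_semibox:
  assumes w: "pos_word w" "even (length w)" and M: "real_of_int (word_matrix w $ 1 $ 1) \<le> M"
  shows "word_matrix w \<in> semibox M"
proof (cases "w = []")
  case True
  then show ?thesis using M by (simp add: semibox_def det_I)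
next
  case False
  then obtain a v where v: "w = a # v" by (cases w) auto
  then have ne: "v \<noteq> []" using w(2) by auto
  let ?m = "word_matrix v"
  have b: "1 \<le> ?m$1$2" "?m$1$2 \<le> ?m$1$1" "?m$2$2 \<le> ?m$2$1"
    using word_matrix_bounds[of v] w(1) v ne by auto
  have a: "1 \<le> int a" using w(1) v by simp
  have "?m$1$2 < ?m$1$1 \<or> ?m$2$2 < ?m$2$1"
  proof (rule ccontr)
    assume "\<not> ?thesis"
    then have "det ?m = 0" using b by (simp add: det_2)
    then show False by (simp add: det_word_matrix)
  qed
  moreover have "1 * (?m$1$1 - ?m$1$2) \<le> int a * (?m$1$1 - ?m$1$2)" using a b by (intro mult_right_mono) auto
  ultimately have lt: "word_matrix w $ 1 $ 2 < word_matrix w $ 1 $ 1"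
    unfolding v word_matrix_Cons_nth right_diff_distrib using b by linarith
  have "det (word_matrix w) = 1" using w(2) by (simp add: det_word_matrix)
  then show ?thesis using word_matrix_bounds[OF w(1) False] lt M by (auto simp: semibox_def)
qed

text \<open>Uniqueness of continued fraction expansions; the second column removes the ambiguity
  between a final digit 1 and its absorption into the previous digit. The first digit is recovered,
  then the tail.\<close>

lemma word_matrix_inj:
  assumes "pos_word u" "pos_word v" "word_matrix u = word_matrix v" shows "u = v"
  using assms
proof (induction u arbitrary: v)
  case Nil
  show ?case
  proof (rule ccontr)
    assume "[] \<noteq> v"
    then have "1 \<le> word_matrix v $ 1 $ 2" using word_matrix_bounds[of v] Nil.prems(2) by auto
    then show False using Nil.prems(3)[symmetric] by simp
  qed
next
  case (Cons a u)
  show ?case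
  proof (cases v)
    case Nil
    have "1 \<le> word_matrix (a # u) $ 1 $ 2" using word_matrix_bounds[of "a # u"] Cons.prems(1) by auto
    then show ?thesis using Cons.prems(3) Nil by simp
  next
    case (Cons b w)
    let ?m = "word_matrix u" and ?n = "word_matrix w"
    have pos: "pos_word u" "pos_word w" "1 \<le> a" "1 \<le> b" using Cons.prems \<open>v = b # w\<close> by auto
    have eq: "?m$1$j = ?n$1$j" "int a * ?m$1$j + ?m$2$j = int b * ?n$1$j + ?n$2$j" for j
      using Cons.prems(3) unfolding \<open>v = b # w\<close> by (metis word_matrix_Cons_nth)+
    \<comment> \<open>If the first digits differed, the difference of the second rows would be at
      least the first row. Since entries of a second row are bounded by those of the first, this
      forces a zero second row and determinant 0.\<close>
    have le: "x = y"
      if "pos_word u" "pos_word w" "word_matrix u $ 1 $ 1 = word_matrix w $ 1 $ 1"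
        "word_matrix u $ 1 $ 2 = word_matrix w $ 1 $ 2"
        "int x * word_matrix u $ 1 $ 1 + word_matrix u $ 2 $ 1 = int y * word_matrix w $ 1 $ 1 + word_matrix w $ 2 $ 1"
        "int x * word_matrix u $ 1 $ 2 + word_matrix u $ 2 $ 2 = int y * word_matrix w $ 1 $ 2 + word_matrix w $ 2 $ 2" "x \<ge> y"
      for u w x y
    proof (rule ccontr)
      assume "x \<noteq> y"
      then have k: "1 \<le> int x - int y" using that(7) by simp
      let ?p = "word_matrix u $ 1 $ 1" and ?p' = "word_matrix u $ 1 $ 2"
      have 1: "(int x - int y) * ?p = word_matrix w $ 2 $ 1 - word_matrix u $ 2 $ 1"
        "(int x - int y) * ?p' = word_matrix w $ 2 $ 2 - word_matrix u $ 2 $ 2"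
        using that(3-6) by (simp_all add: algebra_simps)
      have p: "1 \<le> ?p" "0 \<le> ?p'" using word_matrix_11_ge_1 word_matrix_nonneg that by auto
      have kp: "1 * ?p \<le> (int x - int y) * ?p" by (rule mult_right_mono[OF k]) (use p in simp)
      have kp': "1 * ?p' \<le> (int x - int y) * ?p'" by (rule mult_right_mono[OF k p(2)])
      show False
      proof (cases "w = []")
        case True
        then show False using kp 1(1) p word_matrix_nonneg[OF that(1), of 2 1] by simp
      next
        case False
        note bw = word_matrix_bounds[OF that(2) False]
        have "word_matrix u $ 2 $ 1 = 0" using kp 1(1) bw that(3) word_matrix_nonneg[OF that(1), of 2 1] by linarith
        moreover have "word_matrix u $ 2 $ 2 \<le> 0" using kp' 1(2) bw that(4) by linarith
        ultimately have "det (word_matrix u) = 0" using word_matrix_nonneg[OF that(1), of 2 2] by (simp add: det_2)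
        then show False by (simp add: det_word_matrix)
      qed
    qed
    have "a = b"
    proof (cases "a \<ge> b")
      case True
      then show ?thesis by (intro le[OF pos(1,2)]) (use eq in auto)
    next
      case False
      then have "b = a" by (intro le[OF pos(2,1)]) (use eq in \<open>auto dest: sym\<close>)
      then show ?thesis by simp
    qed
    moreover from this have "?m$2$j = ?n$2$j" for j using eq[of j] by simp
    then have "?m = ?n" using eq(1) by (simp add: mat2_eq_iff)
    then have "u = w" using Cons.IH pos by blast
    ultimately show ?thesis using \<open>v = b # w\<close> by simp
  qed
qed

section \<open>Cutting words by size\<close>

text \<open>Two letters are moved at a time to preserve even lengths. One such move multiplies the
  corner entry by at most a b + b + 1 \<le> (A + 1)^2, so the cut overshoots the threshold by at
  most this factor.\<close>

lemma word_split:
  fixes \<tau> :: real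
  assumes "set (u @ v) \<subseteq> {1..A}" "even (length u)" "even (length v)" "\<tau> \<ge> 1"
    "real_of_int (word_matrix u $ 1 $ 1) \<le> (real A + 1)\<^sup>2 * \<tau>"
  shows "\<exists>u' v'. u @ v = u' @ v' \<and> even (length u') \<and> even (length v') \<and>
    real_of_int (word_matrix u' $ 1 $ 1) \<le> (real A + 1)\<^sup>2 * \<tau> \<and> (v' = [] \<or> \<tau> \<le> real_of_int (word_matrix u' $ 1 $ 1))"
  using assms
proof (induction "length v" arbitrary: u v rule: less_induct)
  case less
  show ?case
  proof (cases "v = [] \<or> \<tau> \<le> real_of_int (word_matrix u $ 1 $ 1)")
    case True
    then show ?thesis using less.prems by blast
  next
    case False
    then obtain a b w where v: "v = a # b # w"
      using less.prems(3) by (cases v; cases "tl v") auto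
    let ?u = "u @ [a, b]" and ?m = "word_matrix u"
    have ab: "1 \<le> a" "a \<le> A" "1 \<le> b" "b \<le> A" and pu: "pos_word u"
      using less.prems(1) v by (auto simp: pos_word_def)
    have "?m$1$2 \<le> ?m$1$1" using word_matrix_bounds[OF pu] by (cases "u = []") auto
    have "word_matrix ?u $ 1 $ 1 = ?m$1$1 * (int a * int b + 1) + ?m$1$2 * int b"
      by (simp add: word_matrix_append word_matrix_Cons mat2_mult_nth)
    also have "\<dots> \<le> ?m$1$1 * (int a * int b + 1) + ?m$1$1 * int b"
      using \<open>?m$1$2 \<le> ?m$1$1\<close> by (intro add_left_mono mult_right_mono) auto
    also have "\<dots> = ?m$1$1 * (int a * int b + int b + 1)" by (simp add: algebra_simps)
    also have "\<dots> \<le> ?m$1$1 * (int A + 1)\<^sup>2"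
    proof (rule mult_left_mono)
      have "int a * int b \<le> int A * int A" using ab by (intro mult_mono) auto
      then show "int a * int b + int b + 1 \<le> (int A + 1)\<^sup>2"
        using ab by (simp add: power2_eq_square algebra_simps)
      show "0 \<le> ?m$1$1" by (rule word_matrix_nonneg[OF pu])
    qed
    finally have "real_of_int (word_matrix ?u $ 1 $ 1) \<le> real_of_int (?m$1$1 * (int A + 1)\<^sup>2)"
      by (simp only: of_int_le_iff)
    also have "\<dots> = (real A + 1)\<^sup>2 * real_of_int (?m$1$1)" by simp
    also have "\<dots> \<le> (real A + 1)\<^sup>2 * \<tau>" using False by (intro mult_left_mono) auto
    finally have "real_of_int (word_matrix ?u $ 1 $ 1) \<le> (real A + 1)\<^sup>2 * \<tau>" .
    moreover have "set (?u @ w) \<subseteq> {1..A}" "even (length ?u)" "even (length w)" "length w < length v"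
      using less.prems v by auto
    ultimately have "\<exists>u' v'. ?u @ w = u' @ v' \<and> even (length u') \<and> even (length v') \<and>
      real_of_int (word_matrix u' $ 1 $ 1) \<le> (real A + 1)\<^sup>2 * \<tau> \<and> (v' = [] \<or> \<tau> \<le> real_of_int (word_matrix u' $ 1 $ 1))"
      using less.hyps less.prems(4) by blast
    then show ?thesis using v by simp
  qed
qed

lemma word_matrix_append_11_ge:
  assumes "pos_word u" "pos_word v"
  shows "word_matrix u $ 1 $ 1 * word_matrix v $ 1 $ 1 \<le> word_matrix (u @ v) $ 1 $ 1"
  using word_matrix_nonneg[OF assms(1)] word_matrix_nonneg[OF assms(2)]
  by (simp add: word_matrix_append mat2_mult_nth)

text \<open>Two prefixes are cut off when their corner entry reaches \<tau> = X^(1/3). Corner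
  entries are supermultiplicative, so if both cuts occur the rest has corner at most X/\<tau>^2 =
  \<tau>.\<close>

lemma word_factor_3:
  fixes X :: real
  assumes w: "set w \<subseteq> {1..A}" "even (length w)" and X: "X \<ge> 1" "real_of_int (word_matrix w $ 1 $ 1) \<le> X"
    and M: "M = (real A + 1)\<^sup>2 * X powr (1 / 3)"
  shows "word_matrix w \<in> (\<lambda>(x1, x2, x3). x1 ** x2 ** x3) ` (semibox M \<times> semibox M \<times> semibox M)"
proof -
  define \<tau> where "\<tau> = X powr (1 / 3)"
  have \<tau>: "\<tau> \<ge> 1" unfolding \<tau>_def using X by (intro ge_one_powr_ge_zero) auto
  have \<tau>3: "\<tau> * \<tau> * \<tau> = X" unfolding \<tau>_def using X by (simp flip: powr_add)
  have A1: "1 \<le> (real A + 1)\<^sup>2" by (simp add: power2_eq_square algebra_simps)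
  have MM: "M = (real A + 1)\<^sup>2 * \<tau>" "\<tau> \<le> M"
    using M mult_right_mono[OF A1, of \<tau>] \<tau> by (auto simp: \<tau>_def)
  have split: "\<exists>u v. w = u @ v \<and> even (length u) \<and> even (length v) \<and>
      real_of_int (word_matrix u $ 1 $ 1) \<le> M \<and> (v = [] \<or> \<tau> \<le> real_of_int (word_matrix u $ 1 $ 1))"
    if "set w \<subseteq> {1..A}" "even (length w)" for w
    using word_split[of "[]" w A \<tau>] that \<tau> MM by simp
  obtain u v where uv: "w = u @ v" "even (length u)" "even (length v)"
      "real_of_int (word_matrix u $ 1 $ 1) \<le> M" "v = [] \<or> \<tau> \<le> real_of_int (word_matrix u $ 1 $ 1)"
    using split[OF w] by blast
  obtain s t where st: "v = s @ t" "even (length s)" "even (length t)"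
      "real_of_int (word_matrix s $ 1 $ 1) \<le> M" "t = [] \<or> \<tau> \<le> real_of_int (word_matrix s $ 1 $ 1)"
    using split[of v] w uv by auto
  have pos: "pos_word u" "pos_word v" "pos_word s" "pos_word t"
    using w(1) uv(1) st(1) by (auto simp: pos_word_def)
  have "real_of_int (word_matrix t $ 1 $ 1) \<le> \<tau>"
  proof (cases "t = []")
    case True
    then show ?thesis using \<tau> by simp
  next
    case False
    let ?u = "real_of_int (word_matrix u $ 1 $ 1)" and ?s = "real_of_int (word_matrix s $ 1 $ 1)"
      and ?t = "real_of_int (word_matrix t $ 1 $ 1)"
    have ge: "\<tau> \<le> ?u" "\<tau> \<le> ?s" using uv(5) st(1,5) False by auto
    have t0: "0 \<le> ?t" using word_matrix_nonneg[OF pos(4), of 1 1] by simp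
    have "\<tau> * (\<tau> * ?t) \<le> ?u * (?s * ?t)" using ge t0 \<tau> by (intro mult_mono mult_nonneg_nonneg) auto
    also have "\<dots> \<le> ?u * real_of_int (word_matrix v $ 1 $ 1)"
      using word_matrix_append_11_ge[OF pos(3,4)] word_matrix_nonneg[OF pos(1), of 1 1] st(1)
      by (intro mult_left_mono) (simp_all flip: of_int_mult)
    also have "\<dots> \<le> real_of_int (word_matrix w $ 1 $ 1)"
      using word_matrix_append_11_ge[OF pos(1,2)] uv(1) by (simp flip: of_int_mult)
    also have "\<dots> \<le> \<tau> * (\<tau> * \<tau>)" using X(2) \<tau>3 by (simp add: mult.assoc)
    finally show ?thesis using \<tau> by simp
  qed
  then have "word_matrix t \<in> semibox M" using pos st MM by (intro even_word_in_semibox) auto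
  moreover have "word_matrix u \<in> semibox M" "word_matrix s \<in> semibox M"
    using pos uv st by (auto intro!: even_word_in_semibox)
  ultimately show ?thesis unfolding uv(1) st(1)
    by (intro image_eqI[where x = "(word_matrix u, word_matrix s, word_matrix t)"])
       (auto simp: word_matrix_append matrix_mul_assoc)
qed

lemma Gamma_word:
  assumes "g \<in> Gamma A"
  obtains w where "g = word_matrix w" "set w \<subseteq> {1..A}" "even (length w)" "pos_word w"
proof -
  obtain w where w: "g = word_matrix w" "set w \<subseteq> {1..A}" "even (length w)"
    using assms unfolding Gamma_def by blast
  moreover have "pos_word w" unfolding pos_word_def using w(2) by auto
  ultimately show ?thesis using that by blast
qed

lemma corner_le_mat_norm: "real_of_int (g$1$1) \<le> mat_norm g"
proof -
  have "(real_of_int (g$1$1))\<^sup>2 \<le> real_of_int (quad_form g)"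
    unfolding quad_form_def trace_def sum_2 mat2_mult_nth transpose_def by (simp add: power2_eq_square)
  then show ?thesis unfolding mat_norm_def by (rule real_le_rsqrt)
qed

lemma Gamma_subset_semibox: "{g \<in> Gamma A. mat_norm g < X} \<subseteq> semibox X"
proof clarify
  fix g assume "g \<in> Gamma A" "mat_norm g < X"
  then show "g \<in> semibox X"
    using corner_le_mat_norm[of g] by (elim Gamma_word) (auto intro!: even_word_in_semibox)
qed

lemma Gamma_factor_3:
  assumes "X \<ge> 1"
  shows "{g \<in> Gamma A. mat_norm g < X} \<subseteq> (\<lambda>(x1, x2, x3). x1 ** x2 ** x3) `
    (semibox ((real A + 1)\<^sup>2 * X powr (1 / 3)) \<times> semibox ((real A + 1)\<^sup>2 * X powr (1 / 3)) \<times>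
     semibox ((real A + 1)\<^sup>2 * X powr (1 / 3)))"
proof clarify
  fix g assume "g \<in> Gamma A" "mat_norm g < X"
  then obtain w where w: "g = word_matrix w" "set w \<subseteq> {1..A}" "even (length w)"
    "real_of_int (word_matrix w $ 1 $ 1) \<le> X"
    using corner_le_mat_norm[of g] by (elim Gamma_word) auto
  show "g \<in> (\<lambda>(x1, x2, x3). x1 ** x2 ** x3) `
    (semibox ((real A + 1)\<^sup>2 * X powr (1 / 3)) \<times> semibox ((real A + 1)\<^sup>2 * X powr (1 / 3)) \<times>
     semibox ((real A + 1)\<^sup>2 * X powr (1 / 3)))"
    unfolding w(1) by (rule word_factor_3[OF w(2,3) assms w(4) refl])
qed

text \<open>The common word length of each outer set tells where to cut the concatenated word, and
  \<open>word_matrix_inj\<close> recovers that word from its matrix; hence the size of the product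
  set is exactly the product of the sizes.\<close>

lemma triple_product_inj:
  assumes X: "S1 \<subseteq> Gamma A" "S1 \<subseteq> word_matrix ` {w. set w \<subseteq> {1..A} \<and> length w = l}"
    and S: "S2 \<subseteq> Gamma B"
    and Z: "S3 \<subseteq> Gamma A" "S3 \<subseteq> word_matrix ` {w. set w \<subseteq> {1..A} \<and> length w = k}"
  shows "inj_on (\<lambda>(x, a, z). x ** a ** z) (S1 \<times> S2 \<times> S3)"
proof (rule inj_onI)
  fix y y' assume y: "y \<in> S1 \<times> S2 \<times> S3" "y' \<in> S1 \<times> S2 \<times> S3"
    and eq': "(case y of (x, a, z) \<Rightarrow> x ** a ** z) = (case y' of (x, a, z) \<Rightarrow> x ** a ** z)"
  obtain x a z x' a' z' where yy: "y = (x, a, z)" "y' = (x', a', z')" by (metis prod_cases3)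
  then have m: "x \<in> S1" "a \<in> S2" "z \<in> S3" "x' \<in> S1" "a' \<in> S2" "z' \<in> S3"
    and eq: "x ** a ** z = x' ** a' ** z'" using y eq' by simp_all
  have fixed: "\<exists>w. g = word_matrix w \<and> pos_word w \<and> length w = n"
    if "g \<in> word_matrix ` {w. set w \<subseteq> {1..A} \<and> length w = n}" for g n
    using that by (force simp: pos_word_def)
  have fx: "\<exists>w. g = word_matrix w \<and> pos_word w \<and> length w = l" if "g \<in> S1" for g
    by (rule fixed) (use X(2) that in blast)
  have fz: "\<exists>w. g = word_matrix w \<and> pos_word w \<and> length w = k" if "g \<in> S3" for g
    by (rule fixed) (use Z(2) that in blast)
  have fs: "\<exists>w. g = word_matrix w \<and> pos_word w" if g: "g \<in> S2" for g
  proof -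
    have "g \<in> Gamma B" using S g by blast
    then show ?thesis by (rule Gamma_word) blast
  qed
  obtain u u' where u: "x = word_matrix u" "pos_word u" "length u = l" "x' = word_matrix u'" "pos_word u'" "length u' = l"
    using fx[OF m(1)] fx[OF m(4)] by blast
  obtain v v' where v: "z = word_matrix v" "pos_word v" "length v = k" "z' = word_matrix v'" "pos_word v'" "length v' = k"
    using fz[OF m(3)] fz[OF m(6)] by blast
  obtain t t' where t: "a = word_matrix t" "pos_word t" "a' = word_matrix t'" "pos_word t'"
    using fs[OF m(2)] fs[OF m(5)] by blast
  have "word_matrix (u @ t @ v) = word_matrix (u' @ t' @ v')"
    using eq by (simp add: u v t word_matrix_append matrix_mul_assoc)
  then have "u @ t @ v = u' @ t' @ v'" using u v t by (intro word_matrix_inj) auto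
  then have "u = u'" "t = t'" "v = v'" using u(3,6) v(3,6) by auto
  then show "y = y'" unfolding yy using u v t by simp
qed

lemma triple_product_eq_image:
  "triple_product S1 S2 S3 = (\<lambda>(x, a, z). x ** a ** z) ` (S1 \<times> S2 \<times> S3)"
proof -
  have "(\<lambda>(x, a, z). x ** a ** z) ` (S1 \<times> S2 \<times> S3) \<subseteq> triple_product S1 S2 S3"
    unfolding triple_product_def by (clarsimp, blast)
  moreover have "x ** a ** z \<in> (\<lambda>(x, a, z). x ** a ** z) ` (S1 \<times> S2 \<times> S3)"
    if "x \<in> S1" "a \<in> S2" "z \<in> S3" for x a z
    using that by (intro image_eqI[where x = "(x, a, z)"]) auto
  ultimately show ?thesis unfolding triple_product_def by blast
qed

section \<open>Mertens' theorem for the primes 1 modulo 4\<close>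

text \<open>Summation by parts: as g is nonincreasing, its variation telescopes to g a - g b, and
  the boundary terms at b and at a - 1 supply the rest of 2 C g a.\<close>

lemma abel_sum_le:
  fixes E g :: "nat \<Rightarrow> real"
  assumes "1 \<le> a" "a \<le> b" and E: "\<And>n. a - 1 \<le> n \<Longrightarrow> \<bar>E n\<bar> \<le> C"
    and g: "\<And>n. a \<le> n \<Longrightarrow> g (Suc n) \<le> g n" "\<And>n. a \<le> n \<Longrightarrow> 0 \<le> g n"
  shows "\<bar>\<Sum>n=a..b. (E n - E (n - 1)) * g n\<bar> \<le> 2 * C * g a"
proof -
  let ?s = "\<lambda>b. \<Sum>n=a..b. (E n - E (n - 1)) * g n"
  have "?s b \<le> E b * g b + C * (g a - g b) + C * g a \<and> ?s b \<ge> E b * g b - C * (g a - g b) - C * g a"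
    using assms(2)
  proof (induction b rule: dec_induct)
    case base
    have "\<bar>E (a - 1) * g a\<bar> \<le> C * g a" using E[of "a - 1"] g(2)[of a] by (simp add: abs_mult mult_right_mono)
    then show ?case by (simp add: algebra_simps abs_le_iff)
  next
    case (step n)
    have "\<bar>E n * (g n - g (Suc n))\<bar> \<le> C * (g n - g (Suc n))"
      unfolding abs_mult using E[of n] g(1)[of n] step(1) by (simp add: mult_right_mono)
    then have k: "E n * g n - E n * g (Suc n) \<le> C * g n - C * g (Suc n)"
        "E n * g n - E n * g (Suc n) \<ge> C * g (Suc n) - C * g n"
      by (simp_all add: abs_le_iff algebra_simps)
    have "?s (Suc n) = ?s n + (E (Suc n) * g (Suc n) - E n * g (Suc n))"
      using step(1) by (simp add: algebra_simps)
    then show ?case using step.IH k by (simp add: algebra_simps)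
  qed
  moreover have "\<bar>E b * g b\<bar> \<le> C * g b" using E[of b] g(2)[of b] assms(2) by (simp add: abs_mult mult_right_mono)
  ultimately show ?thesis by (simp add: abs_le_iff algebra_simps)
qed

lemma of_nat_div_bounds:
  "real (n div d) \<le> real n / real d" "real n / real d < real (n div d) + 1"
  using floor_divide_of_nat_eq[where 'a = real, of n d] by linarith+

section \<open>Chebyshev's bound and the von Mangoldt function\<close>

text \<open>The identity ln = \<Lambda> * 1 summed against a weight h. Weight 1 gives ln N!, and a
  character over n gives the twisted Mertens sum.\<close>

lemma sum_ln_eq_sum_mangoldt:
  fixes h :: "nat \<Rightarrow> real"
  shows "(\<Sum>n=1..N. ln (real n) * h n) = (\<Sum>d=1..N. mangoldt d * (\<Sum>m=1..N div d. h (d * m)))"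
proof -
  have "(\<Sum>n=1..N. ln (real n) * h n) = (\<Sum>n=1..N. \<Sum>d | d dvd n. mangoldt d * h n)"
  proof (rule sum.cong[OF refl])
    fix n assume "n \<in> {1..N}"
    then have "ln (real n) = (\<Sum>d | d dvd n. mangoldt d)" using mangoldt_sum[of n, where 'a = real] by simp
    then show "ln (real n) * h n = (\<Sum>d | d dvd n. mangoldt d * h n)" by (simp add: sum_distrib_right)
  qed
  also have "\<dots> = (\<Sum>(n, d)\<in>(SIGMA n:{1..N}. {d. d dvd n}). mangoldt d * h n)"
    by (rule sum.Sigma) auto
  also have "\<dots> = (\<Sum>(d, m)\<in>(SIGMA d:{1..N}. {1..N div d}). mangoldt d * h (d * m))"
  proof (rule sum.reindex_bij_witness[where i = "\<lambda>(d, m). (d * m, d)" and j = "\<lambda>(n, d). (d, n div d)"], goal_cases)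
    case (1 a)
    then show ?case by auto
  next
    case (2 a)
    obtain n d where a: "a = (n, d)" by (cases a)
    then have n: "1 \<le> n" "n \<le> N" "d dvd n" using 2 by auto
    then obtain m where m: "n = d * m" by (elim dvdE)
    then have "1 \<le> d" "1 \<le> m" using n by (auto simp: Suc_le_eq intro: Nat.gr0I)
    moreover have "d * 1 \<le> d * m" using \<open>1 \<le> m\<close> by (intro mult_le_mono2)
    moreover have "m \<le> N div d" using n(2) m \<open>1 \<le> d\<close> by (simp add: less_eq_div_iff_mult_less_eq mult.commute)
    moreover from calculation have "d \<le> N" using n m by linarith
    ultimately show ?case using a m n by simp
  next
    case (3 b)
    then show ?case by auto
  next
    case (4 b)
    obtain d m where b: "b = (d, m)" by (cases b)
    then have n: "1 \<le> d" "1 \<le> m" "m \<le> N div d" using 4 by auto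
    then have "d * m \<le> N" by (simp add: less_eq_div_iff_mult_less_eq mult.commute)
    then show ?case using n b by (auto simp: Suc_le_eq)
  next
    case (5 a)
    then show ?case by auto
  qed
  also have "\<dots> = (\<Sum>d=1..N. \<Sum>m=1..N div d. mangoldt d * h (d * m))"
    by (rule sum.Sigma[symmetric]) auto
  finally show ?thesis by (simp add: sum_distrib_left)
qed

lemma ln_fact_eq_sum_mangoldt: "ln (fact N :: real) = (\<Sum>d=1..N. mangoldt d * real (N div d))"
proof -
  have "ln (fact N :: real) = ln (\<Prod>n=1..N. real n)" by (simp add: fact_prod)
  also have "\<dots> = (\<Sum>n=1..N. ln (real n) * 1)" by (subst ln_prod) auto
  also have "\<dots> = (\<Sum>d=1..N. mangoldt d * real (N div d))"
    by (subst sum_ln_eq_sum_mangoldt) simp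
  finally show ?thesis .
qed

definition psi :: "nat \<Rightarrow> real" where
  "psi n = (\<Sum>d=1..n. mangoldt d)"

lemma psi_mono: "m \<le> n \<Longrightarrow> psi m \<le> psi n"
  unfolding psi_def by (intro sum_mono2) (auto simp: mangoldt_nonneg)

text \<open>The logarithm of the central binomial coefficient is the sum of \<Lambda>(d)
  (floor(2m/d) - 2 floor(m/d)). The bracket is nonnegative and equals 1 for m < d \<le> 2m, while
  the coefficient is at most 4^m.\<close>

lemma psi_double: "psi (2 * m) - psi m \<le> 2 * real m"
proof -
  have split: "{1..2 * m} = {1..m} \<union> {m+1..2*m}" by auto
  have ext: "(\<Sum>d=1..2*m. mangoldt d * real (m div d)) = ln (fact m)"
    unfolding ln_fact_eq_sum_mangoldt by (intro sum.mono_neutral_right) auto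
  have "psi (2 * m) - psi m = (\<Sum>d=m+1..2*m. mangoldt d)"
    unfolding psi_def split by (subst sum.union_disjoint) auto
  also have "\<dots> = (\<Sum>d=m+1..2*m. mangoldt d * (real (2 * m div d) - 2 * real (m div d)))"
  proof (rule sum.cong[OF refl])
    fix d assume d: "d \<in> {m+1..2*m}"
    then have "2 * m div d = 1" by (intro div_nat_eqI) auto
    moreover have "m div d = 0" using d by simp
    ultimately show "mangoldt d = mangoldt d * (real (2 * m div d) - 2 * real (m div d))" by simp
  qed
  also have "\<dots> \<le> (\<Sum>d=1..2*m. mangoldt d * (real (2 * m div d) - 2 * real (m div d)))"
  proof (rule sum_mono2)
    fix d assume "d \<in> {1..2*m} - {m+1..2*m}"
    have "2 * (m div d) \<le> 2 * m div d"
    proof (cases "d = 0")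
      case False
      have "2 * (m div d) * d \<le> 2 * m" by (simp add: mult.assoc)
      then show ?thesis using False by (simp add: less_eq_div_iff_mult_less_eq)
    qed simp
    then have "2 * real (m div d) \<le> real (2 * m div d)" by linarith
    then show "0 \<le> mangoldt d * (real (2 * m div d) - 2 * real (m div d))"
      by (intro mult_nonneg_nonneg mangoldt_nonneg) simp
  qed auto
  also have "\<dots> = ln (fact (2 * m)) - 2 * ln (fact m)"
    unfolding ext[symmetric] ln_fact_eq_sum_mangoldt[of "2 * m"]
    by (simp add: right_diff_distrib sum_subtractf sum_distrib_left mult.left_commute)
  also have "\<dots> = ln (real ((2 * m) choose m))"
    by (simp add: binomial_fact ln_div ln_mult)
  also have "\<dots> \<le> ln (2 ^ (2 * m))"
  proof (subst ln_le_cancel_iff)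
    have "(2 * m) choose m \<le> 2 ^ (2 * m)" by (rule binomial_le_pow2)
    then show "real ((2 * m) choose m) \<le> 2 ^ (2 * m)" by (metis of_nat_le_iff of_nat_numeral of_nat_power)
  qed auto
  also have "\<dots> \<le> 2 * real m" using ln_2_less_1 by (simp add: ln_realpow mult_left_le)
  finally show ?thesis .
qed

lemma psi_le: "psi n \<le> 4 * real n"
proof (induction n rule: less_induct)
  case (less n)
  consider "n = 0" | "n = 1" | "n = 2" | "n \<ge> 3" by linarith
  then show ?case
  proof cases
    case 3
    have "{1..2} = {1, 2 :: nat}" by auto
    then show ?thesis using 3 ln_2_less_1 by (simp add: psi_def)
  next
    case 4
    define m where "m = (n + 1) div 2"
    have m: "m < n" "n \<le> 2 * m" "2 * m \<le> n + 1" using 4 by (auto simp: m_def)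
    have "psi n \<le> psi (2 * m)" by (rule psi_mono[OF m(2)])
    also have "\<dots> \<le> psi m + 2 * real m" using psi_double[of m] by simp
    also have "\<dots> \<le> 6 * real m" using less.IH[OF m(1)] by simp
    also have "\<dots> \<le> 4 * real n" using m(3) 4 by linarith
    finally show ?thesis .
  qed (simp_all add: psi_def)
qed

text \<open>ln N! is the sum of \<Lambda>(d) floor(N/d). Dropping the floors costs at most psi N
  \<le> 4N, and ln N! lies between N ln N - N and N ln N.\<close>

lemma sum_mangoldt_over_n:
  assumes "N \<ge> 1"
  shows "\<bar>(\<Sum>d=1..N. mangoldt d / real d) - ln (real N)\<bar> \<le> 4"
proof -
  let ?S = "\<Sum>d=1..N. mangoldt d / real d :: real"
  have N: "real N > 0" using assms by simp
  have "ln (fact N) \<le> (\<Sum>d=1..N. mangoldt d * (real N / real d))"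
    unfolding ln_fact_eq_sum_mangoldt
    by (intro sum_mono mult_left_mono mangoldt_nonneg of_nat_div_bounds)
  then have up: "ln (fact N) \<le> real N * ?S" by (simp add: sum_distrib_left mult_ac)
  have "(\<Sum>d=1..N. mangoldt d * (real N / real d - 1)) \<le> ln (fact N)"
    unfolding ln_fact_eq_sum_mangoldt
  proof (intro sum_mono mult_left_mono mangoldt_nonneg)
    fix d show "real N / real d - 1 \<le> real (N div d)"
      using of_nat_div_bounds(2)[of N d] by linarith
  qed
  then have lo: "real N * ?S - psi N \<le> ln (fact N)"
    by (simp add: psi_def sum_distrib_left right_diff_distrib sum_subtractf mult_ac)
  have "ln (fact N) \<le> ln (real N ^ N)"
  proof (subst ln_le_cancel_iff)
    show "fact N \<le> real N ^ N" using fact_le_power[of N, where 'a = real] by simp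
  qed (use N in auto)
  then have f1: "ln (fact N) \<le> real N * ln (real N)" using N by (simp add: ln_realpow)
  \<comment> \<open>A single term of the exponential series is enough of Stirling's formula
    here.\<close>
  have "real N ^ N / fact N \<le> exp (real N)"
  proof -
    have "(\<Sum>n\<in>{N}. inverse (fact n) * real N ^ n) \<le> (\<Sum>n. inverse (fact n) * real N ^ n)"
      by (intro sum_le_suminf summable_exp) auto
    then show ?thesis by (simp add: exp_def scaleR_conv_of_real divide_inverse mult.commute)
  qed
  then have "ln (real N ^ N / fact N) \<le> ln (exp (real N))" using N by (subst ln_le_cancel_iff) auto
  then have f2: "real N * ln (real N) - real N \<le> ln (fact N)" using N by (simp add: ln_div ln_realpow)
  have "real N * (?S - ln (real N)) \<le> real N * 4"
    using lo f1 psi_le[of N] by (simp add: algebra_simps)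
  moreover have "real N * (- (?S - ln (real N))) \<le> real N * 4"
    using up f2 N by (simp add: algebra_simps)
  ultimately show ?thesis using N by (simp add: abs_le_iff)
qed

section \<open>The nonprincipal character modulo 4\<close>

definition chi4 :: "nat \<Rightarrow> real" where
  "chi4 n = (if n mod 4 = 1 then 1 else if n mod 4 = 3 then - 1 else 0)"

lemma chi4_mult: "chi4 (m * n) = chi4 m * chi4 n"
proof -
  have m: "m mod 4 \<in> {0, 1, 2, 3}" and n: "n mod 4 \<in> {0, 1, 2, 3}" by auto
  have "m * n mod 4 = (m mod 4) * (n mod 4) mod 4" by (simp add: mod_mult_eq)
  then show ?thesis using m n unfolding chi4_def by (elim insertE emptyE) simp_all
qed

lemma chi4_abs_le: "\<bar>chi4 n\<bar> \<le> 1" by (simp add: chi4_def)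

lemma sum_chi4: "(\<Sum>n=1..N. chi4 n) = (if N mod 4 \<in> {1, 2} then 1 else 0)"
proof (induction N)
  case (Suc N)
  have "N mod 4 = 0 \<or> N mod 4 = 1 \<or> N mod 4 = 2 \<or> N mod 4 = 3" by linarith
  then show ?case using Suc by (elim disjE) (simp_all add: chi4_def mod_Suc)
qed simp

lemma sum_chi4_mult_le:
  assumes "1 \<le> a" "\<And>n. a \<le> n \<Longrightarrow> g (Suc n) \<le> g n" "\<And>n. a \<le> n \<Longrightarrow> 0 \<le> g n"
  shows "\<bar>\<Sum>n=a..b. chi4 n * g n\<bar> \<le> 2 * g a"
proof (cases "a \<le> b")
  case True
  let ?E = "\<lambda>N. \<Sum>n=1..N. chi4 n"
  have "(\<Sum>n=a..b. chi4 n * g n) = (\<Sum>n=a..b. (?E n - ?E (n - 1)) * g n)"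
  proof (rule sum.cong[OF refl])
    fix n assume "n \<in> {a..b}"
    then obtain k where "n = Suc k" using assms(1) by (cases n) auto
    then show "chi4 n * g n = (?E n - ?E (n - 1)) * g n" by simp
  qed
  also have "\<bar>\<dots>\<bar> \<le> 2 * 1 * g a"
  proof (rule abel_sum_le)
    show "\<bar>\<Sum>n=1..N. chi4 n\<bar> \<le> 1" for N unfolding sum_chi4 by simp
  qed (use assms True in auto)
  finally show ?thesis by simp
next
  case False
  then show ?thesis using assms(3)[of a] by simp
qed

lemma sum_chi4_over_n_tail:
  assumes "M \<le> N"
  shows "\<bar>(\<Sum>n=1..N. chi4 n / real n) - (\<Sum>n=1..M. chi4 n / real n)\<bar> \<le> 2 / (real M + 1)"
proof -
  have "{1..N} = {1..M} \<union> {M+1..N}" using assms by auto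
  then have "(\<Sum>n=1..N. chi4 n / real n) - (\<Sum>n=1..M. chi4 n / real n) = (\<Sum>n=M+1..N. chi4 n / real n)"
    by (simp add: sum.union_disjoint)
  also have "\<dots> = (\<Sum>n=M+1..N. chi4 n * (1 / real n))" by simp
  also have "\<bar>\<dots>\<bar> \<le> 2 * (1 / real (M + 1))"
    by (rule sum_chi4_mult_le) (auto simp: frac_le)
  finally show ?thesis by (simp add: add.commute)
qed

text \<open>An explicit form of L(1, \<chi>) > 0: the sum up to 2 is 1, and the tail beyond it is at
  most 2/3.\<close>

lemma sum_chi4_over_n_ge:
  assumes "N \<ge> 1"
  shows "1 / 3 \<le> (\<Sum>n=1..N. chi4 n / real n)"
proof (cases "N = 1")
  case True
  then show ?thesis by (simp add: chi4_def)
next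
  case False
  have "{1..2} = {1, 2 :: nat}" by auto
  then have "(\<Sum>n=1..2. chi4 n / real n) = 1" by (simp add: chi4_def)
  then show ?thesis using sum_chi4_over_n_tail[of 2 N] assms False unfolding abs_le_iff by simp
qed

lemma ln_over_n_antimono:
  assumes "n \<ge> 3" shows "ln (real (Suc n)) / real (Suc n) \<le> ln (real n) / real n"
proof -
  have "exp 1 \<le> (3 :: real)" using exp_le by simp
  then have "1 \<le> ln (real n)" using assms by (subst ln_ge_iff) auto
  have n: "real n > 0" using assms by simp
  have "ln (real (Suc n)) = ln (real n) + ln (1 + 1 / real n)"
  proof -
    have "real (Suc n) = real n * (1 + 1 / real n)" using n by (simp add: field_simps)
    moreover have "1 + 1 / real n > 0" using n by (simp add: add_pos_pos)
    ultimately show ?thesis using n by (simp only: ln_mult_pos)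
  qed
  also have "\<dots> \<le> ln (real n) + 1 / real n" using n by (simp add: ln_add_one_self_le_self)
  finally have "real n * ln (real (Suc n)) \<le> real n * (ln (real n) + 1 / real n)" using n by (intro mult_left_mono) auto
  also have "\<dots> = real n * ln (real n) + 1" using n by (simp add: field_simps)
  also have "\<dots> \<le> real (Suc n) * ln (real n)" using \<open>1 \<le> ln (real n)\<close> by (simp add: algebra_simps)
  finally show ?thesis using n by (simp add: field_simps)
qed

text \<open>The convergent sum of \<chi>(n) ln n / n equals the sum of \<chi>(d) \<Lambda>(d)/d
  times c(N/d). Replacing c(N/d) by c(N) costs at most 8 by Chebyshev's bound, and c(N) \<ge> 1/3
  may be divided out: 3 (2 + 8) = 30.\<close>

lemma sum_chi4_mangoldt_over_n:
  assumes "N \<ge> 1"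
  shows "\<bar>\<Sum>d=1..N. chi4 d * mangoldt d / real d\<bar> \<le> 30"
proof -
  define c where "c M = (\<Sum>n=1..M. chi4 n / real n)" for M
  let ?S = "\<Sum>d=1..N. chi4 d * mangoldt d / real d :: real"
  have N: "real N > 0" using assms by simp
  have "(\<Sum>n=1..N. ln (real n) * (chi4 n / real n)) = (\<Sum>d=1..N. mangoldt d * (\<Sum>m=1..N div d. chi4 (d * m) / real (d * m)))"
    by (rule sum_ln_eq_sum_mangoldt)
  also have "\<dots> = (\<Sum>d=1..N. chi4 d * mangoldt d / real d * c (N div d))"
    unfolding c_def by (simp add: chi4_mult sum_distrib_left mult_ac)
  finally have id: "(\<Sum>n=1..N. ln (real n) * (chi4 n / real n)) = (\<Sum>d=1..N. chi4 d * mangoldt d / real d * c (N div d))" .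
  have lhs: "\<bar>\<Sum>n=1..N. ln (real n) * (chi4 n / real n)\<bar> \<le> 2"
  proof -
    \<comment> \<open>The terms n = 1 (ln 1 = 0) and n = 2 (even) vanish, and ln n / n decreases
      from n = 3 on.\<close>
    have "(\<Sum>n=1..N. ln (real n) * (chi4 n / real n)) = (\<Sum>n\<in>{3..N}. chi4 n * (ln (real n) / real n))"
    proof (rule sum.mono_neutral_cong_right)
      show "\<forall>i\<in>{1..N} - {3..N}. ln (real i) * (chi4 i / real i) = 0"
      proof
        fix i assume "i \<in> {1..N} - {3..N}"
        then have "i = 1 \<or> i = 2" by auto
        then show "ln (real i) * (chi4 i / real i) = 0" by (auto simp: chi4_def)
      qed
    qed auto
    also have "\<bar>\<dots>\<bar> \<le> 2 * (ln (real 3) / real 3)"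
      by (intro sum_chi4_mult_le ln_over_n_antimono) auto
    also have "\<dots> \<le> 2" using ln_le_minus_one[of 3] by simp
    finally show ?thesis .
  qed
  have diff: "\<bar>(\<Sum>d=1..N. chi4 d * mangoldt d / real d * c (N div d)) - c N * ?S\<bar> \<le> 8"
  proof -
    have "\<bar>(\<Sum>d=1..N. chi4 d * mangoldt d / real d * c (N div d)) - c N * ?S\<bar> =
      \<bar>\<Sum>d=1..N. chi4 d * mangoldt d / real d * (c (N div d) - c N)\<bar>"
      by (simp only: sum_distrib_left right_diff_distrib left_diff_distrib sum_subtractf mult.commute)
    also have "\<dots> \<le> (\<Sum>d=1..N. \<bar>chi4 d * mangoldt d / real d * (c (N div d) - c N)\<bar>)" by (rule sum_abs)
    also have "\<dots> \<le> (\<Sum>d=1..N. mangoldt d * (2 / real N))"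
    proof (rule sum_mono)
      fix d assume d: "d \<in> {1..N}"
      then have d0: "real d > 0" by simp
      have "N div d \<le> N" by simp
      then have "\<bar>c (N div d) - c N\<bar> \<le> 2 / (real (N div d) + 1)"
        unfolding c_def using sum_chi4_over_n_tail[of "N div d" N] by (simp add: abs_minus_commute)
      also have "\<dots> \<le> 2 / (real N / real d)"
        using N d0 of_nat_div_bounds(2)[of N d] by (intro divide_left_mono) (auto intro!: mult_pos_pos add_nonneg_pos divide_pos_pos)
      finally have "\<bar>c (N div d) - c N\<bar> / real d \<le> 2 / real N"
        using d0 N by (simp add: field_simps)
      moreover have "\<bar>chi4 d * mangoldt d\<bar> \<le> mangoldt d"
        unfolding abs_mult using mult_right_mono[OF chi4_abs_le[of d] mangoldt_nonneg[of d]] by simp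
      ultimately have "\<bar>chi4 d * mangoldt d\<bar> * (\<bar>c (N div d) - c N\<bar> / real d) \<le> mangoldt d * (2 / real N)"
        by (intro mult_mono) (auto simp: mangoldt_nonneg)
      then show "\<bar>chi4 d * mangoldt d / real d * (c (N div d) - c N)\<bar> \<le> mangoldt d * (2 / real N)"
        using d0 by (simp add: abs_mult)
    qed
    also have "\<dots> = psi N * (2 / real N)" unfolding psi_def by (rule sum_distrib_right[symmetric])
    also have "\<dots> \<le> 4 * real N * (2 / real N)" by (intro mult_right_mono psi_le) simp
    also have "\<dots> = 8" using N by simp
    finally show ?thesis .
  qed
  have "\<bar>c N * ?S\<bar> \<le> 10" using lhs diff id by (simp add: abs_le_iff)
  moreover have "1 / 3 * \<bar>?S\<bar> \<le> c N * \<bar>?S\<bar>"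
    using sum_chi4_over_n_ge[OF assms] by (intro mult_right_mono) (auto simp: c_def)
  moreover have "c N \<ge> 0" using sum_chi4_over_n_ge[OF assms] by (simp add: c_def)
  ultimately show ?thesis by (simp add: abs_mult)
qed

text \<open>The weight 1 + \<chi> equals 2 at primes 1 modulo 4, while by the two Mertens sums the
  weighted sum of \<Lambda>(n)/n is still ln N + O(1). Summation by parts against 1/ln n then gives
  ln ln.\<close>

lemma sum_split_primes_le:
  fixes w z :: real
  assumes "2 \<le> w" "w < z"
  shows "(\<Sum>p | prime p \<and> w \<le> real p \<and> real p < z \<and> p mod 4 = 1. 2 / real p) \<le> ln (ln z / ln w) + 200"
proof -
  define f :: "nat \<Rightarrow> real" where "f n = (1 + chi4 n) * mangoldt n / real n" for n
  define D where "D N = (\<Sum>n=1..N. f n)" for N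
  define E where "E N = D N - ln (real N)" for N
  define a b where "a = nat \<lceil>w\<rceil>" and "b = nat \<lceil>z\<rceil> - 1"
  have a: "real a \<ge> w" "a \<ge> 2" using assms unfolding a_def by linarith+
  have zz: "real b < z" using assms unfolding b_def by linarith
  have f0: "f n \<ge> 0" for n
    using chi4_abs_le[of n] by (auto simp: f_def mangoldt_nonneg intro!: divide_nonneg_nonneg mult_nonneg_nonneg)
  let ?P = "{p. prime p \<and> w \<le> real p \<and> real p < z \<and> p mod 4 = 1}"
  have sub: "?P \<subseteq> {a..b}"
  proof
    fix p assume "p \<in> ?P"
    then show "p \<in> {a..b}" unfolding a_def b_def by (simp; linarith)
  qed
  have lnw: "ln w > 0" "ln w < ln z" using assms by auto
  have rhs0: "0 \<le> ln (ln z / ln w)" using lnw by (intro ln_ge_zero) auto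
  show ?thesis
  proof (cases "a \<le> b")
    case False
    then have "?P = {}" using sub by auto
    then show ?thesis unfolding \<open>?P = {}\<close> using rhs0 by simp
  next
    case True
    \<comment> \<open>34 = 4 + 30, the two bounds for the untwisted and the twisted sum.\<close>
    have E: "\<bar>E n\<bar> \<le> 34" if "n \<ge> 1" for n
    proof -
      have "D n = (\<Sum>d=1..n. mangoldt d / real d) + (\<Sum>d=1..n. chi4 d * mangoldt d / real d)"
        unfolding D_def f_def by (simp add: ring_distribs add_divide_distrib sum.distrib)
      then show ?thesis using sum_mangoldt_over_n[OF that] sum_chi4_mangoldt_over_n[OF that]
        unfolding E_def by (simp add: abs_le_iff)
    qed
    have "(\<Sum>p\<in>?P. 2 / real p) = (\<Sum>p\<in>?P. f p * (1 / ln (real p)))"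
    proof (rule sum.cong[OF refl])
      fix p assume "p \<in> ?P"
      then have "prime p" "p mod 4 = 1" by auto
      moreover have "ln (real p) > 0" using prime_gt_1_nat[OF \<open>prime p\<close>] by simp
      ultimately show "2 / real p = f p * (1 / ln (real p))" by (simp add: f_def chi4_def)
    qed
    also have "\<dots> \<le> (\<Sum>n=a..b. f n * (1 / ln (real n)))"
      using sub f0 a by (intro sum_mono2) auto
    also have "\<dots> = (\<Sum>n=a..b. (E n - E (n - 1)) * (1 / ln (real n))) + (\<Sum>n=a..b. (ln (real n) - ln (real (n - 1))) / ln (real n))"
      unfolding sum.distrib[symmetric]
    proof (rule sum.cong[OF refl])
      fix n assume "n \<in> {a..b}"
      then obtain k where "n = Suc k" using a(2) by (cases n) auto
      then have "f n = (E n - E (n - 1)) + (ln (real n) - ln (real (n - 1)))" by (simp add: E_def D_def)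
      then show "f n * (1 / ln (real n)) = (E n - E (n - 1)) * (1 / ln (real n)) + (ln (real n) - ln (real (n - 1))) / ln (real n)"
        by (simp add: add_divide_distrib)
    qed
    also have "(\<Sum>n=a..b. (E n - E (n - 1)) * (1 / ln (real n))) \<le> 2 * 34 * (1 / ln (real a))"
    proof -
      have "\<bar>\<Sum>n=a..b. (E n - E (n - 1)) * (1 / ln (real n))\<bar> \<le> 2 * 34 * (1 / ln (real a))"
      proof (rule abel_sum_le)
        show "\<bar>E n\<bar> \<le> 34" if "a - 1 \<le> n" for n using E that a(2) by simp
        show "1 / ln (real (Suc n)) \<le> 1 / ln (real n)" if "a \<le> n" for n
          using that a(2) by (intro divide_left_mono) auto
      qed (use a True in auto)
      then show ?thesis by linarith
    qed
    also have "2 * 34 * (1 / ln (real a)) \<le> 2 * 34 * 2"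
    proof -
      have "1 / 2 \<le> ln (2 :: real)" using ln_one_minus_pos_upper_bound[of "1/2"] by (simp add: ln_div)
      also have "\<dots> \<le> ln (real a)" using a by simp
      finally have "1 / 2 \<le> ln (real a)" .
      then show ?thesis by (simp add: field_simps)
    qed
    \<comment> \<open>A discrete integral of dL/L with L = ln n: for consecutive values v < u of L,
      (u - v)/u \<le> ln u - ln v, which telescopes. The term n = a is at most 1.\<close>
    also have "(\<Sum>n=a..b. (ln (real n) - ln (real (n - 1))) / ln (real n)) \<le> 1 + (ln (ln (real b)) - ln (ln (real a)))"
      using True
    proof (induction b rule: dec_induct)
      case base
      have "ln (real (a - 1)) \<ge> 0" "ln (real a) > 0" using a(2) by auto
      then show ?case by (simp add: field_simps)
    next
      case (step n)
      have n: "n \<ge> 2" using step a by simp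
      define u v where "u = ln (real (Suc n))" and "v = ln (real n)"
      have uv: "u > 0" "v > 0" using n by (auto simp: u_def v_def)
      have "ln (v / u) \<le> v / u - 1" using uv by (intro ln_le_minus_one) simp
      then have "(u - v) / u \<le> ln u - ln v" using uv by (simp add: ln_div diff_divide_distrib)
      then show ?case using step by (simp add: u_def v_def)
    qed
    also have "ln (ln (real b)) - ln (ln (real a)) \<le> ln (ln z) - ln (ln w)"
    proof -
      have "real a \<le> real b" using True by simp
      then have "ln (real b) > 0" "ln (real b) \<le> ln z" "ln w \<le> ln (real a)" using a zz assms by auto
      then show ?thesis using lnw by (intro diff_mono) auto
    qed
    finally have "(\<Sum>p\<in>?P. 2 / real p) \<le> 137 + (ln (ln z) - ln (ln w))" by simp
    then show ?thesis using lnw by (simp add: ln_div)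
  qed
qed


section \<open>The product over primes\<close>

text \<open>The product (1 - x)(1 + x + 3 x^2) equals 1 + x^2 (2 - 3 x), which is at least 1 exactly
  up to x = 2/3 on the positive axis.\<close>

lemma inverse_one_minus_le_exp:
  fixes x :: real
  assumes "0 \<le> x" "x \<le> 2 / 3"
  shows "inverse (1 - x) \<le> exp (x + 3 * x\<^sup>2)"
proof -
  have "1 \<le> (1 - x) * (1 + (x + 3 * x\<^sup>2))"
  proof -
    have "(1 - x) * (1 + (x + 3 * x\<^sup>2)) = 1 + x\<^sup>2 * (2 - 3 * x)"
      by (simp add: algebra_simps power2_eq_square)
    moreover have "0 \<le> x\<^sup>2 * (2 - 3 * x)" using assms by (intro mult_nonneg_nonneg) auto
    ultimately show ?thesis by linarith
  qed
  then have "inverse (1 - x) \<le> 1 + (x + 3 * x\<^sup>2)"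
    using assms by (simp add: field_simps)
  also have "\<dots> \<le> exp (x + 3 * x\<^sup>2)" by (rule exp_ge_add_one_self)
  finally show ?thesis .
qed

lemma sum_inverse_square_tail_le:
  assumes "finite P" "t \<ge> 1" "\<And>n. n \<in> P \<Longrightarrow> t < real n"
  shows "(\<Sum>n\<in>P. 1 / (real n)\<^sup>2) \<le> 2 / t"
proof (cases "P = {}")
  case False
  define m where "m = nat \<lfloor>t\<rfloor>"
  define M where "M = Max P"
  have m: "real m \<le> t" "t < real m + 1" "m \<ge> 1" using assms(2) unfolding m_def by linarith+
  have sub: "P \<subseteq> {Suc m..M}"
  proof
    fix n assume "n \<in> P"
    then have "n \<le> M" "t < real n" using assms unfolding M_def by auto
    then have "real m < real n" using m(1) by linarith
    then show "n \<in> {Suc m..M}" using \<open>n \<le> M\<close> by simp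
  qed
  then have mM: "Suc m \<le> M" using False by (auto simp: subset_iff)
  have "(\<Sum>n\<in>P. 1 / (real n)\<^sup>2) \<le> (\<Sum>n=Suc m..M. 1 / (real n)\<^sup>2)"
    using sub by (intro sum_mono2) auto
  also have "\<dots> \<le> 1 / real m - 1 / real M"
    using mM
  proof (induction M rule: dec_induct)
    case base
    have "1 / (real (Suc m))\<^sup>2 \<le> 1 / (real m * real (Suc m))"
      using m by (intro divide_left_mono) (auto simp: power2_eq_square)
    also have "\<dots> = 1 / real m - 1 / real (Suc m)" using m by (simp add: field_simps)
    finally show ?case by simp
  next
    case (step n)
    have n: "real n > 0" using step by simp
    have "1 / (real (Suc n))\<^sup>2 \<le> 1 / (real n * real (Suc n))"
      using n by (intro divide_left_mono) (auto simp: power2_eq_square)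
    also have "\<dots> = 1 / real n - 1 / real (Suc n)" using n by (simp add: field_simps)
    finally show ?case using step by simp
  qed
  also have "\<dots> \<le> 1 / real m" by simp
  also have "\<dots> \<le> 2 / t"
  proof -
    have "1 \<le> real m" using m(3) by simp
    then have "t \<le> 2 * real m" using m(2) by linarith
    moreover have "1 / real m = 2 / (2 * real m)" by simp
    ultimately show ?thesis using assms(2) by (simp only:) (intro divide_left_mono mult_pos_pos, use \<open>1 \<le> real m\<close> in auto)
  qed
  finally show ?thesis .
qed (use assms in simp)

text \<open>After exponentiation a split prime contributes 4/p, twice the summand of
  \<open>sum_split_primes_le\<close>, hence the square; all else is O(1/p^2). The prime 2, whose
  density is only known to be below 1, is split off.\<close>

lemma dens_mertens:
  "\<exists>C. \<forall>w z :: real. 2 \<le> w \<and> w < z \<longrightarrow>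
     (\<Prod>p | prime p \<and> w \<le> real p \<and> real p < z. inverse (1 - dens p)) \<le> C * (ln z / ln w)\<^sup>2"
proof -
  \<comment> \<open>512 = 2 * 200 + 112, where 112 = 56 * 2 bounds the sum of 56/p^2; the
    coefficient 56 covers 3 * 16 at split and 4 * 8 at inert primes.\<close>
  define K where "K = inverse (1 - dens 2) * exp 512"
  have "(\<Prod>p | prime p \<and> w \<le> real p \<and> real p < z. inverse (1 - dens p)) \<le> K * (ln z / ln w)\<^sup>2"
    if wz: "2 \<le> w" "w < z" for w z :: real
  proof -
    let ?P = "{p. prime p \<and> w \<le> real p \<and> real p < z}" and ?S = "{p. prime p \<and> w \<le> real p \<and> real p < z \<and> p mod 4 = 1}"
    have fin: "finite ?P"
    proof (rule finite_subset)
      show "?P \<subseteq> {..nat \<lceil>z\<rceil>}" by (auto; linarith)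
    qed simp
    have pos: "inverse (1 - dens p) > 0" if "prime p" for p using dens_less_1[OF that] by simp
    have ge1: "inverse (1 - dens 2) \<ge> 1" using dens_less_1[of 2] dens_nonneg[of 2] by (simp add: one_le_inverse)
    have each: "inverse (1 - dens p) \<le> exp ((if p mod 4 = 1 then 4 / real p else 0) + 56 * (1 / (real p)\<^sup>2))"
      if "p \<in> ?P - {2}" for p
    proof -
      have p: "prime p" "p \<noteq> 2" using that by auto
      then have "p \<ge> 3" using prime_ge_2_nat[of p] by linarith
      then have pp: "real p \<ge> 3" by simp
      have s: "1 / (real p)\<^sup>2 \<ge> 0" by simp
      have "dens p + 3 * (dens p)\<^sup>2 \<le> (if p mod 4 = 1 then 4 / real p else 0) + 56 * (1 / (real p)\<^sup>2)"
      proof (cases "p mod 4 = 1")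
        case True
        have d: "dens p \<le> 4 / real p"
          using dens_split_le[OF p(1) True] pp by (elim order_trans) (simp add: frac_le)
        then have "(dens p)\<^sup>2 \<le> (4 / real p)\<^sup>2" by (intro power_mono dens_nonneg)
        also have "\<dots> = 16 * (1 / (real p)\<^sup>2)" by (simp add: power_divide)
        finally have "3 * (dens p)\<^sup>2 \<le> 56 * (1 / (real p)\<^sup>2)"
          using s by linarith
        then show ?thesis using True d by simp
      next
        case False
        have "9 \<le> (real p)\<^sup>2" using power_mono[OF pp, of 2] by simp
        have frac: "4 / (P - 1) \<le> 8 * (1 / P)" if "9 \<le> P" for P :: real
          using that by (simp add: field_simps)
        have d: "dens p \<le> 8 * (1 / (real p)\<^sup>2)"
          using dens_inert_le[OF p False] frac[OF \<open>9 \<le> (real p)\<^sup>2\<close>] by linarith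
        have "(dens p)\<^sup>2 \<le> dens p * 1"
          unfolding power2_eq_square using dens_less_1[OF p(1)] dens_nonneg[of p] by (intro mult_left_mono) auto
        then have "dens p + 3 * (dens p)\<^sup>2 \<le> 4 * (8 * (1 / (real p)\<^sup>2))" using d by linarith
        also have "\<dots> \<le> 56 * (1 / (real p)\<^sup>2)" using s by linarith
        finally show ?thesis using False by simp
      qed
      then show ?thesis
        using inverse_one_minus_le_exp[OF dens_nonneg dens_odd_le[OF p]] by (elim order_trans) simp
    qed
    have first: "(\<Prod>p\<in>?P. inverse (1 - dens p)) \<le> inverse (1 - dens 2) * (\<Prod>p\<in>?P - {2}. inverse (1 - dens p))"
    proof (cases "2 \<in> ?P")
      case True
      show ?thesis unfolding prod.remove[OF fin True] by simp
    next
      case False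
      have "0 \<le> (\<Prod>p\<in>?P. inverse (1 - dens p))" using pos by (intro prod_nonneg) (auto intro: less_imp_le)
      then have "1 * (\<Prod>p\<in>?P. inverse (1 - dens p)) \<le> inverse (1 - dens 2) * (\<Prod>p\<in>?P. inverse (1 - dens p))"
        by (rule mult_right_mono[OF ge1])
      moreover have "?P - {2} = ?P" using False by blast
      ultimately show ?thesis by (simp only: mult_1)
    qed
    have "(\<Prod>p\<in>?P - {2}. inverse (1 - dens p)) \<le>
       (\<Prod>p\<in>?P - {2}. exp ((if p mod 4 = 1 then 4 / real p else 0) + 56 * (1 / (real p)\<^sup>2)))"
      using pos each by (intro prod_mono) (auto intro: less_imp_le)
    also have "\<dots> = exp (\<Sum>p\<in>?P - {2}. (if p mod 4 = 1 then 4 / real p else 0) + 56 * (1 / (real p)\<^sup>2))"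
      using fin by (simp add: exp_sum)
    also have "\<dots> \<le> exp (2 * (ln (ln z / ln w) + 200) + 112)"
    proof (subst exp_le_cancel_iff)
      have "(\<Sum>p\<in>?P - {2}. if p mod 4 = 1 then 4 / real p else 0) \<le> (\<Sum>p\<in>?P. if p mod 4 = 1 then 4 / real p else 0)"
        using fin by (intro sum_mono2) auto
      also have "\<dots> = (\<Sum>p\<in>?S. 4 / real p)"
        using fin by (intro sum.mono_neutral_cong_right) auto
      also have "\<dots> = 2 * (\<Sum>p\<in>?S. 2 / real p)" by (simp add: sum_distrib_left)
      also have "\<dots> \<le> 2 * (ln (ln z / ln w) + 200)" using sum_split_primes_le[OF wz] by simp
      finally have "(\<Sum>p\<in>?P - {2}. if p mod 4 = 1 then 4 / real p else 0) \<le> 2 * (ln (ln z / ln w) + 200)" .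
      moreover have "(\<Sum>p\<in>?P - {2}. 56 * (1 / (real p)\<^sup>2)) \<le> 56 * (2 / 1)"
        unfolding sum_distrib_left[symmetric] using fin
        by (intro mult_left_mono sum_inverse_square_tail_le) (auto dest: prime_gt_1_nat)
      ultimately show "(\<Sum>p\<in>?P - {2}. (if p mod 4 = 1 then 4 / real p else 0) + 56 * (1 / (real p)\<^sup>2)) \<le>
       2 * (ln (ln z / ln w) + 200) + 112" unfolding sum.distrib by linarith
    qed
    also have "exp (2 * (ln (ln z / ln w) + 200) + 112) = (ln z / ln w)\<^sup>2 * exp 512"
    proof -
      have "0 < ln z / ln w" using wz by simp
      then have "exp (2 * ln (ln z / ln w)) = (ln z / ln w)\<^sup>2" by (simp add: exp_double)
      moreover have "2 * (ln (ln z / ln w) + 200) + 112 = 2 * ln (ln z / ln w) + 512" by simp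
      ultimately show ?thesis by (simp only: exp_add)
    qed
    finally have "inverse (1 - dens 2) * (\<Prod>p\<in>?P - {2}. inverse (1 - dens p)) \<le>
        inverse (1 - dens 2) * ((ln z / ln w)\<^sup>2 * exp 512)"
      by (rule mult_left_mono) (use ge1 in linarith)
    then show ?thesis using first by (simp add: K_def mult_ac)
  qed
  then show ?thesis by blast
qed

section \<open>The dimension of the set of bounded continued fractions\<close>

text \<open>Words are stored with the last digit first; the components of \<open>cden\<close> and \<open>cnum\<close> belong to the
  last and to the last but one convergent. Up to a constant factor, \<open>clen w\<close> is the length of the interval of all
  continued fractions starting with \<open>w\<close>.\<close>

primrec cden :: "nat list \<Rightarrow> real \<times> real" where
  "cden [] = (1, 0)"
| "cden (b # w) = (real b * fst (cden w) + snd (cden w), fst (cden w))"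

primrec cnum :: "nat list \<Rightarrow> real \<times> real" where
  "cnum [] = (0, 1)"
| "cnum (b # w) = (real b * fst (cnum w) + snd (cnum w), fst (cnum w))"

text \<open>The Moebius map that sends the value t of the tail to the value of the whole continued
  fraction with initial digits w.\<close>

definition cfrac :: "nat list \<Rightarrow> real \<Rightarrow> real" where
  "cfrac w t = (fst (cnum w) + snd (cnum w) * t) / (fst (cden w) + snd (cden w) * t)"

definition clen :: "nat list \<Rightarrow> real" where
  "clen w = 1 / (fst (cden w) * (fst (cden w) + snd (cden w)))"

definition digits :: "nat \<Rightarrow> nat list \<Rightarrow> bool" where
  "digits A w \<longleftrightarrow> set w \<subseteq> {1..A}"

lemma digits_simps [simp]: "digits A []" "digits A (b # w) \<longleftrightarrow> 1 \<le> b \<and> b \<le> A \<and> digits A w"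
  by (auto simp: digits_def)

lemma cden_bounds:
  assumes "digits A w" shows "1 \<le> fst (cden w) \<and> 0 \<le> snd (cden w) \<and> snd (cden w) \<le> fst (cden w)"
  using assms
proof (induction w)
  case (Cons b w)
  have "1 * fst (cden w) \<le> real b * fst (cden w)" using Cons by (intro mult_right_mono) auto
  moreover have "1 \<le> fst (cden w)" "0 \<le> snd (cden w)" using Cons by auto
  ultimately show ?case unfolding cden.simps fst_conv snd_conv by linarith
qed simp

lemma cden_cnum_det: "\<bar>fst (cnum w) * snd (cden w) - snd (cnum w) * fst (cden w)\<bar> = 1"
proof (induction w)
  case (Cons b w)
  have "fst (cnum (b # w)) * snd (cden (b # w)) - snd (cnum (b # w)) * fst (cden (b # w)) =
      - (fst (cnum w) * snd (cden w) - snd (cnum w) * fst (cden w))"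
    by (simp add: algebra_simps)
  then show ?case using Cons by (simp only: abs_minus_cancel)
qed simp

lemma clen_pos: "digits A w \<Longrightarrow> clen w > 0"
  using cden_bounds[of A w] unfolding clen_def by (intro divide_pos_pos mult_pos_pos) auto

lemma clen_Nil [simp]: "clen [] = 1" by (simp add: clen_def)

lemma clen_Cons:
  assumes "digits A w" "b \<ge> 1"
  shows "clen (b # w) = (1 / fst (cden w)) * (1 / (real b * fst (cden w) + snd (cden w)) - 1 / (real (Suc b) * fst (cden w) + snd (cden w)))"
proof -
  define q r where "q = fst (cden w)" and "r = snd (cden w)"
  have q: "q \<ge> 1" "r \<ge> 0" using cden_bounds[OF assms(1)] by (auto simp: q_def r_def)
  define u where "u = real b * q + r"
  have u: "u > 0" using q assms(2) by (auto simp: u_def intro!: add_pos_nonneg mult_pos_pos)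
  have "1 / (u * (u + q)) = (1 / q) * (1 / u - 1 / (u + q))"
    using u q by (simp add: field_simps)
  moreover have "real (Suc b) * q + r = u + q" by (simp add: u_def algebra_simps)
  ultimately show ?thesis unfolding clen_def by (simp add: u_def q_def r_def)
qed

lemma clen_Cons_le:
  assumes "digits A w" "b \<ge> 1" shows "clen (b # w) \<le> clen w / 2"
proof -
  define q r where "q = fst (cden w)" and "r = snd (cden w)"
  have q: "q \<ge> 1" "r \<ge> 0" using cden_bounds[OF assms(1)] by (auto simp: q_def r_def)
  define u where "u = real b * q + r"
  have "1 * q \<le> real b * q" using q assms(2) by (intro mult_right_mono) auto
  then have u: "u \<ge> q + r" by (simp add: u_def)
  have "2 * (q * (q + r)) \<le> u * (u + q)"
  proof -
    have "(q + r) * (2 * q) \<le> u * (u + q)" using u q by (intro mult_mono) auto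
    then show ?thesis by (simp add: mult_ac)
  qed
  moreover have "0 < 2 * (q * (q + r))" using q by (intro mult_pos_pos) auto
  ultimately have "1 / (u * (u + q)) \<le> 1 / (2 * (q * (q + r)))" by (intro frac_le) auto
  then show ?thesis unfolding clen_def by (simp add: u_def q_def r_def mult.commute)
qed

lemma clen_le: "digits A w \<Longrightarrow> clen w \<le> (1 / 2) ^ length w"
proof (induction w)
  case (Cons b w)
  then have "clen (b # w) \<le> clen w / 2" "clen w \<le> (1 / 2) ^ length w" using clen_Cons_le[of A w b] by auto
  then show ?case by simp
qed simp

text \<open>By partial fractions the lengths of the children telescope in the digit; the digits
  above A account for a proportion of at most 2/(A + 1).\<close>

lemma sum_clen_Cons:
  assumes "digits A w" "A \<ge> 1"
  shows "(1 - 2 / (real A + 1)) * clen w \<le> (\<Sum>b=1..A. clen (b # w))"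
proof -
  define q r where "q = fst (cden w)" and "r = snd (cden w)"
  have q: "q \<ge> 1" "r \<ge> 0" "r \<le> q" using cden_bounds[OF assms(1)] by (auto simp: q_def r_def)
  define g where "g b = - (1 / (real b * q + r))" for b
  have "(\<Sum>b=1..A. clen (b # w)) = (\<Sum>b=1..A. (1 / q) * (g (Suc b) - g b))"
    by (rule sum.cong[OF refl], subst clen_Cons[OF assms(1)]) (auto simp: g_def q_def r_def)
  also have "\<dots> = (1 / q) * (\<Sum>b=1..A. g (Suc b) - g b)" by (simp only: sum_distrib_left)
  also have "(\<Sum>b=1..A. g (Suc b) - g b) = g (Suc A) - g 1" using assms(2) by (intro sum_Suc_diff) simp
  finally have eq: "(\<Sum>b=1..A. clen (b # w)) = (1 / q) * (1 / (q + r) - 1 / (real (Suc A) * q + r))"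
    by (simp add: g_def)
  have Q: "0 < q + r" "0 < real (Suc A) * q + r" "0 < real (Suc A) * q" using q by (auto intro!: add_pos_nonneg)
  have "1 / (real (Suc A) * q + r) \<le> 2 / (real A + 1) * (1 / (q + r))"
  proof -
    have "1 / (real (Suc A) * q + r) \<le> 1 / (real (Suc A) * q)" using Q q by (intro divide_left_mono) auto
    also have "\<dots> = 2 / (real (Suc A) * (2 * q))" by simp
    also have "\<dots> \<le> 2 / (real (Suc A) * (q + r))"
      using Q q by (intro divide_left_mono mult_left_mono mult_pos_pos) auto
    also have "\<dots> = 2 / (real A + 1) * (1 / (q + r))" by (simp add: add.commute)
    finally show ?thesis .
  qed
  then have "(1 - 2 / (real A + 1)) * (1 / (q + r)) \<le> 1 / (q + r) - 1 / (real (Suc A) * q + r)"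
    by (simp only: left_diff_distrib mult_1 diff_left_mono)
  then have "(1 / q) * ((1 - 2 / (real A + 1)) * (1 / (q + r))) \<le> (\<Sum>b=1..A. clen (b # w))"
    unfolding eq using q by (intro mult_left_mono) auto
  moreover have "(1 / q) * ((1 - 2 / (real A + 1)) * (1 / (q + r))) = (1 - 2 / (real A + 1)) * clen w"
    by (simp add: clen_def q_def r_def)
  ultimately show ?thesis by simp
qed

lemma cfrac_Nil [simp]: "cfrac [] t = t" by (simp add: cfrac_def)

lemma cfrac_Cons:
  assumes "digits A w" "b \<ge> 1" "t \<ge> 0" shows "cfrac (b # w) t = cfrac w (1 / (real b + t))"
proof -
  have s: "real b + t > 0" using assms by simp
  have "cfrac w (1 / (real b + t)) = ((fst (cnum w) + snd (cnum w) * (1 / (real b + t))) * (real b + t)) /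
      ((fst (cden w) + snd (cden w) * (1 / (real b + t))) * (real b + t))"
    unfolding cfrac_def using s by (subst mult_divide_mult_cancel_right) auto
  also have "\<dots> = cfrac (b # w) t"
  proof -
    have k: "(m + n * (1 / (real b + t))) * (real b + t) = real b * m + n + m * t" for m n
      using s by (simp add: distrib_right) (simp add: algebra_simps)
    show ?thesis unfolding cfrac_def k by simp
  qed
  finally show ?thesis by simp
qed

lemma cfrac_diff:
  assumes "digits A w" "s \<ge> 0" "t \<ge> 0"
  shows "\<bar>cfrac w s - cfrac w t\<bar> = \<bar>s - t\<bar> / ((fst (cden w) + snd (cden w) * s) * (fst (cden w) + snd (cden w) * t))"
proof -
  define q r m n where "q = fst (cden w)" and "r = snd (cden w)" and "m = fst (cnum w)" and "n = snd (cnum w)"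
  have q: "q \<ge> 1" "r \<ge> 0" using cden_bounds[OF assms(1)] by (auto simp: q_def r_def)
  have p: "q + r * s > 0" "q + r * t > 0" using q assms by (auto intro!: add_pos_nonneg)
  have "cfrac w s - cfrac w t = (m + n * s) / (q + r * s) - (m + n * t) / (q + r * t)"
    by (simp add: cfrac_def q_def r_def m_def n_def)
  also have "\<dots> = (- ((m * r - n * q) * (s - t))) / ((q + r * s) * (q + r * t))"
  proof -
    have "(m + n * s) * (q + r * t) - (m + n * t) * (q + r * s) = - ((m * r - n * q) * (s - t))"
      by (simp add: algebra_simps)
    then show ?thesis using p by (subst diff_frac_eq) auto
  qed
  finally have "\<bar>cfrac w s - cfrac w t\<bar> = (\<bar>m * r - n * q\<bar> * \<bar>s - t\<bar>) / ((q + r * s) * (q + r * t))"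
    using p by (simp add: abs_mult)
  then show ?thesis using cden_cnum_det[of w] by (simp add: q_def r_def m_def n_def)
qed

lemma cfrac_diff_le:
  assumes "digits A w" "s \<ge> 0" "t \<ge> 0"
  shows "\<bar>cfrac w s - cfrac w t\<bar> \<le> 2 * (1 / 2) ^ length w * \<bar>s - t\<bar>"
proof -
  define q r where "q = fst (cden w)" and "r = snd (cden w)"
  have q: "q \<ge> 1" "r \<ge> 0" "r \<le> q" using cden_bounds[OF assms(1)] by (auto simp: q_def r_def)
  have "q * (q + r) \<le> q * (2 * q)" using q by (intro mult_left_mono) auto
  also have "\<dots> \<le> 2 * ((q + r * s) * (q + r * t))"
    using mult_mono[of q "q + r * s" q "q + r * t"] q assms by simp
  finally have k: "q * (q + r) \<le> 2 * ((q + r * s) * (q + r * t))" .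
  have p0: "q * (q + r) > 0" using q by (intro mult_pos_pos) auto
  have "\<bar>cfrac w s - cfrac w t\<bar> = 2 * (1 / (2 * ((q + r * s) * (q + r * t)))) * \<bar>s - t\<bar>"
    by (simp add: cfrac_diff[OF assms] q_def r_def)
  also have "\<dots> \<le> 2 * (1 / (q * (q + r))) * \<bar>s - t\<bar>"
    using k p0 by (intro mult_right_mono mult_left_mono frac_le) auto
  also have "1 / (q * (q + r)) = clen w" by (simp add: clen_def q_def r_def)
  also have "2 * clen w * \<bar>s - t\<bar> \<le> 2 * (1 / 2) ^ length w * \<bar>s - t\<bar>"
    using clen_le[OF assms(1)] by (intro mult_right_mono mult_left_mono) auto
  finally show ?thesis .
qed

lemma cfrac_diff_ge:
  assumes "digits A w" "0 \<le> s" "s \<le> 1" "0 \<le> t" "t \<le> 1"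
  shows "clen w * \<bar>s - t\<bar> / 2 \<le> \<bar>cfrac w s - cfrac w t\<bar>"
proof -
  define q r where "q = fst (cden w)" and "r = snd (cden w)"
  have q: "q \<ge> 1" "r \<ge> 0" "r \<le> q" using cden_bounds[OF assms(1)] by (auto simp: q_def r_def)
  have rs: "r * s \<le> r * 1" "r * t \<le> r * 1" "0 \<le> r * s" "0 \<le> r * t"
    by (rule mult_left_mono; use q assms in simp)+ (use q assms in auto)
  have "(q + r * s) * (q + r * t) \<le> (q + r) * (2 * q)" using rs q by (intro mult_mono) auto
  then have k: "(q + r * s) * (q + r * t) \<le> 2 * (q * (q + r))" by (simp add: mult_ac)
  have p0: "(q + r * s) * (q + r * t) > 0" using q rs by (intro mult_pos_pos) auto
  have "clen w * \<bar>s - t\<bar> / 2 = \<bar>s - t\<bar> / (2 * (q * (q + r)))" by (simp add: clen_def q_def r_def)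
  also have "\<dots> \<le> \<bar>s - t\<bar> / ((q + r * s) * (q + r * t))" using k p0 by (intro divide_left_mono) auto
  also have "\<dots> = \<bar>cfrac w s - cfrac w t\<bar>" using cfrac_diff[OF assms(1,2,4)] by (simp add: q_def r_def)
  finally show ?thesis .
qed

section \<open>Values of infinite continued fractions\<close>

definition bdd_digits :: "nat \<Rightarrow> (nat \<Rightarrow> nat) \<Rightarrow> bool" where
  "bdd_digits A a \<longleftrightarrow> (\<forall>j. 1 \<le> a j \<and> a j \<le> A)"

primrec rprefix :: "(nat \<Rightarrow> nat) \<Rightarrow> nat \<Rightarrow> nat list" where
  "rprefix a 0 = []"
| "rprefix a (Suc n) = a n # rprefix a n"

lemma length_rprefix [simp]: "length (rprefix a n) = n" by (induction n) auto

lemma digits_rprefix: "bdd_digits A a \<Longrightarrow> digits A (rprefix a n)"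
  by (induction n) (auto simp: bdd_digits_def)

lemma bdd_digits_shift: "bdd_digits A a \<Longrightarrow> bdd_digits A (\<lambda>k. a (n + k))"
  by (simp add: bdd_digits_def)

lemma rprefix_eq_iff: "rprefix a n = rprefix b n \<longleftrightarrow> (\<forall>k<n. a k = b k)"
  by (induction n) (auto simp: less_Suc_eq)

lemma cf_convergent_bounds:
  "bdd_digits A a \<Longrightarrow> 0 \<le> cf_convergent a n \<and> cf_convergent a n \<le> 1"
proof (induction n arbitrary: a)
  case (Suc n)
  have "0 \<le> cf_convergent (\<lambda>k. a (Suc k)) n" using Suc.IH[of "\<lambda>k. a (Suc k)"] Suc.prems by (simp add: bdd_digits_def)
  moreover have "1 \<le> real (a 0)" using Suc.prems by (simp add: bdd_digits_def)
  ultimately show ?case by simp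
qed simp

lemma cf_convergent_eq_cfrac:
  assumes "bdd_digits A a"
  shows "cf_convergent a (n + m) = cfrac (rprefix a n) (cf_convergent (\<lambda>k. a (n + k)) m)"
proof (induction n arbitrary: m)
  case (Suc n)
  have "cf_convergent a (Suc n + m) = cfrac (rprefix a n) (cf_convergent (\<lambda>k. a (n + k)) (Suc m))"
    using Suc[of "Suc m"] by simp
  also have "\<dots> = cfrac (rprefix a (Suc n)) (cf_convergent (\<lambda>k. a (Suc n + k)) m)"
    using assms cf_convergent_bounds[OF bdd_digits_shift[OF assms, of "Suc n"], of m]
    by (simp add: cfrac_Cons[OF digits_rprefix[OF assms]] bdd_digits_def)
  finally show ?case .
qed simp

lemma cf_convergent_converges:
  assumes "bdd_digits A a" shows "convergent (cf_convergent a)"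
proof -
  have step: "\<bar>cf_convergent a (n + m) - cf_convergent a n\<bar> \<le> 2 * (1 / 2) ^ n" for n m
  proof -
    let ?c = "cf_convergent (\<lambda>k. a (n + k))"
    note b = cf_convergent_bounds[OF bdd_digits_shift[OF assms, of n]]
    have "\<bar>cf_convergent a (n + m) - cf_convergent a (n + 0)\<bar> \<le> 2 * (1 / 2) ^ n * \<bar>?c m - ?c 0\<bar>"
      unfolding cf_convergent_eq_cfrac[OF assms]
      using cfrac_diff_le[OF digits_rprefix[OF assms, of n], of "?c m" "?c 0"] b by simp
    also have "\<dots> \<le> 2 * (1 / 2) ^ n * 1" using b[of m] by (intro mult_left_mono) auto
    finally show ?thesis by simp
  qed
  have "Cauchy (cf_convergent a)"
  proof (rule metric_CauchyI)
    fix e :: real assume "e > 0"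
    then obtain N where N: "(1 / 2 :: real) ^ N < e / 4" using real_arch_pow_inv[of "e / 4" "1 / 2"] by auto
    have "dist (cf_convergent a m) (cf_convergent a n) < e" if "m \<ge> N" "n \<ge> N" for m n
      using step[of N "m - N"] step[of N "n - N"] that N by (simp add: dist_real_def)
    then show "\<exists>M. \<forall>m\<ge>M. \<forall>n\<ge>M. dist (cf_convergent a m) (cf_convergent a n) < e" by blast
  qed
  then show ?thesis by (rule Cauchy_convergent)
qed

definition cf_value :: "(nat \<Rightarrow> nat) \<Rightarrow> real" where
  "cf_value a = lim (cf_convergent a)"

lemma cf_value_tendsto: "bdd_digits A a \<Longrightarrow> cf_convergent a \<longlonglongrightarrow> cf_value a"
  unfolding cf_value_def using cf_convergent_converges convergent_LIMSEQ_iff by blast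

lemma bounded_cf_set_eq: "bounded_cf_set A = cf_value ` {a. bdd_digits A a}"
proof -
  have "x = cf_value a" if "bdd_digits A a" "cf_convergent a \<longlonglongrightarrow> x" for x a
    using LIMSEQ_unique[OF that(2) cf_value_tendsto[OF that(1)]] .
  then show ?thesis unfolding bounded_cf_set_def bdd_digits_def[symmetric] using cf_value_tendsto by blast
qed

lemma cf_value_bounds: assumes "bdd_digits A a" shows "0 \<le> cf_value a" "cf_value a \<le> 1"
  using cf_convergent_bounds[OF assms] LIMSEQ_le_const[OF cf_value_tendsto[OF assms]] LIMSEQ_le_const2[OF cf_value_tendsto[OF assms]]
  by blast+

lemma cf_value_eq: assumes "bdd_digits A a" shows "cf_value a = 1 / (real (a 0) + cf_value (\<lambda>k. a (Suc k)))"
proof -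
  have b: "bdd_digits A (\<lambda>k. a (Suc k))" using bdd_digits_shift[OF assms, of 1] by simp
  have "1 \<le> real (a 0)" using assms by (simp add: bdd_digits_def)
  then have "(\<lambda>n. cf_convergent a (Suc n)) \<longlonglongrightarrow> 1 / (real (a 0) + cf_value (\<lambda>k. a (Suc k)))"
    using cf_value_bounds[OF b] by (auto intro!: tendsto_intros cf_value_tendsto[OF b])
  moreover have "(\<lambda>n. cf_convergent a (Suc n)) \<longlonglongrightarrow> cf_value a"
    by (rule LIMSEQ_Suc[OF cf_value_tendsto[OF assms]])
  ultimately show ?thesis using LIMSEQ_unique by blast
qed

text \<open>Applying the lower bound to the tail gives the upper bound. Staying away from 0 and 1
  keeps the parts of the set with neighbouring digits from touching.\<close>

lemma cf_value_sharp_bounds: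
  assumes "bdd_digits A a"
  shows "1 / (real A + 1) \<le> cf_value a" "cf_value a \<le> (real A + 1) / (real A + 2)"
proof -
  have lo: "1 / (real A + 1) \<le> cf_value a" if a: "bdd_digits A a" for a
  proof -
    have b: "bdd_digits A (\<lambda>k. a (Suc k))" using bdd_digits_shift[OF a, of 1] by simp
    have "1 \<le> real (a 0)" "real (a 0) \<le> real A" using a by (auto simp: bdd_digits_def)
    then show ?thesis using cf_value_bounds[OF b] unfolding cf_value_eq[OF a] by (intro divide_left_mono) auto
  qed
  show "1 / (real A + 1) \<le> cf_value a" by (rule lo[OF assms])
  have b: "bdd_digits A (\<lambda>k. a (Suc k))" using bdd_digits_shift[OF assms, of 1] by simp
  have "1 \<le> real (a 0)" using assms by (auto simp: bdd_digits_def)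
  then have "cf_value a \<le> 1 / (1 + 1 / (real A + 1))"
    using lo[OF b] cf_value_bounds[OF b] unfolding cf_value_eq[OF assms] by (intro divide_left_mono) (auto intro!: mult_pos_pos add_pos_nonneg)
  also have "1 + 1 / (real A + 1) = (real A + 2) / (real A + 1)" by (simp add: field_simps)
  finally show "cf_value a \<le> (real A + 1) / (real A + 2)" by simp
qed

lemma cf_value_eq_cfrac:
  assumes "bdd_digits A a" shows "cf_value a = cfrac (rprefix a n) (cf_value (\<lambda>k. a (n + k)))"
proof (induction n)
  case (Suc n)
  have b: "bdd_digits A (\<lambda>k. a (n + k))" "bdd_digits A (\<lambda>k. a (n + Suc k))"
    using assms by (auto simp: bdd_digits_def)
  show ?case using Suc cf_value_bounds(1)[OF b(2)] assms cf_value_eq[OF b(1)]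
    by (simp add: cfrac_Cons[OF digits_rprefix[OF assms]] bdd_digits_def)
qed simp

text \<open>At the first differing digit the tails after the common prefix have denominators at
  distance at least 1/(A + 2) and of size at most A + 2, so these tails differ by (A + 2)^(-3); the
  map \<open>cfrac\<close> shrinks this by at most half the cylinder length.\<close>

lemma cf_value_separated:
  assumes a: "bdd_digits A a" and b: "bdd_digits A b" and eq: "rprefix a n = rprefix b n" and ne: "a n \<noteq> b n"
  shows "clen (rprefix a n) / (2 * (real A + 2) ^ 3) \<le> \<bar>cf_value a - cf_value b\<bar>"
proof -
  let ?a = "\<lambda>k. a (n + k)" and ?b = "\<lambda>k. b (n + k)" and ?a' = "\<lambda>k. a (n + Suc k)" and ?b' = "\<lambda>k. b (n + Suc k)"
  have d: "bdd_digits A ?a" "bdd_digits A ?b" "bdd_digits A ?a'" "bdd_digits A ?b'"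
    using a b by (auto simp: bdd_digits_def)
  define s t s' t' where "s = cf_value ?a" and "t = cf_value ?b" and "s' = cf_value ?a'" and "t' = cf_value ?b'"
  have s: "s = 1 / (real (a n) + s')" "t = 1 / (real (b n) + t')"
    unfolding s_def t_def s'_def t'_def using cf_value_eq[OF d(1)] cf_value_eq[OF d(2)] by simp_all
  note bd = cf_value_sharp_bounds[OF d(3), folded s'_def] cf_value_sharp_bounds[OF d(4), folded t'_def]
  note bd0 = cf_value_bounds[OF d(3), folded s'_def] cf_value_bounds[OF d(4), folded t'_def]
  have dig: "1 \<le> real (a n)" "real (a n) \<le> real A" "1 \<le> real (b n)" "real (b n) \<le> real A"
    using a b by (auto simp: bdd_digits_def)
  have frac: "(real A + 1) / (real A + 2) = 1 - 1 / (real A + 2)" by (simp add: field_simps)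
  have "1 \<le> \<bar>real (b n) - real (a n)\<bar>" using ne by linarith
  moreover have "\<bar>t' - s'\<bar> \<le> 1 - 1 / (real A + 2)" using bd bd0 unfolding frac by linarith
  ultimately have num: "1 / (real A + 2) \<le> \<bar>(real (b n) + t') - (real (a n) + s')\<bar>" by linarith
  define u v where "u = real (a n) + s'" and "v = real (b n) + t'"
  have uv: "1 \<le> u" "u \<le> real A + 2" "1 \<le> v" "v \<le> real A + 2" using dig bd0 by (auto simp: u_def v_def)
  have "1 / (real A + 2) ^ 3 = (1 / (real A + 2)) / ((real A + 2) * (real A + 2))" by (simp add: power3_eq_cube)
  also have "\<dots> \<le> \<bar>v - u\<bar> / (u * v)"
    using num uv by (intro frac_le mult_mono mult_pos_pos) (auto simp: u_def v_def)
  also have "\<dots> = \<bar>s - t\<bar>"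
  proof -
    have "s - t = (v - u) / (u * v)" unfolding s u_def[symmetric] v_def[symmetric] using uv by (simp add: field_simps)
    then show ?thesis using uv by (simp add: abs_mult)
  qed
  finally have st: "1 / (real A + 2) ^ 3 \<le> \<bar>s - t\<bar>" .
  have w: "digits A (rprefix a n)" by (rule digits_rprefix[OF a])
  have "clen (rprefix a n) / (2 * (real A + 2) ^ 3) = clen (rprefix a n) * (1 / (real A + 2) ^ 3) / 2" by simp
  also have "\<dots> \<le> clen (rprefix a n) * \<bar>s - t\<bar> / 2"
    using st clen_pos[OF w] by (intro divide_right_mono mult_left_mono) auto
  also have "\<dots> \<le> \<bar>cfrac (rprefix a n) s - cfrac (rprefix a n) t\<bar>"
    using cf_value_bounds[OF d(1)] cf_value_bounds[OF d(2)] by (intro cfrac_diff_ge[OF w]) (auto simp: s_def t_def)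
  also have "\<dots> = \<bar>cf_value a - cf_value b\<bar>"
    using cf_value_eq_cfrac[OF a, of n] cf_value_eq_cfrac[OF b, of n] eq by (simp add: s_def t_def)
  finally show ?thesis .
qed

text \<open>The mass of a word is distributed among its extensions in proportion to their lengths.\<close>

primrec cmass :: "nat \<Rightarrow> nat list \<Rightarrow> real" where
  "cmass A [] = 1"
| "cmass A (b # w) = cmass A w * (clen (b # w) / (\<Sum>c=1..A. clen (c # w)))"

lemma sum_clen_pos:
  assumes "digits A w" "A \<ge> 1" shows "(\<Sum>c=1..A. clen (c # w)) > 0"
  using assms by (intro sum_pos clen_pos[of A]) auto

lemma cmass_pos: "digits A w \<Longrightarrow> cmass A w > 0"
proof (induction w)
  case (Cons b w)
  then show ?case using sum_clen_pos[of A w] clen_pos[of A "b # w"] by simp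
qed simp

lemma sum_cmass_Cons:
  assumes "digits A w" "A \<ge> 1" shows "(\<Sum>b=1..A. cmass A (b # w)) = cmass A w"
proof -
  have "(\<Sum>b=1..A. cmass A (b # w)) = cmass A w * ((\<Sum>b=1..A. clen (b # w)) / (\<Sum>c=1..A. clen (c # w)))"
    unfolding cmass.simps by (simp only: sum_distrib_left sum_divide_distrib)
  then show ?thesis using sum_clen_pos[OF assms] by simp
qed

text \<open>One step multiplies the mass by y/\<sigma>, with x, y the lengths of parent and child
  and \<sigma> the sum over all children. The loss \<sigma> \<ge> 2^(-\<epsilon>) x is paid for by y
  \<le> x/2, as this gives (y/x)^\<epsilon> \<le> 2^(-\<epsilon>).\<close>

lemma cmass_le:
  assumes A: "A \<ge> 1" "2 powr (- \<epsilon>) \<le> 1 - 2 / (real A + 1)" and e: "0 \<le> \<epsilon>"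
  shows "digits A w \<Longrightarrow> cmass A w \<le> clen w powr (1 - \<epsilon>)"
proof (induction w)
  case (Cons b w)
  have w: "digits A w" "b \<ge> 1" using Cons.prems by auto
  define x y \<sigma> where "x = clen w" and "y = clen (b # w)" and "\<sigma> = (\<Sum>c=1..A. clen (c # w))"
  have pos: "x > 0" "y > 0" "\<sigma> > 0"
    using clen_pos[OF w(1)] clen_pos[OF Cons.prems] sum_clen_pos[OF w(1) A(1)] by (auto simp: x_def y_def \<sigma>_def)
  have "2 powr (- \<epsilon>) * x \<le> (1 - 2 / (real A + 1)) * x" using A(2) pos by (intro mult_right_mono) auto
  also have "\<dots> \<le> \<sigma>" using sum_clen_Cons[OF w(1) A(1)] by (simp add: x_def \<sigma>_def)
  finally have s: "2 powr (- \<epsilon>) * x \<le> \<sigma>" .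
  have "y powr \<epsilon> \<le> (x / 2) powr \<epsilon>"
    using clen_Cons_le[OF w] pos e by (intro powr_mono2) (auto simp: x_def y_def)
  also have "\<dots> = x powr \<epsilon> * 2 powr (- \<epsilon>)" using pos by (simp add: powr_divide powr_minus_divide)
  finally have y: "y powr \<epsilon> \<le> x powr \<epsilon> * 2 powr (- \<epsilon>)" .
  have yy: "y = y powr (1 - \<epsilon>) * y powr \<epsilon>" using pos by (simp flip: powr_add)
  have xx: "x powr (1 - \<epsilon>) * x powr \<epsilon> = x" using pos by (simp flip: powr_add)
  have "cmass A (b # w) = cmass A w * (y / \<sigma>)" by (simp add: y_def \<sigma>_def)
  also have "\<dots> \<le> x powr (1 - \<epsilon>) * (y / \<sigma>)"
    using Cons.IH[OF w(1)] pos by (intro mult_right_mono) (auto simp: x_def)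
  also have "\<dots> = x powr (1 - \<epsilon>) * (y powr (1 - \<epsilon>) * y powr \<epsilon>) / \<sigma>" using yy by simp
  also have "\<dots> \<le> x powr (1 - \<epsilon>) * (y powr (1 - \<epsilon>) * (x powr \<epsilon> * 2 powr (- \<epsilon>))) / \<sigma>"
    using y pos by (intro divide_right_mono mult_left_mono) auto
  also have "\<dots> = y powr (1 - \<epsilon>) * (2 powr (- \<epsilon>) * (x powr (1 - \<epsilon>) * x powr \<epsilon>)) / \<sigma>" by (simp only: mult_ac)
  also have "\<dots> = y powr (1 - \<epsilon>) * ((2 powr (- \<epsilon>) * x) / \<sigma>)" unfolding xx by simp
  also have "\<dots> \<le> y powr (1 - \<epsilon>) * 1" using s pos by (intro mult_left_mono) auto
  finally show ?case by (simp add: y_def)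
qed simp

text \<open>A compactness argument by descent. \<open>F v\<close> is the mass of the covering words
  that extend v (a suffix relation, since words are reversed). If it is below the mass of v, it is
  below for some child as well; the infinite sequence so built can pass through no covering word,
  because there \<open>F\<close> is at least the mass.\<close>

lemma cover_mass_ge_1:
  fixes W :: "nat \<Rightarrow> nat list"
  assumes A: "A \<ge> 1" and W: "\<And>i. digits A (W i)"
    and cover: "\<And>a. bdd_digits A a \<Longrightarrow> \<exists>i. rprefix a (length (W i)) = W i"
  shows "1 \<le> (\<Sum>i. ennreal (cmass A (W i)))"
proof (rule ccontr)
  assume less: "\<not> ?thesis"
  define F where "F v = (\<Sum>i. if suffix v (W i) then ennreal (cmass A (W i)) else 0)" for v
  define P where "P v \<longleftrightarrow> digits A v \<and> F v < ennreal (cmass A v)" for v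
  have P0: "P []" using less by (simp add: P_def F_def)
  have step: "\<exists>b. P (b # v)" if v: "P v" for v
  proof (rule ccontr)
    assume no: "\<nexists>b. P (b # v)"
    have dv: "digits A v" using v by (simp add: P_def)
    have "ennreal (cmass A v) = ennreal (\<Sum>b=1..A. cmass A (b # v))" by (simp only: sum_cmass_Cons[OF dv A])
    also have "\<dots> = (\<Sum>b=1..A. ennreal (cmass A (b # v)))"
      using dv by (intro sum_ennreal[symmetric] less_imp_le[OF cmass_pos]) auto
    also have "\<dots> \<le> (\<Sum>b=1..A. F (b # v))"
    proof (rule sum_mono)
      fix b assume "b \<in> {1..A}"
      then have "digits A (b # v)" using dv by simp
      then show "ennreal (cmass A (b # v)) \<le> F (b # v)" using no by (auto simp: P_def not_less)
    qed
    also have "\<dots> = (\<Sum>i. \<Sum>b=1..A. if suffix (b # v) (W i) then ennreal (cmass A (W i)) else 0)"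
      unfolding F_def by (intro suminf_sum[symmetric] summableI)
    also have "\<dots> \<le> F v"
      unfolding F_def
    proof (rule suminf_le)
      fix i
      show "(\<Sum>b=1..A. if suffix (b # v) (W i) then ennreal (cmass A (W i)) else 0) \<le>
          (if suffix v (W i) then ennreal (cmass A (W i)) else 0)"
      proof (cases "\<exists>b. suffix (b # v) (W i)")
        case True
        then obtain b0 where b0: "suffix (b0 # v) (W i)" by blast
        have u: "b = b0" if "suffix (b # v) (W i)" for b
        proof -
          have "suffix (b # v) (b0 # v)" using suffix_length_suffix[OF that b0] by simp
          then show ?thesis by (simp add: suffix_Cons) (auto dest: suffix_length_le)
        qed
        have "(\<Sum>b=1..A. if suffix (b # v) (W i) then ennreal (cmass A (W i)) else 0) \<le>
            (\<Sum>b=1..A. if b = b0 then ennreal (cmass A (W i)) else 0)"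
        proof (rule sum_mono)
          fix b
          show "(if suffix (b # v) (W i) then ennreal (cmass A (W i)) else 0) \<le> (if b = b0 then ennreal (cmass A (W i)) else 0)"
          proof (cases "suffix (b # v) (W i)")
            case True
            then have "b = b0" by (rule u)
            then show ?thesis by simp
          qed simp
        qed
        also have "\<dots> \<le> ennreal (cmass A (W i))" by (simp add: sum.delta)
        also have "\<dots> = (if suffix v (W i) then ennreal (cmass A (W i)) else 0)"
          using suffix_ConsD[OF b0] by simp
        finally show ?thesis .
      qed simp
    qed (auto intro: summableI)
    finally show False using v unfolding P_def by (meson leD)
  qed
  have "\<exists>L. \<forall>n. (length (L n) = n \<and> P (L n)) \<and> (\<exists>b. L (Suc n) = b # L n)"
    by (rule dependent_nat_choice) (use P0 step in force)+
  then obtain L where L: "\<And>n. length (L n) = n" "\<And>n. P (L n)" "\<And>n. \<exists>b. L (Suc n) = b # L n" by blast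
  define a where "a n = hd (L (Suc n))" for n
  have La: "L (Suc n) = a n # L n" for n using L(3)[of n] by (auto simp: a_def)
  have pre: "rprefix a n = L n" for n using L(1)[of 0] by (induction n) (simp_all add: La)
  have "digits A (a n # L n)" for n using L(2)[of "Suc n"] unfolding P_def La[symmetric] by simp
  then have "bdd_digits A a" by (simp add: bdd_digits_def)
  then obtain i where i: "L (length (W i)) = W i" using cover pre by metis
  have "ennreal (cmass A (W i)) \<le> F (W i)"
    unfolding F_def using sum_le_suminf[OF summableI, of "{i}" "\<lambda>j. if suffix (W i) (W j) then ennreal (cmass A (W j)) else 0"]
    by simp
  moreover have "F (W i) < ennreal (cmass A (W i))" using L(2)[of "length (W i)"] i by (simp add: P_def)
  ultimately show False by simp
qed

lemma prefix_small_mass: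
  assumes A: "A \<ge> 1" "2 powr (- \<epsilon>) \<le> 1 - 2 / (real A + 1)" and e: "0 \<le> \<epsilon>" "\<epsilon> < 1"
    and a: "bdd_digits A a" and d: "\<delta> > 0"
  shows "\<exists>n. cmass A (rprefix a n) \<le> \<delta>"
proof -
  define x :: real where "x = (1 / 2) powr (1 - \<epsilon>)"
  have "x < (1 / 2) powr 0" unfolding x_def using e by (intro powr_less_mono') auto
  then have x: "0 < x" "x < 1" by (simp_all add: x_def)
  then obtain n where n: "x ^ n < \<delta>" using real_arch_pow_inv[OF d] by blast
  have "cmass A (rprefix a n) \<le> clen (rprefix a n) powr (1 - \<epsilon>)"
    by (rule cmass_le[OF A e(1) digits_rprefix[OF a]])
  also have "\<dots> \<le> ((1 / 2) ^ n) powr (1 - \<epsilon>)"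
    using clen_le[OF digits_rprefix[OF a, of n]] clen_pos[OF digits_rprefix[OF a, of n]] e
    by (intro powr_mono2) auto
  also have "\<dots> = x ^ n" unfolding x_def by (simp add: powr_powr mult.commute flip: powr_realpow)
  finally have "cmass A (rprefix a n) \<le> \<delta>" using n by linarith
  then show ?thesis by blast
qed

text \<open>The mass distribution principle: cut at the first digit where two points of U differ.
  The separation of values bounds the length of that cylinder, hence its mass, by the diameter. If U
  meets at most one sequence there is no such digit, and a long prefix of mass at most \<delta> is
  used.\<close>

lemma set_common_prefix:
  assumes A: "A \<ge> 1" "2 powr (- \<epsilon>) \<le> 1 - 2 / (real A + 1)" and e: "0 \<le> \<epsilon>" "\<epsilon> < 1"
    and s: "0 < s" "s \<le> 1 - \<epsilon>" and U: "bounded U" "diameter U \<le> 1" and d: "\<delta> > 0"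
  shows "\<exists>w. digits A w \<and> (\<forall>a. bdd_digits A a \<and> cf_value a \<in> U \<longrightarrow> rprefix a (length w) = w) \<and>
    cmass A w \<le> (2 * (real A + 2) ^ 3) * diameter U powr s + \<delta>"
proof -
  define D where "D = 2 * (real A + 2) ^ 3"
  have D: "D \<ge> 1" using one_le_power[of "real A + 2" 3] unfolding D_def by linarith
  have D0: "0 \<le> D * diameter U powr s" using D by simp
  have D1: "x \<le> \<delta> \<Longrightarrow> x \<le> (2 * (real A + 2) ^ 3) * diameter U powr s + \<delta>" for x
    using D0 unfolding D_def by linarith
  show ?thesis
  proof (cases "\<exists>a. bdd_digits A a \<and> cf_value a \<in> U")
    case False
    have one: "bdd_digits A (\<lambda>_. 1)" using A(1) by (simp add: bdd_digits_def)
    obtain n where "cmass A (rprefix (\<lambda>_. 1) n) \<le> \<delta>" using prefix_small_mass[OF A e one d] by blast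
    then show ?thesis using False digits_rprefix[OF one, of n] D1 by (intro exI[of _ "rprefix (\<lambda>_. 1) n"]) auto
  next
    case True
    then obtain a where a: "bdd_digits A a" "cf_value a \<in> U" by blast
    show ?thesis
    proof (cases "\<exists>n b. bdd_digits A b \<and> cf_value b \<in> U \<and> b n \<noteq> a n")
      case False
      obtain n where n: "cmass A (rprefix a n) \<le> \<delta>" using prefix_small_mass[OF A e a(1) d] by blast
      have "rprefix b n = rprefix a n" if "bdd_digits A b" "cf_value b \<in> U" for b
        using False that by (auto simp: rprefix_eq_iff)
      then show ?thesis using n digits_rprefix[OF a(1), of n] D1 by (intro exI[of _ "rprefix a n"]) auto
    next
      case True
      define n where "n = (LEAST n. \<exists>b. bdd_digits A b \<and> cf_value b \<in> U \<and> b n \<noteq> a n)"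
      have "\<exists>b. bdd_digits A b \<and> cf_value b \<in> U \<and> b n \<noteq> a n" unfolding n_def by (rule LeastI_ex[OF True])
      then obtain b where b: "bdd_digits A b" "cf_value b \<in> U" "b n \<noteq> a n" by blast
      have pre: "rprefix c n = rprefix a n" if "bdd_digits A c" "cf_value c \<in> U" for c
        unfolding rprefix_eq_iff
      proof (intro allI impI)
        fix k assume "k < n"
        then have "\<not> (\<exists>b. bdd_digits A b \<and> cf_value b \<in> U \<and> b k \<noteq> a k)" unfolding n_def by (rule not_less_Least)
        then show "c k = a k" using that by blast
      qed
      let ?w = "rprefix a n"
      have w: "digits A ?w" by (rule digits_rprefix[OF a(1)])
      have "clen ?w / D \<le> \<bar>cf_value a - cf_value b\<bar>"
        unfolding D_def using pre[OF b(1,2)] b(3) by (intro cf_value_separated[OF a(1) b(1)]) auto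
      also have "\<dots> \<le> diameter U" using diameter_bounded_bound[OF U(1) a(2) b(2)] by (simp add: dist_real_def)
      finally have sep: "clen ?w \<le> D * diameter U" using D by (simp add: field_simps)
      have du: "0 < diameter U"
      proof (rule ccontr)
        assume "\<not> 0 < diameter U"
        then have "D * diameter U \<le> 0" using D by (intro mult_nonneg_nonpos) auto
        then show False using sep clen_pos[OF w] by linarith
      qed
      have "cmass A ?w \<le> clen ?w powr (1 - \<epsilon>)" by (rule cmass_le[OF A e(1) w])
      also have "\<dots> \<le> (D * diameter U) powr (1 - \<epsilon>)" using sep clen_pos[OF w] e by (intro powr_mono2) auto
      also have "\<dots> = D powr (1 - \<epsilon>) * diameter U powr (1 - \<epsilon>)" using D du by (simp add: powr_mult)
      also have "\<dots> \<le> D * diameter U powr s"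
      proof (rule mult_mono)
        have "D powr (1 - \<epsilon>) \<le> D powr 1" using D e by (intro powr_mono) auto
        then show "D powr (1 - \<epsilon>) \<le> D" using D by simp
        show "diameter U powr (1 - \<epsilon>) \<le> diameter U powr s" using du U(2) s by (intro powr_mono') auto
      qed (use D in auto)
      finally have "cmass A ?w \<le> D * diameter U powr s + \<delta>" using d by simp
      then show ?thesis using w pre unfolding D_def by (intro exI[of _ ?w]) simp
    qed
  qed
qed

lemma hausdorff_measure_cf_pos:
  assumes A: "A \<ge> 1" "2 powr (- \<epsilon>) \<le> 1 - 2 / (real A + 1)" and e: "0 \<le> \<epsilon>" "\<epsilon> < 1"
    and s: "0 < s" "s \<le> 1 - \<epsilon>"
  shows "hausdorff_measure s (bounded_cf_set A) \<noteq> 0"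
proof
  assume "hausdorff_measure s (bounded_cf_set A) = 0"
  define D where "D = 2 * (real A + 2) ^ 3"
  have D: "D > 0" by (simp add: D_def)
  have "hausdorff_premeasure s 1 (bounded_cf_set A) \<le> hausdorff_measure s (bounded_cf_set A)"
    unfolding hausdorff_measure_def by (rule SUP_upper) simp
  \<comment> \<open>With the threshold 1/(2 D) the diameters contribute less than 1/2, and the
    additional masses 2^(-i-2) sum to 1/2, so the prefix words would cover with total mass below
    1.\<close>
  then have "hausdorff_premeasure s 1 (bounded_cf_set A) < ennreal (1 / (2 * D))"
    using D \<open>hausdorff_measure s _ = 0\<close> by simp
  then obtain U :: "nat \<Rightarrow> real set" where U: "bounded_cf_set A \<subseteq> (\<Union>i. U i)"
      "\<And>i. bounded (U i)" "\<And>i. diameter (U i) \<le> 1"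
    and less: "(\<Sum>i. ennreal (diameter (U i) powr s)) < ennreal (1 / (2 * D))"
    unfolding hausdorff_premeasure_def INF_less_iff by auto
  have "\<exists>w. digits A w \<and> (\<forall>a. bdd_digits A a \<and> cf_value a \<in> U i \<longrightarrow> rprefix a (length w) = w) \<and>
    cmass A w \<le> D * diameter (U i) powr s + (1 / 2) ^ Suc (Suc i)" for i
    unfolding D_def by (rule set_common_prefix[OF A e s U(2,3)]) simp
  then obtain W where W: "\<And>i. digits A (W i)"
      "\<And>i a. bdd_digits A a \<Longrightarrow> cf_value a \<in> U i \<Longrightarrow> rprefix a (length (W i)) = W i"
      "\<And>i. cmass A (W i) \<le> D * diameter (U i) powr s + (1 / 2) ^ Suc (Suc i)"
    by metis
  have "1 \<le> (\<Sum>i. ennreal (cmass A (W i)))"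
  proof (rule cover_mass_ge_1[OF A(1) W(1)])
    fix a assume a: "bdd_digits A a"
    then have "cf_value a \<in> (\<Union>i. U i)" using U(1) by (auto simp: bounded_cf_set_eq)
    then show "\<exists>i. rprefix a (length (W i)) = W i" using W(2)[OF a] by blast
  qed
  also have "\<dots> \<le> (\<Sum>i. ennreal D * ennreal (diameter (U i) powr s) + ennreal ((1 / 2) ^ Suc (Suc i)))"
  proof (rule suminf_le)
    fix i
    have "ennreal (cmass A (W i)) \<le> ennreal (D * diameter (U i) powr s + (1 / 2) ^ Suc (Suc i))"
      by (rule ennreal_leI[OF W(3)])
    also have "\<dots> = ennreal D * ennreal (diameter (U i) powr s) + ennreal ((1 / 2) ^ Suc (Suc i))"
      using D by (subst ennreal_plus) (auto simp: ennreal_mult)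
    finally show "ennreal (cmass A (W i)) \<le> ennreal D * ennreal (diameter (U i) powr s) + ennreal ((1 / 2) ^ Suc (Suc i))" .
  qed (auto intro: summableI)
  also have "\<dots> = ennreal D * (\<Sum>i. ennreal (diameter (U i) powr s)) + (\<Sum>i. ennreal ((1 / 2) ^ Suc (Suc i)))"
    by (subst suminf_add[symmetric]) (auto intro: summableI simp: ennreal_suminf_cmult)
  also have "(\<Sum>i. ennreal ((1 / 2) ^ Suc (Suc i))) = ennreal (1 / 2)"
  proof (rule suminf_ennreal_eq)
    have "(\<lambda>i. (1 / 4) * (1 / 2 :: real) ^ i) sums ((1 / 4) * (1 / (1 - 1 / 2)))"
      by (intro sums_mult geometric_sums) simp
    then show "(\<lambda>i. (1 / 2 :: real) ^ Suc (Suc i)) sums (1 / 2)" by simp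
  qed simp
  finally have ge: "1 \<le> ennreal D * (\<Sum>i. ennreal (diameter (U i) powr s)) + ennreal (1 / 2)" .
  define x where "x = enn2real (\<Sum>i. ennreal (diameter (U i) powr s))"
  have x: "0 \<le> x" "(\<Sum>i. ennreal (diameter (U i) powr s)) = ennreal x"
    unfolding x_def using order.strict_trans[OF less ennreal_less_top] by (simp_all only: ennreal_enn2real enn2real_nonneg)
  then have "x < 1 / (2 * D)" using less D by (simp add: ennreal_less_iff)
  then have "D * x + 1 / 2 < 1" using D by (simp add: field_simps)
  have eq: "ennreal (D * x + 1 / 2) = ennreal D * ennreal x + ennreal (1 / 2)"
    using x(1) D by (simp add: ennreal_plus ennreal_mult)
  have "ennreal 1 \<le> ennreal (D * x + 1 / 2)" unfolding eq using ge x(2) by (simp only: ennreal_1)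
  moreover have "0 \<le> D * x + 1 / 2" using x(1) D by simp
  ultimately have "1 \<le> D * x + 1 / 2" by (simp only: ennreal_le_iff)
  then show False using \<open>D * x + 1 / 2 < 1\<close> by linarith
qed

section \<open>Bounds for the dimension\<close>

text \<open>Covering by n intervals of length 1/n costs n * n^(-2), which tends to 0. This makes the
  set of exponents in the definition of the dimension nonempty and bounds the dimension by
  2.\<close>

lemma hausdorff_measure_2_unit_interval:
  fixes E :: "real set"
  assumes "E \<subseteq> {0..1}"
  shows "hausdorff_measure 2 E = 0"
proof -
  have "hausdorff_premeasure 2 d E = 0" if d: "d > 0" for d
  proof (rule ccontr)
    assume "hausdorff_premeasure 2 d E \<noteq> 0"
    have bound: "hausdorff_premeasure 2 d E \<le> ennreal (1 / real n)" if n: "n \<ge> 1" "1 / real n \<le> d" for n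
    proof -
      define U :: "nat \<Rightarrow> real set" where "U i = (if i < n then {real i / real n..(real i + 1) / real n} else {})" for i
      have n0: "real n > 0" using n by simp
      have diam: "diameter (U i) = (if i < n then 1 / real n else 0)" for i
      proof (cases "i < n")
        case True
        have le: "real i / real n \<le> (real i + 1) / real n" using n0 by (intro divide_right_mono) auto
        then have "diameter {real i / real n..(real i + 1) / real n} = (real i + 1) / real n - real i / real n"
          by simp
        then show ?thesis using True by (simp add: U_def diff_divide_distrib[symmetric])
      qed (simp add: U_def)
      have "E \<subseteq> (\<Union>i. U i)"
      proof
        fix x assume "x \<in> E"
        then have x: "0 \<le> x" "x \<le> 1" using assms by auto
        show "x \<in> (\<Union>i. U i)"
        proof (cases "x = 1")
          case True
          then have "x \<in> U (n - 1)" using n by (simp add: U_def of_nat_diff)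
          then show ?thesis by blast
        next
          case False
          define i where "i = nat \<lfloor>x * real n\<rfloor>"
          have xn: "0 \<le> x * real n" "x * real n < real n" using x False n0 by auto
          have i: "real i \<le> x * real n" "x * real n < real i + 1"
            unfolding i_def using xn(1) by linarith+
          have "i < n" using i(1) xn by linarith
          then have "x \<in> U i" using i n0 by (simp add: U_def field_simps)
          then show ?thesis by blast
        qed
      qed
      moreover have "bounded (U i) \<and> diameter (U i) \<le> d" for i
        using n(2) d unfolding diam by (auto simp: U_def)
      ultimately have "hausdorff_premeasure 2 d E \<le> (\<Sum>i. ennreal (diameter (U i) powr 2))"
        unfolding hausdorff_premeasure_def by (intro INF_lower) auto
      also have "\<dots> = (\<Sum>i<n. ennreal (diameter (U i) powr 2))"
        by (intro suminf_finite) (auto simp: diam)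
      also have "\<dots> = (\<Sum>i<n. ennreal ((1 / real n) powr 2))" by (intro sum.cong) (auto simp: diam)
      also have "\<dots> = ennreal (real n * (1 / real n) powr 2)" by (simp add: ennreal_mult ennreal_of_nat_eq_real_of_nat)
      also have "real n * (1 / real n) powr 2 = 1 / real n" using n0 by (simp add: power2_eq_square)
      finally show ?thesis .
    qed
    have le: "hausdorff_premeasure 2 d E \<le> ennreal x" if "x > 0" for x
    proof -
      have mx: "0 < min x d" using that d by simp
      obtain m where m: "1 / min x d < real m" using reals_Archimedean2 by blast
      moreover have "0 < 1 / min x d" using mx by (rule divide_pos_pos[OF zero_less_one])
      ultimately have m0: "0 < real m" by linarith
      then have "m \<ge> 1" by simp
      have "1 < real m * min x d" using m mx by (simp add: divide_less_eq)
      moreover have "1 / t \<le> u" if "1 < t * u" "0 < t" for t u :: real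
        using that by (simp add: divide_le_eq mult.commute)
      ultimately have "1 / real m \<le> min x d" using m0 by blast
      then have "hausdorff_premeasure 2 d E \<le> ennreal (1 / real m)" "1 / real m \<le> x" using bound \<open>m \<ge> 1\<close> by auto
      then show ?thesis using ennreal_leI order_trans by blast
    qed
    have "hausdorff_premeasure 2 d E \<le> 0"
    proof (rule ennreal_le_epsilon)
      fix e :: real assume "0 < e"
      then show "hausdorff_premeasure 2 d E \<le> 0 + ennreal e" using le by simp
    qed
    then show False using \<open>hausdorff_premeasure 2 d E \<noteq> 0\<close> by simp
  qed
  then show ?thesis unfolding hausdorff_measure_def by (simp add: SUP_eq_const)
qed

lemma bounded_cf_set_subset: "bounded_cf_set A \<subseteq> {0..1}"
  using cf_value_bounds by (auto simp: bounded_cf_set_eq)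

lemma cf_dim_le_2: "cf_dim A \<le> 2"
  unfolding cf_dim_def hausdorff_dim_def
  by (rule cInf_lower) (auto intro!: hausdorff_measure_2_unit_interval bounded_cf_set_subset bdd_belowI[of _ 0])

lemma cf_dim_ge:
  assumes "A \<ge> 1" "2 powr (- \<epsilon>) \<le> 1 - 2 / (real A + 1)" "0 \<le> \<epsilon>" "\<epsilon> < 1"
  shows "1 - \<epsilon> \<le> cf_dim A"
  unfolding cf_dim_def hausdorff_dim_def
proof (rule cInf_greatest)
  show "{s. 0 < s \<and> hausdorff_measure s (bounded_cf_set A) = 0} \<noteq> {}"
    using hausdorff_measure_2_unit_interval[OF bounded_cf_set_subset] by (auto intro!: exI[of _ 2])
  show "1 - \<epsilon> \<le> s" if "s \<in> {s. 0 < s \<and> hausdorff_measure s (bounded_cf_set A) = 0}" for s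
    using that hausdorff_measure_cf_pos[OF assms, of s] by force
qed

lemma cf_dim_tendsto_1:
  assumes "0 < \<epsilon>" "\<epsilon> < 1"
  shows "\<exists>A1. \<forall>A\<ge>A1. 1 - \<epsilon> \<le> cf_dim A"
proof -
  define x :: real where "x = 1 - 2 powr (- \<epsilon>)"
  have "2 powr (- \<epsilon>) < 2 powr (0 :: real)" using assms by (intro powr_less_mono) auto
  then have x: "x > 0" by (simp add: x_def)
  obtain A1 where A1: "2 / x < real A1" using reals_Archimedean2 by blast
  have "1 - \<epsilon> \<le> cf_dim A" if "A \<ge> max 1 A1" for A
  proof (rule cf_dim_ge)
    have "2 / x < real A + 1" using that A1 by linarith
    then have "2 / (real A + 1) \<le> x" using x by (simp add: field_simps)
    then show "2 powr (- \<epsilon>) \<le> 1 - 2 / (real A + 1)" by (simp add: x_def)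
  qed (use that assms in auto)
  then show ?thesis by blast
qed

section \<open>Decomposition of the remainder\<close>

lemma squarefree_divisor:
  fixes q :: nat
  assumes q: "squarefree q" and w: "w dvd q"
  shows "squarefree w" "squarefree (q div w)" "coprime w (q div w)"
    "prime_factors (q div w) = prime_factors q - prime_factors w" "prime_factors w \<subseteq> prime_factors q"
proof -
  note c = squarefree_cofactor[OF q w]
  show "squarefree w" "squarefree (q div w)" "coprime w (q div w)" using c by auto
  have q0: "q = w * (q div w)" using w by simp
  have pos: "w > 0" "q div w > 0" using c squarefree_pos by auto
  have un: "prime_factors q = prime_factors w \<union> prime_factors (q div w)"
    using pos by (subst q0, subst prime_factors_product) auto
  have "prime_factors w \<inter> prime_factors (q div w) = {}" by (rule coprime_prime_factors_disjoint[OF c(3)])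
  then show "prime_factors (q div w) = prime_factors q - prime_factors w" "prime_factors w \<subseteq> prime_factors q"
    using un by auto
qed

text \<open>Choosing a summand at every prime is choosing a subset of the prime factors, and for
  squarefree q subsets correspond to divisors.\<close>

lemma prod_add_squarefree:
  fixes f g :: "nat \<Rightarrow> 'a :: comm_ring_1"
  assumes q: "squarefree q"
  shows "(\<Prod>p\<in>prime_factors q. f p + g p) =
    (\<Sum>w | w dvd q. (\<Prod>p\<in>prime_factors (q div w). f p) * (\<Prod>p\<in>prime_factors w. g p))"
proof -
  have q0: "q > 0" by (rule squarefree_pos[OF q])
  have "(\<Prod>p\<in>prime_factors q. f p + g p) = (\<Prod>p\<in>prime_factors q. g p + f p)" by (simp only: add.commute)
  also have "\<dots> = (\<Sum>W\<in>Pow (prime_factors q). prod g W * prod f (prime_factors q - W))"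
    by (rule prod_add) simp
  also have "\<dots> = (\<Sum>w | w dvd q. (\<Prod>p\<in>prime_factors (q div w). f p) * (\<Prod>p\<in>prime_factors w. g p))"
  proof (rule sum.reindex_bij_witness[where i = prime_factors and j = "\<lambda>W. \<Prod>W"])
    fix W assume "W \<in> Pow (prime_factors q)"
    then have W: "finite W" "\<And>p. p \<in> W \<Longrightarrow> prime p" "W \<subseteq> prime_factors q"
      using finite_subset by auto
    have "\<Prod>W dvd \<Prod>(prime_factors q)" using W(3) by (intro prod_dvd_prod_subset) auto
    then have dv: "\<Prod>W dvd q" by (simp add: squarefree_eq_prod_prime_factors[OF q])
    then show "\<Prod>W \<in> {w. w dvd q}" by simp
    show PF: "prime_factors (\<Prod>W) = W"
    proof -
      have "prime_factors (\<Prod>W) = (\<Union>p\<in>W. prime_factors p)"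
      proof -
        have "0 \<notin> id ` W" using W(2) by (auto dest: prime_gt_0_nat)
        then show ?thesis using prime_factors_prod[of W id] W(1) by auto
      qed
      also have "\<dots> = W" using W(2) by (auto simp: prime_factorization_prime)
      finally show ?thesis .
    qed
    show "(\<Prod>p\<in>prime_factors (q div \<Prod>W). f p) * prod g (prime_factors (\<Prod>W)) = prod g W * prod f (prime_factors q - W)"
      unfolding squarefree_divisor(4)[OF q dv] PF by (simp add: mult.commute)
  next
    fix w assume "w \<in> {w. w dvd q}"
    then have w: "w dvd q" by simp
    show "prime_factors w \<in> Pow (prime_factors q)" using squarefree_divisor(5)[OF q w] by simp
    show "\<Prod>(prime_factors w) = w" by (rule squarefree_eq_prod_prime_factors[OF squarefree_divisor(1)[OF q w]])
  qed
  finally show ?thesis .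
qed

definition hit_prod :: "nat \<Rightarrow> int^2^2 \<Rightarrow> real" where
  "hit_prod q g = (\<Prod>p\<in>prime_factors q. hit p g)"

definition exc_prod :: "nat \<Rightarrow> int^2^2 \<Rightarrow> real" where
  "exc_prod q g = (\<Prod>p\<in>prime_factors q. hit p g - rho p)"

definition osc_prod :: "nat \<Rightarrow> int^2^2 \<Rightarrow> real" where
  "osc_prod q g = (\<Prod>p\<in>prime_factors q. osc p g)"

definition kap_prod :: "nat \<Rightarrow> int^2^2 \<Rightarrow> real" where
  "kap_prod q g = (\<Prod>p\<in>prime_factors q. kap p g)"

definition rho_prod :: "nat \<Rightarrow> real" where
  "rho_prod q = (\<Prod>p\<in>prime_factors q. rho p)"

definition dens_prod :: "nat \<Rightarrow> real" where
  "dens_prod q = (\<Prod>p\<in>prime_factors q. dens p)"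

definition exc_mean :: "nat \<Rightarrow> real" where
  "exc_mean q = (\<Prod>p\<in>prime_factors q. dens p - rho p)"

definition triple_sum :: "(int^2^2) set \<Rightarrow> (int^2^2) set \<Rightarrow> (int^2^2) set \<Rightarrow> (int^2^2 \<Rightarrow> real) \<Rightarrow> real" where
  "triple_sum A S B F = (\<Sum>x\<in>A. \<Sum>a\<in>S. \<Sum>z\<in>B. F (x ** a ** z))"

text \<open>The centred product \<open>exc_prod\<close> minus its expected total;
  \<open>exc_mean\<close> is its mean over SL2 modulo the modulus, as \<open>sum_exc_prod\<close>
  shows.\<close>

definition discrepancy :: "(int^2^2) set \<Rightarrow> (int^2^2) set \<Rightarrow> (int^2^2) set \<Rightarrow> nat \<Rightarrow> real" where
  "discrepancy A S B w =
     triple_sum A S B (exc_prod w) - real (card A) * real (card S) * real (card B) * exc_mean w"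

lemma triple_sum_sum: "triple_sum A S B (\<lambda>g. \<Sum>i\<in>I. c i * F i g) = (\<Sum>i\<in>I. c i * triple_sum A S B (F i))"
proof -
  have "triple_sum A S B (\<lambda>g. \<Sum>i\<in>I. c i * F i g) = (\<Sum>x\<in>A. \<Sum>a\<in>S. \<Sum>i\<in>I. \<Sum>z\<in>B. c i * F i (x ** a ** z))"
    unfolding triple_sum_def by (intro sum.cong refl sum.swap)
  also have "\<dots> = (\<Sum>x\<in>A. \<Sum>i\<in>I. \<Sum>a\<in>S. \<Sum>z\<in>B. c i * F i (x ** a ** z))"
    by (intro sum.cong refl sum.swap)
  also have "\<dots> = (\<Sum>i\<in>I. \<Sum>x\<in>A. \<Sum>a\<in>S. \<Sum>z\<in>B. c i * F i (x ** a ** z))" by (rule sum.swap)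
  finally show ?thesis unfolding triple_sum_def by (simp only: sum_distrib_left)
qed

lemma triple_sum_cong:
  "(\<And>g. F g = G g) \<Longrightarrow> triple_sum A S B F = triple_sum A S B G"
  by (simp add: triple_sum_def)

text \<open>Both \<open>hit\<close> and \<open>dens\<close> are split as \<open>rho\<close> plus a
  rest and expanded over the same divisors. The weight \<open>rho_prod\<close> of the cofactor is
  about 1/(q/w), so summing over q costs only a logarithm and divisor-type factors.\<close>

lemma remainder_decomposition:
  assumes q: "squarefree q"
  shows "triple_sum A S B (hit_prod q) - real (card A) * real (card S) * real (card B) * dens_prod q =
    (\<Sum>w | w dvd q. rho_prod (q div w) * discrepancy A S B w)"
proof -
  have h: "hit_prod q g = (\<Sum>w | w dvd q. rho_prod (q div w) * exc_prod w g)" for g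
    unfolding hit_prod_def rho_prod_def exc_prod_def by (subst prod_add_squarefree[OF q, symmetric]) simp
  have d: "dens_prod q = (\<Sum>w | w dvd q. rho_prod (q div w) * exc_mean w)"
    unfolding dens_prod_def rho_prod_def exc_mean_def by (subst prod_add_squarefree[OF q, symmetric]) simp
  have "triple_sum A S B (hit_prod q) = (\<Sum>w | w dvd q. rho_prod (q div w) * triple_sum A S B (exc_prod w))"
    by (simp only: triple_sum_cong[OF h] triple_sum_sum)
  then show ?thesis
    unfolding d discrepancy_def by (simp add: sum_distrib_left right_diff_distrib sum_subtractf mult_ac)
qed

lemma exc_prod_decomposition:
  assumes w: "squarefree w"
  shows "triple_sum A S B (exc_prod w) = (\<Sum>k | k dvd w. triple_sum A S B (\<lambda>g. osc_prod (w div k) g * kap_prod k g))"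
proof -
  have h: "exc_prod w g = (\<Sum>k | k dvd w. 1 * (osc_prod (w div k) g * kap_prod k g))" for g
    unfolding exc_prod_def osc_prod_def kap_prod_def mult_1
    by (subst prod_add_squarefree[OF w, symmetric]) (simp add: kap_def)
  show ?thesis by (simp only: triple_sum_cong[OF h] triple_sum_sum) simp
qed

lemma abs_prod_le_1:
  fixes f :: "'a \<Rightarrow> real"
  assumes "\<And>p. p \<in> P \<Longrightarrow> \<bar>f p\<bar> \<le> 1" shows "\<bar>\<Prod>p\<in>P. f p\<bar> \<le> 1"
  unfolding abs_prod by (rule prod_le_1) (use assms in auto)

lemma exc_prod_abs_le_1: "\<bar>exc_prod w g\<bar> \<le> 1"
  unfolding exc_prod_def by (intro abs_prod_le_1 hit_minus_rho_abs_le_1) auto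

lemma cong_mod_dvd: "[a = b] (mod int m) \<Longrightarrow> d dvd m \<Longrightarrow> [a = b] (mod int d)"
  by (rule cong_dvd_modulus) auto

lemma kap_prod_abs_le_1: "[det g = 1] (mod int k) \<Longrightarrow> \<bar>kap_prod k g\<bar> \<le> 1"
  unfolding kap_prod_def by (intro abs_prod_le_1 kap_abs_le_1) (auto simp: in_prime_factors_iff intro: cong_mod_dvd)

lemma periodic_prods:
  assumes "squarefree w"
  shows "periodic w (exc_prod w)" "periodic w (osc_prod w)" "periodic w (kap_prod w)"
proof -
  have "periodic p (\<lambda>g. hit p g - rho p)" for p
    using periodicD[OF periodic_hit[of p]] unfolding periodic_def by simp
  then show "periodic w (exc_prod w)" "periodic w (osc_prod w)" "periodic w (kap_prod w)"
    unfolding exc_prod_def osc_prod_def kap_prod_def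
    using periodic_osc periodic_kap by (intro periodic_prime_factors[OF assms]; simp)+
qed

section \<open>Means, norms and bounds for the expanded terms\<close>

lemma card_SL2_squarefree:
  assumes "squarefree w" shows "real (card (SL2_mod w)) = (\<Prod>p\<in>prime_factors w. real (card (SL2_mod p)))"
proof -
  have "(\<Sum>g\<in>SL2_mod w. \<Prod>p\<in>prime_factors w. (1 :: real)) = (\<Prod>p\<in>prime_factors w. \<Sum>g\<in>SL2_mod p. 1)"
    by (rule sum_SL2_squarefree[OF assms]) (simp add: periodic_def)
  then show ?thesis by simp
qed

lemma card_SL2_squarefree_le:
  assumes "squarefree w" shows "real (card (SL2_mod w)) \<le> real w ^ 3"
  unfolding card_SL2_squarefree[OF assms]
proof (rule prod_prime_factors_le[OF assms])
  fix p :: nat assume p: "prime p"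
  show "0 \<le> real (card (SL2_mod p)) \<and> real (card (SL2_mod p)) \<le> real p ^ 3"
  proof -
    have "real p * (real p ^ 2 - 1) = real p ^ 3 - real p" by (simp add: algebra_simps power3_eq_cube power2_eq_square)
    then show ?thesis using card_SL2_prime[OF p] by (smt (verit) of_nat_0_le_iff)
  qed
qed

lemma sum_exc_prod:
  assumes "squarefree w"
  shows "(\<Sum>g\<in>SL2_mod w. exc_prod w g) = real (card (SL2_mod w)) * exc_mean w"
proof -
  have per: "periodic p (\<lambda>g. hit p g - rho p)" for p
    using periodicD[OF periodic_hit[of p]] unfolding periodic_def by simp
  have "(\<Sum>g\<in>SL2_mod w. exc_prod w g) = (\<Prod>p\<in>prime_factors w. \<Sum>g\<in>SL2_mod p. hit p g - rho p)"
    unfolding exc_prod_def by (rule sum_SL2_squarefree[OF assms per])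
  also have "\<dots> = (\<Prod>p\<in>prime_factors w. real (card (SL2_mod p)) * (dens p - rho p))"
  proof (rule prod.cong[OF refl])
    fix p assume "p \<in> prime_factors w"
    then have "p > 0" by (simp add: in_prime_factors_iff prime_gt_0_nat)
    then have "real (card (SL2_mod p)) \<noteq> 0" using card_SL2_pos[of p] by linarith
    then show "(\<Sum>g\<in>SL2_mod p. hit p g - rho p) = real (card (SL2_mod p)) * (dens p - rho p)"
      by (simp add: dens_def sum_subtractf right_diff_distrib)
  qed
  also have "\<dots> = real (card (SL2_mod w)) * exc_mean w"
    by (simp add: prod.distrib exc_mean_def card_SL2_squarefree[OF assms])
  finally show ?thesis .
qed

lemma prod_inverse_prime_factors:
  assumes "squarefree w"
  shows "(\<Prod>p\<in>prime_factors w. c / real p ^ j) = c ^ \<omega> w / real w ^ j"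
proof -
  have "real w = (\<Prod>p\<in>prime_factors w. real p)"
    by (subst (1) squarefree_eq_prod_prime_factors[OF assms, symmetric]) simp
  then show ?thesis by (simp add: prod_dividef prod_power_distrib)
qed

text \<open>At each prime \<open>dens - rho\<close> is the mean of \<open>kap\<close> alone, since
  \<open>osc\<close> averages to zero; hence the square in the denominator.\<close>

lemma exc_mean_abs_le:
  assumes "squarefree w" shows "\<bar>exc_mean w\<bar> \<le> 8 ^ \<omega> w / (real w)\<^sup>2"
proof -
  have "\<bar>exc_mean w\<bar> = (\<Prod>p\<in>prime_factors w. \<bar>dens p - rho p\<bar>)" by (simp add: exc_mean_def abs_prod)
  also have "\<dots> \<le> (\<Prod>p\<in>prime_factors w. 8 / real p ^ 2)"
  proof (rule prod_mono)
    fix p assume "p \<in> prime_factors w"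
    then have p: "prime p" by auto
    have c: "real (card (SL2_mod p)) > 0" using card_SL2_pos prime_gt_0_nat[OF p] by simp
    have "\<bar>dens p - rho p\<bar> = \<bar>\<Sum>g\<in>SL2_mod p. kap p g\<bar> / real (card (SL2_mod p))"
      using c by (simp add: dens_eq[OF p] abs_divide)
    also have "\<dots> \<le> (8 / real p ^ 2 * real (card (SL2_mod p))) / real (card (SL2_mod p))"
      by (intro divide_right_mono order_trans[OF sum_abs sum_abs_kap[OF p]]) simp
    also have "\<dots> = 8 / real p ^ 2" using c by (intro nonzero_mult_div_cancel_right) linarith
    finally show "0 \<le> \<bar>dens p - rho p\<bar> \<and> \<bar>dens p - rho p\<bar> \<le> 8 / real p ^ 2" by simp
  qed
  also have "\<dots> = 8 ^ \<omega> w / (real w)\<^sup>2" by (rule prod_inverse_prime_factors[OF assms])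
  finally show ?thesis .
qed

text \<open>For fixed outer factors the sum over the middle set is grouped by residue class. The
  uniform part is the exact mean by translation invariance, and each of at most w^4 classes
  contributes an error of at most \<open>E\<close>.\<close>

lemma discrepancy_small_modulus:
  assumes w: "squarefree w" and A: "\<And>x. x \<in> A \<Longrightarrow> det x = 1" and B: "\<And>x. x \<in> B \<Longrightarrow> det x = 1"
    and S: "finite S" "\<And>x. x \<in> S \<Longrightarrow> det x = 1"
    and eq: "\<And>m. m \<in> SL2_mod w \<Longrightarrow> \<bar>real (card {g \<in> S. mat_cong w g m}) - real (card S) / real (card (SL2_mod w))\<bar> \<le> E"
  shows "\<bar>discrepancy A S B w\<bar> \<le> real (card A) * real (card B) * (real w ^ 4 * E)"
proof -
  have w0: "w > 0" by (rule squarefree_pos[OF w])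
  have N: "real (card (SL2_mod w)) > 0" using card_SL2_pos[OF w0] by simp
  have each: "\<bar>(\<Sum>a\<in>S. exc_prod w (x ** a ** z)) - real (card S) * exc_mean w\<bar> \<le> real w ^ 4 * E"
    if x: "det x = 1" and z: "det z = 1" for x z
  proof -
    let ?H = "\<lambda>m. exc_prod w (x ** m ** z)"
    have per: "periodic w ?H" by (rule periodic_shift[OF periodic_prods(1)[OF w]])
    have "(\<Sum>a\<in>S. ?H a) = (\<Sum>m\<in>SL2_mod w. real (card {a\<in>S. red w a = m}) * ?H m)"
      by (rule sum_by_residue[OF w0 S per])
    also have "\<dots> = (\<Sum>m\<in>SL2_mod w. real (card {a\<in>S. mat_cong w a m}) * ?H m)"
    proof (rule sum.cong[OF refl])
      fix m assume m: "m \<in> SL2_mod w"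
      have "red w a = m \<longleftrightarrow> mat_cong w a m" for a
        using red_eq_iff[of w a m] red_id[OF m] by simp
      then show "real (card {a\<in>S. red w a = m}) * ?H m = real (card {a\<in>S. mat_cong w a m}) * ?H m" by simp
    qed
    finally have s1: "(\<Sum>a\<in>S. ?H a) = (\<Sum>m\<in>SL2_mod w. real (card {a\<in>S. mat_cong w a m}) * ?H m)" .
    have "(\<Sum>m\<in>SL2_mod w. ?H m) = real (card (SL2_mod w)) * exc_mean w"
      using sum_SL2_shift[OF w0 periodic_prods(1)[OF w], of x z] x z by (simp add: sum_exc_prod[OF w])
    then have s2: "real (card S) * exc_mean w = (\<Sum>m\<in>SL2_mod w. real (card S) / real (card (SL2_mod w)) * ?H m)"
      unfolding sum_distrib_left[symmetric] using less_imp_neq[OF N, symmetric] by (simp del: of_nat_eq_0_iff)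
    have "\<bar>(\<Sum>a\<in>S. ?H a) - real (card S) * exc_mean w\<bar> =
        \<bar>\<Sum>m\<in>SL2_mod w. (real (card {a\<in>S. mat_cong w a m}) - real (card S) / real (card (SL2_mod w))) * ?H m\<bar>"
      unfolding s1 s2 by (simp add: sum_subtractf left_diff_distrib)
    also have "\<dots> \<le> (\<Sum>m\<in>SL2_mod w. \<bar>(real (card {a\<in>S. mat_cong w a m}) - real (card S) / real (card (SL2_mod w))) * ?H m\<bar>)"
      by (rule sum_abs)
    also have "\<dots> \<le> (\<Sum>m\<in>SL2_mod w. E * 1)"
      unfolding abs_mult
    proof (rule sum_mono)
      fix m assume "m \<in> SL2_mod w"
      note e = eq[OF this]
      then show "\<bar>real (card {a\<in>S. mat_cong w a m}) - real (card S) / real (card (SL2_mod w))\<bar> * \<bar>?H m\<bar> \<le> E * 1"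
        using exc_prod_abs_le_1 by (intro mult_mono) auto
    qed
    also have "\<dots> = real (card (SL2_mod w)) * E" by simp
    also have "\<dots> \<le> real w ^ 4 * E"
    proof (rule mult_right_mono)
      have "real (card (SL2_mod w)) \<le> real (w ^ 4)" using card_SL2_mod_le by (simp only: of_nat_le_iff)
      then show "real (card (SL2_mod w)) \<le> real w ^ 4" by simp
      obtain m where "m \<in> SL2_mod w" using SL2_mod_nonempty[OF w0] by blast
      then show "0 \<le> E" using eq abs_ge_zero order_trans by blast
    qed
    finally show ?thesis .
  qed
  have swap: "triple_sum A S B (exc_prod w) = (\<Sum>x\<in>A. \<Sum>z\<in>B. \<Sum>a\<in>S. exc_prod w (x ** a ** z))"
    unfolding triple_sum_def by (intro sum.cong refl sum.swap)
  have "discrepancy A S B w = (\<Sum>x\<in>A. \<Sum>z\<in>B. (\<Sum>a\<in>S. exc_prod w (x ** a ** z)) - real (card S) * exc_mean w)"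
    unfolding discrepancy_def swap by (simp add: sum_subtractf)
  also have "\<bar>\<dots>\<bar> \<le> (\<Sum>x\<in>A. \<bar>\<Sum>z\<in>B. (\<Sum>a\<in>S. exc_prod w (x ** a ** z)) - real (card S) * exc_mean w\<bar>)" by (rule sum_abs)
  also have "\<dots> \<le> (\<Sum>x\<in>A. \<Sum>z\<in>B. \<bar>(\<Sum>a\<in>S. exc_prod w (x ** a ** z)) - real (card S) * exc_mean w\<bar>)"
    by (rule sum_mono) (rule sum_abs)
  also have "\<dots> \<le> (\<Sum>x\<in>A. \<Sum>z\<in>B. real w ^ 4 * E)"
    using each A B by (intro sum_mono) auto
  also have "\<dots> = real (card A) * real (card B) * (real w ^ 4 * E)" by simp
  finally show ?thesis .
qed

text \<open>The L1 norm modulo p is O(1/p) for \<open>osc\<close> but O(1/p^2) for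
  \<open>kap\<close>. The factor k^(-2) is what makes terms with large error modulus k small without
  any cancellation.\<close>

lemma sum_abs_osc_kap_prod:
  assumes dk: "coprime d k" "squarefree d" "squarefree k"
  shows "(\<Sum>g\<in>SL2_mod (d * k). \<bar>osc_prod d g * kap_prod k g\<bar>) \<le>
    8 ^ \<omega> (d * k) * real (d * k) ^ 3 / (real d * (real k)\<^sup>2)"
proof -
  have pos: "d > 0" "k > 0" using dk squarefree_pos by auto
  have sq: "squarefree (d * k)" using dk by (simp add: squarefree_mult_coprime)
  have peri: "periodic p (\<lambda>g. \<bar>F g\<bar>)" if "periodic p F" for p and F :: "int^2^2 \<Rightarrow> real"
    using periodicD[OF that] unfolding periodic_def by metis
  have each: "(\<Sum>g\<in>SL2_mod n. \<Prod>p\<in>prime_factors n. \<bar>F p g\<bar>) \<le> 8 ^ \<omega> n / real n ^ j * real (card (SL2_mod n))"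
    if n: "squarefree n" and per: "\<And>p. periodic p (F p)"
      and F: "\<And>p. prime p \<Longrightarrow> (\<Sum>g\<in>SL2_mod p. \<bar>F p g\<bar>) \<le> 8 / real p ^ j * real (card (SL2_mod p))"
    for n j and F :: "nat \<Rightarrow> int^2^2 \<Rightarrow> real"
  proof -
    have "(\<Sum>g\<in>SL2_mod n. \<Prod>p\<in>prime_factors n. \<bar>F p g\<bar>) = (\<Prod>p\<in>prime_factors n. \<Sum>g\<in>SL2_mod p. \<bar>F p g\<bar>)"
      by (rule sum_SL2_squarefree[OF n peri[OF per]])
    also have "\<dots> \<le> (\<Prod>p\<in>prime_factors n. 8 / real p ^ j * real (card (SL2_mod p)))"
      using F by (intro prod_mono) (auto intro: sum_nonneg)
    also have "\<dots> = 8 ^ \<omega> n / real n ^ j * real (card (SL2_mod n))"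
      by (simp only: prod.distrib prod_inverse_prime_factors[OF n] card_SL2_squarefree[OF n])
    finally show ?thesis .
  qed
  have "(\<Sum>g\<in>SL2_mod (d * k). \<bar>osc_prod d g * kap_prod k g\<bar>) = (\<Sum>g\<in>SL2_mod (d * k). \<bar>osc_prod d g\<bar> * \<bar>kap_prod k g\<bar>)"
    by (simp add: abs_mult)
  also have "\<dots> = (\<Sum>g\<in>SL2_mod d. \<bar>osc_prod d g\<bar>) * (\<Sum>g\<in>SL2_mod k. \<bar>kap_prod k g\<bar>)"
    using dk pos by (intro sum_SL2_mult peri periodic_prods) auto
  also have "\<dots> \<le> (8 ^ \<omega> d / real d ^ 1 * real (card (SL2_mod d))) *
      (8 ^ \<omega> k / real k ^ 2 * real (card (SL2_mod k)))"
    unfolding osc_prod_def kap_prod_def abs_prod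
    using sum_abs_osc sum_abs_kap periodic_osc periodic_kap dk
    by (intro mult_mono each) (auto intro!: sum_nonneg prod_nonneg)
  also have "\<dots> \<le> (8 ^ \<omega> d / real d ^ 1 * real d ^ 3) *
      (8 ^ \<omega> k / real k ^ 2 * real k ^ 3)"
    using card_SL2_squarefree_le dk by (intro mult_mono mult_left_mono) auto
  also have "\<dots> = 8 ^ (\<omega> d + \<omega> k) * real (d * k) ^ 3 / (real d * (real k)\<^sup>2)"
    by (simp add: power_add power_mult_distrib)
  also have "\<omega> d + \<omega> k = \<omega> (d * k)"
    using pos coprime_prime_factors_disjoint[OF dk(1)] by (simp add: prime_factors_product card_Un_disjoint)
  finally show ?thesis .
qed

lemma triple_sum_abs_le_coll:
  fixes F :: "int^2^2 \<Rightarrow> real"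
  assumes w: "w > 0" and per: "periodic w F" and L: "(\<Sum>g\<in>SL2_mod w. \<bar>F g\<bar>) \<le> L"
    and A: "finite A" "\<And>x. x \<in> A \<Longrightarrow> det x = 1" and B: "finite B" "\<And>x. x \<in> B \<Longrightarrow> det x = 1"
    and S: "\<And>x. x \<in> S \<Longrightarrow> det x = 1"
  shows "\<bar>triple_sum A S B F\<bar> \<le> real (card S) * (L * sqrt (real (coll w A)) * sqrt (real (coll w B)))"
proof -
  have per': "periodic w (\<lambda>g. \<bar>F g\<bar>)" using periodicD[OF per] unfolding periodic_def by metis
  have each: "(\<Sum>x\<in>A. \<Sum>z\<in>B. \<bar>F (x ** a ** z)\<bar>) \<le> L * sqrt (real (coll w A)) * sqrt (real (coll w B))" if a: "a \<in> S" for a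
  proof (rule bilinear_coll_bound[OF w A B])
    have da: "det a = 1" by (rule S[OF a])
    show "periodic w (\<lambda>g. \<bar>F (g ** a ** h)\<bar>)" for h
      using periodic_shift[OF per', of "mat 1" "a ** h"] by (simp add: matrix_mul_assoc)
    show "periodic w (\<lambda>h. \<bar>F (g ** a ** h)\<bar>)" for g
      using periodic_shift[OF per', of "g ** a" "mat 1"] by simp
    show "(\<Sum>h\<in>SL2_mod w. \<bar>F (g ** a ** h)\<bar>) \<le> L" if g: "g \<in> SL2_mod w" for g
    proof -
      have "[det (g ** a) = 1] (mod int w)" using SL2_mod_det[OF g] da by (simp add: det_mul)
      then show ?thesis using sum_SL2_left[OF w per', of "g ** a"] L by simp
    qed
    show "(\<Sum>g\<in>SL2_mod w. \<bar>F (g ** a ** h)\<bar>) \<le> L" if h: "h \<in> SL2_mod w" for h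
    proof -
      have "[det (a ** h) = 1] (mod int w)" using SL2_mod_det[OF h] da by (simp add: det_mul)
      then show ?thesis using sum_SL2_right[OF w per', of "a ** h"] L by (simp add: matrix_mul_assoc)
    qed
  qed auto
  have "\<bar>triple_sum A S B F\<bar> \<le> (\<Sum>x\<in>A. \<bar>\<Sum>a\<in>S. \<Sum>z\<in>B. F (x ** a ** z)\<bar>)"
    unfolding triple_sum_def by (rule sum_abs)
  also have "\<dots> \<le> (\<Sum>x\<in>A. \<Sum>a\<in>S. \<bar>\<Sum>z\<in>B. F (x ** a ** z)\<bar>)" by (rule sum_mono) (rule sum_abs)
  also have "\<dots> \<le> (\<Sum>x\<in>A. \<Sum>a\<in>S. \<Sum>z\<in>B. \<bar>F (x ** a ** z)\<bar>)"
    by (rule sum_mono, rule sum_mono) (rule sum_abs)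
  also have "\<dots> = (\<Sum>a\<in>S. \<Sum>x\<in>A. \<Sum>z\<in>B. \<bar>F (x ** a ** z)\<bar>)" by (rule sum.swap)
  also have "\<dots> \<le> (\<Sum>a\<in>S. L * sqrt (real (coll w A)) * sqrt (real (coll w B)))" by (rule sum_mono[OF each])
  finally show ?thesis by simp
qed

lemma osc_prod_expand:
  assumes "\<And>p. p \<in> prime_factors d \<Longrightarrow> p mod 4 = 1"
  shows "osc_prod d g = (\<Sum>\<pi>\<in>PiE (prime_factors d) (\<lambda>_. {1, -1} \<times> {1, -1}).
    oscp d (\<lambda>p. line p (fst (\<pi> p))) (\<lambda>p. line p (snd (\<pi> p))) g)"
proof -
  have "osc_prod d g = (\<Prod>p\<in>prime_factors d. \<Sum>st\<in>{1, -1} \<times> {1, -1}. par0 p (g *v line p (fst st)) (line p (snd st)))"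
    unfolding osc_prod_def
  proof (rule prod.cong[OF refl])
    fix p assume "p \<in> prime_factors d"
    then have "p mod 4 = 1" by (rule assms)
    then have "osc p g = (\<Sum>s\<in>{1,-1}. \<Sum>t\<in>{1,-1}. par0 p (g *v line p s) (line p t))" by (simp add: osc_def)
    also have "\<dots> = (\<Sum>st\<in>{1, -1} \<times> {1, -1}. par0 p (g *v line p (fst st)) (line p (snd st)))"
      by (subst sum.cartesian_product) (rule sum.cong, auto)
    finally show "osc p g = (\<Sum>st\<in>{1, -1} \<times> {1, -1}. par0 p (g *v line p (fst st)) (line p (snd st)))" .
  qed
  also have "\<dots> = (\<Sum>\<pi>\<in>PiE (prime_factors d) (\<lambda>_. {1, -1} \<times> {1, -1}).
      \<Prod>p\<in>prime_factors d. par0 p (g *v line p (fst (\<pi> p))) (line p (snd (\<pi> p))))"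
    by (rule prod_sum_PiE) auto
  finally show ?thesis by (simp only: oscp_def)
qed

text \<open>Each prime of d offers four pairs of isotropic lines, so the product is a sum of
  4^\<omega>(d) terms \<open>oscp\<close>; the largest of them dominates. If d has a prime not
  congruent to 1 modulo 4, the product vanishes.\<close>

lemma osc_prod_bilinear_le:
  obtains u v where "nzs d u" "nzs d v"
    "\<bar>\<Sum>x\<in>A. \<Sum>z\<in>B. osc_prod d (x ** a ** z)\<bar> \<le> 4 ^ \<omega> d * \<bar>\<Sum>x\<in>A. \<Sum>z\<in>B. oscp d u v (x ** a ** z)\<bar>"
proof (cases "\<forall>p\<in>prime_factors d. p mod 4 = 1")
  case False
  then obtain p where p: "p \<in> prime_factors d" "p mod 4 \<noteq> 1" by blast
  have "osc_prod d g = 0" for g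
    unfolding osc_prod_def using p by (intro prod_zero) (auto simp: osc_def)
  moreover have "nzs d (\<lambda>p. line p 1)" by (auto simp: nzs_def intro: nz_line)
  ultimately show ?thesis by (intro that[of "\<lambda>p. line p 1" "\<lambda>p. line p 1"]) auto
next
  case True
  define Pi :: "(nat \<Rightarrow> int \<times> int) set" where "Pi = PiE (prime_factors d) (\<lambda>_. {1, -1} \<times> {1, -1})"
  define u where "u \<pi> p = line p (fst (\<pi> p))" for \<pi> :: "nat \<Rightarrow> int \<times> int" and p
  define v where "v \<pi> p = line p (snd (\<pi> p))" for \<pi> :: "nat \<Rightarrow> int \<times> int" and p
  define f where "f \<pi> = \<bar>\<Sum>x\<in>A. \<Sum>z\<in>B. oscp d (u \<pi>) (v \<pi>) (x ** a ** z)\<bar>" for \<pi>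
  have Pi: "finite Pi" "Pi \<noteq> {}"
    unfolding Pi_def by (auto intro!: finite_PiE simp: PiE_eq_empty_iff)
  have "card ({1, -1} \<times> {1, -1} :: (int \<times> int) set) = 4" by (simp add: card_cartesian_product)
  then have cP: "card Pi = 4 ^ \<omega> d"
    unfolding Pi_def by (simp only: card_PiE finite_set_mset prod_constant)
  have "Max (f ` Pi) \<in> f ` Pi" using Pi by (intro Max_in) auto
  then obtain \<pi> where \<pi>: "\<pi> \<in> Pi" "Max (f ` Pi) = f \<pi>" by blast
  have "osc_prod d g = (\<Sum>\<pi>\<in>Pi. oscp d (u \<pi>) (v \<pi>) g)" for g
    unfolding Pi_def u_def v_def by (rule osc_prod_expand) (use True in blast)
  then have "(\<Sum>x\<in>A. \<Sum>z\<in>B. osc_prod d (x ** a ** z)) = (\<Sum>x\<in>A. \<Sum>z\<in>B. \<Sum>\<pi>\<in>Pi. oscp d (u \<pi>) (v \<pi>) (x ** a ** z))"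
    by simp
  also have "\<dots> = (\<Sum>x\<in>A. \<Sum>\<pi>\<in>Pi. \<Sum>z\<in>B. oscp d (u \<pi>) (v \<pi>) (x ** a ** z))"
    by (intro sum.cong refl sum.swap)
  also have "\<dots> = (\<Sum>\<pi>\<in>Pi. \<Sum>x\<in>A. \<Sum>z\<in>B. oscp d (u \<pi>) (v \<pi>) (x ** a ** z))" by (rule sum.swap)
  also have "\<bar>\<dots>\<bar> \<le> (\<Sum>\<pi>\<in>Pi. f \<pi>)" unfolding f_def by (rule sum_abs)
  also have "\<dots> \<le> (\<Sum>\<pi>'\<in>Pi. f \<pi>)" using Pi \<pi>(2) by (intro sum_mono) (metis Max_ge finite_imageI imageI)
  also have "\<dots> = 4 ^ \<omega> d * f \<pi>" by (simp add: cP)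
  finally have "\<bar>\<Sum>x\<in>A. \<Sum>z\<in>B. osc_prod d (x ** a ** z)\<bar> \<le> 4 ^ \<omega> d * f \<pi>" .
  moreover have "nzs d (u \<pi>)" "nzs d (v \<pi>)" unfolding nzs_def u_def v_def by (auto intro: nz_line)
  ultimately show ?thesis unfolding f_def by (intro that[of "u \<pi>" "v \<pi>"]) auto
qed

text \<open>\<open>kap_prod k\<close> is constant once \<open>x\<close> and \<open>z\<close> are fixed modulo \<open>k\<close>; there are at most \<open>k\<^sup>8\<close> such pairs
  of classes.\<close>

lemma small_kappa_part:
  fixes G W :: real
  assumes k: "squarefree k"
    and A: "finite A" "\<And>x. x \<in> A \<Longrightarrow> det x = 1" and B: "finite B" "\<And>x. x \<in> B \<Longrightarrow> det x = 1"
    and S: "\<And>x. x \<in> S \<Longrightarrow> det x = 1"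
    and W0: "0 \<le> W" and W: "\<And>d. d \<in> DD \<Longrightarrow> 4 ^ \<omega> d \<le> W"
    and sieve: "\<And>a A' B' u v. det a = 1 \<Longrightarrow> A' \<subseteq> A \<Longrightarrow> B' \<subseteq> B \<Longrightarrow> (\<And>d. d \<in> DD \<Longrightarrow> nzs d (u d) \<and> nzs d (v d)) \<Longrightarrow>
      (\<Sum>d\<in>DD. \<bar>\<Sum>x\<in>A'. \<Sum>z\<in>B'. oscp d (u d) (v d) (x ** a ** z)\<bar>) \<le> G"
  shows "(\<Sum>d\<in>DD. \<bar>triple_sum A S B (\<lambda>g. osc_prod d g * kap_prod k g)\<bar>) \<le> real (card S) * (real k ^ 8 * (W * G))"
proof -
  have k0: "k > 0" by (rule squarefree_pos[OF k])
  let ?R = "SL2_mod k"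
  define cl where "cl X g = {x \<in> X. red k x = g}" for X :: "(int^2^2) set" and g
  have G0: "0 \<le> G"
  proof -
    have "(\<Sum>d\<in>DD. \<bar>\<Sum>x\<in>{}. \<Sum>z\<in>{}. oscp d (\<lambda>p. line p 1) (\<lambda>p. line p 1) (x ** (mat 1 :: int^2^2) ** z)\<bar>) \<le> G"
      by (rule sieve[where A' = "{}" and B' = "{}" and a = "mat 1" and u = "\<lambda>_ p. line p 1" and v = "\<lambda>_ p. line p 1"]) (auto simp: det_I nzs_def intro: nz_line)
    then show ?thesis by simp
  qed
  have split: "sum F X = (\<Sum>g\<in>?R. \<Sum>x\<in>cl X g. F x)" if "finite X" "\<And>x. x \<in> X \<Longrightarrow> det x = 1" for X and F :: "int^2^2 \<Rightarrow> real"
    unfolding cl_def by (rule sum.group[symmetric]) (use that k0 in \<open>auto intro: red_in_SL2\<close>)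
  have one: "\<bar>\<Sum>x\<in>A. \<Sum>z\<in>B. osc_prod d (x ** a ** z) * kap_prod k (x ** a ** z)\<bar> \<le>
      (\<Sum>g\<in>?R. \<Sum>h\<in>?R. \<bar>\<Sum>x\<in>cl A g. \<Sum>z\<in>cl B h. osc_prod d (x ** a ** z)\<bar>)" if a: "a \<in> S" for a d
  proof -
    let ?f = "\<lambda>x z. osc_prod d (x ** a ** z) * kap_prod k (x ** a ** z)"
    have "(\<Sum>x\<in>A. \<Sum>z\<in>B. ?f x z) = (\<Sum>g\<in>?R. \<Sum>x\<in>cl A g. \<Sum>h\<in>?R. \<Sum>z\<in>cl B h. ?f x z)"
      by (rule trans[OF split[OF A]], simp, rule sum.cong[OF refl], rule sum.cong[OF refl], rule split[OF B]) simp
    also have "\<dots> = (\<Sum>g\<in>?R. \<Sum>h\<in>?R. \<Sum>x\<in>cl A g. \<Sum>z\<in>cl B h. ?f x z)"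
      by (intro sum.cong refl sum.swap)
    also have "\<dots> = (\<Sum>g\<in>?R. \<Sum>h\<in>?R. kap_prod k (g ** a ** h) * (\<Sum>x\<in>cl A g. \<Sum>z\<in>cl B h. osc_prod d (x ** a ** z)))"
    proof (intro sum.cong refl)
      fix g h assume "g \<in> ?R" "h \<in> ?R"
      have "kap_prod k (x ** a ** z) = kap_prod k (g ** a ** h)" if "x \<in> cl A g" "z \<in> cl B h" for x z
      proof -
        have "mat_cong k (x ** a ** z) (g ** a ** h)"
          using that unfolding cl_def by (intro mat_cong_mult mat_cong_refl) (auto intro: mat_cong_sym)
        then show ?thesis by (rule periodicD[OF periodic_prods(3)[OF k]])
      qed
      then show "(\<Sum>x\<in>cl A g. \<Sum>z\<in>cl B h. ?f x z) = kap_prod k (g ** a ** h) * (\<Sum>x\<in>cl A g. \<Sum>z\<in>cl B h. osc_prod d (x ** a ** z))"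
        by (simp add: sum_distrib_left mult.commute)
    qed
    also have "\<bar>\<dots>\<bar> \<le> (\<Sum>g\<in>?R. \<bar>\<Sum>h\<in>?R. kap_prod k (g ** a ** h) * (\<Sum>x\<in>cl A g. \<Sum>z\<in>cl B h. osc_prod d (x ** a ** z))\<bar>)"
      by (rule sum_abs)
    also have "\<dots> \<le> (\<Sum>g\<in>?R. \<Sum>h\<in>?R. \<bar>kap_prod k (g ** a ** h) * (\<Sum>x\<in>cl A g. \<Sum>z\<in>cl B h. osc_prod d (x ** a ** z))\<bar>)"
      by (rule sum_mono) (rule sum_abs)
    also have "\<dots> \<le> (\<Sum>g\<in>?R. \<Sum>h\<in>?R. 1 * \<bar>\<Sum>x\<in>cl A g. \<Sum>z\<in>cl B h. osc_prod d (x ** a ** z)\<bar>)"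
      unfolding abs_mult
    proof (intro sum_mono mult_right_mono kap_prod_abs_le_1)
      fix g h assume "g \<in> ?R" "h \<in> ?R"
      then show "[det (g ** a ** h) = 1] (mod int k)"
        using cong_mult[OF SL2_mod_det[of g k] SL2_mod_det[of h k]] S[OF a] by (simp add: det_mul)
    qed auto
    finally show ?thesis by simp
  qed
  have two: "(\<Sum>d\<in>DD. \<bar>\<Sum>x\<in>A'. \<Sum>z\<in>B'. osc_prod d (x ** a ** z)\<bar>) \<le> W * G"
    if a: "a \<in> S" and AB: "A' \<subseteq> A" "B' \<subseteq> B" for a A' B'
  proof -
    have "\<exists>uv. nzs d (fst uv) \<and> nzs d (snd uv) \<and> \<bar>\<Sum>x\<in>A'. \<Sum>z\<in>B'. osc_prod d (x ** a ** z)\<bar> \<le>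
        4 ^ \<omega> d * \<bar>\<Sum>x\<in>A'. \<Sum>z\<in>B'. oscp d (fst uv) (snd uv) (x ** a ** z)\<bar>" for d
      by (rule osc_prod_bilinear_le[of d a B' A']) (metis fst_conv snd_conv)
    then obtain uv where uv: "\<And>d. nzs d (fst (uv d))" "\<And>d. nzs d (snd (uv d))"
      "\<And>d. \<bar>\<Sum>x\<in>A'. \<Sum>z\<in>B'. osc_prod d (x ** a ** z)\<bar> \<le>
        4 ^ \<omega> d * \<bar>\<Sum>x\<in>A'. \<Sum>z\<in>B'. oscp d (fst (uv d)) (snd (uv d)) (x ** a ** z)\<bar>" by metis
    have "(\<Sum>d\<in>DD. \<bar>\<Sum>x\<in>A'. \<Sum>z\<in>B'. osc_prod d (x ** a ** z)\<bar>) \<le>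
      (\<Sum>d\<in>DD. W * \<bar>\<Sum>x\<in>A'. \<Sum>z\<in>B'. oscp d (fst (uv d)) (snd (uv d)) (x ** a ** z)\<bar>)"
    proof (rule sum_mono)
      fix d assume "d \<in> DD"
      then have "4 ^ \<omega> d * \<bar>\<Sum>x\<in>A'. \<Sum>z\<in>B'. oscp d (fst (uv d)) (snd (uv d)) (x ** a ** z)\<bar>
          \<le> W * \<bar>\<Sum>x\<in>A'. \<Sum>z\<in>B'. oscp d (fst (uv d)) (snd (uv d)) (x ** a ** z)\<bar>"
        by (intro mult_right_mono W) auto
      then show "\<bar>\<Sum>x\<in>A'. \<Sum>z\<in>B'. osc_prod d (x ** a ** z)\<bar> \<le> W * \<bar>\<Sum>x\<in>A'. \<Sum>z\<in>B'. oscp d (fst (uv d)) (snd (uv d)) (x ** a ** z)\<bar>"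
        using uv(3)[of d] by linarith
    qed
    also have "\<dots> = W * (\<Sum>d\<in>DD. \<bar>\<Sum>x\<in>A'. \<Sum>z\<in>B'. oscp d (fst (uv d)) (snd (uv d)) (x ** a ** z)\<bar>)"
      by (simp only: sum_distrib_left)
    also have "\<dots> \<le> W * G"
      by (intro mult_left_mono sieve[OF S[OF a] AB] W0) (use uv in auto)
    finally show ?thesis .
  qed
  have tri: "\<bar>triple_sum A S B F\<bar> \<le> (\<Sum>a\<in>S. \<bar>\<Sum>x\<in>A. \<Sum>z\<in>B. F (x ** a ** z)\<bar>)" for F
    unfolding triple_sum_def by (subst sum.swap) (rule sum_abs)
  have "(\<Sum>d\<in>DD. \<bar>triple_sum A S B (\<lambda>g. osc_prod d g * kap_prod k g)\<bar>) \<le>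
      (\<Sum>d\<in>DD. \<Sum>a\<in>S. \<bar>\<Sum>x\<in>A. \<Sum>z\<in>B. osc_prod d (x ** a ** z) * kap_prod k (x ** a ** z)\<bar>)"
    by (rule sum_mono) (rule tri)
  also have "\<dots> \<le> (\<Sum>d\<in>DD. \<Sum>a\<in>S. \<Sum>g\<in>?R. \<Sum>h\<in>?R. \<bar>\<Sum>x\<in>cl A g. \<Sum>z\<in>cl B h. osc_prod d (x ** a ** z)\<bar>)"
    by (rule sum_mono, rule sum_mono) (rule one)
  also have "\<dots> = (\<Sum>a\<in>S. \<Sum>d\<in>DD. \<Sum>g\<in>?R. \<Sum>h\<in>?R. \<bar>\<Sum>x\<in>cl A g. \<Sum>z\<in>cl B h. osc_prod d (x ** a ** z)\<bar>)"
    by (rule sum.swap)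
  also have "\<dots> = (\<Sum>a\<in>S. \<Sum>g\<in>?R. \<Sum>d\<in>DD. \<Sum>h\<in>?R. \<bar>\<Sum>x\<in>cl A g. \<Sum>z\<in>cl B h. osc_prod d (x ** a ** z)\<bar>)"
    by (rule sum.cong[OF refl]) (rule sum.swap)
  also have "\<dots> = (\<Sum>a\<in>S. \<Sum>g\<in>?R. \<Sum>h\<in>?R. \<Sum>d\<in>DD. \<bar>\<Sum>x\<in>cl A g. \<Sum>z\<in>cl B h. osc_prod d (x ** a ** z)\<bar>)"
    by (rule sum.cong[OF refl], rule sum.cong[OF refl]) (rule sum.swap)
  also have "\<dots> \<le> (\<Sum>a\<in>S. \<Sum>g\<in>?R. \<Sum>h\<in>?R. W * G)"
    by (intro sum_mono two) (auto simp: cl_def)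
  also have "\<dots> = real (card S) * ((real (card ?R))\<^sup>2 * (W * G))" by (simp add: power2_eq_square)
  also have "\<dots> \<le> real (card S) * ((real k ^ 4)\<^sup>2 * (W * G))"
  proof (intro mult_left_mono mult_right_mono power_mono)
    have "real (card ?R) \<le> real (k ^ 4)" using card_SL2_mod_le by (simp only: of_nat_le_iff)
    then show "real (card ?R) \<le> real k ^ 4" by simp
  qed (use W0 G0 in auto)
  finally show ?thesis by (simp flip: power_mult)
qed

section \<open>Sums over squarefree moduli\<close>

definition squarefrees :: "real \<Rightarrow> nat set" where
  "squarefrees Q = {q. squarefree q \<and> real q \<le> Q}"

lemma squarefrees_subset: "squarefrees Q \<subseteq> {1..nat \<lfloor>Q\<rfloor>}"
  unfolding squarefrees_def by (auto simp: le_nat_floor Suc_le_eq intro: squarefree_pos)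

lemma finite_squarefrees [simp]: "finite (squarefrees Q)"
  by (rule finite_subset[OF squarefrees_subset]) simp

lemma card_squarefrees_le: "Q \<ge> 0 \<Longrightarrow> real (card (squarefrees Q)) \<le> Q"
proof -
  assume Q: "Q \<ge> 0"
  have "card (squarefrees Q) \<le> card {1..nat \<lfloor>Q\<rfloor>}" by (intro card_mono squarefrees_subset) simp
  then have "real (card (squarefrees Q)) \<le> real (nat \<lfloor>Q\<rfloor>)" by simp
  also have "\<dots> \<le> Q" using Q by simp
  finally show ?thesis .
qed

lemma squarefrees_dvd: "q \<in> squarefrees Q \<Longrightarrow> w dvd q \<Longrightarrow> w \<in> squarefrees Q"
proof -
  assume q: "q \<in> squarefrees Q" and w: "w dvd q"
  then have "squarefree q" by (simp add: squarefrees_def)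
  then have "w \<le> q" "squarefree w" using w squarefree_pos squarefree_divisor(1) by (auto intro: dvd_imp_le)
  then show ?thesis using q by (auto simp: squarefrees_def intro: order_trans[of "real w" "real q"])
qed

lemma squarefrees_div: "q \<in> squarefrees Q \<Longrightarrow> w dvd q \<Longrightarrow> q div w \<in> squarefrees Q"
  by (erule squarefrees_dvd) (metis dvd_div_mult_self dvd_triv_left)

lemma sum_inverse_squarefrees_le:
  assumes "Q \<ge> 1" shows "(\<Sum>c\<in>squarefrees Q. 1 / real c) \<le> 1 + ln Q"
proof -
  define n where "n = nat \<lfloor>Q\<rfloor>"
  have n: "n \<ge> 1" "real n \<le> Q" using assms unfolding n_def by linarith+
  have "(\<Sum>c\<in>squarefrees Q. 1 / real c) \<le> (\<Sum>c=1..n. 1 / real c)"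
    unfolding n_def by (intro sum_mono2 squarefrees_subset) auto
  also have "\<dots> \<le> 1 + ln (real n)" by (rule harmonic_sum_le_ln[OF n(1)])
  also have "\<dots> \<le> 1 + ln Q" using n by simp
  finally show ?thesis .
qed

lemma sum_divisors_le_sum_product:
  fixes f :: "nat \<Rightarrow> nat \<Rightarrow> real"
  assumes T: "T \<subseteq> squarefrees Q"
    and f: "\<And>c w. 0 \<le> f c w" and R: "finite R"
    and sub: "\<And>q w. q \<in> T \<Longrightarrow> w dvd q \<Longrightarrow> (q div w, w) \<in> R"
  shows "(\<Sum>q\<in>T. \<Sum>w | w dvd q. f (q div w) w) \<le> (\<Sum>(c, w)\<in>R. f c w)"
proof -
  have fT: "finite T" by (rule finite_subset[OF T]) simp
  have pos: "q > 0" if "q \<in> T" for q using that T squarefree_pos by (auto simp: squarefrees_def)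
  have "(\<Sum>q\<in>T. \<Sum>w | w dvd q. f (q div w) w) = (\<Sum>(q, w)\<in>(SIGMA q:T. {w. w dvd q}). f (q div w) w)"
    using pos by (intro sum.Sigma fT) (auto intro: finite_divisors_nat)
  also have "\<dots> = (\<Sum>(c, w)\<in>(\<lambda>(q, w). (q div w, w)) ` (SIGMA q:T. {w. w dvd q}). f c w)"
  proof (subst sum.reindex)
    show "inj_on (\<lambda>(q, w). (q div w, w)) (SIGMA q:T. {w. w dvd q})"
    proof (rule inj_onI)
      fix x y assume x: "x \<in> (SIGMA q:T. {w. w dvd q})" and y: "y \<in> (SIGMA q:T. {w. w dvd q})"
        and eq: "(case x of (q, w) \<Rightarrow> (q div w, w)) = (case y of (q, w) \<Rightarrow> (q div w, w))"
      obtain q w q' w' where xy: "x = (q, w)" "y = (q', w')" by (cases x, cases y)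
      then have "w' = w" "w dvd q" "w dvd q'" "q div w = q' div w" using x y eq by auto
      then have "q = q'" by (metis dvd_mult_div_cancel)
      then show "x = y" using xy \<open>w' = w\<close> by simp
    qed
  qed (simp add: case_prod_unfold)
  also have "\<dots> \<le> (\<Sum>(c, w)\<in>R. f c w)"
    using f sub by (intro sum_mono2 R) auto
  finally show ?thesis .
qed

lemma rho_prod_bounds:
  assumes "squarefree c" shows "0 \<le> rho_prod c" "rho_prod c \<le> 4 ^ \<omega> c / real c"
proof -
  show "0 \<le> rho_prod c" unfolding rho_prod_def rho_def by (intro prod_nonneg) auto
  have "rho_prod c \<le> (\<Prod>p\<in>prime_factors c. 4 / real p ^ 1)"
    unfolding rho_prod_def
  proof (rule prod_mono)
    fix p assume "p \<in> prime_factors c"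
    then have "real p > 0" by (simp add: in_prime_factors_iff prime_gt_0_nat)
    then show "0 \<le> rho p \<and> rho p \<le> 4 / real p ^ 1" by (auto simp: rho_def intro!: divide_left_mono)
  qed
  then show "rho_prod c \<le> 4 ^ \<omega> c / real c"
    unfolding prod_inverse_prime_factors[OF assms] by simp
qed

text \<open>The divisor w of q is small (w \<le> Q0: equidistribution, \<open>E\<close>) or large.
  In the large range the mean is negligible, and w = d k with oscillating part d and error part k.
  For k > Q1 absolute values and collisions suffice (\<open>CC\<close>); for k \<le> Q1 one has d
  \<ge> Q0/Q1, and the large sieve bound \<open>G\<close> applies.\<close>

lemma total_remainder_bound:
  fixes Q Q0 Q1 W CC G E :: real
  assumes A: "finite A" "\<And>x. x \<in> A \<Longrightarrow> det x = 1" and B: "finite B" "\<And>x. x \<in> B \<Longrightarrow> det x = 1"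
    and S: "\<And>x. x \<in> S \<Longrightarrow> det x = 1"
    and Q: "1 \<le> Q1" "Q1 \<le> Q0" "1 \<le> Q"
    and W: "\<And>n. n \<in> squarefrees Q \<Longrightarrow> 8 ^ \<omega> n \<le> W" and W0: "0 \<le> W"
    and E: "\<And>w. squarefree w \<Longrightarrow> real w \<le> Q0 \<Longrightarrow> \<bar>discrepancy A S B w\<bar> \<le> E" "0 \<le> E"
    and CC: "\<And>w. w \<in> squarefrees Q \<Longrightarrow> real w ^ 3 * sqrt (real (coll w A)) * sqrt (real (coll w B)) \<le> CC" "0 \<le> CC"
    and G: "\<And>DD a A' B' u v. det a = 1 \<Longrightarrow> A' \<subseteq> A \<Longrightarrow> B' \<subseteq> B \<Longrightarrow>
      (\<And>d. d \<in> DD \<Longrightarrow> squarefree d \<and> Q0 / Q1 \<le> real d \<and> real d \<le> Q \<and> nzs d (u d) \<and> nzs d (v d)) \<Longrightarrow>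
      (\<Sum>d\<in>DD. \<bar>\<Sum>x\<in>A'. \<Sum>z\<in>B'. oscp d (u d) (v d) (x ** a ** z)\<bar>) \<le> G" "0 \<le> G"
  shows "(\<Sum>q\<in>squarefrees Q. \<bar>triple_sum A S B (hit_prod q) - real (card A) * real (card S) * real (card B) * dens_prod q\<bar>) \<le>
    W * (1 + ln Q) * (Q0 * E + real (card A) * real (card S) * real (card B) * (W * (2 / Q0)) +
      real (card S) * (W * CC * (1 + ln Q) * (2 / Q1)) + real (card S) * (Q1 ^ 9 * (W * G)))"
proof -
  define PP where "PP = real (card A) * real (card S) * real (card B)"
  have PP0: "0 \<le> PP" by (simp add: PP_def)
  let ?SQ = "squarefrees Q"
  define TS where "TS d k = \<bar>triple_sum A S B (\<lambda>g. osc_prod d g * kap_prod k g)\<bar>" for d k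
  have TS0: "0 \<le> TS d k" for d k by (simp add: TS_def)
  have lnQ: "0 \<le> 1 + ln Q" using Q(3) by (simp add: add_nonneg_nonneg)
  have W4: "4 ^ \<omega> n \<le> W" if "n \<in> ?SQ" for n
    using power_mono[of "4::real" 8 "\<omega> n"] W[OF that] by simp
  have sqpos: "squarefree q" "0 < real q" "real q \<le> Q" if "q \<in> ?SQ" for q
    using that squarefree_pos by (auto simp: squarefrees_def)
  have "(\<Sum>q\<in>?SQ. \<bar>triple_sum A S B (hit_prod q) - PP * dens_prod q\<bar>) \<le>
      (\<Sum>q\<in>?SQ. \<Sum>w | w dvd q. rho_prod (q div w) * \<bar>discrepancy A S B w\<bar>)"
  proof (rule sum_mono)
    fix q assume q: "q \<in> ?SQ"
    note sq = sqpos(1)[OF q]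
    have "\<bar>triple_sum A S B (hit_prod q) - PP * dens_prod q\<bar> = \<bar>\<Sum>w | w dvd q. rho_prod (q div w) * discrepancy A S B w\<bar>"
      unfolding PP_def remainder_decomposition[OF sq] ..
    also have "\<dots> \<le> (\<Sum>w | w dvd q. \<bar>rho_prod (q div w) * discrepancy A S B w\<bar>)" by (rule sum_abs)
    also have "\<dots> = (\<Sum>w | w dvd q. rho_prod (q div w) * \<bar>discrepancy A S B w\<bar>)"
    proof (rule sum.cong[OF refl])
      fix w assume "w \<in> {w. w dvd q}"
      then have "0 \<le> rho_prod (q div w)" using squarefree_divisor(2)[OF sq] rho_prod_bounds(1) by simp
      then show "\<bar>rho_prod (q div w) * discrepancy A S B w\<bar> = rho_prod (q div w) * \<bar>discrepancy A S B w\<bar>" by (simp add: abs_mult)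
    qed
    finally show "\<bar>triple_sum A S B (hit_prod q) - PP * dens_prod q\<bar> \<le> (\<Sum>w | w dvd q. rho_prod (q div w) * \<bar>discrepancy A S B w\<bar>)" .
  qed
  also have "\<dots> \<le> (\<Sum>(c, w)\<in>?SQ \<times> ?SQ. rho_prod c * \<bar>discrepancy A S B w\<bar>)"
  proof (rule sum_divisors_le_sum_product)
    show "0 \<le> rho_prod c * \<bar>discrepancy A S B w\<bar>" for c w
      unfolding rho_prod_def rho_def by (intro mult_nonneg_nonneg prod_nonneg) auto
  qed (auto intro: squarefrees_dvd squarefrees_div)
  also have "\<dots> = (\<Sum>c\<in>?SQ. rho_prod c) * (\<Sum>w\<in>?SQ. \<bar>discrepancy A S B w\<bar>)"
    by (simp only: sum_product sum.cartesian_product)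
  also have "\<dots> \<le> (W * (1 + ln Q)) * (\<Sum>w\<in>?SQ. \<bar>discrepancy A S B w\<bar>)"
  proof (rule mult_right_mono)
    have "(\<Sum>c\<in>?SQ. rho_prod c) \<le> (\<Sum>c\<in>?SQ. W * (1 / real c))"
    proof (rule sum_mono)
      fix c assume c: "c \<in> ?SQ"
      have "rho_prod c \<le> 4 ^ \<omega> c / real c" by (rule rho_prod_bounds(2)[OF sqpos(1)[OF c]])
      also have "\<dots> \<le> W / real c" using W4[OF c] by (intro divide_right_mono) auto
      finally show "rho_prod c \<le> W * (1 / real c)" by simp
    qed
    also have "\<dots> \<le> W * (1 + ln Q)"
      unfolding sum_distrib_left[symmetric] using sum_inverse_squarefrees_le[OF Q(3)] W0 by (rule mult_left_mono)
    finally show "(\<Sum>c\<in>?SQ. rho_prod c) \<le> W * (1 + ln Q)" .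
  qed (auto intro: sum_nonneg)
  also have "\<dots> \<le> (W * (1 + ln Q)) * (Q0 * E + PP * (W * (2 / Q0)) +
      real (card S) * (W * CC * (1 + ln Q) * (2 / Q1)) + real (card S) * (Q1 ^ 9 * (W * G)))"
  proof (rule mult_left_mono)
    define SM LG where "SM = {w \<in> ?SQ. real w \<le> Q0}" and "LG = {w \<in> ?SQ. Q0 < real w}"
    have fin: "finite SM" "finite LG" by (auto simp: SM_def LG_def)
    have "?SQ = SM \<union> LG" "SM \<inter> LG = {}" by (auto simp: SM_def LG_def)
    then have split: "(\<Sum>w\<in>?SQ. \<bar>discrepancy A S B w\<bar>) = (\<Sum>w\<in>SM. \<bar>discrepancy A S B w\<bar>) + (\<Sum>w\<in>LG. \<bar>discrepancy A S B w\<bar>)"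
      using fin by (simp add: sum.union_disjoint)
    have sm: "(\<Sum>w\<in>SM. \<bar>discrepancy A S B w\<bar>) \<le> Q0 * E"
    proof -
      have "(\<Sum>w\<in>SM. \<bar>discrepancy A S B w\<bar>) \<le> (\<Sum>w\<in>SM. E)"
        using sqpos(1) by (intro sum_mono E(1)) (auto simp: SM_def)
      also have "\<dots> = real (card SM) * E" by simp
      also have "\<dots> \<le> Q0 * E"
      proof (rule mult_right_mono[OF _ E(2)])
        have "card SM \<le> card (squarefrees Q0)" by (rule card_mono[OF finite_squarefrees]) (auto simp: SM_def squarefrees_def)
        then have "real (card SM) \<le> real (card (squarefrees Q0))" by simp
        also have "\<dots> \<le> Q0" using Q by (intro card_squarefrees_le) auto
        finally show "real (card SM) \<le> Q0" .
      qed
      finally show ?thesis .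
    qed
    \<comment> \<open>Reindexing w = d k by coprime pairs lets the two ranges of k be summed
      separately, with w beyond Q0 throughout.\<close>
    define R where "R = {(d, k). d \<in> ?SQ \<and> k \<in> ?SQ \<and> coprime d k \<and> d * k \<in> LG}"
    have finR: "finite R" by (rule finite_subset[of _ "?SQ \<times> ?SQ"]) (auto simp: R_def)
    have lg: "(\<Sum>w\<in>LG. \<bar>discrepancy A S B w\<bar>) \<le> (\<Sum>w\<in>LG. \<Sum>k | k dvd w. TS (w div k) k) + (\<Sum>w\<in>LG. PP * \<bar>exc_mean w\<bar>)"
      unfolding sum.distrib[symmetric]
    proof (rule sum_mono)
      fix w assume "w \<in> LG"
      then have sq: "squarefree w" using sqpos(1) by (simp add: LG_def)
      have "\<bar>discrepancy A S B w\<bar> \<le> \<bar>triple_sum A S B (exc_prod w)\<bar> + \<bar>PP * exc_mean w\<bar>"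
        unfolding discrepancy_def PP_def by (rule abs_triangle_ineq4)
      moreover have "\<bar>triple_sum A S B (exc_prod w)\<bar> \<le> (\<Sum>k | k dvd w. TS (w div k) k)"
        unfolding exc_prod_decomposition[OF sq] TS_def by (rule sum_abs)
      moreover have "\<bar>PP * exc_mean w\<bar> = PP * \<bar>exc_mean w\<bar>" using PP0 by (simp add: abs_mult)
      ultimately show "\<bar>discrepancy A S B w\<bar> \<le> (\<Sum>k | k dvd w. TS (w div k) k) + PP * \<bar>exc_mean w\<bar>" by linarith
    qed
    have mean: "(\<Sum>w\<in>LG. PP * \<bar>exc_mean w\<bar>) \<le> PP * (W * (2 / Q0))"
    proof -
      have "(\<Sum>w\<in>LG. PP * \<bar>exc_mean w\<bar>) \<le> (\<Sum>w\<in>LG. PP * (W * (1 / (real w)\<^sup>2)))"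
      proof (intro sum_mono mult_left_mono PP0)
        fix w assume "w \<in> LG"
        then have w: "w \<in> ?SQ" by (simp add: LG_def)
        have "\<bar>exc_mean w\<bar> \<le> 8 ^ \<omega> w / (real w)\<^sup>2" by (rule exc_mean_abs_le[OF sqpos(1)[OF w]])
        also have "\<dots> \<le> W / (real w)\<^sup>2" using W[OF w] by (intro divide_right_mono) auto
        finally show "\<bar>exc_mean w\<bar> \<le> W * (1 / (real w)\<^sup>2)" by simp
      qed
      also have "\<dots> = PP * (W * (\<Sum>w\<in>LG. 1 / (real w)\<^sup>2))" by (simp only: sum_distrib_left)
      also have "\<dots> \<le> PP * (W * (2 / Q0))"
        using Q by (intro mult_left_mono PP0 W0 sum_inverse_square_tail_le fin) (auto simp: LG_def)
      finally show ?thesis .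
    qed
    have "(\<Sum>w\<in>LG. \<Sum>k | k dvd w. TS (w div k) k) \<le> (\<Sum>(d, k)\<in>R. TS d k)"
    proof (rule sum_divisors_le_sum_product[OF _ TS0 finR])
      show "LG \<subseteq> ?SQ" by (auto simp: LG_def)
      fix w k assume w: "w \<in> LG" "k dvd w"
      then have "w \<in> ?SQ" by (simp add: LG_def)
      moreover from this have "coprime (w div k) k" using squarefree_divisor(3)[OF sqpos(1) w(2)] by (simp add: coprime_commute)
      ultimately show "(w div k, k) \<in> R" using w squarefrees_dvd squarefrees_div by (auto simp: R_def)
    qed
    also have "\<dots> = (\<Sum>(d, k)\<in>{x \<in> R. Q1 < real (snd x)}. TS d k) + (\<Sum>(d, k)\<in>{x \<in> R. real (snd x) \<le> Q1}. TS d k)"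
    proof -
      have "R = {x \<in> R. Q1 < real (snd x)} \<union> {x \<in> R. real (snd x) \<le> Q1}" by auto
      then show ?thesis using finR by (subst sum.union_disjoint[symmetric]) auto
    qed
    also have "(\<Sum>(d, k)\<in>{x \<in> R. Q1 < real (snd x)}. TS d k) \<le> real (card S) * (W * CC * (1 + ln Q) * (2 / Q1))"
    proof -
      define BK where "BK = {k \<in> ?SQ. Q1 < real k}"
      have "(\<Sum>(d, k)\<in>{x \<in> R. Q1 < real (snd x)}. TS d k) \<le>
          (\<Sum>(d, k)\<in>{x \<in> R. Q1 < real (snd x)}. real (card S) * (W * CC) * ((1 / real d) * (1 / (real k)\<^sup>2)))"
      proof (rule sum_mono)
        fix x assume x: "x \<in> {x \<in> R. Q1 < real (snd x)}"
        obtain d k where dk: "x = (d, k)" by (cases x)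
        then have c: "d \<in> ?SQ" "k \<in> ?SQ" "coprime d k" "d * k \<in> ?SQ" using x by (auto simp: R_def LG_def)
        define w where "w = d * k"
        have w: "w \<in> ?SQ" "w > 0" using c(4) sqpos(2)[OF c(1)] sqpos(2)[OF c(2)] by (simp_all add: w_def)
        have sq: "squarefree d" "squarefree k" "squarefree w" using sqpos(1) c w by auto
        have per: "periodic w (\<lambda>g. osc_prod d g * kap_prod k g)"
          using periodicD[OF periodic_dvd[OF periodic_prods(2)[OF sq(1)], of w]] periodicD[OF periodic_dvd[OF periodic_prods(3)[OF sq(2)], of w]]
          unfolding periodic_def w_def by auto
        have "TS d k \<le> real (card S) * ((8 ^ \<omega> w * real w ^ 3 / (real d * (real k)\<^sup>2)) * sqrt (real (coll w A)) * sqrt (real (coll w B)))"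
          unfolding TS_def
          by (rule triple_sum_abs_le_coll[OF w(2) per _ A B S])
             (use sum_abs_osc_kap_prod[OF c(3) sq(1,2)] in \<open>simp_all add: w_def\<close>)
        also have "\<dots> = real (card S) * (8 ^ \<omega> w * (real w ^ 3 * sqrt (real (coll w A)) * sqrt (real (coll w B)))) * ((1 / real d) * (1 / (real k)\<^sup>2))"
          by (simp add: mult_ac)
        also have "\<dots> \<le> real (card S) * (W * CC) * ((1 / real d) * (1 / (real k)\<^sup>2))"
          using W[OF w(1)] CC(1)[OF w(1)] W0
          by (intro mult_right_mono mult_left_mono mult_mono) auto
        finally show "(case x of (d, k) \<Rightarrow> TS d k) \<le> (case x of (d, k) \<Rightarrow> real (card S) * (W * CC) * ((1 / real d) * (1 / (real k)\<^sup>2)))"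
          by (simp add: dk)
      qed
      also have "\<dots> \<le> (\<Sum>(d, k)\<in>?SQ \<times> BK. real (card S) * (W * CC) * ((1 / real d) * (1 / (real k)\<^sup>2)))"
        using W0 CC(2) by (intro sum_mono2) (auto simp: R_def BK_def)
      also have "\<dots> = real (card S) * (W * CC) * ((\<Sum>d\<in>?SQ. 1 / real d) * (\<Sum>k\<in>BK. 1 / (real k)\<^sup>2))"
      proof -
        have "(\<Sum>d\<in>?SQ. 1 / real d) * (\<Sum>k\<in>BK. 1 / (real k)\<^sup>2) = (\<Sum>(d, k)\<in>?SQ \<times> BK. (1 / real d) * (1 / (real k)\<^sup>2))"
          by (simp only: sum_product sum.cartesian_product)
        then show ?thesis by (simp only: sum_distrib_left case_prod_unfold)
      qed
      also have "\<dots> \<le> real (card S) * (W * CC) * ((1 + ln Q) * (2 / Q1))"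
        using sum_inverse_squarefrees_le[OF Q(3)] W0 CC(2) Q(1) lnQ
        by (intro mult_left_mono mult_mono sum_inverse_square_tail_le) (auto simp: BK_def intro!: sum_nonneg)
      finally show ?thesis by (simp add: mult_ac)
    qed
    also have "(\<Sum>(d, k)\<in>{x \<in> R. real (snd x) \<le> Q1}. TS d k) \<le> real (card S) * (Q1 ^ 9 * (W * G))"
    proof -
      define SK where "SK = {k \<in> ?SQ. real k \<le> Q1}"
      define DD where "DD k = {d. (d, k) \<in> R}" for k
      have finDD: "finite (DD k)" for k by (rule finite_subset[of _ ?SQ]) (auto simp: DD_def R_def)
      have "(\<Sum>(d, k)\<in>{x \<in> R. real (snd x) \<le> Q1}. TS d k) = (\<Sum>(k, d)\<in>(SIGMA k:SK. DD k). TS d k)"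
        by (rule sum.reindex_bij_witness[where i = "\<lambda>(k, d). (d, k)" and j = "\<lambda>(d, k). (k, d)"])
           (auto simp: R_def SK_def DD_def)
      also have "\<dots> = (\<Sum>k\<in>SK. \<Sum>d\<in>DD k. TS d k)"
        using finDD by (intro sum.Sigma[symmetric]) (auto simp: SK_def)
      also have "\<dots> \<le> (\<Sum>k\<in>SK. real (card S) * (Q1 ^ 8 * (W * G)))"
      proof (rule sum_mono)
        fix k assume k: "k \<in> SK"
        then have ksq: "squarefree k" "0 < real k" "real k \<le> Q1" using sqpos by (auto simp: SK_def)
        have dd: "squarefree d \<and> Q0 / Q1 \<le> real d \<and> real d \<le> Q" "d \<in> ?SQ" if d: "d \<in> DD k" for d
        proof -
          have dk: "d \<in> ?SQ" "Q0 < real d * real k" using d by (auto simp: DD_def R_def LG_def)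
          have "real d * real k \<le> real d * Q1" using ksq by (intro mult_left_mono) auto
          then have "Q0 / Q1 \<le> real d" using dk(2) Q by (simp add: field_simps)
          then show "squarefree d \<and> Q0 / Q1 \<le> real d \<and> real d \<le> Q" "d \<in> ?SQ" using sqpos dk by auto
        qed
        have "(\<Sum>d\<in>DD k. TS d k) \<le> real (card S) * (real k ^ 8 * (W * G))"
          unfolding TS_def
        proof (rule small_kappa_part[OF ksq(1) A B S W0])
          show "4 ^ \<omega> d \<le> W" if "d \<in> DD k" for d using W4 dd(2)[OF that] by blast
          show "(\<Sum>d\<in>DD k. \<bar>\<Sum>x\<in>A'. \<Sum>z\<in>B'. oscp d (u d) (v d) (x ** a ** z)\<bar>) \<le> G"
            if "det a = 1" "A' \<subseteq> A" "B' \<subseteq> B" "\<And>d. d \<in> DD k \<Longrightarrow> nzs d (u d) \<and> nzs d (v d)" for a A' B' u v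
            using that dd by (intro G(1)) auto
        qed
        also have "\<dots> \<le> real (card S) * (Q1 ^ 8 * (W * G))"
          using ksq W0 G(2) by (intro mult_left_mono mult_right_mono power_mono) auto
        finally show "(\<Sum>d\<in>DD k. TS d k) \<le> real (card S) * (Q1 ^ 8 * (W * G))" .
      qed
      also have "\<dots> = real (card SK) * (real (card S) * (Q1 ^ 8 * (W * G)))" by simp
      also have "\<dots> \<le> Q1 * (real (card S) * (Q1 ^ 8 * (W * G)))"
      proof (rule mult_right_mono)
        have "card SK \<le> card (squarefrees Q1)" by (rule card_mono[OF finite_squarefrees]) (auto simp: SK_def squarefrees_def)
        then have "real (card SK) \<le> real (card (squarefrees Q1))" by simp
        also have "\<dots> \<le> Q1" using Q by (intro card_squarefrees_le) auto
        finally show "real (card SK) \<le> Q1" .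
      qed (use W0 G(2) Q in auto)
      also have "\<dots> = real (card S) * (Q1 ^ 9 * (W * G))" by (simp add: eval_nat_numeral mult_ac)
      finally show ?thesis .
    qed
    finally have "(\<Sum>w\<in>LG. \<Sum>k | k dvd w. TS (w div k) k) \<le>
        real (card S) * (W * CC * (1 + ln Q) * (2 / Q1)) + real (card S) * (Q1 ^ 9 * (W * G))" by simp
    then show "(\<Sum>w\<in>?SQ. \<bar>discrepancy A S B w\<bar>) \<le> Q0 * E + PP * (W * (2 / Q0)) +
      real (card S) * (W * CC * (1 + ln Q) * (2 / Q1)) + real (card S) * (Q1 ^ 9 * (W * G))"
      using split sm lg mean by linarith
  qed (use W0 lnQ in simp)
  finally show ?thesis unfolding PP_def .
qed

section \<open>Choice of the parameters\<close>

lemma Gamma_ball_props: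
  assumes "O1 \<subseteq> {g \<in> Gamma A. mat_norm g < X}"
  shows "finite O1" "\<And>x. x \<in> O1 \<Longrightarrow> det x = 1" "O1 \<subseteq> semibox X"
proof -
  show s: "O1 \<subseteq> semibox X" using assms Gamma_subset_semibox by blast
  show "finite O1" by (rule finite_subset[OF s]) simp
  show "det x = 1" if "x \<in> O1" for x using that s semibox_det by blast
qed

text \<open>Moduli up to \<open>N\<^sup>\<kappa>\<close> count as small, error moduli up to \<open>N\<^sup>\<kappa>\<^sup>/\<^sup>2\<^sup>0\<^sup>0\<close> are split into residue
  classes, and every loss is a power of \<open>N\<^sup>\<epsilon>\<close> with \<open>\<epsilon>\<close> tiny compared to \<open>\<kappa>\<close>.\<close>

lemma remainder_power_saving:
  fixes C\<^sub>0 \<theta> c\<^sub>1 \<alpha> \<epsilon> \<kappa> :: real and A :: nat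
  assumes pos: "C\<^sub>0 > 0" "\<theta> > 0" "c\<^sub>1 > 0" "0 < \<alpha>" "\<alpha> < 1 / 8" "0 < \<epsilon>"
    and \<kappa>: "\<kappa> = 10000 * \<epsilon>" "\<kappa> * (C\<^sub>0 + 10) \<le> \<alpha> * \<theta> / 2"
  shows "\<forall>\<^sub>F N in at_top. \<forall>OX S OZ.
    OX \<subseteq> {g \<in> Gamma A. mat_norm g < N powr (3/4 - \<alpha>)} \<longrightarrow> N powr (2 * (3/4 - \<alpha>) - 3 * \<epsilon>) \<le> real (card OX) \<longrightarrow>
    OZ \<subseteq> {g \<in> Gamma A. mat_norm g < N powr (1/4)} \<longrightarrow> N powr (1/2 - 3 * \<epsilon>) \<le> real (card OZ) \<longrightarrow>
    is_aleph C\<^sub>0 \<theta> c\<^sub>1 (N powr \<alpha>) S \<longrightarrow>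
    (\<Sum>q\<in>squarefrees (N powr (1/18)). \<bar>triple_sum OX S OZ (hit_prod q) - real (card OX) * real (card S) * real (card OZ) * dens_prod q\<bar>)
      \<le> real (card OX) * real (card S) * real (card OZ) * N powr (- \<epsilon>)"
proof -
  define x where "x = 3/4 - \<alpha>"
  have x: "5/8 < x" "x < 3/4" using pos by (auto simp: x_def)
  obtain K where K: "K \<ge> 1" "\<And>n. n \<ge> 1 \<Longrightarrow> (8::real) ^ \<omega> n \<le> K * real n powr \<epsilon>"
    using pow_omega_le[OF pos(6), of 8] by auto
  obtain C where C: "C \<ge> 1" "\<And>M r. M \<ge> 1 \<Longrightarrow> r \<ge> 1 \<Longrightarrow> real r ^ 3 \<le> M\<^sup>2 \<Longrightarrow>
      real (coll r (semibox M)) \<le> C * M powr (4 + \<epsilon>) / real r ^ 3"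
    using coll_semibox[OF pos(6)] by blast
  obtain D where D: "D \<ge> 1" and LS: "\<And>M Z Q M0 A B a DD u v.
    M \<ge> 1 \<Longrightarrow> Z \<ge> 1 \<Longrightarrow> Q \<ge> 1 \<Longrightarrow> M0 \<ge> 1 \<Longrightarrow> Q ^ 6 \<le> M\<^sup>2 \<Longrightarrow> Q ^ 3 \<le> Z\<^sup>2 \<Longrightarrow>
    A \<subseteq> (\<lambda>(x1, x2, x3). x1 ** x2 ** x3) ` (semibox M \<times> semibox M \<times> semibox M) \<Longrightarrow>
    B \<subseteq> semibox Z \<Longrightarrow> det a = 1 \<Longrightarrow>
    (\<And>d. d \<in> DD \<Longrightarrow> squarefree d \<and> M0 \<le> real d \<and> real d \<le> Q \<and> nzs d (u d) \<and> nzs d (v d)) \<Longrightarrow>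
    (\<Sum>d\<in>DD. \<bar>\<Sum>x\<in>A. \<Sum>z\<in>B. oscp d (u d) (v d) (x ** a ** z)\<bar>)\<^sup>2
      \<le> D * real (card A) * (M powr (6 + \<epsilon>) * Z powr (4 + \<epsilon>) * Q powr \<epsilon> * M0 powr (- 1 / 4))"
    using large_sieve[OF pos(6)] by blast
  define a where "a = (real A + 1)\<^sup>2"
  have a: "a \<ge> 1" by (simp add: a_def)
  have ev: "\<forall>\<^sub>F N in at_top. c \<le> N powr \<epsilon>" for c :: real using pos(6) by real_asymp
  have evln: "\<forall>\<^sub>F N in at_top. 1 + ln (N powr (1/18)) \<le> N powr \<epsilon>" using pos(6) by real_asymp
  show ?thesis
    using ev[of K] ev[of C] ev[of D] ev[of "a powr (6 + \<epsilon>)"] ev[of c\<^sub>1] ev[of 4] evln eventually_ge_at_top[of 1]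
  proof eventually_elim
    case (elim N)
    show ?case
    proof (intro allI impI)
      fix OX S OZ :: "(int^2^2) set"
      assume OX: "OX \<subseteq> {g \<in> Gamma A. mat_norm g < N powr (3/4 - \<alpha>)}" and cX: "N powr (2 * (3/4 - \<alpha>) - 3 * \<epsilon>) \<le> real (card OX)"
        and OZ: "OZ \<subseteq> {g \<in> Gamma A. mat_norm g < N powr (1/4)}" and cZ: "N powr (1/2 - 3 * \<epsilon>) \<le> real (card OZ)"
        and S: "is_aleph C\<^sub>0 \<theta> c\<^sub>1 (N powr \<alpha>) S"
      note OX = OX[folded x_def] and cX = cX[folded x_def]
      note pX = Gamma_ball_props[OF OX] and pZ = Gamma_ball_props[OF OZ]
      have SG: "S \<subseteq> {g \<in> Gamma 2. mat_norm g < N powr \<alpha>}" using S by (simp add: is_aleph_def)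
      note pS = Gamma_ball_props[OF SG]
      have N1: "1 \<le> N" by fact
      then have N0: "0 < N" by simp
      have mono: "N powr s \<le> N powr t" if "s \<le> t" for s t using N1 that by (intro powr_mono) auto
      have padd: "N powr s * N powr t = N powr (s + t)" for s t by (simp add: powr_add)
      define nX nS nZ where "nX = real (card OX)" and "nS = real (card S)" and "nZ = real (card OZ)"
      have nn: "0 \<le> nX" "0 \<le> nS" "0 \<le> nZ" by (auto simp: nX_def nS_def nZ_def)
      define Q Q0 Q1 where "Q = N powr (1/18)" and "Q0 = N powr \<kappa>" and "Q1 = N powr (\<kappa> / 200)"
      \<comment> \<open>One factor N^\<epsilon> absorbs the constant \<open>K\<close>, the other the
        factor n^\<epsilon> of the bound for 8^\<omega>(n).\<close>
      define W where "W = N powr (2 * \<epsilon>)"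
      \<comment> \<open>N^(4 \<kappa>) counts residue classes, N^(\<kappa> \<open>C\<^sub>0\<close>)
        is the loss in the modulus, N^(-\<alpha> \<theta>) is the gain from the middle set of size
        parameter N^\<alpha>, and N^\<epsilon> absorbs \<open>c\<^sub>1\<close>.\<close>
      define E where "E = nX * nS * nZ * N powr (\<epsilon> + \<kappa> * (4 + C\<^sub>0) - \<alpha> * \<theta>)"
      \<comment> \<open>The sharp collision bounds give X^2 Z^2 = N^(2x + 1/2) here, independently
        of w, up to N^(2 \<epsilon>).\<close>
      define CC where "CC = N powr (2 * x + 1/2 + 2 * \<epsilon>)"
      \<comment> \<open>Q0/Q1 is N^(199 \<kappa>/200); the large sieve saves its power 1/4 in the
        square of the sum, hence 199 \<kappa>/1600 after taking the root.\<close>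
      define G where "G = nX * nZ * N powr (7 * \<epsilon> - 199 * \<kappa> / 1600)"
      have \<kappa>0: "\<kappa> > 0" using \<kappa>(1) pos by simp
      have ge1: "1 \<le> Q1" "Q1 \<le> Q0" "1 \<le> Q" "1 \<le> Q0 / Q1"
        unfolding Q1_def Q0_def Q_def using N1 \<kappa>0 by (auto intro!: ge_one_powr_ge_zero mono simp: divide_powr_uminus padd)
      have "(\<Sum>q\<in>squarefrees Q. \<bar>triple_sum OX S OZ (hit_prod q) - real (card OX) * real (card S) * real (card OZ) * dens_prod q\<bar>) \<le>
        W * (1 + ln Q) * (Q0 * E + real (card OX) * real (card S) * real (card OZ) * (W * (2 / Q0)) +
          real (card S) * (W * CC * (1 + ln Q) * (2 / Q1)) + real (card S) * (Q1 ^ 9 * (W * G)))"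
      proof (rule total_remainder_bound[OF pX(1,2) pZ(1,2) pS(2) ge1(1-3)])
        fix n assume "n \<in> squarefrees Q"
        then have n: "n \<ge> 1" "real n \<le> Q" using squarefrees_subset[of Q] by (auto simp: squarefrees_def)
        have "(8::real) ^ \<omega> n \<le> K * real n powr \<epsilon>" by (rule K(2)[OF n(1)])
        also have "\<dots> \<le> N powr \<epsilon> * N powr \<epsilon>"
        proof (rule mult_mono)
          have "real n \<le> N powr 1" using n(2) mono[of "1/18" 1] by (simp add: Q_def)
          then show "real n powr \<epsilon> \<le> N powr \<epsilon>" using N0 pos by (intro powr_mono2) auto
        qed (use elim in auto)
        finally show "8 ^ \<omega> n \<le> W" by (simp add: W_def padd)
      next
        fix w assume w: "squarefree w" "real w \<le> Q0"
        have w1: "w > 0" using squarefree_pos[OF w(1)] .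
        have "\<bar>discrepancy OX S OZ w\<bar> \<le> real (card OX) * real (card OZ) * (real w ^ 4 * (c\<^sub>1 * (real (card S) * real w powr C\<^sub>0 * (N powr \<alpha>) powr (- \<theta>))))"
          by (rule discrepancy_small_modulus[OF w(1) pX(2) pZ(2) pS(1,2)]) (use S w1 in \<open>auto simp: is_aleph_def Suc_le_eq\<close>)
        also have "\<dots> \<le> nX * nZ * (N powr (4 * \<kappa>) * (N powr \<epsilon> * (nS * N powr (\<kappa> * C\<^sub>0) * N powr (- (\<alpha> * \<theta>)))))"
        proof (unfold nX_def nZ_def nS_def, intro mult_left_mono mult_mono)
          have "real w ^ 4 \<le> Q0 ^ 4" using w by (intro power_mono) auto
          also have "\<dots> = N powr (4 * \<kappa>)" unfolding Q0_def using N0 by (simp add: powr_power mult.commute)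
          finally show "real w ^ 4 \<le> N powr (4 * \<kappa>)" .
          have "real w powr C\<^sub>0 \<le> Q0 powr C\<^sub>0" using w pos by (intro powr_mono2) auto
          then show "real w powr C\<^sub>0 \<le> N powr (\<kappa> * C\<^sub>0)" unfolding Q0_def by (simp add: powr_powr)
        qed (use elim pos in \<open>auto simp: powr_powr\<close>)
        also have "\<dots> = nX * nS * nZ * (N powr (4 * \<kappa>) * (N powr \<epsilon> * (N powr (\<kappa> * C\<^sub>0) * N powr (- (\<alpha> * \<theta>)))))"
          by (simp only: mult_ac)
        also have "\<dots> = E" unfolding padd E_def by (simp add: algebra_simps)
        finally show "\<bar>discrepancy OX S OZ w\<bar> \<le> E" .
      next
        fix w assume "w \<in> squarefrees Q"
        then have w: "w \<ge> 1" "real w \<le> Q" using squarefrees_subset[of Q] by (auto simp: squarefrees_def)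
        have "real w ^ 3 \<le> Q ^ 3" using w by (intro power_mono) auto
        also have "\<dots> = N powr (1/6)" unfolding Q_def using N0 by (simp add: powr_power)
        finally have w3: "real w ^ 3 \<le> N powr (1/6)" .
        have w0: "real w ^ 3 > 0" using w by simp
        have col: "real w ^ 3 * real (coll w V) \<le> N powr \<epsilon> * N powr (t * (4 + \<epsilon>))"
          if t: "1/4 \<le> t" and V: "V \<subseteq> semibox (N powr t)" for t V
        proof -
          have "(N powr t)\<^sup>2 = N powr (2 * t)" using N0 by (simp add: powr_power mult.commute)
          moreover have "N powr (1/6) \<le> N powr (2 * t)" using t by (intro mono) auto
          ultimately have "real w ^ 3 \<le> (N powr t)\<^sup>2" using w3 by simp
          moreover have "1 \<le> N powr t" using N1 t by (intro ge_one_powr_ge_zero) auto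
          ultimately have "real (coll w (semibox (N powr t))) \<le> C * (N powr t) powr (4 + \<epsilon>) / real w ^ 3"
            using w(1) by (intro C(2)) auto
          then have "real w ^ 3 * real (coll w (semibox (N powr t))) \<le> C * N powr (t * (4 + \<epsilon>))"
            using w0 by (simp add: powr_powr field_simps)
          moreover have "real (coll w V) \<le> real (coll w (semibox (N powr t)))"
            using coll_mono[OF V finite_semibox] by simp
          then have "real w ^ 3 * real (coll w V) \<le> real w ^ 3 * real (coll w (semibox (N powr t)))"
            using w0 by (intro mult_left_mono) auto
          moreover have "C * N powr (t * (4 + \<epsilon>)) \<le> N powr \<epsilon> * N powr (t * (4 + \<epsilon>))"
            using elim by (intro mult_right_mono) auto
          ultimately show ?thesis by linarith
        qed
        have "real w ^ 3 * sqrt (real (coll w OX)) * sqrt (real (coll w OZ)) =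
            sqrt (real w ^ 3 * real (coll w OX)) * sqrt (real w ^ 3 * real (coll w OZ))"
        proof -
          have "sqrt (r * s) * sqrt (r * t) = r * sqrt s * sqrt t" if "0 < r" for r s t :: real
          proof -
            have "sqrt (r * s) * sqrt (r * t) = (sqrt r * sqrt r) * sqrt s * sqrt t" by (simp only: real_sqrt_mult mult_ac)
            then show ?thesis using that by simp
          qed
          then show ?thesis using w0 by simp
        qed
        also have "\<dots> \<le> sqrt (N powr \<epsilon> * N powr (x * (4 + \<epsilon>))) * sqrt (N powr \<epsilon> * N powr (1/4 * (4 + \<epsilon>)))"
        proof (rule mult_mono)
          show "sqrt (real w ^ 3 * real (coll w OX)) \<le> sqrt (N powr \<epsilon> * N powr (x * (4 + \<epsilon>)))"
            by (rule real_sqrt_le_mono, rule col[OF _ pX(3)]) (use x in simp)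
          show "sqrt (real w ^ 3 * real (coll w OZ)) \<le> sqrt (N powr \<epsilon> * N powr (1/4 * (4 + \<epsilon>)))"
            by (rule real_sqrt_le_mono, rule col[OF _ pZ(3)]) simp
        qed (use w0 in auto)
        also have "\<dots> = N powr ((\<epsilon> + x * (4 + \<epsilon>)) / 2) * N powr ((\<epsilon> + 1/4 * (4 + \<epsilon>)) / 2)"
        proof -
          have "sqrt (N powr t) = N powr (t / 2)" for t using N0 by (simp add: powr_half_sqrt[symmetric] powr_powr)
          then show ?thesis by (simp only: padd)
        qed
        also have "\<dots> \<le> CC"
          unfolding CC_def padd
        proof (rule mono)
          define y where "y = x * \<epsilon>"
          have "y \<le> \<epsilon>" unfolding y_def using mult_right_mono[of x 1 \<epsilon>] x pos by simp
          moreover have eq: "x * (4 + \<epsilon>) = 4 * x + y" "1/4 * (4 + \<epsilon>) = 1 + \<epsilon> / 4" by (simp_all add: y_def algebra_simps)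
          ultimately show "(\<epsilon> + x * (4 + \<epsilon>)) / 2 + (\<epsilon> + 1/4 * (4 + \<epsilon>)) / 2 \<le> 2 * x + 1/2 + 2 * \<epsilon>"
            using pos(6) unfolding eq by argo
        qed
        finally show "real w ^ 3 * sqrt (real (coll w OX)) * sqrt (real (coll w OZ)) \<le> CC" .
      next
        fix DD and a' :: "int^2^2" and A' B' u v
        assume h: "det a' = 1" "A' \<subseteq> OX" "B' \<subseteq> OZ"
          "\<And>d. d \<in> DD \<Longrightarrow> squarefree d \<and> Q0 / Q1 \<le> real d \<and> real d \<le> Q \<and> nzs d (u d) \<and> nzs d (v d)"
        define M where "M = a * (N powr x) powr (1/3)"
        have Mx: "M = a * N powr (x / 3)" by (simp add: M_def powr_powr)
        have Nx: "1 \<le> N powr x" "1 \<le> N powr (x / 3)" "1 \<le> N powr (1/4)" using N1 x by (auto intro!: ge_one_powr_ge_zero)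
        have M1: "N powr (x / 3) \<le> M" using a mult_right_mono[of 1 a "N powr (x / 3)"] by (simp add: Mx)
        have "(\<Sum>d\<in>DD. \<bar>\<Sum>x\<in>A'. \<Sum>z\<in>B'. oscp d (u d) (v d) (x ** a' ** z)\<bar>)\<^sup>2
          \<le> D * real (card A') * (M powr (6 + \<epsilon>) * (N powr (1/4)) powr (4 + \<epsilon>) * Q powr \<epsilon> * (Q0 / Q1) powr (- 1 / 4))"
        proof (rule LS[OF _ Nx(3) ge1(3,4) _ _ _ _ h(1,4)])
          show "1 \<le> M" using M1 Nx by linarith
          have "Q ^ 6 = N powr (1/3)" unfolding Q_def using N0 by (simp add: powr_power)
          also have "\<dots> \<le> N powr (2 * (x / 3))" using x by (intro mono) auto
          also have "\<dots> = (N powr (x / 3))\<^sup>2" using N0 by (simp add: powr_power mult.commute)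
          also have "\<dots> \<le> M\<^sup>2" using M1 by (intro power_mono) auto
          finally show "Q ^ 6 \<le> M\<^sup>2" .
          have "Q ^ 3 = N powr (1/6)" unfolding Q_def using N0 by (simp add: powr_power)
          also have "\<dots> \<le> N powr (1/2)" by (intro mono) auto
          also have "\<dots> = (N powr (1/4))\<^sup>2" using N0 by (simp add: powr_power)
          finally show "Q ^ 3 \<le> (N powr (1/4))\<^sup>2" .
          show "A' \<subseteq> (\<lambda>(x1, x2, x3). x1 ** x2 ** x3) ` (semibox M \<times> semibox M \<times> semibox M)"
            using h(2) OX Gamma_factor_3[OF Nx(1), of A] unfolding M_def a_def by blast
          show "B' \<subseteq> semibox (N powr (1/4))" using h(3) pZ(3) by blast
        qed
        also have "\<dots> \<le> N powr \<epsilon> * nX * ((N powr \<epsilon> * N powr (2 * x + \<epsilon>)) * N powr (1 + \<epsilon>) * N powr \<epsilon> * N powr (- 199 * \<kappa> / 800))"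
        proof (intro mult_mono)
          show "real (card A') \<le> nX" using card_mono[OF pX(1) h(2)] by (simp add: nX_def)
          have "M powr (6 + \<epsilon>) = a powr (6 + \<epsilon>) * N powr (x / 3 * (6 + \<epsilon>))"
            unfolding Mx using a N0 by (simp add: powr_mult powr_powr)
          also have "\<dots> \<le> N powr \<epsilon> * N powr (2 * x + \<epsilon>)"
          proof (intro mult_mono mono)
            have "x * \<epsilon> \<le> 3 * \<epsilon>" using x pos by (intro mult_right_mono) auto
            then show "x / 3 * (6 + \<epsilon>) \<le> 2 * x + \<epsilon>" by (simp add: field_simps)
          qed (use elim in auto)
          finally show "M powr (6 + \<epsilon>) \<le> N powr \<epsilon> * N powr (2 * x + \<epsilon>)" .
          show "(N powr (1/4)) powr (4 + \<epsilon>) \<le> N powr (1 + \<epsilon>)"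
            unfolding powr_powr using pos by (intro mono) auto
          show "Q powr \<epsilon> \<le> N powr \<epsilon>" unfolding Q_def powr_powr using pos by (intro mono) auto
          have "Q0 / Q1 = N powr (199 * \<kappa> / 200)" unfolding Q0_def Q1_def by (simp add: powr_diff[symmetric])
          then show "(Q0 / Q1) powr (- 1 / 4) \<le> N powr (- 199 * \<kappa> / 800)" by (simp add: powr_powr)
        qed (use elim nn in auto)
        also have "\<dots> = nX * N powr (2 * x + 1 + 5 * \<epsilon> - 199 * \<kappa> / 800)"
        proof -
          have "N powr \<epsilon> * nX * ((N powr \<epsilon> * N powr (2 * x + \<epsilon>)) * N powr (1 + \<epsilon>) * N powr \<epsilon> * N powr (- 199 * \<kappa> / 800)) =
            nX * (N powr \<epsilon> * (N powr \<epsilon> * (N powr (2 * x + \<epsilon>) * (N powr (1 + \<epsilon>) * (N powr \<epsilon> * N powr (- 199 * \<kappa> / 800))))))"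
            by (simp only: mult_ac)
          then show ?thesis unfolding padd by (simp add: algebra_simps)
        qed
        \<comment> \<open>The full-box sizes N^(2x) and N are traded for the actual sizes of the two
          sets, one factor of the first and two of the second, each costing 3 \<epsilon>; thus 5
          \<epsilon> becomes 14 \<epsilon>.\<close>
        also have "\<dots> = nX * (N powr (2 * x - 3 * \<epsilon>) * (N powr (1/2 - 3 * \<epsilon>))\<^sup>2 * N powr (14 * \<epsilon> - 199 * \<kappa> / 800))"
        proof -
          have "(N powr (1/2 - 3 * \<epsilon>))\<^sup>2 = N powr (1 - 6 * \<epsilon>)" using N0 by (simp add: powr_power algebra_simps)
          then show ?thesis by (simp only: padd) (simp add: algebra_simps)
        qed
        also have "\<dots> \<le> nX * (nX * nZ\<^sup>2 * N powr (14 * \<epsilon> - 199 * \<kappa> / 800))"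
          using cX cZ nn unfolding nX_def nZ_def by (intro mult_left_mono mult_right_mono mult_mono power_mono) auto
        also have "\<dots> = G\<^sup>2"
        proof -
          have "(N powr (7 * \<epsilon> - 199 * \<kappa> / 1600))\<^sup>2 = N powr (14 * \<epsilon> - 199 * \<kappa> / 800)" using N0 by (simp add: powr_power algebra_simps)
          then show ?thesis unfolding G_def power_mult_distrib by (simp add: power2_eq_square)
        qed
        finally show "(\<Sum>d\<in>DD. \<bar>\<Sum>x\<in>A'. \<Sum>z\<in>B'. oscp d (u d) (v d) (x ** a' ** z)\<bar>) \<le> G"
          by (rule power2_le_imp_le) (use nn in \<open>simp add: G_def\<close>)
      qed (use nn in \<open>auto simp: W_def E_def CC_def G_def\<close>)
      also have "\<dots> \<le> (N powr (2 * \<epsilon>) * N powr \<epsilon>) * (4 * (nX * nS * nZ * N powr (- 38 * \<epsilon>)))"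
      proof (rule mult_mono)
        have lnQ: "1 + ln Q \<le> N powr \<epsilon>" "0 \<le> 1 + ln Q" using elim ge1 by (auto simp: Q_def)
        then show "W * (1 + ln Q) \<le> N powr (2 * \<epsilon>) * N powr \<epsilon>" unfolding W_def by (intro mult_left_mono) auto
        define PP where "PP = nX * nS * nZ"
        have PP: "0 \<le> PP" using nn by (simp add: PP_def)
        have "\<kappa> * (C\<^sub>0 + 10) > 0" using \<kappa>0 pos by simp
        have e1: "\<kappa> + (\<epsilon> + \<kappa> * (4 + C\<^sub>0) - \<alpha> * \<theta>) \<le> - 38 * \<epsilon>"
        proof -
          have "\<kappa> * (C\<^sub>0 + 10) = \<kappa> * (4 + C\<^sub>0) + 6 * \<kappa>" by (simp add: algebra_simps)
          then show ?thesis using \<kappa> \<kappa>0 pos \<open>\<kappa> * (C\<^sub>0 + 10) > 0\<close> by linarith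
        qed
        have t1: "Q0 * E \<le> PP * N powr (- 38 * \<epsilon>)"
        proof -
          have "Q0 * E = PP * (N powr \<kappa> * N powr (\<epsilon> + \<kappa> * (4 + C\<^sub>0) - \<alpha> * \<theta>))" by (simp add: Q0_def E_def PP_def)
          also have "\<dots> \<le> PP * N powr (- 38 * \<epsilon>)" unfolding padd by (intro mult_left_mono mono e1 PP)
          finally show ?thesis .
        qed
        have two: "2 \<le> N powr \<epsilon>" using elim by simp
        have t2: "PP * (W * (2 / Q0)) \<le> PP * N powr (- 38 * \<epsilon>)"
        proof (rule mult_left_mono[OF _ PP])
          have "W * (2 / Q0) \<le> N powr (2 * \<epsilon>) * (N powr \<epsilon> / N powr \<kappa>)"
            unfolding W_def Q0_def using two by (intro mult_left_mono divide_right_mono) auto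
          also have "\<dots> = N powr (2 * \<epsilon> + (\<epsilon> - \<kappa>))" by (simp only: powr_diff[symmetric] padd)
          also have "\<dots> \<le> N powr (- 38 * \<epsilon>)" using \<kappa> pos by (intro mono) auto
          finally show "W * (2 / Q0) \<le> N powr (- 38 * \<epsilon>)" .
        qed
        have XZ: "N powr (2 * x + 1/2 - 6 * \<epsilon>) \<le> nX * nZ"
        proof -
          have "N powr (2 * x - 3 * \<epsilon>) * N powr (1/2 - 3 * \<epsilon>) \<le> nX * nZ"
            using cX cZ unfolding nX_def nZ_def by (intro mult_mono) auto
          then show ?thesis unfolding padd by (simp add: algebra_simps)
        qed
        \<comment> \<open>The tightest term, where 38 comes from: Q1 = N^(50 \<epsilon>), of which
          12 \<epsilon> is spent on the losses.\<close>
        have t3: "nS * (W * CC * (1 + ln Q) * (2 / Q1)) \<le> PP * N powr (- 38 * \<epsilon>)"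
        proof -
          have "W * CC * (1 + ln Q) * (2 / Q1) \<le> N powr (2 * \<epsilon>) * N powr (2 * x + 1/2 + 2 * \<epsilon>) * N powr \<epsilon> * (N powr \<epsilon> / N powr (\<kappa> / 200))"
            unfolding W_def CC_def Q1_def using two lnQ by (intro mult_mono divide_right_mono) auto
          also have "\<dots> = N powr (2 * x + 1/2 - 6 * \<epsilon>) * N powr (12 * \<epsilon> - \<kappa> / 200)"
            by (simp only: padd powr_diff[symmetric]) (simp add: algebra_simps)
          also have "\<dots> \<le> (nX * nZ) * N powr (- 38 * \<epsilon>)"
            using XZ \<kappa> nn by (intro mult_mono mono) auto
          finally have "nS * (W * CC * (1 + ln Q) * (2 / Q1)) \<le> nS * ((nX * nZ) * N powr (- 38 * \<epsilon>))" using nn by (intro mult_left_mono)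
          then show ?thesis by (simp add: PP_def mult_ac)
        qed
        have t4: "nS * (Q1 ^ 9 * (W * G)) \<le> PP * N powr (- 38 * \<epsilon>)"
        proof -
          have "Q1 ^ 9 = N powr (9 * \<kappa> / 200)" unfolding Q1_def using N0 by (simp add: powr_power)
          then have "nS * (Q1 ^ 9 * (W * G)) = PP * (N powr (9 * \<kappa> / 200) * (N powr (2 * \<epsilon>) * N powr (7 * \<epsilon> - 199 * \<kappa> / 1600)))"
            by (simp add: W_def G_def PP_def)
          also have "\<dots> \<le> PP * N powr (- 38 * \<epsilon>)" unfolding padd using \<kappa> pos by (intro mult_left_mono mono PP) auto
          finally show ?thesis .
        qed
        show "Q0 * E + real (card OX) * real (card S) * real (card OZ) * (W * (2 / Q0)) +
          real (card S) * (W * CC * (1 + ln Q) * (2 / Q1)) + real (card S) * (Q1 ^ 9 * (W * G)) \<le> 4 * (nX * nS * nZ * N powr (- 38 * \<epsilon>))"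
          using t1 t2 t3 t4 unfolding PP_def nX_def nS_def nZ_def by linarith
        show "0 \<le> Q0 * E + real (card OX) * real (card S) * real (card OZ) * (W * (2 / Q0)) +
          real (card S) * (W * CC * (1 + ln Q) * (2 / Q1)) + real (card S) * (Q1 ^ 9 * (W * G))"
          unfolding Q0_def E_def W_def CC_def Q1_def G_def using ln_ge_zero[OF ge1(3)] nn by (intro add_nonneg_nonneg mult_nonneg_nonneg) auto
      qed (use N0 in auto)
      also have "\<dots> \<le> (N powr (2 * \<epsilon>) * N powr \<epsilon>) * (N powr \<epsilon> * (nX * nS * nZ * N powr (- 38 * \<epsilon>)))"
        using elim nn by (intro mult_left_mono mult_right_mono) auto
      also have "\<dots> = nX * nS * nZ * (N powr (2 * \<epsilon>) * (N powr \<epsilon> * (N powr \<epsilon> * N powr (- 38 * \<epsilon>))))" by (simp only: mult_ac)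
      also have "\<dots> \<le> nX * nS * nZ * N powr (- \<epsilon>)"
        unfolding padd using nn pos by (intro mult_left_mono mono) auto
      finally show "(\<Sum>q\<in>squarefrees (N powr (1/18)). \<bar>triple_sum OX S OZ (hit_prod q) - real (card OX) * real (card S) * real (card OZ) * dens_prod q\<bar>)
        \<le> real (card OX) * real (card S) * real (card OZ) * N powr (- \<epsilon>)"
        unfolding Q_def nX_def nS_def nZ_def .
    qed
  qed
qed

section \<open>From the sieve sequence to sums over triples\<close>

lemma prod_primes_dvd:
  fixes m :: nat
  assumes "finite P" "\<And>p. p \<in> P \<Longrightarrow> prime p" "\<And>p. p \<in> P \<Longrightarrow> p dvd m"
  shows "\<Prod>P dvd m"
  using assms
proof (induction P rule: finite_induct)
  case (insert p P)
  have "coprime p (\<Prod>P)" using insert by (intro coprime_prod_primes) auto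
  then show ?case using insert by (simp add: divides_mult)
qed simp

lemma hit_prod_eq:
  assumes "squarefree q"
  shows "hit_prod q g = of_bool (int q dvd (quad_form g)\<^sup>2 - 4)"
proof -
  let ?m = "nat \<bar>(quad_form g)\<^sup>2 - 4\<bar>"
  have d: "int p dvd (quad_form g)\<^sup>2 - 4 \<longleftrightarrow> p dvd ?m" for p by (simp add: int_dvd_int_iff[symmetric])
  have "(\<forall>p\<in>prime_factors q. p dvd ?m) \<longleftrightarrow> q dvd ?m"
  proof
    assume "\<forall>p\<in>prime_factors q. p dvd ?m"
    then have "\<Prod>(prime_factors q) dvd ?m" by (intro prod_primes_dvd) auto
    then show "q dvd ?m" by (simp only: squarefree_eq_prod_prime_factors[OF assms])
  qed (auto simp: in_prime_factors_iff intro: dvd_trans)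
  then show ?thesis
    unfolding hit_prod_def hit_def d by (cases "q dvd ?m") auto
qed

text \<open>Summing the sequence over multiples of q counts the matrices with q dividing f^2 - 4,
  and for squarefree q this is tested prime by prime. Indexing by naturals is harmless since
  determinant 1 gives f^2 \<ge> 4.\<close>

lemma sieve_mass_eq:
  assumes P: "finite P" "\<And>g. g \<in> P \<Longrightarrow> det g = 1" and q: "squarefree q"
  shows "real (sieve_mass P q) = (\<Sum>g\<in>P. hit_prod q g)"
proof -
  define val where "val g = nat ((quad_form g)\<^sup>2 - 4)" for g
  have val: "(quad_form g)\<^sup>2 - 4 = int (val g)" if "g \<in> P" for g
    using quad_form_square_ge[OF P(2)[OF that]] by (simp add: val_def)
  have seq: "sieve_seq P n = card {g \<in> P. val g = n}" for n
    unfolding sieve_seq_def using val by (intro arg_cong[where f = card]) auto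
  have supp: "{n. sieve_seq P n \<noteq> 0 \<and> q dvd n} = {n \<in> val ` P. q dvd n}"
  proof -
    have "card {g \<in> P. val g = n} \<noteq> 0 \<longleftrightarrow> n \<in> val ` P" for n
    proof -
      have "finite {g \<in> P. val g = n}" using P(1) by simp
      then show ?thesis by (subst card_0_eq) auto
    qed
    then show ?thesis unfolding seq by blast
  qed
  define H where "H = {g \<in> P. q dvd val g}"
  have "sieve_mass P q = (\<Sum>n\<in>{n \<in> val ` P. q dvd n}. card {g \<in> H. val g = n})"
    unfolding sieve_mass_def supp unfolding seq H_def by (intro sum.cong refl arg_cong[where f = card]) auto
  also have "\<dots> = (\<Sum>n\<in>{n \<in> val ` P. q dvd n}. \<Sum>g\<in>{g \<in> H. val g = n}. 1)" by simp
  also have "\<dots> = (\<Sum>g\<in>H. 1)"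
    using P(1) by (intro sum.group) (auto simp: H_def)
  finally have "sieve_mass P q = card H" by simp
  moreover have "(\<Sum>g\<in>P. hit_prod q g) = real (card H)"
  proof -
    have "(\<Sum>g\<in>P. hit_prod q g) = (\<Sum>g\<in>P. of_bool (q dvd val g))"
      by (rule sum.cong[OF refl]) (simp add: hit_prod_eq[OF q] val)
    then show ?thesis unfolding H_def using sum_of_bool_card[OF P(1)] by simp
  qed
  ultimately show ?thesis by simp
qed

lemma dens_prod_multiplicative: "multiplicative dens_prod"
  unfolding multiplicative_def
proof (intro conjI allI impI)
  show "dens_prod 1 = 1" by (simp add: dens_prod_def)
  fix m n :: nat assume h: "0 < m \<and> 0 < n \<and> coprime m n"
  have "prime_factors m \<inter> prime_factors n = {}" using h by (intro coprime_prime_factors_disjoint) simp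
  then show "dens_prod (m * n) = dens_prod m * dens_prod n"
    using h unfolding dens_prod_def by (simp add: prime_factors_product prod.union_disjoint)
qed

lemma dens_prod_prime: "prime p \<Longrightarrow> dens_prod p = dens p"
  by (simp add: dens_prod_def prime_factorization_prime)

lemma triple_product_stats:
  assumes OX: "is_Omega A c X OX" and S: "S \<subseteq> {g \<in> Gamma 2. mat_norm g < Y}" and OZ: "is_Omega A c' Z OZ"
  shows "card (triple_product OX S OZ) = card OX * (card S * card OZ)"
    "finite (triple_product OX S OZ)" "\<And>g. g \<in> triple_product OX S OZ \<Longrightarrow> det g = 1"
    "(\<Sum>g\<in>triple_product OX S OZ. F g) = triple_sum OX S OZ F"
proof -
  have bX: "OX \<subseteq> {g \<in> Gamma A. mat_norm g < X}" and bZ: "OZ \<subseteq> {g \<in> Gamma A. mat_norm g < Z}"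
    using OX OZ by (auto simp: is_Omega_def)
  note pX = Gamma_ball_props[OF bX] and pZ = Gamma_ball_props[OF bZ] and pS = Gamma_ball_props[OF S]
  obtain l where l: "OX \<subseteq> word_matrix ` {w. set w \<subseteq> {1..A} \<and> length w = l}" using OX by (auto simp: is_Omega_def)
  obtain k where k: "OZ \<subseteq> word_matrix ` {w. set w \<subseteq> {1..A} \<and> length w = k}" using OZ by (auto simp: is_Omega_def)
  have inj: "inj_on (\<lambda>(x, a, z). x ** a ** z) (OX \<times> S \<times> OZ)"
    by (rule triple_product_inj[OF _ l _ _ k]) (use bX bZ S in auto)
  show "card (triple_product OX S OZ) = card OX * (card S * card OZ)"
    unfolding triple_product_eq_image card_image[OF inj] by (simp add: card_cartesian_product)
  show "finite (triple_product OX S OZ)"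
    unfolding triple_product_eq_image using pX pZ pS by (intro finite_imageI finite_cartesian_product)
  show "det g = 1" if "g \<in> triple_product OX S OZ" for g
    using that pX(2) pZ(2) pS(2) unfolding triple_product_def by (auto simp: det_mul)
  have "(\<Sum>g\<in>triple_product OX S OZ. F g) = (\<Sum>(x, a, z)\<in>OX \<times> S \<times> OZ. F (x ** a ** z))"
    unfolding triple_product_eq_image by (subst sum.reindex[OF inj]) (simp add: case_prod_unfold)
  also have "\<dots> = triple_sum OX S OZ F"
    unfolding triple_sum_def by (simp add: sum.cartesian_product case_prod_unfold)
  finally show "(\<Sum>g\<in>triple_product OX S OZ. F g) = triple_sum OX S OZ F" .
qed

text \<open>The constant and the logarithm in the lower bound are absorbed into an arbitrarily small
  power of N.\<close>

lemma Omega_card_ge: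
  assumes "0 < s" "0 < c" "0 < \<tau>"
  shows "\<forall>\<^sub>F N in at_top. \<forall>S. is_Omega A c (N powr s) S \<longrightarrow> N powr (2 * cf_dim A * s - \<tau>) \<le> real (card S)"
proof -
  have "\<forall>\<^sub>F N :: real in at_top. N powr (- \<tau>) \<le> c / ln (N powr s)" using assms by real_asymp
  then show ?thesis
  proof eventually_elim
    case (elim N)
    show ?case
    proof (intro allI impI)
      fix S assume "is_Omega A c (N powr s) S"
      then have "c * ((N powr s) powr (2 * cf_dim A) / ln (N powr s)) \<le> real (card S)" by (simp add: is_Omega_def)
      moreover have "N powr (2 * cf_dim A * s - \<tau>) = N powr (2 * cf_dim A * s) * N powr (- \<tau>)" by (simp flip: powr_add)
      moreover have "N powr (2 * cf_dim A * s) * N powr (- \<tau>) \<le> N powr (2 * cf_dim A * s) * (c / ln (N powr s))"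
        using elim by (intro mult_left_mono) auto
      moreover have "(N powr s) powr (2 * cf_dim A) = N powr (2 * cf_dim A * s)" by (simp add: powr_powr mult.commute)
      ultimately show "N powr (2 * cf_dim A * s - \<tau>) \<le> real (card S)" by (simp add: mult.commute)
    qed
  qed
qed

theorem theorem3p2:
  fixes C\<^sub>0 \<theta> c\<^sub>1 :: real
  assumes "C\<^sub>0 > 0" and "\<theta> > 0" and "c\<^sub>1 > 0"
    and "\<forall>\<^sub>F Y in at_top. \<exists>S. is_aleph C\<^sub>0 \<theta> c\<^sub>1 Y S"
  shows "\<exists>\<eta>\<^sub>0>0. \<forall>\<eta>. 0 < \<eta> \<and> \<eta> < \<eta>\<^sub>0 \<longrightarrow>
    (\<forall>A\<^sub>0. \<exists>A::nat. A \<ge> A\<^sub>0 \<and> A \<ge> 1 \<and>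
    (\<exists>X Y Z :: real \<Rightarrow> real.
      (\<forall>N\<ge>1. X N * Y N * Z N = N) \<and>
      filterlim X at_top at_top \<and> filterlim Y at_top at_top \<and> filterlim Z at_top at_top \<and>
      (\<forall>c\<^sub>2>0. \<forall>\<Omega>\<^sub>X S \<Omega>\<^sub>Z P :: real \<Rightarrow> (int^2^2) set. \<forall>T :: real \<Rightarrow> real.
        (\<forall>\<^sub>F N in at_top. is_Omega A c\<^sub>2 (X N) (\<Omega>\<^sub>X N)) \<and>
        (\<forall>\<^sub>F N in at_top. is_aleph C\<^sub>0 \<theta> c\<^sub>1 (Y N) (S N)) \<and>
        (\<forall>\<^sub>F N in at_top. is_Omega A c\<^sub>2 (Z N) (\<Omega>\<^sub>Z N)) \<and>
        (\<forall>N. P N = triple_product (\<Omega>\<^sub>X N) (S N) (\<Omega>\<^sub>Z N)) \<and>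
        T \<in> \<Theta>[at_top](\<lambda>N. N ^ 4) \<and>
        (\<forall>\<^sub>F N in at_top. \<forall>n. sieve_seq (P N) n \<noteq> 0 \<longrightarrow> real n < T N) \<longrightarrow>
        (\<exists>(\<beta> :: nat \<Rightarrow> real) (r :: real \<Rightarrow> nat \<Rightarrow> real).
          (\<forall>N q. squarefree q \<longrightarrow>
             real (sieve_mass (P N) q) = \<beta> q * real (card (P N)) + r N q) \<and>
          multiplicative \<beta> \<and>
          (\<forall>p. prime p \<longrightarrow> \<beta> p \<noteq> 1) \<and>
          (\<exists>C. \<forall>w z :: real. 2 \<le> w \<and> w < z \<longrightarrow>
             (\<Prod>p | prime p \<and> w \<le> real p \<and> real p < z. inverse (1 - \<beta> p))
               \<le> C * (ln z / ln w)\<^sup>2) \<and>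
          (\<forall>K :: real.
             (\<lambda>N. \<Sum>q | squarefree q \<and> real q < T N powr (1/72 - \<eta>). \<bar>r N q\<bar>)
               \<in> O[at_top](\<lambda>N. real (card (P N)) / ln N powr K))) \<and>
        (\<forall>\<^sub>F N in at_top. real (card (P N)) > N powr (2 * cf_dim A - \<eta>)))))"
proof (rule exI[of _ "1/72"], intro conjI allI impI, goal_cases)
  case 1
  show ?case by simp
next
  case (2 \<eta> A\<^sub>0)
  \<comment> \<open>The upper limit 1/72 keeps the exponent of the level positive.\<close>
  then have \<eta>: "0 < \<eta> \<and> \<eta> < 1/72" by simp
  \<comment> \<open>The outer sets have total size parameter N^(1 - \<alpha>). As the dimension is
    at most 2, this loses at most \<eta>/4 in the exponent; with \<eta>/4 for each outer set the
    total loss stays below \<eta>.\<close>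
  define \<alpha> where "\<alpha> = \<eta> / 16"
  have \<alpha>: "0 < \<alpha>" "\<alpha> < 1/8" using \<eta> by (auto simp: \<alpha>_def)
  \<comment> \<open>The first bound keeps the loss N^(\<kappa> (5 + \<open>C\<^sub>0\<close>)) at
    small moduli below the equidistribution gain N^(\<alpha> \<theta>); the cap 1/100 makes
    \<epsilon> < 1.\<close>
  define \<kappa> where "\<kappa> = min (\<alpha> * \<theta> / (2 * (C\<^sub>0 + 10))) (1/100)"
  define \<epsilon> where "\<epsilon> = \<kappa> / 10000"
  have k0: "0 < \<kappa>" using \<alpha> assms by (simp add: \<kappa>_def)
  have \<epsilon>: "0 < \<epsilon>" "\<epsilon> < 1" using k0 by (auto simp: \<epsilon>_def \<kappa>_def)
  have \<kappa>: "\<kappa> = 10000 * \<epsilon>" "\<kappa> * (C\<^sub>0 + 10) \<le> \<alpha> * \<theta> / 2"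
  proof -
    show "\<kappa> = 10000 * \<epsilon>" by (simp add: \<epsilon>_def)
    have "\<kappa> * (C\<^sub>0 + 10) \<le> \<alpha> * \<theta> / (2 * (C\<^sub>0 + 10)) * (C\<^sub>0 + 10)"
      using assms by (intro mult_right_mono) (auto simp: \<kappa>_def)
    also have "\<dots> = \<alpha> * \<theta> / 2" using assms by (simp add: field_simps)
    finally show "\<kappa> * (C\<^sub>0 + 10) \<le> \<alpha> * \<theta> / 2" .
  qed
  obtain A1 where A1: "\<And>A. A \<ge> A1 \<Longrightarrow> 1 - \<epsilon> \<le> cf_dim A" using cf_dim_tendsto_1[OF \<epsilon>] by blast
  \<comment> \<open>\<open>A1\<close> depends only on \<epsilon>, hence on \<eta> and the
    equidistribution constants: the dimension deficit is at most \<epsilon>, so completing the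
    sparse sets costs only small multiples of \<epsilon> in the exponent.\<close>
  define A where "A = max (max A\<^sub>0 A1) 1"
  define \<delta> where "\<delta> = cf_dim A"
  have \<delta>: "1 - \<epsilon> \<le> \<delta>" "\<delta> \<le> 2" unfolding \<delta>_def by (auto intro: A1 cf_dim_le_2 simp: A_def)
  define x where "x = 3/4 - \<alpha>"
  have x: "0 < x" "x < 1" using \<alpha> by (auto simp: x_def)
  have powr_top: "filterlim (\<lambda>N :: real. N powr s) at_top at_top" if "0 < s" for s using that by real_asymp
  have size: "\<forall>\<^sub>F N in at_top. real (card (P N)) > N powr (2 * cf_dim A - \<eta>)"
    if c2: "0 < c\<^sub>2"
      and OX: "\<forall>\<^sub>F N in at_top. is_Omega A c\<^sub>2 (N powr x) (\<Omega>\<^sub>X N)"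
      and S: "\<forall>\<^sub>F N in at_top. is_aleph C\<^sub>0 \<theta> c\<^sub>1 (N powr \<alpha>) (S N)"
      and OZ: "\<forall>\<^sub>F N in at_top. is_Omega A c\<^sub>2 (N powr (1/4)) (\<Omega>\<^sub>Z N)"
      and P: "\<forall>N. P N = triple_product (\<Omega>\<^sub>X N) (S N) (\<Omega>\<^sub>Z N)"
    for c\<^sub>2 and \<Omega>\<^sub>X S \<Omega>\<^sub>Z P :: "real \<Rightarrow> (int^2^2) set"
  proof -
    have e4: "0 < \<eta> / 4" using \<eta> by simp
    show ?thesis
      using OX S OZ Omega_card_ge[OF x(1) c2 e4, of A] Omega_card_ge[OF _ c2 e4, of "1/4" A, simplified] eventually_gt_at_top[of 1]
    proof eventually_elim
      case (elim N)
      have SG: "S N \<subseteq> {g \<in> Gamma 2. mat_norm g < N powr \<alpha>}" "S N \<noteq> {}" using elim(2) by (auto simp: is_aleph_def)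
      have "card (S N) \<noteq> 0" using Gamma_ball_props(1)[OF SG(1)] SG(2) by simp
      then have S1: "1 \<le> real (card (S N))" by linarith
      have "N powr (2 * \<delta> * x - \<eta> / 4) \<le> real (card (\<Omega>\<^sub>X N))" using elim(1,4) by (simp add: \<delta>_def)
      moreover have "N powr (2 * \<delta> * (1/4) - \<eta> / 4) \<le> real (card (\<Omega>\<^sub>Z N))" using elim(3,5) by (simp add: \<delta>_def)
      ultimately have "N powr (2 * \<delta> * x - \<eta> / 4) * (1 * N powr (2 * \<delta> * (1/4) - \<eta> / 4)) \<le>
          real (card (\<Omega>\<^sub>X N)) * (real (card (S N)) * real (card (\<Omega>\<^sub>Z N)))"
        using S1 by (intro mult_mono mult_nonneg_nonneg) auto
      moreover have "N powr (2 * \<delta> - \<eta>) < N powr ((2 * \<delta> * x - \<eta> / 4) + (2 * \<delta> * (1/4) - \<eta> / 4))"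
      proof (rule powr_less_mono)
        have "\<delta> * \<eta> \<le> 2 * \<eta>" using \<delta> \<eta> by (intro mult_right_mono) auto
        moreover have "(2 * \<delta> * x - \<eta> / 4) + (2 * \<delta> * (1/4) - \<eta> / 4) = 2 * \<delta> - \<delta> * \<eta> / 8 - \<eta> / 2"
          by (simp add: x_def \<alpha>_def algebra_simps)
        ultimately show "2 * \<delta> - \<eta> < (2 * \<delta> * x - \<eta> / 4) + (2 * \<delta> * (1/4) - \<eta> / 4)" using \<eta> by linarith
      qed (use elim in simp)
      moreover have "real (card (P N)) = real (card (\<Omega>\<^sub>X N)) * (real (card (S N)) * real (card (\<Omega>\<^sub>Z N)))"
        using triple_product_stats(1)[OF elim(1) SG(1) elim(3)] P by simp
      moreover have "N powr ((2 * \<delta> * x - \<eta> / 4) + (2 * \<delta> * (1/4) - \<eta> / 4)) =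
            N powr (2 * \<delta> * x - \<eta> / 4) * (1 * N powr (2 * \<delta> * (1/4) - \<eta> / 4))"
          by (simp only: powr_add mult_1)
        ultimately show ?case unfolding \<delta>_def by linarith
    qed
  qed
  have core: "\<exists>(\<beta> :: nat \<Rightarrow> real) (r :: real \<Rightarrow> nat \<Rightarrow> real).
          (\<forall>N q. squarefree q \<longrightarrow>
             real (sieve_mass (P N) q) = \<beta> q * real (card (P N)) + r N q) \<and>
          multiplicative \<beta> \<and>
          (\<forall>p. prime p \<longrightarrow> \<beta> p \<noteq> 1) \<and>
          (\<exists>C. \<forall>w z :: real. 2 \<le> w \<and> w < z \<longrightarrow>
             (\<Prod>p | prime p \<and> w \<le> real p \<and> real p < z. inverse (1 - \<beta> p))
               \<le> C * (ln z / ln w)\<^sup>2) \<and>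
          (\<forall>K :: real.
             (\<lambda>N. \<Sum>q | squarefree q \<and> real q < T N powr (1/72 - \<eta>). \<bar>r N q\<bar>)
               \<in> O[at_top](\<lambda>N. real (card (P N)) / ln N powr K))"
    if c2: "0 < c\<^sub>2"
      and OX: "\<forall>\<^sub>F N in at_top. is_Omega A c\<^sub>2 (N powr x) (\<Omega>\<^sub>X N)"
      and S: "\<forall>\<^sub>F N in at_top. is_aleph C\<^sub>0 \<theta> c\<^sub>1 (N powr \<alpha>) (S N)"
      and OZ: "\<forall>\<^sub>F N in at_top. is_Omega A c\<^sub>2 (N powr (1/4)) (\<Omega>\<^sub>Z N)"
      and P: "\<forall>N. P N = triple_product (\<Omega>\<^sub>X N) (S N) (\<Omega>\<^sub>Z N)"
      and T: "T \<in> \<Theta>[at_top](\<lambda>N. N ^ 4)" "\<forall>\<^sub>F N in at_top. \<forall>n. sieve_seq (P N) n \<noteq> 0 \<longrightarrow> real n < T N"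
    for c\<^sub>2 and \<Omega>\<^sub>X S \<Omega>\<^sub>Z P :: "real \<Rightarrow> (int^2^2) set" and T :: "real \<Rightarrow> real"
  proof -
    have size: "\<forall>\<^sub>F N in at_top. real (card (P N)) > N powr (2 * cf_dim A - \<eta>)" by (rule size[OF c2 OX S OZ P])
    define r where "r N q = real (sieve_mass (P N) q) - dens_prod q * real (card (P N))" for N q
    have rem: "\<forall>\<^sub>F N in at_top. (\<Sum>q | squarefree q \<and> real q < T N powr (1/72 - \<eta>). \<bar>r N q\<bar>) \<le> real (card (P N)) * N powr (- \<epsilon>)"
    proof -
      obtain c where c: "c > 0" "\<forall>\<^sub>F N in at_top. norm (T N) \<le> c * norm (N ^ 4 :: real)"
        using T(1) by (auto simp: bigtheta_def elim!: landau_o.bigE)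
      define e where "e = 1/72 - \<eta>"
      have e: "0 < e" using \<eta> by (simp add: e_def)
      have ev: "\<forall>\<^sub>F N :: real in at_top. c powr e \<le> N powr (4 * \<eta>)" using \<eta> by real_asymp
      have q: "0 < (1/4 :: real)" by simp
      show ?thesis
        using OX S OZ Omega_card_ge[OF x(1) c2 \<epsilon>(1), of A] Omega_card_ge[OF q c2 \<epsilon>(1), of A]
          remainder_power_saving[OF assms(1-3) \<alpha> \<epsilon>(1) \<kappa>, of A] eventually_gt_at_top[of 1] c(2) ev T(2) size
      proof eventually_elim
        case (elim N)
        have SG: "S N \<subseteq> {g \<in> Gamma 2. mat_norm g < N powr \<alpha>}" using elim(2) by (auto simp: is_aleph_def)
        have PN: "triple_product (\<Omega>\<^sub>X N) (S N) (\<Omega>\<^sub>Z N) = P N" using P by simp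
        note st = triple_product_stats[OF elim(1) SG elim(3), unfolded PN]
        have mono: "N powr s \<le> N powr t" if "s \<le> t" for s t using elim(7) that by (intro powr_mono) auto
        have cX: "N powr (2 * x - 3 * \<epsilon>) \<le> real (card (\<Omega>\<^sub>X N))"
        proof -
          have "(1 - \<epsilon>) * x \<le> \<delta> * x" using \<delta> x by (intro mult_right_mono) auto
          moreover have "(1 - \<epsilon>) * x = x - \<epsilon> * x" by (simp add: algebra_simps)
          moreover have "\<epsilon> * x \<le> \<epsilon>" using mult_left_mono[of x 1 \<epsilon>] x \<epsilon> by simp
          ultimately have "2 * x - 3 * \<epsilon> \<le> 2 * (\<delta> * x) - \<epsilon>" by argo
          then have "N powr (2 * x - 3 * \<epsilon>) \<le> N powr (2 * cf_dim A * x - \<epsilon>)" by (intro mono) (simp add: \<delta>_def)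
          then show ?thesis using elim(1,4) by force
        qed
        have cZ: "N powr (1/2 - 3 * \<epsilon>) \<le> real (card (\<Omega>\<^sub>Z N))"
        proof -
          have "N powr (1/2 - 3 * \<epsilon>) \<le> N powr (2 * cf_dim A * (1/4) - \<epsilon>)"
            using \<delta>(1) \<epsilon>(1) unfolding \<delta>_def by (intro mono) linarith
          then show ?thesis using elim(3,5) by force
        qed
        let ?f = "\<lambda>q. triple_sum (\<Omega>\<^sub>X N) (S N) (\<Omega>\<^sub>Z N) (hit_prod q) - real (card (\<Omega>\<^sub>X N)) * real (card (S N)) * real (card (\<Omega>\<^sub>Z N)) * dens_prod q"
        have PP: "real (card (P N)) = real (card (\<Omega>\<^sub>X N)) * real (card (S N)) * real (card (\<Omega>\<^sub>Z N))"
          unfolding st(1) by simp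
        have rf: "r N q = ?f q" if "squarefree q" for q
        proof -
          have "real (sieve_mass (P N) q) = triple_sum (\<Omega>\<^sub>X N) (S N) (\<Omega>\<^sub>Z N) (hit_prod q)"
            using sieve_mass_eq[OF st(2,3) that] st(4)[of "hit_prod q"] by simp
          then show ?thesis unfolding r_def PP by simp
        qed
        \<comment> \<open>\<open>T\<close> is only bounded in absolute value; its positivity,
          required for monotonicity of the power, comes from a nonzero term of the sieve
          sequence.\<close>
        have Tpos: "0 < T N"
        proof -
          have "card (P N) \<noteq> 0" using elim(11) by (metis less_numeral_extra(3) not_less of_nat_0 powr_ge_zero)
          then obtain g where g: "g \<in> P N" by fastforce
          define n where "n = nat ((quad_form g)\<^sup>2 - 4)"
          have "g \<in> {g \<in> P N. (quad_form g)\<^sup>2 - 4 = int n}"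
            using g quad_form_square_ge[OF st(3)[OF g]] by (simp add: n_def)
          then have "sieve_seq (P N) n \<noteq> 0" unfolding sieve_seq_def using st(2) by (auto simp: card_eq_0_iff)
          then have "real n < T N" using elim(10) by blast
          then show ?thesis by (meson le_less_trans of_nat_0_le_iff)
        qed
        have N0: "0 < N" using elim(7) by simp
        \<comment> \<open>Four times 1/72 - \<eta> is 1/18 - 4 \<eta>; the spare 4 \<eta> absorbs
          the implied constant of T.\<close>
        have "T N powr e \<le> (c * N ^ 4) powr e"
          using elim(8) Tpos e N0 by (intro powr_mono2) auto
        also have "\<dots> = c powr e * N powr (4 * e)"
          using c N0 by (simp add: powr_mult powr_powr flip: powr_numeral)
        also have "\<dots> \<le> N powr (4 * \<eta>) * N powr (4 * e)" using elim(9) by (intro mult_right_mono) auto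
        also have "\<dots> = N powr (1/18)" by (simp add: e_def flip: powr_add)
        finally have Tle: "T N powr e \<le> N powr (1/18)" .
        have "(\<Sum>q | squarefree q \<and> real q < T N powr e. \<bar>r N q\<bar>) \<le> (\<Sum>q\<in>squarefrees (N powr (1/18)). \<bar>r N q\<bar>)"
          using Tle by (intro sum_mono2[OF finite_squarefrees]) (auto simp: squarefrees_def)
        also have "\<dots> = (\<Sum>q\<in>squarefrees (N powr (1/18)). \<bar>?f q\<bar>)"
          using rf by (intro sum.cong) (auto simp: squarefrees_def)
        also have "\<dots> \<le> real (card (P N)) * N powr (- \<epsilon>)"
          unfolding PP using elim(1,2,3,6) cX cZ unfolding x_def is_Omega_def by blast
        finally show ?case by (simp only: e_def)
      qed
    qed
    show ?thesis
    proof (intro exI[of _ dens_prod] exI[of _ r] conjI allI impI)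
      show "real (sieve_mass (P N) q) = dens_prod q * real (card (P N)) + r N q" for N q by (simp add: r_def)
      show "multiplicative dens_prod" by (rule dens_prod_multiplicative)
      show "dens_prod p \<noteq> 1" if "prime p" for p using dens_less_1[OF that] dens_prod_prime[OF that] by simp
      show "\<exists>C. \<forall>w z :: real. 2 \<le> w \<and> w < z \<longrightarrow>
             (\<Prod>p | prime p \<and> w \<le> real p \<and> real p < z. inverse (1 - dens_prod p)) \<le> C * (ln z / ln w)\<^sup>2"
      proof -
        have "(\<Prod>p | prime p \<and> w \<le> real p \<and> real p < z. inverse (1 - dens_prod p)) =
          (\<Prod>p | prime p \<and> w \<le> real p \<and> real p < z. inverse (1 - dens p))" for w z :: real
          by (rule prod.cong) (auto simp: dens_prod_prime)
        then show ?thesis using dens_mertens by simp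
      qed
      fix K :: real
      \<comment> \<open>K is an arbitrary real; a positive exponent \<open>L\<close> at least K
        suffices, and the power saving N^(-\<epsilon>) beats ln N to the power
        \<open>L\<close>.\<close>
      define L where "L = max 1 K"
      have L: "0 < L" "K \<le> L" by (auto simp: L_def)
      have "\<forall>\<^sub>F N :: real in at_top. ln N powr L \<le> N powr \<epsilon>" using L(1) \<epsilon>(1) by real_asymp
      moreover have "\<forall>\<^sub>F N :: real in at_top. 1 \<le> ln N" by real_asymp
      ultimately have "\<forall>\<^sub>F N in at_top. norm (\<Sum>q | squarefree q \<and> real q < T N powr (1/72 - \<eta>). \<bar>r N q\<bar>)
          \<le> 1 * norm (real (card (P N)) / ln N powr K)"
        using rem eventually_gt_at_top[of 1]
      proof eventually_elim
        case (elim N)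
        have "ln N powr K \<le> ln N powr L" using elim L by (intro powr_mono) auto
        then have "ln N powr K \<le> N powr \<epsilon>" using elim by linarith
        then have "1 / N powr \<epsilon> \<le> 1 / ln N powr K" using elim by (intro divide_left_mono mult_pos_pos) auto
        then have "real (card (P N)) * (1 / N powr \<epsilon>) \<le> real (card (P N)) * (1 / ln N powr K)" by (intro mult_left_mono) auto
        then have "(\<Sum>q | squarefree q \<and> real q < T N powr (1/72 - \<eta>). \<bar>r N q\<bar>) \<le> real (card (P N)) / ln N powr K"
          using elim by (simp add: powr_minus_divide)
        moreover have "0 \<le> (\<Sum>q | squarefree q \<and> real q < T N powr (1/72 - \<eta>). \<bar>r N q\<bar>)" by (rule sum_nonneg) simp
        ultimately show ?case by simp
      qed
      then show "(\<lambda>N. \<Sum>q | squarefree q \<and> real q < T N powr (1/72 - \<eta>). \<bar>r N q\<bar>)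
          \<in> O[at_top](\<lambda>N. real (card (P N)) / ln N powr K)"
        by (rule bigoI)
    qed
  qed
  show ?case
  proof (rule exI[of _ A], intro conjI, goal_cases)
    case 1
    show ?case by (simp add: A_def)
  next
    case 2
    show ?case by (simp add: A_def)
  next
    case 3
    show ?case
    proof (rule exI[of _ "\<lambda>N. N powr x"], rule exI[of _ "\<lambda>N. N powr \<alpha>"], rule exI[of _ "\<lambda>N. N powr (1/4)"],
        intro conjI powr_top allI impI, goal_cases)
      case (1 N)
      have "N powr x * N powr \<alpha> * N powr (1/4) = N powr (x + \<alpha> + 1/4)" by (simp only: powr_add)
      then show ?case using 1 by (simp add: x_def)
    next
      case (5 c\<^sub>2 \<Omega>\<^sub>X S \<Omega>\<^sub>Z P T)
      then show ?case by (intro core) auto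
    next
      case (6 c\<^sub>2 \<Omega>\<^sub>X S \<Omega>\<^sub>Z P T)
      then show ?case by (intro size) auto
    qed (use x \<alpha> in auto)
  qed
qed

end
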